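(* Let $m,N\geq 1$ be integers, let $\Omega\subset\mathbb{R}^N$ be a bounded open set with Lipschitz boundary, let $\mathbb{M}$ be the space of real $m\times N$ matrices, let $p\in\,]1,\infty[$ and let $L:\mathbb{M}\to[0,\infty]$ be continuous. Assume that the following condition holds: (C$_{p,p}$) for every $\xi\in\mathbb{M}$ and every sequence $\{v_n\}_n\subset W^{1,p}(Y;\mathbb{R}^m)$ such that $v_n\rightharpoonup l_\xi$ in $W^{1,p}(Y;\mathbb{R}^m)$ and $\sup_n\int_Y L(\nabla v_n(y))\,dy<\infty$, there exist a subsequence $\{v_n\}_n$ (not relabeled) and $\{w_n\}_n\subset l_\xi+W^{1,p}_0(Y;\mathbb{R}^m)$ such that $|\nabla v_n-\nabla w_n|\to 0$ in measure on $Y$ and $\{L(\nabla w_n)\}_n$ is equi-integrable on $Y$. Then the functional $I:W^{1,p}(\Omega;\mathbb{R}^m)\to[0,\infty]$, $I(u):=\int_\Omega L(\nabla u(x))\,dx$, is sequentially weakly lower semicontinuous on $W^{1,p}(\Omega;\mathbb{R}^m)$ if and only if $L$ is $W^{1,p}$-quasiconvex.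
   Context: $Y:=\,]-\tfrac12,\tfrac12[^N$ is the open unit cube of $\mathbb{R}^N$, and for $\xi\in\mathbb{M}$, $l_\xi(y):=\xi y$. The symbol $\rightharpoonup$ denotes weak convergence. Continuity of $L$ is with respect to the usual topology of $[0,\infty]$. $W^{1,p}$-quasiconvexity: $L$ is $W^{1,p}$-quasiconvex if for every $\xi\in\mathbb{M}$, $\int_Y L(\nabla u(y))\,dy\geq L(\xi)$ for all $u\in l_\xi+W^{1,p}_0(Y;\mathbb{R}^m)$. Sequential weak lower semicontinuity of $I$ on $W^{1,p}(\Omega;\mathbb{R}^m)$: $u_n\rightharpoonup u$ in $W^{1,p}(\Omega;\mathbb{R}^m)$ implies $\liminf_{n\to\infty}I(u_n)\geq I(u)$. *)

theory Defs
  imports "HOL-Analysis.Analysis"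
begin

subsection \<open>Smooth test functions\<close>

definition partial_deriv :: "'n \<Rightarrow> (real^'n \<Rightarrow> 'b::real_normed_vector) \<Rightarrow> real^'n::finite \<Rightarrow> 'b" where
  "partial_deriv j f x = frechet_derivative f (at x) (axis j 1)"

primrec Ck :: "nat \<Rightarrow> (real^'n::finite \<Rightarrow> 'b::real_normed_vector) \<Rightarrow> bool" where
  "Ck 0 f \<longleftrightarrow> continuous_on UNIV f"
| "Ck (Suc k) f \<longleftrightarrow> (\<forall>x. f differentiable (at x)) \<and> (\<forall>j. Ck k (partial_deriv j f))"

definition test_functions :: "(real^'n::finite) set \<Rightarrow> (real^'n \<Rightarrow> 'b::real_normed_vector) set" where
  "test_functions \<Omega> = {\<phi>. (\<forall>k. Ck k \<phi>) \<and>
     compact (closure {x. \<phi> x \<noteq> 0}) \<and> closure {x. \<phi> x \<noteq> 0} \<subseteq> \<Omega>}"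


subsection \<open>Sobolev spaces\<close>

text \<open>
  Elements of Lebesgue and Sobolev spaces over an open set are represented by functions on the
  whole space; only their values on the open set matter, and functions that agree almost everywhere
  on it represent the same element.
\<close>

definition Lp_space :: "real \<Rightarrow> (real^'n::finite) set \<Rightarrow> (real^'n \<Rightarrow> 'b::euclidean_space) set" where
  "Lp_space p \<Omega> = {f. f \<in> borel_measurable (lebesgue_on \<Omega>) \<and>
     integrable (lebesgue_on \<Omega>) (\<lambda>x. norm (f x) powr p)}"

definition locally_integrable :: "(real^'n::finite) set \<Rightarrow> (real^'n \<Rightarrow> 'b::euclidean_space) \<Rightarrow> bool" where
  "locally_integrable \<Omega> f \<longleftrightarrow> f \<in> borel_measurable (lebesgue_on \<Omega>) \<and>
     (\<forall>K. compact K \<and> K \<subseteq> \<Omega> \<longrightarrow> integrable (lebesgue_on K) f)"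

definition is_weak_grad ::
  "(real^'n::finite) set \<Rightarrow> (real^'n \<Rightarrow> real^'m::finite) \<Rightarrow> (real^'n \<Rightarrow> real^'n^'m) \<Rightarrow> bool" where
  "is_weak_grad \<Omega> u G \<longleftrightarrow> locally_integrable \<Omega> u \<and> locally_integrable \<Omega> G \<and>
     (\<forall>\<phi>\<in>test_functions \<Omega>. \<forall>i j.
        (\<integral>x. u x $ i * partial_deriv j \<phi> x \<partial>lebesgue_on \<Omega>) =
        - (\<integral>x. G x $ i $ j * \<phi> x \<partial>lebesgue_on \<Omega>))"

text \<open>
  The weak gradient is unique up to a null set; a representative is chosen. It is meaningful only
  for functions that have a weak gradient.
\<close>

definition weak_grad ::
  "(real^'n::finite) set \<Rightarrow> (real^'n \<Rightarrow> real^'m::finite) \<Rightarrow> (real^'n \<Rightarrow> real^'n^'m)" where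
  "weak_grad \<Omega> u = (SOME G. is_weak_grad \<Omega> u G)"

definition W1p :: "real \<Rightarrow> (real^'n::finite) set \<Rightarrow> (real^'n \<Rightarrow> real^'m::finite) set" where
  "W1p p \<Omega> = {u. u \<in> Lp_space p \<Omega> \<and> (\<exists>G. is_weak_grad \<Omega> u G \<and> G \<in> Lp_space p \<Omega>)}"

text \<open>The norm of \<^typ>\<open>real^'n^'m\<close> used here is the Frobenius norm.\<close>

definition W1p_norm :: "real \<Rightarrow> (real^'n::finite) set \<Rightarrow> (real^'n \<Rightarrow> real^'m::finite) \<Rightarrow> real" where
  "W1p_norm p \<Omega> u =
     ((\<integral>x. norm (u x) powr p \<partial>lebesgue_on \<Omega>) +
      (\<integral>x. norm (weak_grad \<Omega> u x) powr p \<partial>lebesgue_on \<Omega>)) powr (1 / p)"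

definition W1p_0 :: "real \<Rightarrow> (real^'n::finite) set \<Rightarrow> (real^'n \<Rightarrow> real^'m::finite) set" where
  "W1p_0 p \<Omega> = {u \<in> W1p p \<Omega>. \<exists>\<phi>. (\<forall>k. \<phi> k \<in> test_functions \<Omega>) \<and>
     (\<lambda>k. W1p_norm p \<Omega> (\<lambda>x. u x - \<phi> k x)) \<longlonglongrightarrow> 0}"

text \<open>
  Boundedness forces a functional in the dual to respect equality almost everywhere on the domain.
\<close>

definition W1p_dual ::
  "real \<Rightarrow> (real^'n::finite) set \<Rightarrow> ((real^'n \<Rightarrow> real^'m::finite) \<Rightarrow> real) set" where
  "W1p_dual p \<Omega> = {l.
     (\<forall>u\<in>W1p p \<Omega>. \<forall>v\<in>W1p p \<Omega>. l (\<lambda>x. u x + v x) = l u + l v) \<and>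
     (\<forall>c. \<forall>u\<in>W1p p \<Omega>. l (\<lambda>x. c *\<^sub>R u x) = c * l u) \<and>
     (\<exists>C. \<forall>u\<in>W1p p \<Omega>. \<bar>l u\<bar> \<le> C * W1p_norm p \<Omega> u)}"

definition W1p_weakly_converges ::
  "real \<Rightarrow> (real^'n::finite) set \<Rightarrow> (nat \<Rightarrow> real^'n \<Rightarrow> real^'m::finite) \<Rightarrow> (real^'n \<Rightarrow> real^'m) \<Rightarrow> bool" where
  "W1p_weakly_converges p \<Omega> u v \<longleftrightarrow> (\<forall>n. u n \<in> W1p p \<Omega>) \<and> v \<in> W1p p \<Omega> \<and>
     (\<forall>l\<in>W1p_dual p \<Omega>. (\<lambda>n. l (u n)) \<longlonglongrightarrow> l v)"


subsection \<open>Lipschitz boundary\<close>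

text \<open>
  Near each boundary point the set is, in coordinates with last axis along some unit vector
  \<open>\<nu>\<close>, the part of a ball strictly above the graph of a Lipschitz function on the hyperplane
  orthogonal to \<open>\<nu>\<close>.
\<close>

definition lipschitz_boundary :: "(real^'n::finite) set \<Rightarrow> bool" where
  "lipschitz_boundary \<Omega> \<longleftrightarrow> (\<forall>x0\<in>frontier \<Omega>. \<exists>\<nu> r C. \<exists>\<gamma> :: real^'n \<Rightarrow> real.
     norm \<nu> = 1 \<and> r > 0 \<and> C-lipschitz_on {y. y \<bullet> \<nu> = 0} \<gamma> \<and>
     \<Omega> \<inter> ball x0 r = {x \<in> ball x0 r. x \<bullet> \<nu> > \<gamma> (x - (x \<bullet> \<nu>) *\<^sub>R \<nu>)})"


subsection \<open>Convergence in measure and equi-integrability\<close>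

definition tendsto_zero_in_measure ::
  "(real^'n::finite) set \<Rightarrow> (nat \<Rightarrow> real^'n \<Rightarrow> real) \<Rightarrow> bool" where
  "tendsto_zero_in_measure A f \<longleftrightarrow>
     (\<forall>e>0. (\<lambda>n. emeasure lebesgue {x \<in> A. \<bar>f n x\<bar> > e}) \<longlonglongrightarrow> 0)"

text \<open>To be used on sets of finite measure only: tightness is not required.\<close>

definition equi_integrable_on ::
  "(nat \<Rightarrow> real^'n::finite \<Rightarrow> ennreal) \<Rightarrow> (real^'n) set \<Rightarrow> bool" where
  "equi_integrable_on f A \<longleftrightarrow>
     (\<forall>n. f n \<in> borel_measurable (lebesgue_on A) \<and> (\<integral>\<^sup>+x. f n x \<partial>lebesgue_on A) < \<infinity>) \<and>
     (\<forall>e::real>0. \<exists>d::real>0. \<forall>E\<in>sets lebesgue. E \<subseteq> A \<and> emeasure lebesgue E < ennreal d \<longrightarrow>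
        (\<forall>n. (\<integral>\<^sup>+x. f n x \<partial>lebesgue_on E) < ennreal e))"


subsection \<open>The integral functional, quasiconvexity, and the compactness condition\<close>

definition unit_cube :: "(real^'n::finite) set" where
  "unit_cube = {y. \<forall>i. - 1 / 2 < y $ i \<and> y $ i < 1 / 2}"

definition energy ::
  "(real^'n^'m \<Rightarrow> ennreal) \<Rightarrow> (real^'n::finite) set \<Rightarrow> (real^'n \<Rightarrow> real^'m::finite) \<Rightarrow> ennreal" where
  "energy L \<Omega> u = (\<integral>\<^sup>+x. L (weak_grad \<Omega> u x) \<partial>lebesgue_on \<Omega>)"

text \<open>The set of \<open>u\<close> with the affine boundary datum \<open>l\<^sub>\<xi> y = \<xi> y\<close> on the unit cube.\<close>

definition affine_W1p_0 :: "real \<Rightarrow> real^'n^'m \<Rightarrow> (real^'n::finite \<Rightarrow> real^'m::finite) set" where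
  "affine_W1p_0 p \<xi> = {u. (\<lambda>y. u y - \<xi> *v y) \<in> W1p_0 p unit_cube}"

definition W1p_quasiconvex :: "real \<Rightarrow> (real^'n::finite^'m::finite \<Rightarrow> ennreal) \<Rightarrow> bool" where
  "W1p_quasiconvex p L \<longleftrightarrow> (\<forall>\<xi>. \<forall>u\<in>affine_W1p_0 p \<xi>. energy L unit_cube u \<ge> L \<xi>)"

definition condition_Cpp :: "real \<Rightarrow> (real^'n::finite^'m::finite \<Rightarrow> ennreal) \<Rightarrow> bool" where
  "condition_Cpp p L \<longleftrightarrow> (\<forall>\<xi> v.
     W1p_weakly_converges p unit_cube v (\<lambda>y. \<xi> *v y) \<and> (SUP n. energy L unit_cube (v n)) < \<infinity> \<longrightarrow>
     (\<exists>r w. strict_mono r \<and> (\<forall>n. w n \<in> affine_W1p_0 p \<xi>) \<and>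
        tendsto_zero_in_measure unit_cube
          (\<lambda>n y. norm (weak_grad unit_cube (v (r n)) y - weak_grad unit_cube (w n) y)) \<and>
        equi_integrable_on (\<lambda>n y. L (weak_grad unit_cube (w n) y)) unit_cube))"

definition W1p_seq_weakly_lsc ::
  "real \<Rightarrow> (real^'n::finite) set \<Rightarrow> ((real^'n \<Rightarrow> real^'m::finite) \<Rightarrow> ennreal) \<Rightarrow> bool" where
  "W1p_seq_weakly_lsc p \<Omega> I \<longleftrightarrow>
     (\<forall>u v. W1p_weakly_converges p \<Omega> u v \<longrightarrow> liminf (\<lambda>n. I (u n)) \<ge> I v)"

end

theory Submission
  imports Defs "HOL-Computational_Algebra.Polynomial"
begin

text \<open>Sufficiency. Along a subsequence realising the lower limit, blow up at a point where the dyadic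
  oscillation of the limit gradient \<open>H\<close> vanishes. The rescaled functions on the unit cube have gradients
  whose averages over dyadic subcubes converge to \<open>H(x)\<close>; with the bounded \<open>L\<^sup>p\<close> norm that the extra term
  \<open>\<delta> \<bar>\<nabla>u\<bar>\<^sup>p\<close> provides, they converge weakly to \<open>H(x) y\<close>, so condition (C) and quasiconvexity
  bound \<open>L(H(x))\<close> by the lower limit of the dyadic averages of the energy densities. Since averaging
  over dyadic cubes preserves integrals, Fatou's lemma integrates this inequality over the domain,
  without any compactness of measures; then \<open>\<delta> \<rightarrow> 0\<close>, which needs that weakly convergent sequences are bounded.
  Weak convergence on the cube follows from the convergence of averages by passing to midpoint
  combinations (a Mazur argument through uniform convexity of the \<open>p\<close>-th power) and the Poincare
  inequality.

  Necessity. Fill the domain by its maximal dyadic cubes of generation at least \<open>n\<close> and put a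
  rescaled copy of \<open>u(y) - \<xi> y\<close> into each. Added to \<open>\<xi> x\<close> this converges weakly to \<open>\<xi> x\<close>, while
  the energy does not depend on \<open>n\<close>.\<close>

subsection \<open>Convexity of powers\<close>

text \<open>Two features of the definitions shape the proof. Weak convergence is tested against all
  bounded functionals on the Sobolev space, and these are not represented by integrals; so weak
  convergence is shown by contradiction: a half-space \<open>e \<le> s * l u\<close> is stable under
  midpoints, while suitable midpoint combinations tend to zero in norm. And \<open>L\<close> may be
  infinite and obeys no growth bound, so energies of sequences with gradients close in measure are
  compared only after truncating \<open>L\<close>. Half-open cubes given by floors tile the space
  exactly. Hence averaging is integration against a symmetric kernel of mass one
  (\<open>tower_dcube\<close>), and averages differentiate integrals along a subsequence of
  generations (\<open>dyadic_differentiation\<close>) without covering or maximal theorems. The same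
  averages replace completeness of L^p, since Fatou's lemma moves bounds from averages to functions.
  Conditions on cubes start at generation 1: up to a null set, the unit cube is a union of dyadic
  cubes only from there on.\<close>

lemma powr_tangent:
  fixes x b p :: real
  assumes "0 \<le> x" "0 \<le> b" "1 < p"
  shows "p * x * b powr (p - 1) \<le> x powr p + (p - 1) * b powr p"
proof -
  define q where "q = p / (p - 1)"
  have q: "q > 1" "1/p + 1/q = 1" "(p - 1) * q = p"
    using assms by (auto simp: q_def field_simps)
  \<comment> \<open>Young's inequality for \<open>x\<close> and \<open>b powr (p - 1)\<close>.
    Multiplied by \<open>p\<close> it says that \<open>t powr p\<close> lies above its tangent at
    \<open>b\<close>, with the term \<open>(p - 1) * b powr p\<close> moved to the right.\<close>
  have "x * b powr (p - 1) \<le> x powr p / p + (b powr (p - 1)) powr q / q"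
    by (rule Youngs_inequality) (use assms q in auto)
  also have "(b powr (p - 1)) powr q = b powr p"
    by (simp add: powr_powr q)
  finally have "p * (x * b powr (p - 1)) \<le> p * (x powr p / p + b powr p / q)"
    using assms by (intro mult_left_mono) auto
  also have "\<dots> = x powr p + (p - 1) * b powr p"
    using assms by (simp add: q_def field_simps)
  finally show ?thesis by (simp add: mult_ac)
qed

text \<open>On a finite measure space the constant 1 is integrable, and
  \<open>|f| \<le> 1 + |f|^p\<close> pointwise. This is how the L^p functions below become Bochner
  integrable.\<close>

lemma integrable_of_powr:
  fixes f :: "'a \<Rightarrow> 'b::{banach, second_countable_topology}"
  assumes M: "finite_measure M" and f: "f \<in> borel_measurable M" and p: "1 < p"
    and fin: "(\<integral>\<^sup>+x. ennreal (norm (f x) powr p) \<partial>M) < \<infinity>"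
  shows "integrable M f"
proof (rule integrableI_bounded)
  interpret finite_measure M by fact
  have le: "norm (f x) \<le> 1 + norm (f x) powr p" for x
  proof (cases "norm (f x) \<le> 1")
    case False
    then have "norm (f x) powr 1 \<le> norm (f x) powr p"
      using p by (intro powr_mono) auto
    then show ?thesis using False by simp
  qed (simp add: add_increasing2)
  have "(\<integral>\<^sup>+x. ennreal (norm (f x)) \<partial>M) \<le> (\<integral>\<^sup>+x. 1 + ennreal (norm (f x) powr p) \<partial>M)"
    using le by (intro nn_integral_mono) (simp flip: ennreal_1 ennreal_plus)
  also have "\<dots> = emeasure M (space M) + (\<integral>\<^sup>+x. ennreal (norm (f x) powr p) \<partial>M)"
    using f by (subst nn_integral_add) auto
  also have "\<dots> < \<infinity>"
    using fin by (simp add: less_top[symmetric] emeasure_finite)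
  finally show "(\<integral>\<^sup>+x. ennreal (norm (f x)) \<partial>M) < \<infinity>" .
qed fact

text \<open>Integrating the tangent inequality at the mean of \<open>norm f\<close> gives Jensen's
  inequality; the factor \<open>\<mu> powr (p - 1)\<close> appears because the measure is not
  normalised. The right side is an extended integral, so an infinite p-th moment is covered as
  well.\<close>

lemma jensen_powr:
  fixes f :: "'a \<Rightarrow> 'b::{banach, second_countable_topology}"
  assumes M: "finite_measure M" and f: "f \<in> borel_measurable M" and p: "1 < p"
  shows "ennreal (norm (integral\<^sup>L M f) powr p)
    \<le> ennreal (measure M (space M) powr (p - 1)) * (\<integral>\<^sup>+x. ennreal (norm (f x) powr p) \<partial>M)"
proof -
  interpret finite_measure M by fact
  define \<mu> where "\<mu> = measure M (space M)"
  define J where "J = (\<integral>\<^sup>+x. ennreal (norm (f x) powr p) \<partial>M)"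
  show ?thesis
  proof (cases "\<mu> = 0")
    case True
    then have "AE x in M. False"
      by (intro AE_I[of _ _ "space M"]) (auto simp: \<mu>_def emeasure_eq_measure)
    then have "integral\<^sup>L M f = integral\<^sup>L M (\<lambda>x. 0)"
      by (intro integral_cong_AE) (use f in auto)
    then show ?thesis using p by simp
  next
    case mu: False
    then have mu: "\<mu> > 0" by (simp add: \<mu>_def less_le)
    show ?thesis
    proof (cases "J < \<infinity>")
      case False
      then have "J = top" by (simp add: less_top[symmetric])
      moreover have "ennreal (\<mu> powr (p - 1)) \<noteq> 0" using mu by simp
      ultimately have "ennreal (\<mu> powr (p - 1)) * J = top" by (simp add: ennreal_mult_top)
      then show ?thesis by (simp add: J_def \<mu>_def)
    next
      case True
      have int: "integrable M f"
        by (rule integrable_of_powr[OF M f p]) (use True J_def in auto)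
      have intp: "integrable M (\<lambda>x. norm (f x) powr p)"
        using f True by (intro integrableI_bounded) (auto simp: J_def)
      have J: "J = ennreal (\<integral>x. norm (f x) powr p \<partial>M)"
        unfolding J_def by (rule nn_integral_eq_integral[OF intp]) auto
      \<comment> \<open>\<open>b\<close> is the mean of \<open>norm f\<close>; with the tangent
        taken there, the two multiples of \<open>b powr p\<close> combine to the single term in
        \<open>*\<close>.\<close>
      define b where "b = (\<integral>x. norm (f x) \<partial>M) / \<mu>"
      have b: "b \<ge> 0" using mu by (simp add: b_def)
      have "(\<integral>x. p * norm (f x) * b powr (p - 1) \<partial>M) \<le> (\<integral>x. norm (f x) powr p + (p - 1) * b powr p \<partial>M)"
        using int intp b p by (intro integral_mono) (auto intro!: powr_tangent)
      then have "p * (\<mu> * b) * b powr (p - 1) \<le> (\<integral>x. norm (f x) powr p \<partial>M) + \<mu> * ((p - 1) * b powr p)"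
        using int intp mu by (simp add: b_def \<mu>_def)
      moreover have "p * (\<mu> * b) * b powr (p - 1) = \<mu> * p * b powr p"
      proof -
        have "b * b powr (p - 1) = b powr p"
          using b p by (cases "b = 0") (simp_all add: powr_diff)
        moreover have "p * (\<mu> * b) * b powr (p - 1) = \<mu> * p * (b * b powr (p - 1))" by simp
        ultimately show ?thesis by (simp only:)
      qed
      ultimately have "\<mu> * p * b powr p \<le> (\<integral>x. norm (f x) powr p \<partial>M) + \<mu> * ((p - 1) * b powr p)"
        by linarith
      then have *: "\<mu> * b powr p \<le> (\<integral>x. norm (f x) powr p \<partial>M)"
        by (simp add: algebra_simps)
      have "norm (integral\<^sup>L M f) powr p \<le> (\<mu> * b) powr p"
        using mu p by (intro powr_mono2) (auto simp: b_def)
      also have "\<dots> = \<mu> powr (p - 1) * (\<mu> * b powr p)"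
        using mu b by (simp add: powr_mult powr_diff)
      also have "\<dots> \<le> \<mu> powr (p - 1) * (\<integral>x. norm (f x) powr p \<partial>M)"
        using * by (intro mult_left_mono) auto
      finally show ?thesis
        unfolding J_def[symmetric] \<mu>_def[symmetric] J
        by (simp add: ennreal_mult'[symmetric])
    qed
  qed
qed

lemma sum_powr_le:
  fixes f :: "'i \<Rightarrow> 'b::{banach, second_countable_topology}"
  assumes I: "finite I" and p: "1 < p"
  shows "norm (\<Sum>i\<in>I. f i) powr p \<le> real (card I) powr (p - 1) * (\<Sum>i\<in>I. norm (f i) powr p)"
proof -
  have "ennreal (norm (\<Sum>i\<in>I. f i) powr p) \<le>
    ennreal (real (card I) powr (p - 1)) * (\<Sum>i\<in>I. ennreal (norm (f i) powr p))"
    using jensen_powr[OF finite_measure_count_space[OF I], of f p] I p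
    by (simp add: lebesgue_integral_count_space_finite nn_integral_count_space_finite
        measure_count_space)
  also have "\<dots> = ennreal (real (card I) powr (p - 1) * (\<Sum>i\<in>I. norm (f i) powr p))"
    by (subst sum_ennreal) (auto simp: ennreal_mult sum_nonneg)
  finally show ?thesis
    by (subst (asm) ennreal_le_iff) (auto intro!: mult_nonneg_nonneg sum_nonneg)
qed

text \<open>The difference quotients over the two halves of the interval are values of the strictly
  increasing derivative at points on either side of the midpoint.\<close>

lemma powr_midpoint_less:
  fixes x y p :: real
  assumes "0 \<le> x" "x < y" "1 < p"
  shows "((x + y) / 2) powr p < (x powr p + y powr p) / 2"
proof -
  define s where "s = (x + y) / 2"
  have s: "x < s" "s < y" "s - x = y - s" using assms by (auto simp: s_def field_simps)
  have D: "((\<lambda>t. t powr p) has_real_derivative p * t powr (p - 1)) (at t)" if "t > 0" for t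
    using that by (auto intro!: derivative_eq_intros simp: powr_diff)
  have C: "continuous_on {a..b} (\<lambda>t::real. t powr p)" if "a \<ge> 0" for a b
    using that assms by (intro continuous_on_powr' continuous_intros) auto
  \<comment> \<open>\<open>D\<close> holds for positive arguments while \<open>x\<close> may be 0,
    so the left half uses the mean value theorem that asks only for continuity at the
    endpoints.\<close>
  obtain t1 where t1: "x < t1" "t1 < s" "s powr p - x powr p = (s - x) * (p * t1 powr (p - 1))"
  proof -
    have "\<exists>l z. x < z \<and> z < s \<and> DERIV (\<lambda>t. t powr p) z :> l \<and> s powr p - x powr p = (s - x) * l"
      using s assms by (intro MVT C) (auto simp: real_differentiable_def intro!: exI D)
    then obtain l z where z: "x < z" "z < s" "DERIV (\<lambda>t. t powr p) z :> l"
      "s powr p - x powr p = (s - x) * l" by blast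
    then have "l = p * z powr (p - 1)" using assms by (intro DERIV_unique[OF z(3) D]) auto
    then show ?thesis using that z by blast
  qed
  obtain t2 where t2: "s < t2" "t2 < y" "y powr p - s powr p = (y - s) * (p * t2 powr (p - 1))"
  proof -
    have "\<exists>z. s < z \<and> z < y \<and> y powr p - s powr p = (y - s) * (p * z powr (p - 1))"
      using s assms by (intro MVT2 D) auto
    then show ?thesis using that by blast
  qed
  have "t1 powr (p - 1) < t2 powr (p - 1)"
    using t1 t2 assms by (intro powr_less_mono2) auto
  then have "(s - x) * (p * t1 powr (p - 1)) < (y - s) * (p * t2 powr (p - 1))"
    unfolding s(3) using s assms by simp
  then have "s powr p - x powr p < y powr p - s powr p"
    using t1(3) t2(3) by linarith
  then show ?thesis by (simp add: s_def field_simps)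
qed

lemma norm_powr_midpoint_le:
  fixes a b :: "'a::real_normed_vector"
  assumes "1 < p"
  shows "norm ((1/2) *\<^sub>R (a + b)) powr p \<le> (norm a powr p + norm b powr p) / 2"
proof -
  have "norm ((1/2) *\<^sub>R (a + b)) powr p \<le> ((norm a + norm b) / 2) powr p"
    using assms norm_triangle_ineq[of a b] by (intro powr_mono2) auto
  also have "\<dots> \<le> (norm a powr p + norm b powr p) / 2"
    using powr_midpoint_less[of "norm a" "norm b" p] powr_midpoint_less[of "norm b" "norm a" p] assms
    by (cases "norm a" "norm b" rule: linorder_cases) (auto simp: add_ac)
  finally show ?thesis .
qed

text \<open>Equality forces equal norms by strict convexity of the power, and then equality in the
  triangle inequality, which in an inner product space aligns the two vectors.\<close>

lemma norm_powr_midpoint_eq_imp: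
  fixes a b :: "'a::real_inner"
  assumes "1 < p" and eq: "norm ((1/2) *\<^sub>R (a + b)) powr p = (norm a powr p + norm b powr p) / 2"
  shows "a = b"
proof -
  have 1: "norm ((1/2) *\<^sub>R (a + b)) powr p \<le> ((norm a + norm b) / 2) powr p"
    using assms norm_triangle_ineq[of a b] by (intro powr_mono2) auto
  have ab: "norm a = norm b"
    using powr_midpoint_less[of "norm a" "norm b" p] powr_midpoint_less[of "norm b" "norm a" p] assms 1
    by (cases "norm a" "norm b" rule: linorder_cases) (auto simp: add_ac)
  then have "norm ((1/2) *\<^sub>R (a + b)) powr p = norm a powr p" using eq by simp
  then have "norm ((1/2) *\<^sub>R (a + b)) = norm a"
    using assms by (metis norm_ge_zero powr_powr powr_one right_inverse less_numeral_extra(3) order.strict_trans zero_less_one)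
  then have "norm (a + b) = norm a + norm b" using ab by simp
  then have "norm a *\<^sub>R b = norm b *\<^sub>R a" by (simp add: norm_triangle_eq)
  then show ?thesis using ab by (cases "norm a = 0") auto
qed

text \<open>A pointwise form of uniform convexity of L^p that can be integrated. Points far apart
  have a definite convexity defect: compactness gives this on the unit sphere of pairs, homogeneity
  of degree \<open>p\<close> gives it everywhere, and the \<open>\<epsilon>\<close> term absorbs
  pairs that are close together.\<close>

lemma uniform_convexity_powr:
  fixes p \<epsilon> :: real
  assumes p: "1 < p" and e: "\<epsilon> > 0"
  obtains C where "C > 0" "\<And>a b::'a::euclidean_space. norm (a - b) powr p \<le> \<epsilon> * (norm a powr p + norm b powr p) +
     C * ((norm a powr p + norm b powr p) / 2 - norm ((1/2) *\<^sub>R (a + b)) powr p)"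
proof -
  define n where "n z = norm (fst z) powr p + norm (snd z) powr p" for z :: "'a \<times> 'a"
  define d where "d z = n z / 2 - norm ((1/2) *\<^sub>R (fst z + snd z)) powr p" for z :: "'a \<times> 'a"
  define m where "m z = norm (fst z - snd z) powr p" for z :: "'a \<times> 'a"
  have cont: "continuous_on UNIV n" "continuous_on UNIV d" "continuous_on UNIV m"
    unfolding n_def d_def m_def using p by (auto intro!: continuous_intros continuous_on_powr')
  \<comment> \<open>\<open>T\<close> holds the normalised pairs that are not
    \<open>\<epsilon>\<close>-close. There the defect \<open>d\<close> is continuous and, by the
    equality case, nowhere zero, hence bounded below.\<close>
  define T where "T = {z. n z = 1 \<and> m z \<ge> \<epsilon>}"
  have d0: "d z \<ge> 0" for z
    using norm_powr_midpoint_le[OF p, of "fst z" "snd z"] by (simp add: d_def n_def)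
  have "compact T"
  proof -
    have "closed T"
      unfolding T_def
      by (intro closed_Collect_conj closed_Collect_eq closed_Collect_le cont continuous_on_const)
    moreover have "T \<subseteq> cball 0 1 \<times> cball 0 1"
    proof
      fix z assume "z \<in> T"
      then have "norm (fst z) powr p \<le> 1" "norm (snd z) powr p \<le> 1"
        by (simp_all add: T_def n_def) (smt (verit) powr_ge_zero)+
      then have "norm (fst z) \<le> 1" "norm (snd z) \<le> 1"
        using p by (smt (verit, best) gr_one_powr)+
      then show "z \<in> cball 0 1 \<times> cball 0 1" by (cases z) auto
    qed
    ultimately show ?thesis
      using bounded_subset[OF bounded_Times[OF bounded_cball bounded_cball]] compact_eq_bounded_closed by blast
  qed
  have "\<exists>c>0. \<forall>z\<in>T. c \<le> d z"
  proof (cases "T = {}")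
    case False
    then obtain z0 where z0: "z0 \<in> T" "\<And>z. z \<in> T \<Longrightarrow> d z0 \<le> d z"
      using continuous_attains_inf[OF \<open>compact T\<close> False continuous_on_subset[OF cont(2)]] by auto
    have "d z0 \<noteq> 0"
    proof
      assume "d z0 = 0"
      then have "fst z0 = snd z0"
        using norm_powr_midpoint_eq_imp[OF p, of "fst z0" "snd z0"] by (simp add: d_def n_def)
      then have "m z0 = 0" using p by (simp add: m_def)
      then show False using z0 e by (auto simp: T_def)
    qed
    then show ?thesis using z0 d0[of z0] by (intro exI[of _ "d z0"]) auto
  qed (auto intro: exI[of _ 1])
  then obtain c where c: "c > 0" "\<And>z. z \<in> T \<Longrightarrow> c \<le> d z" by blast
  \<comment> \<open>On normalised pairs \<open>m \<le> 2 powr p\<close>, and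
    \<open>d \<ge> c\<close> on \<open>T\<close>; hence the quotient.\<close>
  define C where "C = 2 powr p / c"
  have unit: "m z \<le> \<epsilon> + C * d z" if "n z = 1" for z
  proof (cases "m z \<ge> \<epsilon>")
    case True
    then have "c \<le> d z" using c that by (simp add: T_def)
    have "norm (fst z) powr p \<le> 1" "norm (snd z) powr p \<le> 1"
      using that by (simp_all add: n_def) (smt (verit) powr_ge_zero)+
    then have "norm (fst z) \<le> 1" "norm (snd z) \<le> 1"
      using p by (smt (verit, best) gr_one_powr)+
    then have "norm (fst z - snd z) \<le> 2" using norm_triangle_ineq4[of "fst z" "snd z"] by linarith
    then have "m z \<le> 2 powr p" unfolding m_def using p by (intro powr_mono2) auto
    also have "\<dots> \<le> C * d z" using \<open>c \<le> d z\<close> c by (simp add: C_def field_simps)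
    finally show ?thesis using e by simp
  next
    case False
    then show ?thesis using d0[of z] c by (simp add: C_def add_increasing2)
  qed
  show ?thesis
  proof (rule that)
    show "C > 0" using c by (simp add: C_def)
    fix a b :: 'a
    show "norm (a - b) powr p \<le> \<epsilon> * (norm a powr p + norm b powr p) +
     C * ((norm a powr p + norm b powr p) / 2 - norm ((1/2) *\<^sub>R (a + b)) powr p)"
    proof (cases "n (a, b) = 0")
      case True
      then have "a = 0" "b = 0" by (auto simp: n_def add_nonneg_eq_0_iff)
      then show ?thesis by simp
    next
      case False
      then have npos: "n (a,b) > 0" using less_le by (fastforce simp: n_def)
      \<comment> \<open>Dividing by \<open>s\<close> normalises the pair, since \<open>n\<close> is
        homogeneous of degree \<open>p\<close>.\<close>
      define s where "s = n (a, b) powr (1 / p)"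
      have s: "s > 0" "s powr p = n (a,b)" using npos p by (auto simp: s_def powr_powr)
      define z where "z = ((1/s) *\<^sub>R a, (1/s) *\<^sub>R b)"
      have sc: "norm ((1/s) *\<^sub>R x) powr p = norm x powr p / n (a,b)" for x :: 'a
        using s by (simp add: powr_divide)
      have nz: "n z = 1" using npos by (simp only: z_def n_def fst_conv snd_conv sc) (simp add: n_def add_divide_distrib[symmetric])
      have mz: "m z = norm (a - b) powr p / n (a,b)"
        by (simp only: z_def m_def fst_conv snd_conv sc[symmetric] scaleR_diff_right)
      have "(1/2) *\<^sub>R (fst z + snd z) = (1/s) *\<^sub>R ((1/2) *\<^sub>R (a + b))"
        by (simp add: z_def algebra_simps)
      then have dz: "d z = 1 / 2 - norm ((1/2) *\<^sub>R (a + b)) powr p / n (a,b)"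
        by (simp only: d_def nz sc)
      have "m z * n (a,b) \<le> (\<epsilon> + C * d z) * n (a,b)"
        using unit[OF nz] npos by (intro mult_right_mono) auto
      then have "norm (a - b) powr p \<le>
          \<epsilon> * n (a,b) + C * (n (a,b) / 2 - norm ((1/2) *\<^sub>R (a + b)) powr p)"
        using npos unfolding mz dz by (simp add: algebra_simps)
      then show ?thesis by (simp add: n_def)
    qed
  qed
qed

subsection \<open>Dyadic cubes\<close>

text \<open>Equality of floors is an equivalence relation, so the cubes of one generation partition
  the whole space and can be indexed by any of their points.\<close>

definition dcube :: "nat \<Rightarrow> real^'n::finite \<Rightarrow> (real^'n) set" where
  "dcube k x = {y. \<forall>i. \<lfloor>2^k * y $ i\<rfloor> = \<lfloor>2^k * x $ i\<rfloor>}"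

definition dcenter :: "nat \<Rightarrow> real^'n::finite \<Rightarrow> real^'n" where
  "dcenter k x = (\<chi> i. (of_int \<lfloor>2^k * x $ i\<rfloor> + 1/2) / 2^k)"

text \<open>The dimension occurs in no term argument, hence the \<open>itself\<close>
  argument.\<close>

definition dvol :: "'n::finite itself \<Rightarrow> nat \<Rightarrow> real" where
  "dvol _ k = (1 / 2^k) ^ CARD('n)"

lemma dvol_pos [simp]: "dvol T k > 0" "dvol T k \<ge> 0" "dvol T k \<noteq> 0"
  by (auto simp: dvol_def)

lemma dcube_self [simp]: "x \<in> dcube k x"
  by (simp add: dcube_def)

lemma dcube_sym: "y \<in> dcube k x \<longleftrightarrow> x \<in> dcube k y"
  by (auto simp: dcube_def)

lemma dcube_eq: "y \<in> dcube k x \<Longrightarrow> dcube k y = dcube k x"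
  by (auto simp: dcube_def)

lemma dcenter_eq: "y \<in> dcube k x \<Longrightarrow> dcenter k y = dcenter k x"
  by (auto simp: dcube_def dcenter_def)

text \<open>Halving the integer label of a cube gives the label of its parent; the generations are
  nested for this reason.\<close>

lemma floor_double: "\<lfloor>2 * t\<rfloor> div 2 = \<lfloor>t::real\<rfloor>"
  using floor_divide_real_eq_div[of 2 "2 * t"] by simp

lemma dcube_Suc_subset: "dcube (Suc k) x \<subseteq> dcube k x"
proof
  fix y assume "y \<in> dcube (Suc k) x"
  then have "\<lfloor>2 * (2^k * y $ i)\<rfloor> div 2 = \<lfloor>2 * (2^k * x $ i)\<rfloor> div 2" for i
    by (auto simp: dcube_def mult_ac)
  then show "y \<in> dcube k x" by (simp add: dcube_def floor_double)
qed

lemma dcube_mono: "k \<le> l \<Longrightarrow> dcube l x \<subseteq> dcube k x"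
  by (induction l rule: dec_induct) (use dcube_Suc_subset in blast)+

text \<open>The constant is the crude l1 bound; what matters is that it tends to zero with growing
  \<open>k\<close>.\<close>

lemma dist_dcube: "y \<in> dcube k x \<Longrightarrow> dist y (x::real^'n::finite) \<le> CARD('n) / 2^k"
proof -
  assume y: "y \<in> dcube k x"
  have "dist y x \<le> (\<Sum>i\<in>(UNIV::'n set). \<bar>(y - x) $ i\<bar>)"
    unfolding dist_norm by (rule norm_le_l1_cart)
  also have "\<dots> \<le> (\<Sum>i\<in>(UNIV::'n set). 1 / 2^k)"
  proof (rule sum_mono)
    fix i
    have "\<lfloor>2^k * y $ i\<rfloor> = \<lfloor>2^k * x $ i\<rfloor>" using y by (simp add: dcube_def)
    then have "\<bar>2^k * y $ i - 2^k * x $ i\<bar> \<le> 1" by linarith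
    moreover have "2^k * \<bar>(y - x) $ i\<bar> = \<bar>2^k * (y - x) $ i\<bar>"
      by (simp only: abs_mult) simp
    ultimately have "2^k * \<bar>(y - x) $ i\<bar> \<le> 1"
      by (simp add: right_diff_distrib)
    then show "\<bar>(y - x) $ i\<bar> \<le> 1 / 2^k" by (simp add: field_simps)
  qed
  also have "\<dots> = CARD('n) / 2^k" by simp
  finally show ?thesis .
qed

lemma dcube_iff: "y \<in> dcube k x \<longleftrightarrow>
    (\<forall>i. - 1/2 \<le> 2^k * (y $ i - dcenter k x $ i) \<and> 2^k * (y $ i - dcenter k x $ i) < 1/2)"
proof -
  have eq: "2^k * (y $ i - dcenter k x $ i) = 2^k * y $ i - of_int \<lfloor>2^k * x $ i\<rfloor> - 1/2" for i
    by (simp add: dcenter_def field_simps)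
  have *: "a \<le> t \<and> t < a + 1 \<longleftrightarrow> - 1/2 \<le> t - a - 1/2 \<and> t - a - 1/2 < 1/2" for a t :: real
    by linarith
  show ?thesis
    unfolding dcube_def mem_Collect_eq floor_eq_iff eq * ..
qed

text \<open>The normalised dyadic cube. Tilings produce this set while the Sobolev spaces live on
  the open \<open>unit_cube\<close>; the two differ by a null set, and the lemmas below pass between
  them almost everywhere.\<close>

definition half_open_cube :: "(real^'n::finite) set" where
  "half_open_cube = {y. \<forall>i. - 1/2 \<le> y $ i \<and> y $ i < 1/2}"

lemma unit_cube_eq_box: "unit_cube = box (\<chi> i. - 1/2) (\<chi> i. 1/2)"
  by (auto simp: unit_cube_def mem_box_cart)

lemma open_unit_cube [simp]: "open unit_cube" and bounded_unit_cube [simp]: "bounded unit_cube"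
  by (auto simp: unit_cube_eq_box)

lemma convex_unit_cube [simp]: "convex unit_cube"
  by (auto simp: unit_cube_eq_box)

lemma emeasure_unit_cube: "emeasure lborel (unit_cube :: (real^'n::finite) set) = 1"
proof -
  have "((\<chi> i. 1/2) - (\<chi> i. - 1/2)) \<bullet> b = 1" if "b \<in> Basis" for b :: "real^'n"
    using that by (auto simp: Basis_vec_def inner_axis)
  moreover have "(\<chi> i. - 1/2) \<bullet> b \<le> (\<chi> i. 1/2) \<bullet> b" if "b \<in> Basis" for b :: "real^'n"
    using that by (auto simp: Basis_vec_def inner_axis)
  ultimately show ?thesis
    unfolding unit_cube_eq_box by (simp add: emeasure_lborel_box_eq)
qed

lemma unit_cube_lebesgue [simp]: "unit_cube \<in> sets lebesgue" and unit_cube_borel [measurable]: "unit_cube \<in> sets borel"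
  by (auto simp: borel_open)

lemma half_open_cube_borel [measurable]: "half_open_cube \<in> sets borel"
  unfolding half_open_cube_def by measurable

lemma unit_cube_subset_half_open: "unit_cube \<subseteq> half_open_cube"
  by (auto simp: unit_cube_def half_open_cube_def less_imp_le)

lemma half_open_diff_null: "half_open_cube - unit_cube \<in> null_sets lborel"
proof -
  have "half_open_cube - unit_cube \<subseteq> cbox (\<chi> i. - 1/2) (\<chi> i. 1/2) - box (\<chi> i. - 1/2) (\<chi> i. 1/2)"
    unfolding unit_cube_eq_box[symmetric] by (auto simp: half_open_cube_def mem_box_cart less_imp_le)
  moreover have "cbox a b - box a b \<in> null_sets lborel" for a b :: "real^'n"
    by (metis negligible_frontier_interval negligible_iff_null_sets null_sets_completion_iff
        sets.Diff borel_closed closed_cbox borel_open open_box sets_lborel)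
  ultimately show ?thesis
    using null_sets_subset by (metis half_open_cube_borel sets.Diff sets_lborel unit_cube_borel)
qed

lemma AE_unit_cube_iff_half_open: "AE y in lebesgue. y \<in> unit_cube \<longleftrightarrow> y \<in> half_open_cube"
  using AE_completion[OF AE_not_in[OF half_open_diff_null]] unit_cube_subset_half_open
  by (auto elim!: eventually_mono)

lemma dcube_borel [measurable]: "dcube k x \<in> sets borel"
  unfolding dcube_iff[abs_def, folded Collect_mem_eq]
  by (subst set_eq_iff[THEN iffD2, of "dcube k x" "{y. \<forall>i. - 1/2 \<le> 2^k * (y $ i - dcenter k x $ i) \<and> 2^k * (y $ i - dcenter k x $ i) < 1/2}"])
     (auto simp: dcube_iff, measurable)

lemma dcube_lebesgue [simp]: "dcube k x \<in> sets lebesgue"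
  by (intro sets_completionI_sets) simp

subsection \<open>Affine change of variables\<close>

lemma measurable_lebesgue_affine:
  fixes c :: "'a::euclidean_space"
  assumes "r \<noteq> 0"
  shows "(\<lambda>x. c + r *\<^sub>R x) \<in> lebesgue \<rightarrow>\<^sub>M lebesgue"
proof -
  have "(\<lambda>x. c + (\<Sum>j\<in>Basis. (r * (x \<bullet> j)) *\<^sub>R j)) \<in> lebesgue \<rightarrow>\<^sub>M lebesgue"
    using assms by (rule lebesgue_affine_measurable)
  then show ?thesis
    unfolding scaleR_scaleR[symmetric] scaleR_sum_right[symmetric] euclidean_representation .
qed

lemma lebesgue_affine:
  fixes c :: "'a::euclidean_space"
  assumes "r \<noteq> 0"
  shows "lebesgue = density (distr lebesgue lebesgue (\<lambda>x. c + r *\<^sub>R x)) (\<lambda>_. ennreal (\<bar>r\<bar> ^ DIM('a)))"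
  using lebesgue_affine_euclidean[of "\<lambda>_. r" c] assms
  unfolding scaleR_scaleR[symmetric] scaleR_sum_right[symmetric] euclidean_representation
  by (simp add: prod_constant)

lemma nn_integral_lebesgue_affine:
  fixes c :: "'a::euclidean_space"
  assumes r: "r \<noteq> 0" and f: "f \<in> borel_measurable lebesgue"
  shows "(\<integral>\<^sup>+x. f x \<partial>lebesgue) = ennreal (\<bar>r\<bar> ^ DIM('a)) * (\<integral>\<^sup>+x. f (c + r *\<^sub>R x) \<partial>lebesgue)"
proof -
  note [measurable] = measurable_lebesgue_affine[OF r] f
  have "(\<integral>\<^sup>+x. f x \<partial>lebesgue) =
      (\<integral>\<^sup>+x. f x \<partial>density (distr lebesgue lebesgue (\<lambda>x. c + r *\<^sub>R x)) (\<lambda>_. ennreal (\<bar>r\<bar> ^ DIM('a))))"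
    using lebesgue_affine[OF r] by metis
  also have "\<dots> = ennreal (\<bar>r\<bar> ^ DIM('a)) * (\<integral>\<^sup>+x. f x \<partial>distr lebesgue lebesgue (\<lambda>x. c + r *\<^sub>R x))"
    using f by (subst nn_integral_density) (auto intro: nn_integral_cmult)
  also have "\<dots> = ennreal (\<bar>r\<bar> ^ DIM('a)) * (\<integral>\<^sup>+x. f (c + r *\<^sub>R x) \<partial>lebesgue)"
    by (subst nn_integral_distr[OF measurable_lebesgue_affine[OF r]]) (use f in auto)
  finally show ?thesis .
qed

text \<open>The indicator of the exceptional null set and its pull-back have integrals that agree up
  to the nonzero factor of the change of variables.\<close>

lemma AE_lebesgue_affine:
  fixes c :: "'a::euclidean_space"
  assumes r: "r \<noteq> 0" and P: "AE x in lebesgue. P x"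
  shows "AE x in lebesgue. P (c + r *\<^sub>R x)"
proof -
  obtain N where N: "N \<in> null_sets lebesgue" "{x. \<not> P x} \<subseteq> N"
    using P by (auto simp: eventually_ae_filter)
  have m: "(\<lambda>x. c + r *\<^sub>R x) -` N \<in> sets lebesgue"
    using measurable_sets[OF measurable_lebesgue_affine[OF r, of c], of N] N by auto
  have "(\<integral>\<^sup>+x. indicator N x \<partial>lebesgue) = ennreal (\<bar>r\<bar> ^ DIM('a)) * (\<integral>\<^sup>+x. indicator N (c + r *\<^sub>R x) \<partial>lebesgue)"
    using N by (intro nn_integral_lebesgue_affine r) auto
  moreover have "(\<integral>\<^sup>+x. indicator N x \<partial>lebesgue) = emeasure lebesgue N"
    using N by (intro nn_integral_indicator) auto
  ultimately have "(\<integral>\<^sup>+x. indicator N (c + r *\<^sub>R x) \<partial>lebesgue) = 0"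
    using N r by (auto simp: null_sets_def simp del: emeasure_completion nn_integral_indicator)
  moreover have "indicator N (c + r *\<^sub>R x) = (indicator ((\<lambda>x. c + r *\<^sub>R x) -` N) x :: ennreal)" for x
    by (auto simp: indicator_def)
  ultimately have "emeasure lebesgue ((\<lambda>x. c + r *\<^sub>R x) -` N) = 0"
    using nn_integral_indicator[OF m] by simp
  then show ?thesis
    using m N by (intro AE_I[of _ _ "(\<lambda>x. c + r *\<^sub>R x) -` N"]) auto
qed

lemma
  fixes c :: "'a::euclidean_space" and f :: "'a \<Rightarrow> 'b::{banach, second_countable_topology}"
  assumes r: "r \<noteq> 0" and f: "f \<in> borel_measurable lebesgue"
  shows integral_lebesgue_affine:
      "(\<integral>x. f x \<partial>lebesgue) = (\<bar>r\<bar> ^ DIM('a)) *\<^sub>R (\<integral>x. f (c + r *\<^sub>R x) \<partial>lebesgue)"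
    and integrable_lebesgue_affine:
      "integrable lebesgue f \<longleftrightarrow> integrable lebesgue (\<lambda>x. f (c + r *\<^sub>R x))"
proof -
  let ?D = "distr lebesgue lebesgue (\<lambda>x. c + r *\<^sub>R x)"
  have "(\<integral>x. f x \<partial>lebesgue) = (\<integral>x. f x \<partial>density ?D (\<lambda>_. ennreal (\<bar>r\<bar> ^ DIM('a))))"
    using lebesgue_affine[OF r] by metis
  also have "\<dots> = (\<integral>x. (\<bar>r\<bar> ^ DIM('a)) *\<^sub>R f x \<partial>?D)"
    using f by (subst integral_density) auto
  also have "\<dots> = (\<integral>x. (\<bar>r\<bar> ^ DIM('a)) *\<^sub>R f (c + r *\<^sub>R x) \<partial>lebesgue)"
    using f by (subst integral_distr[OF measurable_lebesgue_affine[OF r]]) auto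
  finally show "(\<integral>x. f x \<partial>lebesgue) = (\<bar>r\<bar> ^ DIM('a)) *\<^sub>R (\<integral>x. f (c + r *\<^sub>R x) \<partial>lebesgue)"
    using r by simp
  have "integrable lebesgue f \<longleftrightarrow> integrable (density ?D (\<lambda>_. ennreal (\<bar>r\<bar> ^ DIM('a)))) f"
    using lebesgue_affine[OF r, of c] by metis
  also have "\<dots> \<longleftrightarrow> integrable ?D (\<lambda>x. (\<bar>r\<bar> ^ DIM('a)) *\<^sub>R f x)"
    using f by (subst integrable_density) auto
  also have "\<dots> \<longleftrightarrow> integrable lebesgue (\<lambda>x. (\<bar>r\<bar> ^ DIM('a)) *\<^sub>R f (c + r *\<^sub>R x))"
    using f by (subst integrable_distr_eq[OF measurable_lebesgue_affine[OF r]]) auto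
  also have "\<dots> \<longleftrightarrow> integrable lebesgue (\<lambda>x. f (c + r *\<^sub>R x))"
  proof
    assume "integrable lebesgue (\<lambda>x. (\<bar>r\<bar> ^ DIM('a)) *\<^sub>R f (c + r *\<^sub>R x))"
    from integrable_scaleR_right[OF this, of "1 / \<bar>r\<bar> ^ DIM('a)"]
    show "integrable lebesgue (\<lambda>x. f (c + r *\<^sub>R x))" using r by simp
  qed auto
  finally show "integrable lebesgue f \<longleftrightarrow> integrable lebesgue (\<lambda>x. f (c + r *\<^sub>R x))" .
qed

lemma indicator_dcube_affine:
  "AE y in lebesgue. y \<in> unit_cube \<longleftrightarrow> dcenter k x + (1 / 2^k) *\<^sub>R y \<in> dcube k x"
proof -
  have "dcenter k x + (1 / 2^k) *\<^sub>R y \<in> dcube k x \<longleftrightarrow> y \<in> half_open_cube" for y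
    by (auto simp: dcube_iff half_open_cube_def)
  then show ?thesis using AE_unit_cube_iff_half_open by simp
qed

lemma unit_cube_to_dcube: "y \<in> unit_cube \<Longrightarrow> dcenter k x + (1 / 2^k) *\<^sub>R y \<in> dcube k x"
  by (auto simp: dcube_iff unit_cube_def less_imp_le)

text \<open>The affine normalisation turns the cube into the half-open unit cube; the faces that
  distinguish it from the open one carry no mass, so \<open>unit_cube\<close> can stand on the
  right.\<close>

lemma nn_integral_dcube:
  fixes x :: "real^'n::finite"
  assumes f: "f \<in> borel_measurable (lebesgue_on (dcube k x))"
  shows "(\<integral>\<^sup>+y. f y \<partial>lebesgue_on (dcube k x)) =
    ennreal (dvol TYPE('n) k) * (\<integral>\<^sup>+y. f (dcenter k x + (1 / 2^k) *\<^sub>R y) \<partial>lebesgue_on unit_cube)"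
proof -
  let ?T = "\<lambda>y. dcenter k x + (1 / 2^k) *\<^sub>R y"
  have m: "(\<lambda>y. f y * indicator (dcube k x) y) \<in> borel_measurable lebesgue"
    using f by (subst (asm) borel_measurable_restrict_space_iff_ennreal) auto
  have "(\<integral>\<^sup>+y. f y \<partial>lebesgue_on (dcube k x)) = (\<integral>\<^sup>+y. f y * indicator (dcube k x) y \<partial>lebesgue)"
    by (subst nn_integral_restrict_space) auto
  also have "\<dots> = ennreal (dvol TYPE('n) k) * (\<integral>\<^sup>+y. f (?T y) * indicator (dcube k x) (?T y) \<partial>lebesgue)"
    by (subst nn_integral_lebesgue_affine[where r="1/2^k" and c="dcenter k x", OF _ m]) (auto simp: dvol_def)
  also have "(\<integral>\<^sup>+y. f (?T y) * indicator (dcube k x) (?T y) \<partial>lebesgue) =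
      (\<integral>\<^sup>+y. f (?T y) * indicator unit_cube y \<partial>lebesgue)"
    using indicator_dcube_affine[of k x] by (intro nn_integral_cong_AE) (auto elim!: eventually_mono simp: indicator_def)
  also have "\<dots> = (\<integral>\<^sup>+y. f (?T y) \<partial>lebesgue_on unit_cube)"
    by (subst nn_integral_restrict_space) auto
  finally show ?thesis .
qed

lemma measurable_dcube_affine:
  fixes x :: "real^'n::finite"
  assumes f: "f \<in> borel_measurable (lebesgue_on (dcube k x))"
  shows "(\<lambda>y. f (dcenter k x + (1 / 2^k) *\<^sub>R y)) \<in> borel_measurable (lebesgue_on unit_cube)"
proof -
  have "(\<lambda>y. dcenter k x + (1 / 2^k) *\<^sub>R y) \<in> lebesgue_on unit_cube \<rightarrow>\<^sub>M lebesgue_on (dcube k x)"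
    by (intro measurable_restrict_space3 measurable_lebesgue_affine) (auto simp: unit_cube_to_dcube)
  from measurable_compose[OF this f] show ?thesis .
qed

lemma
  fixes x :: "real^'n::finite" and f :: "real^'n \<Rightarrow> 'b::{banach, second_countable_topology}"
  assumes f: "f \<in> borel_measurable (lebesgue_on (dcube k x))"
  shows integral_dcube: "(\<integral>y. f y \<partial>lebesgue_on (dcube k x)) =
      dvol TYPE('n) k *\<^sub>R (\<integral>y. f (dcenter k x + (1 / 2^k) *\<^sub>R y) \<partial>lebesgue_on unit_cube)"
    and integrable_dcube: "integrable (lebesgue_on (dcube k x)) f \<longleftrightarrow>
      integrable (lebesgue_on unit_cube) (\<lambda>y. f (dcenter k x + (1 / 2^k) *\<^sub>R y))"
proof -
  let ?T = "\<lambda>y. dcenter k x + (1 / 2^k) *\<^sub>R y"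
  have m: "(\<lambda>y. indicator (dcube k x) y *\<^sub>R f y) \<in> borel_measurable lebesgue"
    using f by (subst (asm) borel_measurable_restrict_space_iff) auto
  note m1 = measurable_dcube_affine[OF f]
  have m2: "(\<lambda>y. indicator unit_cube y *\<^sub>R f (?T y)) \<in> borel_measurable lebesgue"
    using m1 by (subst (asm) borel_measurable_restrict_space_iff) auto
  have m3: "(\<lambda>y. indicator (dcube k x) (?T y) *\<^sub>R f (?T y)) \<in> borel_measurable lebesgue"
    using measurable_compose[OF measurable_lebesgue_affine m, of "1/2^k"] by auto
  have ae: "AE y in lebesgue. indicator (dcube k x) (?T y) *\<^sub>R f (?T y) = indicator unit_cube y *\<^sub>R f (?T y)"
    using indicator_dcube_affine[of k x] by (auto elim!: eventually_mono simp: indicator_def)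
  show "(\<integral>y. f y \<partial>lebesgue_on (dcube k x)) = dvol TYPE('n) k *\<^sub>R (\<integral>y. f (?T y) \<partial>lebesgue_on unit_cube)"
    using integral_lebesgue_affine[OF _ m, of "1/2^k" "dcenter k x"] integral_cong_AE[OF m3 m2 ae]
    by (simp add: integral_restrict_space dvol_def)
  show "integrable (lebesgue_on (dcube k x)) f \<longleftrightarrow> integrable (lebesgue_on unit_cube) (\<lambda>y. f (?T y))"
    using integrable_lebesgue_affine[OF _ m, of "1/2^k" "dcenter k x"] integrable_cong_AE[OF m3 m2 ae]
    by (simp add: integrable_restrict_space)
qed

lemma emeasure_dcube: "emeasure lebesgue (dcube k (x::real^'n::finite)) = ennreal (dvol TYPE('n) k)"
  using nn_integral_dcube[of "\<lambda>_. 1" k x] emeasure_unit_cube[where 'n='n]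
  by (simp add: emeasure_restrict_space)

lemma measure_dcube: "measure lebesgue (dcube k (x::real^'n::finite)) = dvol TYPE('n) k"
  using emeasure_dcube[of k x] by (simp add: measure_def)

lemma dcube_lmeasurable [simp]: "dcube k x \<in> lmeasurable"
  using emeasure_dcube[of k x] by (intro fmeasurableI) auto

lemma unit_cube_lmeasurable [simp]: "unit_cube \<in> lmeasurable"
  by (intro fmeasurableI) (simp_all add: emeasure_unit_cube)

lemma measure_unit_cube [simp]: "measure lebesgue (unit_cube :: (real^'n::finite) set) = 1"
  using emeasure_unit_cube[where 'n='n] by (simp add: measure_def)

subsection \<open>Averages over dyadic cubes\<close>

text \<open>Countably many integer vectors label the cubes of one generation. Whatever is constant
  on these cubes is therefore Borel, which makes averages and levels measurable without a Fubini
  argument.\<close>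

lemma dcube_union_borel:
  fixes S :: "(real^'n::finite) set"
  assumes "\<And>x. x \<in> S \<Longrightarrow> dcube k x \<subseteq> S"
  shows "S \<in> sets borel"
proof -
  define l where "l x = (\<lambda>i. \<lfloor>2^k * x $ i\<rfloor>)" for x :: "real^'n"
  have "S = (\<Union>z\<in>l ` S. {y. l y = z})"
    using assms by (fastforce simp: l_def dcube_def fun_eq_iff)
  moreover have "{y. l y = z} \<in> sets borel" if "z \<in> l ` S" for z
  proof -
    from that obtain x where "z = l x" by (elim imageE)
    then have "{y. l y = z} = dcube k x" by (auto simp: l_def dcube_def fun_eq_iff)
    then show ?thesis by simp
  qed
  moreover have "countable (l ` S)" by (rule countableI_type)
  ultimately show ?thesis using sets.countable_UN'[of "l ` S" "\<lambda>z. {y. l y = z}" borel] by auto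
qed

lemma measurable_vec_nth [measurable (raw)]:
  fixes f :: "'a \<Rightarrow> 'b::euclidean_space ^ 'n::finite"
  assumes "f \<in> borel_measurable M"
  shows "(\<lambda>x. f x $ i) \<in> borel_measurable M"
  by (rule measurable_compose[OF assms borel_measurable_continuous_onI])
     (auto intro!: continuous_intros)

lemma dcube_rel_measurable [measurable]:
  "Measurable.pred (borel \<Otimes>\<^sub>M borel) (\<lambda>(x, y). y \<in> dcube k (x::real^'a::finite))"
proof -
  \<comment> \<open>Equality of the two floors is stated as a real difference lying in
    \<open>{0}\<close>, a measurable condition on a real-valued function.\<close>
  have "(\<lambda>(x, y). y \<in> dcube k (x::real^'a)) = (\<lambda>z. \<forall>i. real_of_int \<lfloor>2^k * snd z $ i\<rfloor> - real_of_int \<lfloor>2^k * fst z $ i\<rfloor> \<in> {0})"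
    by (auto simp: dcube_def)
  moreover have "Measurable.pred (borel \<Otimes>\<^sub>M borel) (\<lambda>z::(real^'a) \<times> (real^'a). \<forall>i. real_of_int \<lfloor>2^k * snd z $ i\<rfloor> - real_of_int \<lfloor>2^k * fst z $ i\<rfloor> \<in> {0})"
    by measurable
  ultimately show ?thesis by (simp only:)
qed

text \<open>Averaging is integration against a symmetric kernel of total mass one, so exchanging the
  order of integration returns \<open>f\<close>. The generation \<open>\<kappa>\<close> may vary
  with the point as long as it is constant on the cube it selects: a constant
  \<open>\<kappa>\<close> serves the averages in the sufficiency proof, a variable one the filling
  in the necessity proof.\<close>

lemma tower_dcube:
  fixes f :: "real^'n::finite \<Rightarrow> ennreal"
  assumes sub: "\<And>x. x \<in> \<Omega> \<Longrightarrow> dcube (\<kappa> x) x \<subseteq> \<Omega>"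
    and cst: "\<And>x y. x \<in> \<Omega> \<Longrightarrow> y \<in> dcube (\<kappa> x) x \<Longrightarrow> \<kappa> y = \<kappa> x"
    and f: "f \<in> borel_measurable (lebesgue_on \<Omega>)"
  shows "(\<integral>\<^sup>+x. ennreal (1 / dvol TYPE('n) (\<kappa> x)) * (\<integral>\<^sup>+y. f y \<partial>lebesgue_on (dcube (\<kappa> x) x)) \<partial>lebesgue_on \<Omega>)
    = (\<integral>\<^sup>+x. f x \<partial>lebesgue_on \<Omega>)"
proof -
  define \<Omega>k where "\<Omega>k k = {x \<in> \<Omega>. \<kappa> x = k}" for k
  have Ok: "\<Omega>k k \<in> sets borel" for k
  proof (rule dcube_union_borel[of _ k])
    fix x assume x: "x \<in> \<Omega>k k"
    show "dcube k x \<subseteq> \<Omega>k k"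
    proof
      fix y assume y: "y \<in> dcube k x"
      then have "y \<in> \<Omega>" "\<kappa> y = k" using sub[of x] cst[of x y] x by (auto simp: \<Omega>k_def)
      then show "y \<in> \<Omega>k k" by (simp add: \<Omega>k_def)
    qed
  qed
  have "\<Omega> = (\<Union>k. \<Omega>k k)" by (auto simp: \<Omega>k_def)
  then have O[measurable]: "\<Omega> \<in> sets borel" using Ok by (auto intro!: sets.countable_UN)
  have OL: "\<Omega> \<in> sets lebesgue" using O by simp
  \<comment> \<open>Extended by 0 off \<open>\<Omega>\<close>, the generation becomes Borel on the
    whole space.\<close>
  define \<kappa>' where "\<kappa>' x = (if x \<in> \<Omega> then \<kappa> x else 0)" for x
  have k'[measurable]: "\<kappa>' \<in> borel \<rightarrow>\<^sub>M count_space UNIV"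
  proof (subst measurable_count_space_eq2_countable, safe)
    fix k
    have "\<kappa>' -` {k} = \<Omega>k k \<union> (if k = 0 then - \<Omega> else {})"
      by (auto simp: \<kappa>'_def \<Omega>k_def split: if_splits)
    then show "\<kappa>' -` {k} \<inter> space borel \<in> sets borel" using Ok O by auto
  qed auto
  have fm: "(\<lambda>x. f x * indicator \<Omega> x) \<in> borel_measurable (completion lborel)"
    using f OL by (subst (asm) borel_measurable_restrict_space_iff_ennreal) auto
  \<comment> \<open>The exchange of integrals takes place on the Borel product space, so
    \<open>f\<close> is replaced by an almost everywhere equal Borel function.\<close>
  obtain g where g[measurable]: "g \<in> borel_measurable lborel" and fg: "AE x in lborel. f x * indicator \<Omega> x = g x"
    using completion_ex_borel_measurable[OF fm] by blast
  define K :: "real^'n \<Rightarrow> real^'n \<Rightarrow> ennreal"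
    where "K x y = (if x \<in> \<Omega> \<and> y \<in> dcube (\<kappa>' x) x then ennreal (1 / dvol TYPE('n) (\<kappa>' x)) else 0)" for x y
  have Kk: "(\<lambda>z. if fst z \<in> \<Omega> \<and> snd z \<in> dcube k (fst z) then ennreal (1 / dvol TYPE('n) k) else 0)
      \<in> borel_measurable (lborel \<Otimes>\<^sub>M lborel)" for k
  proof -
    have [measurable]: "Measurable.pred (lborel \<Otimes>\<^sub>M lborel) (\<lambda>z. snd z \<in> dcube k (fst z :: real^'n))"
      using dcube_rel_measurable[of k] by (simp add: case_prod_unfold cong: measurable_cong_sets sets_pair_measure_cong)
    show ?thesis by measurable
  qed
  have Km[measurable]: "(\<lambda>z. K (fst z) (snd z)) \<in> borel_measurable (lborel \<Otimes>\<^sub>M lborel)"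
    unfolding K_def by (rule measurable_compose_countable[OF Kk]) measurable
  have Km'[measurable]: "case_prod K \<in> borel_measurable (lborel \<Otimes>\<^sub>M lborel)"
    using Km by (simp add: case_prod_unfold)
  \<comment> \<open>The constancy of \<open>\<kappa>\<close> on its cubes enters here: if
    \<open>y\<close> is in the cube of \<open>x\<close>, both points select the same cube.\<close>
  have Ksym: "K x y = K y x" for x y
  proof -
    have *: "b \<in> \<Omega> \<and> a \<in> dcube (\<kappa> b) b \<and> \<kappa> b = \<kappa> a" if a: "a \<in> \<Omega>" and b: "b \<in> dcube (\<kappa> a) a" for a b
    proof -
      have "b \<in> \<Omega>" using sub[OF a] b by (rule subsetD)
      moreover have k: "\<kappa> b = \<kappa> a" using cst[OF a b] .
      moreover have "a \<in> dcube (\<kappa> b) b" using b unfolding k by (subst dcube_sym)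
      ultimately show ?thesis by blast
    qed
    show ?thesis
    proof (cases "x \<in> \<Omega> \<and> y \<in> dcube (\<kappa> x) x")
      case True
      then show ?thesis using *[of x y] by (auto simp: K_def \<kappa>'_def)
    next
      case False
      then have "\<not> (y \<in> \<Omega> \<and> x \<in> dcube (\<kappa> y) y)" using *[of y x] by metis
      then show ?thesis using False by (auto simp: K_def \<kappa>'_def)
    qed
  qed
  have inner: "ennreal (1 / dvol TYPE('n) (\<kappa> x)) * (\<integral>\<^sup>+y. f y \<partial>lebesgue_on (dcube (\<kappa> x) x)) * indicator \<Omega> x
      = (\<integral>\<^sup>+y. K x y * g y \<partial>lborel)" for x
  proof (cases "x \<in> \<Omega>")
    case True
    have "(\<integral>\<^sup>+y. f y \<partial>lebesgue_on (dcube (\<kappa> x) x)) = (\<integral>\<^sup>+y. f y * indicator (dcube (\<kappa> x) x) y \<partial>lborel)"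
      by (subst nn_integral_restrict_space) (auto simp: nn_integral_completion)
    also have "\<dots> = (\<integral>\<^sup>+y. g y * indicator (dcube (\<kappa> x) x) y \<partial>lborel)"
      using fg sub[OF True] by (intro nn_integral_cong_AE) (auto elim!: eventually_mono simp: indicator_def)
    finally have "ennreal (1 / dvol TYPE('n) (\<kappa> x)) * (\<integral>\<^sup>+y. f y \<partial>lebesgue_on (dcube (\<kappa> x) x))
      = (\<integral>\<^sup>+y. ennreal (1 / dvol TYPE('n) (\<kappa> x)) * (g y * indicator (dcube (\<kappa> x) x) y) \<partial>lborel)"
      by (subst nn_integral_cmult) auto
    also have "\<dots> = (\<integral>\<^sup>+y. K x y * g y \<partial>lborel)"
      using True by (intro nn_integral_cong) (auto simp: K_def \<kappa>'_def indicator_def)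
    finally show ?thesis using True by simp
  qed (simp add: K_def)
  have "(\<integral>\<^sup>+x. ennreal (1 / dvol TYPE('n) (\<kappa> x)) * (\<integral>\<^sup>+y. f y \<partial>lebesgue_on (dcube (\<kappa> x) x)) \<partial>lebesgue_on \<Omega>)
     = (\<integral>\<^sup>+x. (\<integral>\<^sup>+y. K x y * g y \<partial>lborel) \<partial>lborel)"
    using OL by (subst nn_integral_restrict_space) (auto simp: nn_integral_completion inner)
  also have "\<dots> = (\<integral>\<^sup>+y. (\<integral>\<^sup>+x. K x y * g y \<partial>lborel) \<partial>lborel)"
    by (rule lborel_pair.Fubini') measurable
  also have "\<dots> = (\<integral>\<^sup>+y. f y * indicator \<Omega> y \<partial>lborel)"
  proof (rule nn_integral_cong_AE, use fg in eventually_elim)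
    fix y assume y: "f y * indicator \<Omega> y = g y"
    have "(\<integral>\<^sup>+x. K x y \<partial>lborel) = indicator \<Omega> y"
    proof (cases "y \<in> \<Omega>")
      case True
      have "(\<integral>\<^sup>+x. K x y \<partial>lborel) = (\<integral>\<^sup>+x. ennreal (1 / dvol TYPE('n) (\<kappa> y)) * indicator (dcube (\<kappa> y) y) x \<partial>lborel)"
        using True unfolding Ksym[of _ y] by (intro nn_integral_cong) (auto simp: K_def \<kappa>'_def indicator_def)
      also have "\<dots> = ennreal (1 / dvol TYPE('n) (\<kappa> y)) * emeasure lborel (dcube (\<kappa> y) y)"
        by (subst nn_integral_cmult_indicator) auto
      also have "\<dots> = 1"
        using emeasure_dcube[of "\<kappa> y" y] by (simp add: ennreal_mult'[symmetric])
      finally show ?thesis using True by simp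
    next
      case False
      then show ?thesis unfolding Ksym[of _ y] by (simp add: K_def)
    qed
    moreover have "(\<integral>\<^sup>+x. K x y * g y \<partial>lborel) = (\<integral>\<^sup>+x. K x y \<partial>lborel) * g y"
      by (rule nn_integral_multc) measurable
    ultimately show "(\<integral>\<^sup>+x. K x y * g y \<partial>lborel) = f y * indicator \<Omega> y"
      using y by (auto simp: indicator_def)
  qed
  also have "\<dots> = (\<integral>\<^sup>+x. f x \<partial>lebesgue_on \<Omega>)"
    using OL by (subst nn_integral_restrict_space) (auto simp: nn_integral_completion)
  finally show ?thesis .
qed

lemma tower_dcube_level:
  fixes f :: "real^'n::finite \<Rightarrow> ennreal"
  assumes f: "f \<in> borel_measurable lebesgue"
  shows "(\<integral>\<^sup>+x. ennreal (1 / dvol TYPE('n) k) * (\<integral>\<^sup>+y. f y \<partial>lebesgue_on (dcube k x)) \<partial>lebesgue)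
    = (\<integral>\<^sup>+x. f x \<partial>lebesgue)"
  using tower_dcube[of UNIV "\<lambda>_. k" f] f by (simp add: lebesgue_on_UNIV_eq)

lemma open_dcube_exhaust:
  assumes U: "open U" and x: "(x::real^'n::finite) \<in> U"
  obtains k where "\<And>j. j \<ge> k \<Longrightarrow> dcube j x \<subseteq> U"
proof -
  obtain e where e: "e > 0" "ball x e \<subseteq> U" using U x open_contains_ball by blast
  have "(\<lambda>k. CARD('n) / 2^k :: real) \<longlonglongrightarrow> 0" by (rule LIMSEQ_divide_realpow_zero) simp
  then have "eventually (\<lambda>k. CARD('n) / 2^k < e) sequentially"
    using e by (auto dest: order_tendstoD)
  then obtain k where k: "\<And>j. j \<ge> k \<Longrightarrow> CARD('n) / 2^j < e"
    by (auto simp: eventually_sequentially)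
  have "dcube j x \<subseteq> U" if "j \<ge> k" for j
  proof
    fix y assume "y \<in> dcube j x"
    then show "y \<in> U" using dist_dcube[of y j x] k[OF that] e by (auto simp: dist_commute)
  qed
  then show ?thesis using that by blast
qed

section \<open>Mean oscillation and dyadic differentiation of integrals\<close>

definition dosc :: "nat \<Rightarrow> (real^'n::finite \<Rightarrow> 'b::real_normed_vector) \<Rightarrow> real^'n \<Rightarrow> ennreal" where
  "dosc k g x = ennreal (1 / dvol TYPE('n) k) * (\<integral>\<^sup>+y. ennreal (norm (g y - g x)) * indicator (dcube k x) y \<partial>lborel)"

lemma dosc_measurable [measurable]:
  fixes g :: "real^'n::finite \<Rightarrow> 'b::{second_countable_topology, real_normed_vector}"
  assumes [measurable]: "g \<in> borel_measurable borel"
  shows "dosc k g \<in> borel_measurable borel"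
proof -
  have [measurable]: "Measurable.pred (borel \<Otimes>\<^sub>M lborel) (\<lambda>z. snd z \<in> dcube k (fst z :: real^'n))"
    using dcube_rel_measurable[of k] by (simp add: case_prod_unfold cong: measurable_cong_sets sets_pair_measure_cong)
  have "(\<lambda>z. ennreal (norm (g (snd z) - g (fst z))) * (if snd z \<in> dcube k (fst z) then 1 else 0))
     \<in> borel_measurable (borel \<Otimes>\<^sub>M lborel)"
    by measurable
  then have "(\<lambda>(x, y). ennreal (norm (g y - g x)) * indicator (dcube k x) y) \<in> borel_measurable (borel \<Otimes>\<^sub>M lborel)"
    by (simp add: case_prod_unfold indicator_def of_bool_def)
  then show ?thesis
    unfolding dosc_def by (intro borel_measurable_times_ennreal lborel.borel_measurable_nn_integral) auto
qed

lemma tower_lborel: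
  fixes f :: "real^'n::finite \<Rightarrow> ennreal"
  assumes f: "f \<in> borel_measurable borel"
  shows "(\<integral>\<^sup>+x. ennreal (1 / dvol TYPE('n) k) * (\<integral>\<^sup>+y. f y * indicator (dcube k x) y \<partial>lborel) \<partial>lborel)
    = (\<integral>\<^sup>+x. f x \<partial>lborel)"
  using tower_dcube_level[of f k] f
  by (simp add: nn_integral_restrict_space nn_integral_completion measurable_completion)

lemma dosc_add_le:
  fixes g :: "real^'n::finite \<Rightarrow> 'b::{second_countable_topology, real_normed_vector}"
  assumes [measurable]: "g \<in> borel_measurable borel" "h \<in> borel_measurable borel"
  shows "dosc k (\<lambda>x. g x + h x) x \<le> dosc k g x + dosc k h x"
proof -
  have "dosc k (\<lambda>x. g x + h x) x \<le> ennreal (1 / dvol TYPE('n) k) * (\<integral>\<^sup>+y. ennreal (norm (g y - g x)) * indicator (dcube k x) y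
      + ennreal (norm (h y - h x)) * indicator (dcube k x) y \<partial>lborel)"
    unfolding dosc_def
  proof (intro mult_left_mono nn_integral_mono)
    fix y
    have "norm (g y + h y - (g x + h x)) \<le> norm (g y - g x) + norm (h y - h x)"
      by (rule norm_diff_triangle_ineq)
    then show "ennreal (norm (g y + h y - (g x + h x))) * indicator (dcube k x) y
      \<le> ennreal (norm (g y - g x)) * indicator (dcube k x) y + ennreal (norm (h y - h x)) * indicator (dcube k x) y"
      by (auto simp: indicator_def simp flip: ennreal_plus)
  qed auto
  also have "\<dots> = dosc k g x + dosc k h x"
    unfolding dosc_def by (subst nn_integral_add) (auto simp: distrib_left)
  finally show ?thesis .
qed

text \<open>One copy of the norm comes from the average, whose integral is preserved, the other from
  the value at \<open>x\<close>. Uniformity in \<open>k\<close> makes vanishing oscillation stable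
  under L^1 limits.\<close>

lemma nn_integral_dosc_le:
  fixes g :: "real^'n::finite \<Rightarrow> 'b::{second_countable_topology, real_normed_vector}"
  assumes [measurable]: "g \<in> borel_measurable borel"
  shows "(\<integral>\<^sup>+x. dosc k g x \<partial>lborel) \<le> 2 * (\<integral>\<^sup>+x. ennreal (norm (g x)) \<partial>lborel)"
proof -
  have "dosc k g x \<le> ennreal (1 / dvol TYPE('n) k) * (\<integral>\<^sup>+y. ennreal (norm (g y)) * indicator (dcube k x) y \<partial>lborel) + ennreal (norm (g x))" for x
  proof -
    have "dosc k g x \<le> ennreal (1 / dvol TYPE('n) k) * (\<integral>\<^sup>+y. ennreal (norm (g y)) * indicator (dcube k x) y
      + ennreal (norm (g x)) * indicator (dcube k x) y \<partial>lborel)"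
      unfolding dosc_def
    proof (intro mult_left_mono nn_integral_mono)
      fix y
      show "ennreal (norm (g y - g x)) * indicator (dcube k x) y
        \<le> ennreal (norm (g y)) * indicator (dcube k x) y + ennreal (norm (g x)) * indicator (dcube k x) y"
        using norm_triangle_ineq4[of "g y" "g x"] by (auto simp: indicator_def simp flip: ennreal_plus)
    qed auto
    also have "\<dots> = ennreal (1 / dvol TYPE('n) k) * (\<integral>\<^sup>+y. ennreal (norm (g y)) * indicator (dcube k x) y \<partial>lborel)
        + ennreal (1 / dvol TYPE('n) k) * (ennreal (norm (g x)) * emeasure lborel (dcube k x))"
      by (subst nn_integral_add) (auto simp: distrib_left nn_integral_cmult_indicator)
    also have "ennreal (1 / dvol TYPE('n) k) * (ennreal (norm (g x)) * emeasure lborel (dcube k x)) = ennreal (norm (g x))"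
      using emeasure_dcube[of k x] by (simp flip: ennreal_mult)
    finally show ?thesis .
  qed
  then have "(\<integral>\<^sup>+x. dosc k g x \<partial>lborel) \<le>
     (\<integral>\<^sup>+x. ennreal (1 / dvol TYPE('n) k) * (\<integral>\<^sup>+y. ennreal (norm (g y)) * indicator (dcube k x) y \<partial>lborel) + ennreal (norm (g x)) \<partial>lborel)"
    by (intro nn_integral_mono)
  also have "\<dots> = (\<integral>\<^sup>+x. ennreal (norm (g x)) \<partial>lborel) + (\<integral>\<^sup>+x. ennreal (norm (g x)) \<partial>lborel)"
  proof (subst nn_integral_add)
    have [measurable]: "Measurable.pred (borel \<Otimes>\<^sub>M lborel) (\<lambda>z. snd z \<in> dcube k (fst z :: real^'n))"
      using dcube_rel_measurable[of k] by (simp add: case_prod_unfold cong: measurable_cong_sets sets_pair_measure_cong)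
    have "(\<lambda>z. ennreal (norm (g (snd z))) * (if snd z \<in> dcube k (fst z) then 1 else 0))
       \<in> borel_measurable (borel \<Otimes>\<^sub>M lborel)"
      by measurable
    then have "(\<lambda>(x, y). ennreal (norm (g y)) * indicator (dcube k x) y) \<in> borel_measurable (borel \<Otimes>\<^sub>M lborel)"
      by (simp add: case_prod_unfold indicator_def of_bool_def)
    then show "(\<lambda>x. ennreal (1 / dvol TYPE('n) k) * (\<integral>\<^sup>+y. ennreal (norm (g y)) * indicator (dcube k x) y \<partial>lborel)) \<in> borel_measurable lborel"
      by (auto intro!: borel_measurable_times_ennreal lborel.borel_measurable_nn_integral)
  qed (auto simp: tower_lborel)
  finally show ?thesis by (simp add: mult_2)
qed

text \<open>The oscillation vanishes in L^1 rather than pointwise: this version passes to L^1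
  limits, and pointwise information is recovered later along a subsequence.\<close>

definition dosc_null :: "(real^'n::finite \<Rightarrow> 'b::real_normed_vector) \<Rightarrow> bool" where
  "dosc_null g \<longleftrightarrow> (\<lambda>k. \<integral>\<^sup>+x. dosc k g x \<partial>lborel) \<longlonglongrightarrow> 0"

lemma dosc_null_approx:
  fixes g :: "real^'n::finite \<Rightarrow> 'b::{second_countable_topology, real_normed_vector}"
  assumes g[measurable]: "g \<in> borel_measurable borel"
    and ap: "\<And>e::real. e > 0 \<Longrightarrow> \<exists>h\<in>borel_measurable borel. dosc_null h \<and> (\<integral>\<^sup>+x. ennreal (norm (g x - h x)) \<partial>lborel) \<le> ennreal e"
  shows "dosc_null g"
  unfolding dosc_null_def
proof (rule order_tendstoI)
  fix a :: ennreal assume a: "0 < a"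
  \<comment> \<open>The oscillation of \<open>h\<close> contributes \<open>e\<close> and the
    approximation error \<open>2 * e\<close>.\<close>
  obtain e :: real where e: "e > 0" "ennreal (3 * e) < a"
  proof (cases "a = top")
    case True then show ?thesis using that[of 1] by simp
  next
    case False
    then obtain r where r: "a = ennreal r" "r > 0"
      using a by (cases a) auto
    then show ?thesis using that[of "r/6"] by (simp add: ennreal_lessI)
  qed
  obtain h where h[measurable]: "h \<in> borel_measurable borel" and hn: "dosc_null h"
    and hd: "(\<integral>\<^sup>+x. ennreal (norm (g x - h x)) \<partial>lborel) \<le> ennreal e"
    using ap[OF e(1)] by blast
  have "(\<integral>\<^sup>+x. dosc k g x \<partial>lborel) \<le> (\<integral>\<^sup>+x. dosc k h x \<partial>lborel) + 2 * ennreal e" for k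
  proof -
    have "(\<integral>\<^sup>+x. dosc k g x \<partial>lborel) \<le> (\<integral>\<^sup>+x. dosc k h x + dosc k (\<lambda>x. g x - h x) x \<partial>lborel)"
      using dosc_add_le[of h "\<lambda>x. g x - h x" k] by (intro nn_integral_mono) auto
    also have "\<dots> = (\<integral>\<^sup>+x. dosc k h x \<partial>lborel) + (\<integral>\<^sup>+x. dosc k (\<lambda>x. g x - h x) x \<partial>lborel)"
      by (rule nn_integral_add) measurable
    also have "\<dots> \<le> (\<integral>\<^sup>+x. dosc k h x \<partial>lborel) + 2 * ennreal e"
      using nn_integral_dosc_le[of "\<lambda>x. g x - h x" k] mult_left_mono[OF hd, of 2]
      by (intro add_left_mono) auto
    finally show ?thesis .
  qed
  note le = this
  have "eventually (\<lambda>k. (\<integral>\<^sup>+x. dosc k h x \<partial>lborel) < ennreal e) sequentially"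
    using hn e unfolding dosc_null_def by (intro order_tendstoD) auto
  then show "eventually (\<lambda>k. (\<integral>\<^sup>+x. dosc k g x \<partial>lborel) < a) sequentially"
  proof eventually_elim
    case (elim k)
    have "(\<integral>\<^sup>+x. dosc k g x \<partial>lborel) \<le> ennreal e + 2 * ennreal e"
      using le[of k] elim by (meson add_right_mono less_imp_le order_trans)
    also have "\<dots> = ennreal (3 * e)"
      using e by (simp add: ennreal_plus[symmetric] ennreal_mult'[symmetric] del: ennreal_plus flip: ennreal_numeral)
    finally show ?case using e by simp
  qed
qed auto

text \<open>Outer regularity replaces \<open>A\<close> by an open set \<open>U\<close>, and
  \<open>U\<close> is exhausted by unions of dyadic cubes of one generation. The indicator of such a
  union has no oscillation from that generation on.\<close>

lemma dosc_null_indicator: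
  fixes c :: "'b::{second_countable_topology, real_normed_vector}"
  assumes A: "A \<in> sets borel" and fin: "emeasure lborel (A::(real^'n::finite) set) < \<infinity>"
  shows "dosc_null (\<lambda>x. indicator A x *\<^sub>R c)"
proof (rule dosc_null_approx)
  show "(\<lambda>x. indicator A x *\<^sub>R c) \<in> borel_measurable borel" using A by measurable
  fix e :: real assume e: "e > 0"
  \<comment> \<open>Each of the two approximations, \<open>A\<close> by \<open>U\<close> and
    \<open>U\<close> by \<open>V k\<close>, errs on a set of measure less than \<open>d\<close>;
    hence the factor 2.\<close>
  define d where "d = e / (2 * (norm c + 1))"
  have nc: "norm c + 1 > 0" by (simp add: add_nonneg_pos)
  have d: "d > 0" "norm c * (2 * d) \<le> e" using e nc by (auto simp: d_def field_simps)
  have AL: "A \<in> sets lebesgue" using A by simp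
  obtain U where U: "open U" "A \<subseteq> U" "U - A \<in> lmeasurable" "emeasure lebesgue (U - A) < ennreal d"
    using sets_lebesgue_outer_open[OF AL d(1)] by blast
  have Ub[measurable]: "U \<in> sets borel" using U by simp
  have "emeasure lborel U \<le> emeasure lborel A + emeasure lborel (U - A)"
  proof -
    have "U = A \<union> (U - A)" using U by auto
    then show ?thesis using A Ub by (metis emeasure_subadditive sets.Diff sets_lborel)
  qed
  also have "\<dots> < \<infinity>" using U(4) fin A Ub
    by (auto simp: less_top[symmetric])
  finally have Ufin: "emeasure lborel U < \<infinity>" .
  define V where "V k = {x. dcube k x \<subseteq> U}" for k
  have Vb[measurable]: "V k \<in> sets borel" for k
    by (rule dcube_union_borel[of _ k]) (auto simp: V_def dest: dcube_eq)
  have inc: "incseq V" unfolding incseq_def V_def using dcube_mono by blast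
  have VU: "(\<Union>k. V k) = U"
  proof
    show "(\<Union>k. V k) \<subseteq> U" using dcube_self by (auto simp: V_def)
    show "U \<subseteq> (\<Union>k. V k)"
    proof
      fix x assume "x \<in> U"
      then obtain k where "\<And>j. j \<ge> k \<Longrightarrow> dcube j x \<subseteq> U" using open_dcube_exhaust[OF U(1)] by blast
      then show "x \<in> (\<Union>k. V k)" by (auto simp: V_def)
    qed
  qed
  have "(\<lambda>k. emeasure lborel (U - V k)) \<longlonglongrightarrow> emeasure lborel (\<Inter>k. U - V k)"
  proof (rule Lim_emeasure_decseq)
    show "decseq (\<lambda>k. U - V k)" using inc by (fastforce simp: decseq_def incseq_def)
    fix k
    have "emeasure lborel (U - V k) \<le> emeasure lborel U" by (intro emeasure_mono) auto
    then show "emeasure lborel (U - V k) \<noteq> \<infinity>" using Ufin by (auto simp: top_unique)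
  qed auto
  moreover have "(\<Inter>k. U - V k) = {}" using VU by auto
  ultimately have "(\<lambda>k. emeasure lborel (U - V k)) \<longlonglongrightarrow> 0" by (simp only: emeasure_empty)
  then have "eventually (\<lambda>k. emeasure lborel (U - V k) < ennreal d) sequentially"
    using d by (intro order_tendstoD) auto
  then obtain k where k: "emeasure lborel (U - V k) < ennreal d"
    by (auto simp: eventually_sequentially)
  let ?h = "\<lambda>x. indicator (V k) x *\<^sub>R c"
  \<comment> \<open>From generation \<open>k\<close> on, a cube lies either inside
    \<open>V k\<close> or in its complement.\<close>
  have "dosc j ?h x = 0" if "j \<ge> k" for j x
  proof -
    have "x \<in> V k \<longleftrightarrow> y \<in> V k" if y: "y \<in> dcube j x" for y
      using dcube_eq[of y k x] dcube_mono[OF \<open>j \<ge> k\<close>, of x] y unfolding V_def by blast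
    then have "ennreal (norm (?h y - ?h x)) * indicator (dcube j x) y = 0" for y
      by (cases "y \<in> dcube j x") (simp_all add: indicator_def)
    then show ?thesis unfolding dosc_def by (simp only:) simp
  qed
  then have "eventually (\<lambda>j. (\<integral>\<^sup>+x. dosc j ?h x \<partial>lborel) = 0) sequentially"
    by (intro eventually_sequentiallyI[of k]) simp
  then have 1: "dosc_null ?h" unfolding dosc_null_def by (rule tendsto_eventually)
  have "(\<integral>\<^sup>+x. ennreal (norm (indicator A x *\<^sub>R c - ?h x)) \<partial>lborel) \<le>
     (\<integral>\<^sup>+x. ennreal (norm c) * (indicator (U - A) x + indicator (U - V k) x) \<partial>lborel)"
  proof (intro nn_integral_mono)
    fix x
    have "x \<in> V k \<Longrightarrow> x \<in> U" using VU by blast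
    then show "ennreal (norm (indicator A x *\<^sub>R c - ?h x)) \<le> ennreal (norm c) * (indicator (U - A) x + indicator (U - V k) x)"
      using U(2) by (cases "x \<in> A"; cases "x \<in> V k") auto
  qed
  also have "\<dots> = ennreal (norm c) * (emeasure lborel (U - A) + emeasure lborel (U - V k))"
    using A U(1) Vb Ub by (simp add: nn_integral_cmult nn_integral_add)
  also have "\<dots> \<le> ennreal (norm c) * (ennreal d + ennreal d)"
  proof (intro mult_left_mono add_mono)
    show "emeasure lborel (U - A) \<le> ennreal d" using U(4) A Ub by simp
  qed (use k in auto)
  also have "\<dots> = ennreal (norm c * (2 * d))"
    using d(1) by (subst ennreal_plus[symmetric]) (simp_all only: ennreal_mult[symmetric] mult_2 norm_ge_zero add_nonneg_nonneg less_imp_le)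
  also have "\<dots> \<le> ennreal e" using d by (intro ennreal_leI)
  finally show "\<exists>h\<in>borel_measurable borel. dosc_null h \<and> (\<integral>\<^sup>+x. ennreal (norm (indicator A x *\<^sub>R c - h x)) \<partial>lborel) \<le> ennreal e"
    using 1 by (intro bexI[of _ ?h]) auto
qed

lemma dosc_null_integrable:
  fixes g :: "real^'n::finite \<Rightarrow> 'b::{banach, second_countable_topology}"
  assumes "integrable lborel g"
  shows "dosc_null g"
  using assms
proof induction
  case (base A c)
  then show ?case by (intro dosc_null_indicator) auto
next
  case (add f g)
  have [measurable]: "f \<in> borel_measurable borel" "g \<in> borel_measurable borel"
    using add by (auto dest: borel_measurable_integrable)
  have 0: "(\<lambda>k. (\<integral>\<^sup>+x. dosc k f x \<partial>lborel) + (\<integral>\<^sup>+x. dosc k g x \<partial>lborel)) \<longlonglongrightarrow> 0"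
    using tendsto_add[of "\<lambda>k. \<integral>\<^sup>+x. dosc k f x \<partial>lborel" 0 _ "\<lambda>k. \<integral>\<^sup>+x. dosc k g x \<partial>lborel" 0] add
    unfolding dosc_null_def by simp
  show ?case
    unfolding dosc_null_def
  proof (rule tendsto_sandwich[OF _ _ tendsto_const 0])
    show "eventually (\<lambda>k. (\<integral>\<^sup>+x. dosc k (\<lambda>x. f x + g x) x \<partial>lborel) \<le> (\<integral>\<^sup>+x. dosc k f x \<partial>lborel) + (\<integral>\<^sup>+x. dosc k g x \<partial>lborel)) sequentially"
    proof (intro always_eventually allI)
      fix k
      have "(\<integral>\<^sup>+x. dosc k (\<lambda>x. f x + g x) x \<partial>lborel) \<le> (\<integral>\<^sup>+x. dosc k f x + dosc k g x \<partial>lborel)"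
        by (intro nn_integral_mono dosc_add_le) measurable
      then show "(\<integral>\<^sup>+x. dosc k (\<lambda>x. f x + g x) x \<partial>lborel) \<le> (\<integral>\<^sup>+x. dosc k f x \<partial>lborel) + (\<integral>\<^sup>+x. dosc k g x \<partial>lborel)"
        by (subst (asm) nn_integral_add) auto
    qed
  qed auto
next
  case (lim f s)
  have [measurable]: "f \<in> borel_measurable borel" "\<And>i. s i \<in> borel_measurable borel"
    using lim by (auto dest: borel_measurable_integrable)
  show ?case
  proof (rule dosc_null_approx)
    fix e :: real assume e: "e > 0"
    have "(\<lambda>i. \<integral>\<^sup>+x. ennreal (norm (f x - s i x)) \<partial>lborel) \<longlonglongrightarrow> 0"
    proof (rule nn_integral_dominated_convergence_norm[where w="\<lambda>x. 2 * norm (f x)"])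
      show "AE x in lborel. norm (s j x) \<le> 2 * norm (f x)" for j
        using lim by simp
      have "integrable lborel (\<lambda>x. 2 * norm (f x))" using lim by auto
      then show "(\<integral>\<^sup>+x. ennreal (2 * norm (f x)) \<partial>lborel) < \<infinity>"
        by (subst nn_integral_eq_integral) auto
      show "AE x in lborel. (\<lambda>i. s i x) \<longlonglongrightarrow> f x" using lim by simp
    qed auto
    then have "eventually (\<lambda>i. (\<integral>\<^sup>+x. ennreal (norm (f x - s i x)) \<partial>lborel) < ennreal e) sequentially"
      using e by (intro order_tendstoD) auto
    then obtain i where "(\<integral>\<^sup>+x. ennreal (norm (f x - s i x)) \<partial>lborel) < ennreal e"
      by (auto simp: eventually_sequentially)
    then show "\<exists>h\<in>borel_measurable borel. dosc_null h \<and> (\<integral>\<^sup>+x. ennreal (norm (f x - h x)) \<partial>lborel) \<le> ennreal e"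
      using lim by (intro bexI[of _ "s i"]) (auto intro: less_imp_le)
  qed auto
qed

lemma completion_ex_borel_measurable_euclidean:
  fixes g :: "'a \<Rightarrow> 'b::euclidean_space"
  assumes g: "g \<in> borel_measurable (completion M)"
  shows "\<exists>h\<in>borel_measurable M. AE x in M. g x = h x"
proof -
  have "\<forall>b. \<exists>h\<in>borel_measurable M. AE x in M. g x \<bullet> b = h x"
    using g by (intro allI completion_ex_borel_measurable_real) auto
  then obtain h where h: "\<And>b. h b \<in> borel_measurable M" "\<And>b. AE x in M. g x \<bullet> b = h b x"
    by metis
  have "AE x in M. \<forall>b\<in>Basis. g x \<bullet> b = h b x"
    using h(2) by (subst AE_finite_all) auto
  then have "AE x in M. g x = (\<Sum>b\<in>Basis. h b x *\<^sub>R b)"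
  proof eventually_elim
    case (elim x)
    then have "(\<Sum>b\<in>Basis. h b x *\<^sub>R b) = (\<Sum>b\<in>Basis. (g x \<bullet> b) *\<^sub>R b)"
      by (intro sum.cong) auto
    then show ?case by (simp add: euclidean_representation)
  qed
  then show ?thesis using h(1) by (intro bexI[of _ "\<lambda>x. \<Sum>b\<in>Basis. h b x *\<^sub>R b"]) auto
qed

text \<open>L^1 convergence of the oscillation gives almost everywhere convergence along a
  subsequence \<open>r\<close> of generations. This suffices for the blow-up, which needs only
  arbitrarily fine good cubes, and it replaces a maximal inequality.\<close>

lemma dyadic_differentiation:
  fixes g :: "real^'n::finite \<Rightarrow> 'b::euclidean_space"
  assumes g: "integrable lebesgue g"
  obtains r :: "nat \<Rightarrow> nat" where "strict_mono r"
    "AE x in lebesgue. (\<lambda>j. ennreal (1 / dvol TYPE('n) (r j)) * (\<integral>\<^sup>+y. ennreal (norm (g y - g x)) \<partial>lebesgue_on (dcube (r j) x))) \<longlonglongrightarrow> 0"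
proof -
  obtain h where h[measurable]: "h \<in> borel_measurable lborel" and ae: "AE x in lborel. g x = h x"
    using completion_ex_borel_measurable_euclidean[OF borel_measurable_integrable[OF g]] by blast
  have hi: "integrable lborel h"
    using g h integrable_cong_AE[OF borel_measurable_integrable[OF g] measurable_completion[OF h] AE_completion[OF ae]]
    by (simp add: integrable_completion)
  have lim: "(\<lambda>k. \<integral>\<^sup>+x. dosc k h x \<partial>lborel) \<longlonglongrightarrow> 0"
    using dosc_null_integrable[OF hi] by (simp add: dosc_null_def)
  have [measurable]: "h \<in> borel_measurable borel" using h by simp
  have fin: "(\<integral>\<^sup>+x. dosc k h x \<partial>lborel) < \<infinity>" for k
  proof -
    have "(\<integral>\<^sup>+x. dosc k h x \<partial>lborel) \<le> 2 * (\<integral>\<^sup>+x. ennreal (norm (h x)) \<partial>lborel)"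
      by (rule nn_integral_dosc_le) measurable
    also have "\<dots> < \<infinity>" using hi by (simp add: integrable_iff_bounded ennreal_mult_less_top)
    finally show ?thesis .
  qed
  define u where "u k x = enn2real (dosc k h x)" for k x
  have aefin: "AE x in lborel. dosc k h x < \<infinity>" for k
    using nn_integral_PInf_AE[of "dosc k h" lborel] fin[of k] by (auto simp: less_top)
  have nnu: "(\<integral>\<^sup>+x. ennreal (norm (u k x)) \<partial>lborel) = (\<integral>\<^sup>+x. dosc k h x \<partial>lborel)" for k
    using aefin[of k] by (intro nn_integral_cong_AE) (auto elim!: eventually_mono simp: u_def)
  have ui: "integrable lborel (u k)" for k
  proof (rule integrableI_bounded)
    show "u k \<in> borel_measurable lborel" unfolding u_def by measurable
  qed (use fin[of k] nnu in simp)
  have "(\<lambda>k. \<integral>x. norm (u k x) \<partial>lborel) \<longlonglongrightarrow> 0"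
  proof -
    have "ennreal (\<integral>x. norm (u k x) \<partial>lborel) = (\<integral>\<^sup>+x. dosc k h x \<partial>lborel)" for k
      unfolding nnu[symmetric] by (subst nn_integral_eq_integral) (use ui in auto)
    then have "(\<lambda>k. ennreal (\<integral>x. norm (u k x) \<partial>lborel)) \<longlonglongrightarrow> ennreal 0" using lim by simp
    then show ?thesis by (subst (asm) tendsto_ennreal_iff) auto
  qed
  then obtain r where r: "strict_mono r" "AE x in lborel. (\<lambda>k. u (r k) x) \<longlonglongrightarrow> 0"
    using tendsto_L1_AE_subseq[of lborel u, OF ui] by auto
  have "AE x in lborel. \<forall>k. dosc k h x < \<infinity>" using aefin by (simp add: AE_all_countable)
  then have "AE x in lborel. (\<lambda>j. ennreal (1 / dvol TYPE('n) (r j)) * (\<integral>\<^sup>+y. ennreal (norm (g y - g x)) \<partial>lebesgue_on (dcube (r j) x))) \<longlonglongrightarrow> 0"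
    using r(2) ae
  proof eventually_elim
    case (elim x)
    have "ennreal (1 / dvol TYPE('n) j) * (\<integral>\<^sup>+y. ennreal (norm (g y - g x)) \<partial>lebesgue_on (dcube j x)) = ennreal (u j x)" for j
    proof -
      have "(\<integral>\<^sup>+y. ennreal (norm (g y - g x)) \<partial>lebesgue_on (dcube j x)) = (\<integral>\<^sup>+y. ennreal (norm (h y - h x)) * indicator (dcube j x) y \<partial>lborel)"
        using ae elim(3) by (subst nn_integral_restrict_space, simp, subst nn_integral_completion, intro nn_integral_cong_AE) (auto elim!: eventually_mono)
      then show ?thesis using elim(1) by (simp add: u_def dosc_def)
    qed
    moreover have "(\<lambda>j. ennreal (u (r j) x)) \<longlonglongrightarrow> ennreal 0" using elim(2) by (rule tendsto_ennrealI)
    ultimately show ?case by simp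
  qed
  then show ?thesis using that[OF r(1)] by (simp add: AE_completion_iff)
qed

subsection \<open>Smooth bump functions\<close>

text \<open>The one-variable counterpart of \<open>Ck\<close>: smoothness of a product of functions
  of single coordinates reduces to it factor by factor.\<close>

primrec D1 :: "nat \<Rightarrow> (real \<Rightarrow> real) \<Rightarrow> bool" where
  "D1 0 f \<longleftrightarrow> continuous_on UNIV f"
| "D1 (Suc k) f \<longleftrightarrow> (\<forall>x. f differentiable (at x)) \<and> D1 k (deriv f)"

lemma differentiable_imp_DERIV: "f differentiable (at x) \<Longrightarrow> DERIV f x :> deriv f (x::real)"
  using DERIV_deriv_iff_real_differentiable by blast

lemma D1_SucD: "D1 (Suc k) f \<Longrightarrow> D1 k f"
  by (induction k arbitrary: f)
     (auto simp: continuous_on_eq_continuous_at differentiable_imp_continuous_within)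

lemma D1_add: "D1 k f \<Longrightarrow> D1 k g \<Longrightarrow> D1 k (\<lambda>x. f x + g x)"
proof (induction k arbitrary: f g)
  case (Suc k)
  have "deriv (\<lambda>x. f x + g x) = (\<lambda>x. deriv f x + deriv g x)"
    using Suc.prems by (intro ext DERIV_imp_deriv DERIV_add) (auto intro: differentiable_imp_DERIV)
  then show ?case using Suc by auto
qed (auto intro: continuous_on_add)

lemma D1_mult: "D1 k f \<Longrightarrow> D1 k g \<Longrightarrow> D1 k (\<lambda>x. f x * g x)"
proof (induction k arbitrary: f g)
  case (Suc k)
  have "deriv (\<lambda>x. f x * g x) = (\<lambda>x. deriv f x * g x + deriv g x * f x)"
    using Suc.prems by (intro ext DERIV_imp_deriv DERIV_mult) (auto intro: differentiable_imp_DERIV)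
  moreover have "D1 k f" "D1 k g" using Suc.prems by (simp_all only: D1_SucD)
  ultimately show ?case using Suc by (auto intro!: D1_add)
qed (auto intro: continuous_on_mult)

lemma D1_const: "D1 k (\<lambda>x. c)"
proof (induction k arbitrary: c)
  case (Suc k)
  have "deriv (\<lambda>x. c) = (\<lambda>x. 0::real)" by (intro ext DERIV_imp_deriv) auto
  then show ?case using Suc by auto
qed auto

lemma D1_affine: "D1 k f \<Longrightarrow> D1 k (\<lambda>x. f (a * x + b))"
proof (induction k arbitrary: f)
  case 0
  then show ?case
    using continuous_on_compose2[of UNIV f UNIV "\<lambda>x. a * x + b"] by (simp add: continuous_intros)
next
  case (Suc k)
  have D: "DERIV (\<lambda>x. f (a * x + b)) x :> a * deriv f (a * x + b)" for x
  proof -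
    have "DERIV f (a * x + b) :> deriv f (a * x + b)" using Suc.prems by (auto intro: differentiable_imp_DERIV)
    then show ?thesis
      by (rule DERIV_chain2[where g="\<lambda>x. a * x + b", THEN DERIV_cong]) (auto intro!: derivative_eq_intros)
  qed
  then have "deriv (\<lambda>x. f (a * x + b)) = (\<lambda>x. a * deriv f (a * x + b))"
    by (intro ext DERIV_imp_deriv)
  then show ?case using Suc D by (auto intro!: D1_mult D1_const simp: real_differentiable_def)
qed

text \<open>In a class closed under taking derivatives every member is continuous, being
  differentiable, and differentiation never leaves the class; so induction on \<open>k\<close> shows
  smoothness.\<close>

lemma D1_closed:
  assumes "\<And>f. f \<in> S \<Longrightarrow> \<exists>g\<in>S. \<forall>x. DERIV f x :> g x" "f \<in> S"
  shows "D1 k f"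
  using assms(2)
proof (induction k arbitrary: f)
  case 0
  then show ?case using assms(1) by (metis DERIV_isCont D1.simps(1) continuous_at_imp_continuous_on)
next
  case (Suc k)
  then obtain g where g: "g \<in> S" "\<And>x. DERIV f x :> g x" using assms(1) by blast
  then have "deriv f = g" by (intro ext DERIV_imp_deriv)
  then show ?case using Suc.IH[OF g(1)] g(2) by (auto simp: real_differentiable_def)
qed

definition expinv :: "real \<Rightarrow> real" where
  "expinv t = (if t > 0 then exp (- (1 / t)) else 0)"

text \<open>All derivatives of \<open>expinv\<close> have this form, so its range is the class to
  which \<open>D1_closed\<close> is applied.\<close>

definition pexp :: "real poly \<Rightarrow> real \<Rightarrow> real" where
  "pexp P t = (if t > 0 then poly P (1 / t) * exp (- (1 / t)) else 0)"

lemma tendsto_poly_div_exp: "((\<lambda>u::real. poly P u * exp (- u)) \<longlongrightarrow> 0) at_top"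
proof -
  have "((\<lambda>u. \<Sum>i\<le>degree P. coeff P i * (u ^ i / exp u)) \<longlongrightarrow> (\<Sum>i\<le>degree P. coeff P i * 0)) at_top"
    by (intro tendsto_sum tendsto_mult tendsto_const tendsto_power_div_exp_0)
  moreover have "(\<Sum>i\<le>degree P. coeff P i * (u ^ i / exp u)) = poly P u * exp (- u)" for u :: real
    by (simp add: poly_altdef sum_distrib_right exp_minus divide_inverse mult.assoc)
  ultimately show ?thesis by simp
qed

text \<open>For \<open>t > 0\<close> the product and chain rules produce \<open>P - pderiv P\<close>
  at \<open>1 / t\<close> with an extra factor \<open>1 / t^2\<close>, absorbed as
  \<open>monom 1 2\<close>. At 0 the exponential beats every polynomial in
  \<open>1 / t\<close>.\<close>

lemma DERIV_pexp: "DERIV (pexp P) t :> pexp (monom 1 2 * (P - pderiv P)) t"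
proof -
  let ?Q = "monom 1 2 * (P - pderiv P)"
  consider "t > 0" | "t < 0" | "t = 0" by linarith
  then show ?thesis
  proof cases
    case 1
    have D: "DERIV (\<lambda>t. poly P (1 / t) * exp (- (1 / t))) t :> pexp ?Q t"
    proof -
      have i: "DERIV (\<lambda>t. 1 / t) t :> - (1 / t^2)"
        using 1 by (auto intro!: derivative_eq_intros simp: power2_eq_square)
      have "DERIV (\<lambda>t. poly P (1 / t)) t :> poly (pderiv P) (1 / t) * - (1 / t^2)"
        by (rule DERIV_chain2[OF poly_DERIV i])
      moreover have "DERIV (\<lambda>t. exp (- (1 / t))) t :> exp (- (1 / t)) * - (- (1 / t^2))"
        by (rule DERIV_chain2[OF DERIV_exp DERIV_minus[OF i]])
      ultimately show ?thesis
        by (rule DERIV_mult[THEN DERIV_cong])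
           (use 1 in \<open>simp add: pexp_def poly_monom power_one_over ring_distribs mult_ac\<close>)
    qed
    have ev: "eventually (\<lambda>s. poly P (1 / s) * exp (- (1 / s)) = pexp P s) (nhds t)"
      using eventually_nhds_in_open[of "{0<..}" t] 1 by (auto elim!: eventually_mono simp: pexp_def)
    show ?thesis by (rule DERIV_cong_ev[THEN iffD1, OF refl ev refl D])
  next
    case 2
    have D: "DERIV (\<lambda>t. 0) t :> pexp ?Q t" using 2 by (simp add: pexp_def)
    have ev: "eventually (\<lambda>s. 0 = pexp P s) (nhds t)"
      using eventually_nhds_in_open[of "{..<0}" t] 2 by (auto elim!: eventually_mono simp: pexp_def)
    show ?thesis by (rule DERIV_cong_ev[THEN iffD1, OF refl ev refl D])
  next
    case 3
    have r: "((\<lambda>h. pexp P h / h) \<longlongrightarrow> 0) (at_right 0)"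
    proof -
      \<comment> \<open>With \<open>u = 1 / h\<close> the difference quotient is again a polynomial
        in \<open>u\<close>, multiplied by one more power of \<open>u\<close>, times
        \<open>exp (- u)\<close>.\<close>
      have "((\<lambda>u. poly (monom 1 1 * P) u * exp (- u)) \<longlongrightarrow> 0) at_top"
        by (rule tendsto_poly_div_exp)
      from filterlim_compose[OF this filterlim_inverse_at_top_right]
      have "((\<lambda>h::real. poly (monom 1 1 * P) (inverse h) * exp (- inverse h)) \<longlongrightarrow> 0) (at_right 0)" .
      then show ?thesis
        by (rule Lim_transform_eventually)
           (auto simp: eventually_at_right_less pexp_def poly_monom field_simps eventually_at_filter)
    qed
    have l: "((\<lambda>h. pexp P h / h) \<longlongrightarrow> 0) (at_left 0)"
      by (rule Lim_transform_eventually[OF tendsto_const]) (auto simp: eventually_at_filter pexp_def)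
    have "((\<lambda>h. pexp P h / h) \<longlongrightarrow> 0) (at 0)"
      using l r by (rule filterlim_split_at)
    then show ?thesis using 3 by (simp add: DERIV_def pexp_def)
  qed
qed

lemma D1_expinv: "D1 k expinv"
proof (rule D1_closed)
  show "expinv \<in> range pexp"
    by (intro image_eqI[of _ _ 1]) (auto simp: expinv_def pexp_def fun_eq_iff)
  fix f assume "f \<in> range pexp"
  then show "\<exists>g\<in>range pexp. \<forall>x. DERIV f x :> g x" using DERIV_pexp by blast
qed

lemma has_derivative_partial_prod:
  fixes h :: "'n::finite \<Rightarrow> real \<Rightarrow> real"
  assumes "\<And>i x. DERIV (h i) x :> h' i x"
  shows "((\<lambda>x::real^'n. \<Prod>i\<in>UNIV. h i (x $ i)) has_derivative
    (\<lambda>y. \<Sum>i\<in>UNIV. (h' i (x $ i) * y $ i) * (\<Prod>j\<in>UNIV - {i}. h j (x $ j)))) (at x)"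
proof (rule has_derivative_prod)
  fix i
  have "(h i has_derivative (\<lambda>t. h' i (x $ i) * t)) (at (x $ i))"
    using assms[of i "x $ i"] by (simp add: has_field_derivative_def mult_commute_abs)
  moreover have "((\<lambda>x::real^'n. x $ i) has_derivative (\<lambda>y. y $ i)) (at x)"
    by (intro bounded_linear_imp_has_derivative bounded_linear_vec_nth)
  ultimately show "((\<lambda>x::real^'n. h i (x $ i)) has_derivative (\<lambda>y. h' i (x $ i) * y $ i)) (at x)"
    using has_derivative_compose by fastforce
qed

lemma partial_deriv_eq:
  assumes "(f has_derivative f') (at x)"
  shows "partial_deriv j f x = f' (axis j 1)"
  using frechet_derivative_at[OF assms] by (simp add: partial_deriv_def)

text \<open>A partial derivative of the product replaces just one factor by its derivative, so the
  class is stable and the induction runs over all families \<open>h\<close> at once.\<close>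

lemma Ck_prod:
  fixes h :: "'n::finite \<Rightarrow> real \<Rightarrow> real"
  assumes "\<And>i. D1 k (h i)"
  shows "Ck k (\<lambda>x::real^'n. \<Prod>i\<in>UNIV. h i (x $ i))"
  using assms
proof (induction k arbitrary: h)
  case 0
  have "continuous_on UNIV (\<lambda>x::real^'n. h i (x $ i))" for i
    using 0[of i] continuous_on_compose2[of UNIV "h i" UNIV "\<lambda>x::real^'n. x $ i"]
    by (simp add: continuous_intros)
  then show ?case by (auto intro!: continuous_on_prod)
next
  case (Suc k)
  have D: "DERIV (h i) x :> deriv (h i) x" for i x
    using Suc.prems[of i] by (auto intro: differentiable_imp_DERIV)
  note hd = has_derivative_partial_prod[of h "\<lambda>i. deriv (h i)", OF D]
  have "partial_deriv j (\<lambda>x::real^'n. \<Prod>i\<in>UNIV. h i (x $ i)) = (\<lambda>x. \<Prod>i\<in>UNIV. (h(j := deriv (h j))) i (x $ i))" for j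
  proof
    fix x :: "real^'n"
    have "partial_deriv j (\<lambda>x::real^'n. \<Prod>i\<in>UNIV. h i (x $ i)) x =
       (\<Sum>i\<in>UNIV. (deriv (h i) (x $ i) * axis j 1 $ i) * (\<Prod>j\<in>UNIV - {i}. h j (x $ j)))"
      by (rule partial_deriv_eq[OF hd])
    also have "\<dots> = (\<Sum>i\<in>UNIV. if i = j then deriv (h j) (x $ j) * (\<Prod>i\<in>UNIV - {j}. h i (x $ i)) else 0)"
      by (intro sum.cong) (auto simp: axis_def)
    also have "\<dots> = deriv (h j) (x $ j) * (\<Prod>i\<in>UNIV - {j}. h i (x $ i))"
      by simp
    also have "\<dots> = (\<Prod>i\<in>UNIV. (h(j := deriv (h j))) i (x $ i))"
      by (subst prod.remove[of UNIV j]) (auto intro!: prod.cong)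
    finally show "partial_deriv j (\<lambda>x::real^'n. \<Prod>i\<in>UNIV. h i (x $ i)) x = (\<Prod>i\<in>UNIV. (h(j := deriv (h j))) i (x $ i))" .
  qed
  moreover have "D1 k ((h(j := deriv (h j))) i)" for i j
    using D1_SucD[OF Suc.prems[of i]] Suc.prems[of j] by auto
  moreover have "(\<lambda>x::real^'n. \<Prod>i\<in>UNIV. h i (x $ i)) differentiable (at x)" for x
    using hd[of x] by (rule differentiableI)
  ultimately show ?case using Suc.IH by (simp del: fun_upd_apply)
qed

text \<open>The shift by 1 keeps the support at distance \<open>1 / r\<close> from the faces, hence
  compact in the open box; as \<open>r\<close> grows every factor tends to 1 inside. For
  \<open>r = 0\<close> the function is zero.\<close>

definition bump :: "nat \<Rightarrow> real^'n \<Rightarrow> real^'n \<Rightarrow> real^'n::finite \<Rightarrow> real" where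
  "bump r a b x = (\<Prod>i\<in>UNIV. expinv (real r * (x $ i - a $ i) - 1) * expinv (real r * (b $ i - x $ i) - 1))"

lemma Ck_bump: "Ck k (bump r a b)"
proof -
  have "D1 k (\<lambda>t. expinv (real r * (t - a $ i) - 1) * expinv (real r * (b $ i - t) - 1))" for i
    using D1_affine[OF D1_expinv, of k "real r" "- real r * a $ i - 1"]
      D1_affine[OF D1_expinv, of k "- real r" "real r * b $ i - 1"]
    by (intro D1_mult) (auto simp: algebra_simps)
  from Ck_prod[of k "\<lambda>i t. expinv (real r * (t - a $ i) - 1) * expinv (real r * (b $ i - t) - 1)", OF this]
  show ?thesis unfolding bump_def[abs_def] .
qed

lemma expinv_bounds: "0 \<le> expinv t" "expinv t \<le> 1"
  by (auto simp: expinv_def)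

lemma bump_bounds: "0 \<le> bump r a b x" "bump r a b x \<le> 1"
  unfolding bump_def by (auto intro!: prod_nonneg prod_le_1 mult_nonneg_nonneg mult_le_one expinv_bounds)

lemma bump_support: "closure {x. bump r a b x \<noteq> 0} \<subseteq> box a b" (is ?A)
    "compact (closure {x. bump r a b x \<noteq> 0})" (is ?B)
proof -
  let ?K = "cbox (\<chi> i. a $ i + 1 / real r) (\<chi> i. b $ i - 1 / real r)"
  have r: "r > 0" if "bump r a b x \<noteq> 0" for x
    using that by (cases "r = 0") (auto simp: bump_def expinv_def)
  have "x \<in> ?K" if x: "bump r a b x \<noteq> 0" for x
  proof -
    have "real r * (x $ i - a $ i) - 1 > 0" "real r * (b $ i - x $ i) - 1 > 0" for i
      using x by (auto simp: bump_def expinv_def split: if_splits)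
    then have "x $ i - a $ i > 1 / real r" "b $ i - x $ i > 1 / real r" for i
      using r[OF x] by (auto simp: field_simps)
    then show ?thesis by (auto simp: mem_box_cart algebra_simps intro: less_imp_le)
  qed
  then have sub: "closure {x. bump r a b x \<noteq> 0} \<subseteq> ?K"
    by (intro closure_minimal) auto
  show ?B using sub by (meson bounded_cbox bounded_subset closed_closure compact_eq_bounded_closed)
  show ?A
  proof (cases "{x. bump r a b x \<noteq> 0} = {}")
    case False
    then have "r > 0" using r by auto
    then have "?K \<subseteq> box a b" by (auto simp: mem_box_cart) (smt (verit) divide_pos_pos of_nat_0_less_iff)+
    then show ?thesis using sub by auto
  qed simp
qed

lemma bump_test_functions: "box a b \<subseteq> \<Omega> \<Longrightarrow> bump r a b \<in> test_functions \<Omega>"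
  using bump_support[of r a b] by (auto simp: test_functions_def Ck_bump)

lemma tendsto_bump: "(\<lambda>r. bump r a b x) \<longlonglongrightarrow> indicator (box a b) x"
proof (cases "x \<in> box a b")
  case True
  have e: "(\<lambda>r. expinv (real r * s - 1)) \<longlonglongrightarrow> 1" if s: "s > 0" for s
  proof -
    have lim: "filterlim (\<lambda>r. s * real r - 1) at_top sequentially"
      using s by real_asymp
    have "((\<lambda>r. exp (- (1 / (s * real r - 1)))) \<longlonglongrightarrow> exp (- 0))"
      by (intro tendsto_exp tendsto_minus tendsto_divide_0[OF tendsto_const]
          filterlim_at_top_imp_at_infinity lim)
    moreover have "eventually (\<lambda>r. s * real r - 1 > 0) sequentially"
      using lim unfolding filterlim_at_top_dense by blast
    ultimately have "(\<lambda>r. expinv (s * real r - 1)) \<longlonglongrightarrow> exp (-0)"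
      by (auto elim!: Lim_transform_eventually eventually_mono simp: expinv_def)
    then show ?thesis by (simp add: mult.commute)
  qed
  have "(\<lambda>r. bump r a b x) \<longlonglongrightarrow> (\<Prod>i\<in>(UNIV::'a set). 1 * 1)"
    unfolding bump_def using True by (intro tendsto_prod tendsto_mult e) (auto simp: mem_box_cart)
  then show ?thesis using True by simp
next
  case False
  have "bump r a b x = 0" for r
  proof (rule ccontr)
    assume "bump r a b x \<noteq> 0"
    then have "x \<in> closure {x. bump r a b x \<noteq> 0}" using closure_subset[of "{x. bump r a b x \<noteq> 0}"] by auto
    then show False using bump_support(1)[of r a b] False by auto
  qed
  then show ?thesis using False by simp
qed

subsection \<open>Calculus of test functions\<close>

lemma partial_deriv_scaleR:
  "f differentiable (at x) \<Longrightarrow> partial_deriv j (\<lambda>x. s *\<^sub>R f x) x = s *\<^sub>R partial_deriv j f x"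
  by (subst partial_deriv_eq[of _ "\<lambda>v. s *\<^sub>R frechet_derivative f (at x) v"])
     (auto intro!: has_derivative_scaleR_right simp: frechet_derivative_works partial_deriv_def)

lemma Ck_scaleR: "Ck k f \<Longrightarrow> Ck k (\<lambda>x. s *\<^sub>R f x)"
proof (induction k arbitrary: f)
  case (Suc k)
  then have "partial_deriv j (\<lambda>x. s *\<^sub>R f x) = (\<lambda>x. s *\<^sub>R partial_deriv j f x)" for j
    by (auto simp: partial_deriv_scaleR)
  then show ?case using Suc by auto
qed (auto intro: continuous_intros)

lemma has_derivative_affine_comp:
  assumes "f differentiable (at (c + s *\<^sub>R x))"
  shows "((\<lambda>x. f (c + s *\<^sub>R x)) has_derivative (\<lambda>v. s *\<^sub>R frechet_derivative f (at (c + s *\<^sub>R x)) v)) (at x)"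
proof -
  let ?D = "frechet_derivative f (at (c + s *\<^sub>R x))"
  have D: "(f has_derivative ?D) (at (c + s *\<^sub>R x))" using assms by (simp add: frechet_derivative_works)
  have "((\<lambda>x. c + s *\<^sub>R x) has_derivative (\<lambda>v. s *\<^sub>R v)) (at x)"
    by (auto intro!: derivative_eq_intros)
  from has_derivative_compose[OF this, of f ?D] D
  have "((\<lambda>x. f (c + s *\<^sub>R x)) has_derivative (\<lambda>v. ?D (s *\<^sub>R v))) (at x)" by simp
  moreover have "?D (s *\<^sub>R v) = s *\<^sub>R ?D v" for v
    using D by (simp add: has_derivative_bounded_linear linear_simps(5))
  ultimately show ?thesis by simp
qed

lemma partial_deriv_affine:
  assumes "f differentiable (at (c + s *\<^sub>R x))"
  shows "partial_deriv j (\<lambda>x. f (c + s *\<^sub>R x)) x = s *\<^sub>R partial_deriv j f (c + s *\<^sub>R x)"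
  using partial_deriv_eq[OF has_derivative_affine_comp[OF assms]] by (simp add: partial_deriv_def)

lemma Ck_affine: "Ck k f \<Longrightarrow> Ck k (\<lambda>x. f (c + s *\<^sub>R x))"
proof (induction k arbitrary: f)
  case 0
  then show ?case
    using continuous_on_compose2[of UNIV f UNIV "\<lambda>x. c + s *\<^sub>R x"] by (simp add: continuous_intros)
next
  case (Suc k)
  then have "partial_deriv j (\<lambda>x. f (c + s *\<^sub>R x)) = (\<lambda>x. s *\<^sub>R partial_deriv j f (c + s *\<^sub>R x))" for j
    by (auto simp: partial_deriv_affine)
  moreover have "(\<lambda>x. f (c + s *\<^sub>R x)) differentiable (at x)" for x
    using Suc.prems has_derivative_affine_comp[of f c s x] by (auto simp: differentiable_def)
  ultimately show ?case using Suc by (auto intro!: Ck_scaleR)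
qed

lemma test_functions_affine:
  assumes phi: "\<phi> \<in> test_functions \<Omega>" and s: "s \<noteq> 0"
    and sub: "\<And>x. c + s *\<^sub>R x \<in> \<Omega> \<Longrightarrow> x \<in> \<Omega>'"
  shows "(\<lambda>x. \<phi> (c + s *\<^sub>R x)) \<in> test_functions \<Omega>'"
proof -
  let ?S = "closure {x. \<phi> x \<noteq> 0}" and ?T = "\<lambda>y. (1/s) *\<^sub>R (y - c)"
  have c: "compact ?S" "?S \<subseteq> \<Omega>" using phi by (auto simp: test_functions_def)
  have "compact (?T ` ?S)" by (intro compact_continuous_image c continuous_intros)
  moreover have sub1: "{x. \<phi> (c + s *\<^sub>R x) \<noteq> 0} \<subseteq> ?T ` ?S"
  proof
    fix x assume "x \<in> {x. \<phi> (c + s *\<^sub>R x) \<noteq> 0}"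
    then have "c + s *\<^sub>R x \<in> ?S" using closure_subset by fastforce
    then show "x \<in> ?T ` ?S" using s by (intro image_eqI[of _ _ "c + s *\<^sub>R x"]) auto
  qed
  ultimately have sub2: "closure {x. \<phi> (c + s *\<^sub>R x) \<noteq> 0} \<subseteq> ?T ` ?S"
    by (intro closure_minimal compact_imp_closed)
  moreover have "?T ` ?S \<subseteq> \<Omega>'"
  proof safe
    fix y assume "y \<in> ?S"
    then have "c + s *\<^sub>R ?T y \<in> \<Omega>" using c s by auto
    then show "?T y \<in> \<Omega>'" by (rule sub)
  qed
  moreover have "compact (closure {x. \<phi> (c + s *\<^sub>R x) \<noteq> 0})"
    using sub2 \<open>compact (?T ` ?S)\<close> by (meson bounded_subset closed_closure compact_eq_bounded_closed)
  ultimately show ?thesis using phi by (auto simp: test_functions_def Ck_affine)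
qed

lemma test_functions_mono: "\<Omega> \<subseteq> \<Omega>' \<Longrightarrow> test_functions \<Omega> \<subseteq> test_functions \<Omega>'"
  by (auto simp: test_functions_def)

definition C1 :: "(real^'n::finite \<Rightarrow> 'b::real_normed_vector) \<Rightarrow> bool" where
  "C1 f \<longleftrightarrow> (\<forall>x. f differentiable (at x)) \<and> (\<forall>j. continuous_on UNIV (partial_deriv j f))"

lemma C1_test: "\<phi> \<in> test_functions \<Omega> \<Longrightarrow> C1 \<phi>"
  unfolding test_functions_def C1_def using Ck.simps(1) Ck.simps(2)[of 0 \<phi>] by blast

lemma C1_continuous: "C1 f \<Longrightarrow> continuous_on UNIV f"
  by (auto simp: C1_def continuous_on_eq_continuous_at differentiable_imp_continuous_within)

lemma frechet_eq_sum_partial: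
  assumes "f differentiable (at x)"
  shows "frechet_derivative f (at x) v = (\<Sum>j\<in>UNIV. v $ j *\<^sub>R partial_deriv j f x)"
proof -
  have l: "linear (frechet_derivative f (at x))"
    using assms by (rule linear_frechet_derivative)
  have "v = (\<Sum>j\<in>UNIV. v $ j *\<^sub>R axis j 1)"
    using basis_expansion[of v] by (simp add: scalar_mult_eq_scaleR)
  then have "frechet_derivative f (at x) v = frechet_derivative f (at x) (\<Sum>j\<in>UNIV. v $ j *\<^sub>R axis j 1)" by simp
  also have "\<dots> = (\<Sum>j\<in>UNIV. v $ j *\<^sub>R partial_deriv j f x)"
    using l by (simp add: linear_sum linear_scale partial_deriv_def)
  finally show ?thesis .
qed

lemma partial_deriv_eq_0:
  assumes "\<And>y. y \<notin> K \<Longrightarrow> f y = 0" "closed K" "x \<notin> K"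
  shows "partial_deriv j f x = 0"
proof -
  have "eventually (\<lambda>y. y \<in> - K) (nhds x)"
    using assms by (intro eventually_nhds_in_open) auto
  then have "eventually (\<lambda>y. 0 = f y) (at x)"
    using assms(1) by (auto simp: eventually_at_filter elim!: eventually_mono)
  then have "(f has_derivative (\<lambda>_. 0)) (at x)"
    using assms by (intro has_derivative_transform_eventually[OF has_derivative_const]) auto
  then show ?thesis by (simp add: partial_deriv_eq)
qed

text \<open>\<open>M\<close> adds the sup norm of \<open>f\<close> to the sum of those of its
  partial derivatives, so one number bounds values, derivatives and, by the mean value inequality,
  difference quotients.\<close>

lemma C1_compact_bounds:
  fixes f :: "real^'n::finite \<Rightarrow> 'b::real_normed_vector"
  assumes C: "C1 f" and K: "compact K" "\<And>y. y \<notin> K \<Longrightarrow> f y = 0"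
  obtains M where "M \<ge> 0" "\<And>x. norm (f x) \<le> M" "\<And>j x. norm (partial_deriv j f x) \<le> M"
    "\<And>x y. norm (f x - f y) \<le> M * norm (x - y)"
proof -
  have bnd: "\<exists>B\<ge>0. \<forall>x. norm (g x) \<le> B" if "continuous_on UNIV g" "\<And>x. x \<notin> K \<Longrightarrow> g x = 0" for g :: "real^'n \<Rightarrow> 'b"
  proof -
    have "bounded (g ` K)" using K(1) continuous_on_subset[OF that(1)]
      by (intro compact_imp_bounded compact_continuous_image) auto
    then obtain B where B: "B > 0" "\<And>x. x \<in> K \<Longrightarrow> norm (g x) \<le> B"
      unfolding bounded_pos by auto
    then show ?thesis using that(2) by (intro exI[of _ B]) (metis less_imp_le norm_zero)
  qed
  obtain B0 where B0: "B0 \<ge> 0" "\<And>x. norm (f x) \<le> B0" using bnd[OF C1_continuous[OF C]] K by blast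
  have "\<exists>B\<ge>0. \<forall>x. norm (partial_deriv j f x) \<le> B" for j
    using C K by (intro bnd) (auto simp: C1_def intro: partial_deriv_eq_0 compact_imp_closed)
  then obtain B where B: "\<And>j. B j \<ge> 0" "\<And>j x. norm (partial_deriv j f x) \<le> B j" by metis
  define M where "M = B0 + (\<Sum>j\<in>UNIV. B j)"
  have S: "B j \<le> (\<Sum>j\<in>UNIV. B j)" for j using B by (intro member_le_sum) auto
  have "norm (f x - f y) \<le> (\<Sum>j\<in>UNIV. B j) * norm (x - y)" for x y
  proof (rule differentiable_bound[of UNIV f "\<lambda>x. frechet_derivative f (at x)"])
    show "(f has_derivative frechet_derivative f (at x)) (at x within UNIV)" for x
      using C by (auto simp: C1_def frechet_derivative_works)
    fix x
    have "norm (frechet_derivative f (at x) v) \<le> (\<Sum>j\<in>UNIV. B j) * norm v" for v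
    proof -
      have "norm (frechet_derivative f (at x) v) \<le> (\<Sum>j\<in>UNIV. norm (v $ j *\<^sub>R partial_deriv j f x))"
        using C by (subst frechet_eq_sum_partial) (auto simp: C1_def simp del: norm_scaleR intro: norm_sum)
      also have "\<dots> \<le> (\<Sum>j\<in>UNIV. norm v * B j)"
        using B component_le_norm_cart[of v] by (intro sum_mono) (auto intro!: mult_mono)
      finally show ?thesis by (simp add: sum_distrib_left mult.commute)
    qed
    then show "onorm (frechet_derivative f (at x)) \<le> (\<Sum>j\<in>UNIV. B j)"
      by (rule onorm_le)
  qed auto
  then have "norm (f x - f y) \<le> M * norm (x - y)" for x y
    using B0(1) by (simp add: M_def distrib_right add_increasing)
  moreover have "norm (partial_deriv j f x) \<le> M" for j x
    using B(2)[of j x] S[of j] B0(1) by (simp add: M_def)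
  moreover have "norm (f x) \<le> M" for x
    using B0(2)[of x] B(1) by (simp add: M_def add_increasing2 sum_nonneg)
  moreover have "M \<ge> 0" using B0 B by (simp add: M_def sum_nonneg)
  ultimately show ?thesis using that by blast
qed

lemma C1_mult:
  fixes f g :: "real^'n::finite \<Rightarrow> real"
  assumes f: "C1 f" and g: "C1 g"
  shows "C1 (\<lambda>x. f x * g x)" "partial_deriv j (\<lambda>x. f x * g x) x = f x * partial_deriv j g x + partial_deriv j f x * g x"
proof -
  have D: "((\<lambda>x. f x * g x) has_derivative (\<lambda>v. f x * frechet_derivative g (at x) v + frechet_derivative f (at x) v * g x)) (at x)" for x
    using f g by (intro has_derivative_mult) (auto simp: C1_def frechet_derivative_works)
  have E: "partial_deriv j (\<lambda>x. f x * g x) x = f x * partial_deriv j g x + partial_deriv j f x * g x" for j x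
    using partial_deriv_eq[OF D] by (simp add: partial_deriv_def)
  then show "partial_deriv j (\<lambda>x. f x * g x) x = f x * partial_deriv j g x + partial_deriv j f x * g x" .
  have "partial_deriv j (\<lambda>x. f x * g x) = (\<lambda>x. f x * partial_deriv j g x + partial_deriv j f x * g x)" for j
    using E by auto
  then show "C1 (\<lambda>x. f x * g x)"
    using D f g by (auto simp: C1_def differentiable_def intro!: continuous_intros C1_continuous[OF f] C1_continuous[OF g])
qed

lemma integrable_lebesgue_bounded_support:
  fixes f :: "'a::euclidean_space \<Rightarrow> 'b::{banach, second_countable_topology}"
  assumes f: "f \<in> borel_measurable lebesgue" and b: "\<And>x. norm (f x) \<le> M" and S: "bounded S" and s: "\<And>x. x \<notin> S \<Longrightarrow> f x = 0"
  shows "integrable lebesgue f"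
proof -
  obtain a where a: "S \<subseteq> cbox (-a) a" using bounded_subset_cbox_symmetric[OF S] by blast
  have "integrable lebesgue (\<lambda>x. M * indicator (cbox (-a) a) x :: real)"
    by (intro integrable_mult_right integrable_real_indicator) (use emeasure_lborel_cbox_finite[of "-a" a] in auto)
  then show ?thesis
    by (rule Bochner_Integration.integrable_bound[OF _ f])
       (use a s b in \<open>auto simp: indicator_def intro!: AE_I2 order_trans[OF b]\<close>)
qed

lemma borel_measurable_continuous_lebesgue:
  "continuous_on UNIV f \<Longrightarrow> f \<in> borel_measurable lebesgue"
  by (intro measurable_completion) (simp add: borel_measurable_continuous_onI)

lemma integrable_continuous_compact:
  fixes f :: "'a::euclidean_space \<Rightarrow> 'b::euclidean_space"
  assumes f: "continuous_on UNIV f" and K: "compact K" "\<And>y. y \<notin> K \<Longrightarrow> f y = 0"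
  shows "integrable lebesgue f"
proof -
  have "bounded (f ` K)" using K(1) continuous_on_subset[OF f] by (intro compact_imp_bounded compact_continuous_image) auto
  then obtain B where B: "B > 0" "\<And>x. x \<in> K \<Longrightarrow> norm (f x) \<le> B" unfolding bounded_pos by auto
  have "norm (f x) \<le> B" for x using B K(2) by (cases "x \<in> K") auto
  then show ?thesis
    using K compact_imp_bounded by (intro integrable_lebesgue_bounded_support[of f B K] borel_measurable_continuous_lebesgue f) auto
qed

text \<open>By translation invariance, difference quotients have integral zero.\<close>

lemma integral_partial_deriv_eq_0:
  fixes f :: "real^'n::finite \<Rightarrow> real"
  assumes C: "C1 f" and K: "compact K" "\<And>y. y \<notin> K \<Longrightarrow> f y = 0"
  shows "(\<integral>x. partial_deriv j f x \<partial>lebesgue) = 0"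
proof -
  obtain M where M: "M \<ge> 0" "\<And>x. norm (f x) \<le> M" "\<And>j x. norm (partial_deriv j f x) \<le> M"
    "\<And>x y. norm (f x - f y) \<le> M * norm (x - y)"
    using C1_compact_bounds[OF C K] by blast
  define v :: "real^'n" where "v = axis j 1"
  have nv: "norm v = 1" by (simp add: v_def)
  define q where "q n x = real (Suc n) * (f (x + (1 / real (Suc n)) *\<^sub>R v) - f x)" for n x
  \<comment> \<open>\<open>S\<close> is the closed 1-neighbourhood of \<open>K\<close>. The steps
    have length at most 1, so it contains the support of every difference quotient and carries one
    integrable majorant.\<close>
  define S where "S = {x + y |x y. x \<in> K \<and> y \<in> cball (0::real^'n) 1}"
  have SI: "x \<in> K \<Longrightarrow> y \<in> cball 0 1 \<Longrightarrow> x + y \<in> S" for x y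
    unfolding S_def by blast
  have cS: "compact S" unfolding S_def by (rule compact_sums[OF K(1) compact_cball])
  have fm: "f \<in> borel_measurable lebesgue"
    by (intro borel_measurable_continuous_lebesgue C1_continuous C)
  have fi: "integrable lebesgue f"
    by (intro integrable_continuous_compact[OF C1_continuous[OF C] K])
  have fi': "integrable lebesgue (\<lambda>x. f (x + (1 / real (Suc n)) *\<^sub>R v))"
       "(\<integral>x. f (x + (1 / real (Suc n)) *\<^sub>R v) \<partial>lebesgue) = (\<integral>x. f x \<partial>lebesgue)" for n
    using integrable_lebesgue_affine[of 1 f "(1 / real (Suc n)) *\<^sub>R v"] fi fm
      integral_lebesgue_affine[of 1 f "(1 / real (Suc n)) *\<^sub>R v"] by (auto simp: add.commute)
  have q0: "(\<integral>x. q n x \<partial>lebesgue) = 0" for n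
    unfolding q_def using fi fi' by simp
  have qn: "norm (q n x) \<le> M * indicator S x" for n x
  proof (cases "x \<in> S")
    case True
    have "norm (q n x) = real (Suc n) * norm (f (x + (1 / real (Suc n)) *\<^sub>R v) - f x)"
      by (simp add: q_def abs_mult)
    also have "\<dots> \<le> real (Suc n) * (M * norm ((1 / real (Suc n)) *\<^sub>R v))"
      using M(4)[of "x + (1 / real (Suc n)) *\<^sub>R v" x] by (intro mult_left_mono) auto
    also have "\<dots> = M" by (simp add: nv)
    finally show ?thesis using True by simp
  next
    case False
    have "x \<notin> K"
    proof
      assume "x \<in> K"
      then have "x + 0 \<in> S" by (intro SI) auto
      then show False using False by simp
    qed
    moreover have "x + (1 / real (Suc n)) *\<^sub>R v \<notin> K"
    proof
      assume "x + (1 / real (Suc n)) *\<^sub>R v \<in> K"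
      then have "(x + (1 / real (Suc n)) *\<^sub>R v) + - ((1 / real (Suc n)) *\<^sub>R v) \<in> S"
        using nv by (intro SI) auto
      then show False using False by simp
    qed
    ultimately show ?thesis using K(2) M(1) by (simp add: q_def)
  qed
  have lim: "(\<lambda>n. q n x) \<longlonglongrightarrow> partial_deriv j f x" for x
  proof -
    have D: "(f has_derivative frechet_derivative f (at x)) (at x)"
      using C by (auto simp: C1_def frechet_derivative_works)
    have "((\<lambda>t. f (x + t *\<^sub>R v)) has_derivative (\<lambda>t. frechet_derivative f (at x) (t *\<^sub>R v))) (at 0)"
    proof -
      have "((\<lambda>t. x + t *\<^sub>R v) has_derivative (\<lambda>t. t *\<^sub>R v)) (at 0)"
        by (auto intro!: derivative_eq_intros)
      from has_derivative_compose[OF this, of f "frechet_derivative f (at x)"]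
      show ?thesis using D by simp
    qed
    moreover have "(\<lambda>t. frechet_derivative f (at x) (t *\<^sub>R v)) = (*) (partial_deriv j f x)"
      using C linear_frechet_derivative[of f "at x"] by (auto simp: linear_scale partial_deriv_def v_def C1_def mult.commute)
    ultimately have "DERIV (\<lambda>t. f (x + t *\<^sub>R v)) 0 :> partial_deriv j f x"
      by (simp add: has_field_derivative_def)
    then have "((\<lambda>h. (f (x + h *\<^sub>R v) - f x) / h) \<longlongrightarrow> partial_deriv j f x) (at 0)"
      by (simp add: DERIV_def)
    moreover have "filterlim (\<lambda>n. 1 / real (Suc n)) (at 0) sequentially"
      unfolding filterlim_at using LIMSEQ_Suc[OF lim_1_over_n] by auto
    ultimately have "(\<lambda>n. (f (x + (1 / real (Suc n)) *\<^sub>R v) - f x) / (1 / real (Suc n))) \<longlonglongrightarrow> partial_deriv j f x"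
      by (rule filterlim_compose)
    then show ?thesis by (simp add: q_def mult.commute)
  qed
  have "(\<lambda>n. \<integral>x. q n x \<partial>lebesgue) \<longlonglongrightarrow> (\<integral>x. partial_deriv j f x \<partial>lebesgue)"
  proof (rule integral_dominated_convergence[where w="\<lambda>x. M * indicator S x"])
    show "partial_deriv j f \<in> borel_measurable lebesgue"
      using C by (intro borel_measurable_continuous_lebesgue) (auto simp: C1_def)
    show "q n \<in> borel_measurable lebesgue" for n
      unfolding q_def using fi'(1)[of n] fm by (intro borel_measurable_times borel_measurable_diff) auto
    have "S \<in> lmeasurable" using cS by (rule lmeasurable_compact)
    then show "integrable lebesgue (\<lambda>x. M * indicator S x :: real)"
      by (intro integrable_mult_right integrable_real_indicator) (auto simp: fmeasurable_def)
  qed (use lim qn in auto)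
  then have "(\<lambda>n. 0::real) \<longlonglongrightarrow> (\<integral>x. partial_deriv j f x \<partial>lebesgue)" by (simp add: q0)
  then show ?thesis using LIMSEQ_unique tendsto_const by blast
qed

text \<open>The product inherits its compact support from \<open>f\<close> alone, so its partial
  derivatives integrate to zero while \<open>g\<close> may be any function of class
  \<open>C1\<close>.\<close>

lemma integration_by_parts:
  fixes f g :: "real^'n::finite \<Rightarrow> real"
  assumes f: "C1 f" and g: "C1 g" and K: "compact K" "\<And>y. y \<notin> K \<Longrightarrow> f y = 0"
  shows "(\<integral>x. f x * partial_deriv j g x \<partial>lebesgue) = - (\<integral>x. partial_deriv j f x * g x \<partial>lebesgue)"
proof -
  have "integrable lebesgue (\<lambda>x. f x * partial_deriv j g x)"
    using f g K by (intro integrable_continuous_compact[of _ K] continuous_on_mult C1_continuous[OF f]) (auto simp: C1_def)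
  moreover have "integrable lebesgue (\<lambda>x. partial_deriv j f x * g x)"
    using f g K partial_deriv_eq_0[OF K(2) compact_imp_closed[OF K(1)]]
    by (intro integrable_continuous_compact[of _ K] continuous_on_mult C1_continuous[OF g]) (auto simp: C1_def)
  moreover have "(\<integral>x. partial_deriv j (\<lambda>x. f x * g x) x \<partial>lebesgue) = 0"
    using K C1_mult(1)[OF f g] by (intro integral_partial_deriv_eq_0[of _ K]) auto
  ultimately show ?thesis by (simp add: C1_mult(2)[OF f g])
qed

subsection \<open>Dyadic averages and the fundamental lemma\<close>

definition davg :: "nat \<Rightarrow> (real^'n::finite \<Rightarrow> 'b::{banach, second_countable_topology}) \<Rightarrow> real^'n \<Rightarrow> 'b" where
  "davg k g x = (1 / dvol TYPE('n) k) *\<^sub>R (\<integral>y. g y \<partial>lebesgue_on (dcube k x))"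

lemma integrable_lebesgue_on_subset:
  fixes f :: "'a::euclidean_space \<Rightarrow> 'b::{banach, second_countable_topology}"
  assumes "integrable (lebesgue_on S) f" "T \<subseteq> S" "S \<in> sets lebesgue" "T \<in> sets lebesgue"
  shows "integrable (lebesgue_on T) f"
proof -
  have "integrable lebesgue (\<lambda>x. indicator S x *\<^sub>R f x)" using assms by (simp add: integrable_restrict_space)
  then have "integrable lebesgue (\<lambda>x. indicator T x *\<^sub>R (indicator S x *\<^sub>R f x))"
    using assms(4) by (rule integrable_mult_indicator[rotated])
  moreover have "(\<lambda>x. indicat_real T x *\<^sub>R (indicat_real S x *\<^sub>R f x)) = (\<lambda>x. indicat_real T x *\<^sub>R f x)"
    using assms(2) by (auto simp: indicator_def fun_eq_iff)
  ultimately have "integrable lebesgue (\<lambda>x. indicat_real T x *\<^sub>R f x)" by (simp only:)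
  then show ?thesis using assms(4) by (simp add: integrable_restrict_space)
qed

lemma finite_measure_dcube: "finite_measure (lebesgue_on (dcube k x))"
  by (rule finite_measure_lebesgue_on) simp

lemma davg_diff_le:
  fixes g :: "real^'n::finite \<Rightarrow> 'b::{banach, second_countable_topology}"
  assumes g: "integrable (lebesgue_on (dcube k x)) g"
  shows "ennreal (norm (davg k g x - c)) \<le>
    ennreal (1 / dvol TYPE('n) k) * (\<integral>\<^sup>+y. ennreal (norm (g y - c)) \<partial>lebesgue_on (dcube k x))"
proof -
  interpret finite_measure "lebesgue_on (dcube k x)" by (rule finite_measure_dcube)
  have i: "integrable (lebesgue_on (dcube k x)) (\<lambda>y. g y - c)" using g by auto
  have "davg k g x - c = (1 / dvol TYPE('n) k) *\<^sub>R (\<integral>y. g y - c \<partial>lebesgue_on (dcube k x))"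
    using g by (simp add: davg_def measure_restrict_space measure_dcube scaleR_diff_right)
  then have "norm (davg k g x - c) = (1 / dvol TYPE('n) k) * norm (\<integral>y. g y - c \<partial>lebesgue_on (dcube k x))"
    by simp
  also have "ennreal \<dots> \<le> ennreal ((1 / dvol TYPE('n) k) * (\<integral>y. norm (g y - c) \<partial>lebesgue_on (dcube k x)))"
    by (intro ennreal_leI mult_left_mono integral_norm_bound) auto
  also have "\<dots> = ennreal (1 / dvol TYPE('n) k) * (\<integral>\<^sup>+y. ennreal (norm (g y - c)) \<partial>lebesgue_on (dcube k x))"
    using i by (subst nn_integral_eq_integral) (auto simp: ennreal_mult[symmetric])
  finally show ?thesis .
qed

lemma davg_tendsto:
  fixes g :: "real^'n::finite \<Rightarrow> 'b::euclidean_space"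
  assumes g: "integrable lebesgue g"
  obtains r :: "nat \<Rightarrow> nat" where "strict_mono r" "AE x in lebesgue. (\<lambda>j. davg (r j) g x) \<longlonglongrightarrow> g x"
proof -
  obtain r :: "nat \<Rightarrow> nat" where r: "strict_mono r"
    "AE x in lebesgue. (\<lambda>j. ennreal (1 / dvol TYPE('n) (r j)) * (\<integral>\<^sup>+y. ennreal (norm (g y - g x)) \<partial>lebesgue_on (dcube (r j) x))) \<longlonglongrightarrow> 0"
    using dyadic_differentiation[OF g] by blast
  have "AE x in lebesgue. (\<lambda>j. davg (r j) g x) \<longlonglongrightarrow> g x"
    using r(2)
  proof eventually_elim
    case (elim x)
    have i: "integrable (lebesgue_on (dcube k x)) g" for k
      using integrable_lebesgue_on_subset[of UNIV g "dcube k x"] g by (simp add: lebesgue_on_UNIV_eq)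
    have "(\<lambda>j. ennreal (norm (davg (r j) g x - g x))) \<longlonglongrightarrow> 0"
      by (rule tendsto_sandwich[OF _ _ tendsto_const elim]) (auto intro!: always_eventually davg_diff_le i)
    then have "(\<lambda>j. norm (davg (r j) g x - g x)) \<longlonglongrightarrow> 0"
      using tendsto_ennreal_iff[of "\<lambda>j. norm (davg (r j) g x - g x)" sequentially 0] by simp
    then show ?case by (simp add: tendsto_norm_zero_iff LIM_zero_iff)
  qed
  then show ?thesis using that r(1) by blast
qed

text \<open>Differentiation looks at arbitrarily fine cubes only, so vanishing integrals from some
  generation on determine the function.\<close>

lemma AE_zero_of_dcube_integrals:
  fixes g :: "real^'n::finite \<Rightarrow> 'b::euclidean_space"
  assumes g: "integrable lebesgue g" and z: "\<And>l x. l \<ge> k \<Longrightarrow> (\<integral>y. g y \<partial>lebesgue_on (dcube l x)) = 0"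
  shows "AE x in lebesgue. g x = 0"
proof -
  obtain r where r: "strict_mono r" "AE x in lebesgue. (\<lambda>j. davg (r j) g x) \<longlonglongrightarrow> g x"
    using davg_tendsto[OF g] by blast
  from r(2) show ?thesis
  proof eventually_elim
    case (elim x)
    have "eventually (\<lambda>j. davg (r j) g x = 0) sequentially"
    proof (rule eventually_sequentiallyI[of k])
      fix j assume "k \<le> j"
      then have "k \<le> r j" using seq_suble[OF r(1), of j] by linarith
      then show "davg (r j) g x = 0" using z by (simp add: davg_def)
    qed
    then have "(\<lambda>j. davg (r j) g x) \<longlonglongrightarrow> 0" by (rule tendsto_eventually)
    with elim show ?case using LIMSEQ_unique by blast
  qed
qed

lemma integral_lebesgue_on_eq:
  fixes f :: "'a::euclidean_space \<Rightarrow> 'b::{banach, second_countable_topology}"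
  assumes "S \<in> sets lebesgue" "\<And>x. x \<notin> S \<Longrightarrow> f x = 0"
  shows "integral\<^sup>L (lebesgue_on S) f = integral\<^sup>L lebesgue f"
    and "integrable (lebesgue_on S) f \<longleftrightarrow> integrable lebesgue f"
proof -
  have "(\<lambda>x. indicat_real S x *\<^sub>R f x) = f" using assms(2) by (auto simp: indicator_def)
  then show "integral\<^sup>L (lebesgue_on S) f = integral\<^sup>L lebesgue f" "integrable (lebesgue_on S) f \<longleftrightarrow> integrable lebesgue f"
    using assms(1) by (simp_all add: integral_restrict_space integrable_restrict_space)
qed

lemma integral_lebesgue_on_subset_eq:
  fixes f :: "'a::euclidean_space \<Rightarrow> 'b::{banach, second_countable_topology}"
  assumes "S \<in> sets lebesgue" "T \<in> sets lebesgue" "T \<subseteq> S" "\<And>x. x \<in> S \<Longrightarrow> x \<notin> T \<Longrightarrow> f x = 0"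
  shows "integral\<^sup>L (lebesgue_on S) f = integral\<^sup>L (lebesgue_on T) f"
    and "integrable (lebesgue_on S) f \<longleftrightarrow> integrable (lebesgue_on T) f"
proof -
  have "(\<lambda>x. indicat_real S x *\<^sub>R f x) = (\<lambda>x. indicat_real T x *\<^sub>R f x)"
    using assms(3,4) by (auto simp: indicator_def fun_eq_iff)
  then show "integral\<^sup>L (lebesgue_on S) f = integral\<^sup>L (lebesgue_on T) f"
    "integrable (lebesgue_on S) f \<longleftrightarrow> integrable (lebesgue_on T) f"
    using assms by (simp_all add: integral_restrict_space integrable_restrict_space)
qed

lemma locally_integrable_mult:
  fixes g :: "real^'n::finite \<Rightarrow> 'b::euclidean_space" and f :: "real^'n \<Rightarrow> real"
  assumes g: "locally_integrable \<Omega> g" and f: "continuous_on UNIV f"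
    and K: "compact K" "K \<subseteq> \<Omega>" "\<And>x. x \<notin> K \<Longrightarrow> f x = 0" and O: "\<Omega> \<in> sets lebesgue"
  shows "integrable (lebesgue_on \<Omega>) (\<lambda>x. f x *\<^sub>R g x)"
proof -
  have KL: "K \<in> sets lebesgue" using K(1) by (intro sets_completionI_sets) (simp add: borel_compact)
  have gK: "integrable (lebesgue_on K) g" using g K by (auto simp: locally_integrable_def)
  have "bounded (f ` K)" using K(1) continuous_on_subset[OF f] by (intro compact_imp_bounded compact_continuous_image) auto
  then obtain B where B: "B > 0" "\<And>x. x \<in> K \<Longrightarrow> norm (f x) \<le> B" unfolding bounded_pos by auto
  have fm: "f \<in> borel_measurable (lebesgue_on K)"
    by (intro measurable_restrict_space1 borel_measurable_continuous_lebesgue f)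
  have "integrable (lebesgue_on K) (\<lambda>x. f x *\<^sub>R g x)"
  proof (rule Bochner_Integration.integrable_bound)
    show "integrable (lebesgue_on K) (\<lambda>x. B *\<^sub>R g x)" using gK by auto
    show "(\<lambda>x. f x *\<^sub>R g x) \<in> borel_measurable (lebesgue_on K)"
      using fm gK by (intro borel_measurable_scaleR) auto
    show "AE x in lebesgue_on K. norm (f x *\<^sub>R g x) \<le> norm (B *\<^sub>R g x)"
      using B by (intro AE_I2) (auto intro!: mult_right_mono)
  qed
  then show ?thesis
    using integral_lebesgue_on_subset_eq(2)[OF O KL K(2), of "\<lambda>x. f x *\<^sub>R g x"] K(3) by simp
qed

text \<open>The open counterpart of \<open>dcube\<close>, for the places where openness matters: as
  the box of a bump function and as a domain of weak differentiation.\<close>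

definition dbox :: "nat \<Rightarrow> real^'n::finite \<Rightarrow> (real^'n) set" where
  "dbox k x = box (\<chi> i. dcenter k x $ i - (1/2) / 2^k) (\<chi> i. dcenter k x $ i + (1/2) / 2^k)"

lemma dbox_iff: "y \<in> dbox k x \<longleftrightarrow> (\<lambda>y. 2^k *\<^sub>R (y - dcenter k x)) y \<in> unit_cube"
  by (auto simp: dbox_def unit_cube_def mem_box_cart field_simps)

lemma dbox_affine_iff: "dcenter k x + (1 / 2^k) *\<^sub>R y \<in> dbox k x \<longleftrightarrow> y \<in> unit_cube"
  by (simp add: dbox_iff)

lemma dbox_subset: "dbox k x \<subseteq> dcube k x"
  by (auto simp: dbox_iff dcube_iff unit_cube_def less_imp_le)

lemma open_dbox [simp]: "open (dbox k x)"
  unfolding dbox_def by (rule open_box)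

lemma AE_dbox: "AE y in lebesgue. y \<in> dbox k x \<longleftrightarrow> y \<in> dcube k x"
proof -
  have "AE y in lebesgue. (- (2^k *\<^sub>R dcenter k x) + 2^k *\<^sub>R y \<in> unit_cube) = (- (2^k *\<^sub>R dcenter k x) + 2^k *\<^sub>R y \<in> half_open_cube)"
    by (rule AE_lebesgue_affine[OF _ AE_unit_cube_iff_half_open]) simp
  then show ?thesis
    by (auto elim!: eventually_mono simp: dbox_iff dcube_iff half_open_cube_def algebra_simps)
qed

text \<open>Bump functions tend boundedly to indicators of boxes, so \<open>g\<close> integrates to
  zero over every dyadic cube whose closure lies in \<open>\<Omega>\<close>, and dyadic
  differentiation gives \<open>g = 0\<close>. Since \<open>g\<close> is only locally integrable, the
  argument runs inside one such cube at a time.\<close>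

lemma fundamental_lemma:
  fixes g :: "real^'n::finite \<Rightarrow> real"
  assumes O: "open \<Omega>" and g: "locally_integrable \<Omega> g"
    and z: "\<And>\<phi>. \<phi> \<in> test_functions \<Omega> \<Longrightarrow> (\<integral>x. g x * \<phi> x \<partial>lebesgue_on \<Omega>) = 0"
  shows "AE x in lebesgue_on \<Omega>. g x = 0"
proof -
  have OL: "\<Omega> \<in> sets lebesgue" using O by auto
  have box0: "(\<integral>y. g y \<partial>lebesgue_on (dcube l x)) = 0" if sub: "closure (dcube l x) \<subseteq> \<Omega>" for l x
  proof -
    define Q where "Q = dcube l x"
    define B where "B = dbox l x"
    have cQ: "compact (closure Q)"
    proof -
      have "Q \<subseteq> cball x (CARD('n) / 2^l)" using dist_dcube by (auto simp: Q_def dist_commute)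
      then show ?thesis by (meson bounded_cball bounded_subset compact_closure)
    qed
    have QO: "Q \<subseteq> \<Omega>" using sub closure_subset by (auto simp: Q_def)
    have QL: "Q \<in> sets lebesgue" by (simp add: Q_def)
    have gQ: "integrable (lebesgue_on Q) g"
    proof (rule integrable_lebesgue_on_subset)
      show "integrable (lebesgue_on (closure Q)) g" using g cQ sub by (auto simp: locally_integrable_def Q_def)
    qed (use closure_subset cQ QL borel_compact in auto)
    have i1: "integrable lebesgue (\<lambda>y. indicator Q y * g y)"
      using gQ QL by (simp add: integrable_restrict_space)
    have BL: "B \<in> sets lebesgue" unfolding B_def by (intro sets_completionI_sets) simp
    obtain a b where ab: "B = box a b" by (auto simp: B_def dbox_def)
    have BQ: "B \<subseteq> Q" by (simp add: B_def Q_def dbox_subset)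
    have t0: "(\<integral>y. bump r a b y * (indicator Q y * g y) \<partial>lebesgue) = 0" for r
    proof -
      have bs: "bump r a b y = 0" if "y \<notin> B" for y
        using bump_support(1)[of r a b] closure_subset[of "{x. bump r a b x \<noteq> 0}"] that ab by auto
      have "(\<integral>x. g x * bump r a b x \<partial>lebesgue_on \<Omega>) = 0"
        using BQ QO ab by (intro z bump_test_functions) auto
      also have "(\<integral>x. g x * bump r a b x \<partial>lebesgue_on \<Omega>) = (\<integral>x. g x * bump r a b x \<partial>lebesgue)"
        using bs BQ QO by (intro integral_lebesgue_on_eq OL) auto
      also have "\<dots> = (\<integral>y. bump r a b y * (indicator Q y * g y) \<partial>lebesgue)"
        using bs BQ by (intro Bochner_Integration.integral_cong) (auto simp: indicator_def)
      finally show ?thesis by simp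
    qed
    have bm: "bump r a b \<in> borel_measurable lebesgue" for r
      using Ck_bump[of 0 r a b] by (intro borel_measurable_continuous_lebesgue) simp
    have "(\<lambda>r. \<integral>y. bump r a b y * (indicator Q y * g y) \<partial>lebesgue) \<longlonglongrightarrow> (\<integral>y. indicator B y * (indicator Q y * g y) \<partial>lebesgue)"
    proof (rule integral_dominated_convergence[where w="\<lambda>y. norm (indicator Q y * g y)"])
      show "(\<lambda>y. indicator B y * (indicator Q y * g y)) \<in> borel_measurable lebesgue"
        by (rule borel_measurable_times[OF borel_measurable_indicator[OF BL] borel_measurable_integrable[OF i1]])
      show "(\<lambda>y. bump r a b y * (indicator Q y * g y)) \<in> borel_measurable lebesgue" for r
        using borel_measurable_times[OF bm borel_measurable_integrable[OF i1]] .
      show "AE y in lebesgue. (\<lambda>r. bump r a b y * (indicator Q y * g y)) \<longlonglongrightarrow> indicator B y * (indicator Q y * g y)"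
        unfolding ab by (intro AE_I2 tendsto_mult tendsto_bump tendsto_const)
      show "AE y in lebesgue. norm (bump r a b y * (indicator Q y * g y)) \<le> norm (indicator Q y * g y)" for r
      proof (intro AE_I2)
        fix y
        have "\<bar>bump r a b y\<bar> * \<bar>indicator Q y * g y\<bar> \<le> 1 * \<bar>indicator Q y * g y\<bar>"
          using bump_bounds[of r a b y] by (intro mult_right_mono) auto
        then show "norm (bump r a b y * (indicator Q y * g y)) \<le> norm (indicator Q y * g y)"
          by (simp add: abs_mult)
      qed
    qed (use i1 in auto)
    then have "(\<lambda>r::nat. 0::real) \<longlonglongrightarrow> (\<integral>y. indicator B y * (indicator Q y * g y) \<partial>lebesgue)"
      by (simp only: t0)
    then have "(\<integral>y. indicator B y * (indicator Q y * g y) \<partial>lebesgue) = 0"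
      by (simp add: LIMSEQ_const_iff)
    also have "(\<integral>y. indicator B y * (indicator Q y * g y) \<partial>lebesgue) = (\<integral>y. indicator Q y * g y \<partial>lebesgue)"
    proof (rule integral_cong_AE)
      show "AE y in lebesgue. indicator B y * (indicator Q y * g y) = indicator Q y * g y"
        using AE_dbox[of l x] by (auto elim!: eventually_mono simp: indicator_def B_def Q_def)
      show "(\<lambda>y. indicator B y * (indicator Q y * g y)) \<in> borel_measurable lebesgue"
        by (rule borel_measurable_times[OF borel_measurable_indicator[OF BL] borel_measurable_integrable[OF i1]])
    qed (use i1 in auto)
    finally show ?thesis using QL by (simp add: integral_restrict_space Q_def)
  qed
  have cube: "AE y in lebesgue. y \<in> dcube k x \<longrightarrow> g y = 0" if sub: "closure (dcube k x) \<subseteq> \<Omega>" for k x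
  proof -
    define Q where "Q = dcube k x"
    have cQ: "compact (closure Q)"
    proof -
      have "Q \<subseteq> cball x (CARD('n) / 2^k)" using dist_dcube by (auto simp: Q_def dist_commute)
      then show ?thesis by (meson bounded_cball bounded_subset compact_closure)
    qed
    have QL: "Q \<in> sets lebesgue" by (simp add: Q_def)
    have gQ: "integrable (lebesgue_on Q) g"
    proof (rule integrable_lebesgue_on_subset)
      show "integrable (lebesgue_on (closure Q)) g" using g cQ sub by (auto simp: locally_integrable_def Q_def)
    qed (use closure_subset cQ QL borel_compact in auto)
    have i1: "integrable lebesgue (\<lambda>y. indicator Q y *\<^sub>R g y)"
      using gQ QL by (simp add: integrable_restrict_space)
    have "AE y in lebesgue. indicator Q y *\<^sub>R g y = 0"
    proof (rule AE_zero_of_dcube_integrals[OF i1, of k])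
      fix l y assume l: "k \<le> l"
      show "(\<integral>y. indicator Q y *\<^sub>R g y \<partial>lebesgue_on (dcube l y)) = 0"
      proof (cases "y \<in> Q")
        case True
        then have s: "dcube l y \<subseteq> Q" using dcube_mono[OF l, of y] dcube_eq[of y k x] by (auto simp: Q_def)
        then have "(\<integral>y. indicator Q y *\<^sub>R g y \<partial>lebesgue_on (dcube l y)) = (\<integral>y. g y \<partial>lebesgue_on (dcube l y))"
          by (intro Bochner_Integration.integral_cong) (auto simp: indicator_def)
        also have "\<dots> = 0" using s sub closure_mono[OF s] by (intro box0) (auto simp: Q_def)
        finally show ?thesis .
      next
        \<comment> \<open>A cube of generation at least \<open>k\<close> that starts outside
          \<open>Q\<close> is disjoint from it.\<close>
        case False
        have "z \<notin> Q" if "z \<in> dcube l y" for z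
        proof
          assume "z \<in> Q"
          then have "dcube k z = dcube k x" unfolding Q_def by (rule dcube_eq)
          moreover have "z \<in> dcube k y" using that dcube_mono[OF l, of y] by auto
          then have "y \<in> dcube k z" by (subst dcube_sym)
          ultimately show False using False by (simp add: Q_def)
        qed
        then have "(\<integral>y. indicator Q y *\<^sub>R g y \<partial>lebesgue_on (dcube l y)) = (\<integral>y. 0 \<partial>lebesgue_on (dcube l y))"
          by (intro Bochner_Integration.integral_cong) (auto simp: indicator_def)
        then show ?thesis by simp
      qed
    qed
    then show ?thesis by (auto elim!: eventually_mono simp: Q_def)
  qed
  \<comment> \<open>Integer labels make the family of cubes countable, so that one exceptional null
    set serves all of them.\<close>
  define rep where "rep k z = (\<chi> i. real_of_int (z i) / 2^k)" for k and z :: "'n \<Rightarrow> int"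
  have rep: "dcube k (rep k (\<lambda>i. \<lfloor>2^k * x $ i\<rfloor>)) = dcube k x" for k x
    by (auto simp: dcube_def rep_def)
  have "AE y in lebesgue. \<forall>k z. closure (dcube k (rep k z)) \<subseteq> \<Omega> \<longrightarrow> y \<in> dcube k (rep k z) \<longrightarrow> g y = 0"
    using cube by (simp add: AE_all_countable)
  then have "AE y in lebesgue. y \<in> \<Omega> \<longrightarrow> g y = 0"
  proof eventually_elim
    case (elim y)
    show ?case
    proof
      assume "y \<in> \<Omega>"
      then obtain e where e: "e > 0" "cball y e \<subseteq> \<Omega>" using O open_contains_cball by blast
      have "y \<in> ball y e" using e(1) by simp
      from open_dcube_exhaust[OF open_ball this]
      obtain k where "\<And>j. j \<ge> k \<Longrightarrow> dcube j y \<subseteq> ball y e" by blast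
      then have "dcube k y \<subseteq> ball y e" by simp
      then have "closure (dcube k y) \<subseteq> cball y e" using ball_subset_cball[of y e] by (intro closure_minimal closed_cball) blast
      then have "closure (dcube k (rep k (\<lambda>i. \<lfloor>2^k * y $ i\<rfloor>))) \<subseteq> \<Omega>" using e(2) unfolding rep by blast
      then show "g y = 0" using elim[rule_format, of k "\<lambda>i. \<lfloor>2^k * y $ i\<rfloor>"] by (simp add: rep)
    qed
  qed
  then show ?thesis using OL by (simp add: AE_restrict_space_iff)
qed

subsection \<open>Weak gradients\<close>

lemma compact_sets_lebesgue: "compact (K :: 'a::euclidean_space set) \<Longrightarrow> K \<in> sets lebesgue"
  by (intro sets_completionI_sets) (simp add: borel_compact)

lemma open_sets_lebesgue: "open (K :: 'a::euclidean_space set) \<Longrightarrow> K \<in> sets lebesgue"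
  by (intro sets_completionI_sets) simp

lemma locally_integrable_add:
  "locally_integrable \<Omega> f \<Longrightarrow> locally_integrable \<Omega> g \<Longrightarrow> locally_integrable \<Omega> (\<lambda>x. f x + g x)"
  by (auto simp: locally_integrable_def)

lemma locally_integrable_scaleR:
  "locally_integrable \<Omega> f \<Longrightarrow> locally_integrable \<Omega> (\<lambda>x. c *\<^sub>R f x)"
  by (auto simp: locally_integrable_def)

lemma locally_integrable_bounded_linear:
  assumes "locally_integrable \<Omega> f" "bounded_linear T"
  shows "locally_integrable \<Omega> (\<lambda>x. T (f x))"
  unfolding locally_integrable_def
proof (intro conjI allI impI)
  have "T \<in> borel_measurable borel"
    using assms(2) by (intro borel_measurable_continuous_onI linear_continuous_on)
  then show "(\<lambda>x. T (f x)) \<in> borel_measurable (lebesgue_on \<Omega>)"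
    using assms(1) measurable_compose unfolding locally_integrable_def by blast
qed (use assms in \<open>auto simp: locally_integrable_def intro: integrable_bounded_linear\<close>)

lemma locally_integrable_subset:
  "locally_integrable \<Omega> f \<Longrightarrow> \<Omega>' \<subseteq> \<Omega> \<Longrightarrow> locally_integrable \<Omega>' f"
  unfolding locally_integrable_def
  by (meson measurable_restrict_mono order_trans)

lemma locally_integrable_continuous:
  assumes "continuous_on UNIV f"
  shows "locally_integrable \<Omega> f"
  unfolding locally_integrable_def
proof (intro conjI allI impI)
  show "f \<in> borel_measurable (lebesgue_on \<Omega>)"
    by (intro measurable_restrict_space1 borel_measurable_continuous_lebesgue assms)
  fix K assume K: "compact K \<and> K \<subseteq> \<Omega>"
  have "bounded (f ` K)" using K continuous_on_subset[OF assms] by (intro compact_imp_bounded compact_continuous_image) auto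
  then obtain B where B: "\<And>x. x \<in> K \<Longrightarrow> norm (f x) \<le> B" unfolding bounded_pos by auto
  interpret finite_measure "lebesgue_on K"
    using K by (intro finite_measure_lebesgue_on lmeasurable_compact) auto
  show "integrable (lebesgue_on K) f"
    by (rule integrable_const_bound[of _ B])
       (auto intro!: AE_I2 B measurable_restrict_space1 borel_measurable_continuous_lebesgue assms)
qed

lemma test_function_props:
  assumes "\<phi> \<in> test_functions \<Omega>"
  obtains K where "compact K" "K \<subseteq> \<Omega>" "\<And>x. x \<notin> K \<Longrightarrow> \<phi> x = 0" "\<And>j x. x \<notin> K \<Longrightarrow> partial_deriv j \<phi> x = 0"
    "continuous_on UNIV \<phi>" "\<And>j. continuous_on UNIV (partial_deriv j \<phi>)" "C1 \<phi>"
proof -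
  let ?K = "closure {x. \<phi> x \<noteq> 0}"
  have 1: "compact ?K" "?K \<subseteq> \<Omega>" using assms by (auto simp: test_functions_def)
  have 2: "\<phi> x = 0" if "x \<notin> ?K" for x
    using that closure_subset[of "{x. \<phi> x \<noteq> 0}"] by auto
  have c: "C1 \<phi>" by (rule C1_test[OF assms])
  show ?thesis
  proof (rule that[of ?K])
    show "partial_deriv j \<phi> x = 0" if "x \<notin> ?K" for j x
      by (rule partial_deriv_eq_0[OF 2 closed_closure that])
    show "continuous_on UNIV (partial_deriv j \<phi>)" for j using c by (simp add: C1_def)
    show "compact ?K" "?K \<subseteq> \<Omega>" by (rule 1)+
    show "\<phi> x = 0" if "x \<notin> ?K" for x by (rule 2[OF that])
    show "continuous_on UNIV \<phi>" by (rule C1_continuous[OF c])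
    show "C1 \<phi>" by (rule c)
  qed
qed

lemma weak_grad_integrable:
  fixes u :: "real^'n::finite \<Rightarrow> real^'m::finite" and G :: "real^'n \<Rightarrow> real^'n^'m"
  assumes O: "open \<Omega>" and phi: "\<phi> \<in> test_functions \<Omega>"
  shows "locally_integrable \<Omega> u \<Longrightarrow> integrable (lebesgue_on \<Omega>) (\<lambda>x. u x $ i * partial_deriv j \<phi> x)"
    and "locally_integrable \<Omega> G \<Longrightarrow> integrable (lebesgue_on \<Omega>) (\<lambda>x. G x $ i $ j * \<phi> x)"
proof -
  obtain K where K: "compact K" "K \<subseteq> \<Omega>" "\<And>x. x \<notin> K \<Longrightarrow> \<phi> x = 0" "\<And>j x. x \<notin> K \<Longrightarrow> partial_deriv j \<phi> x = 0"
    "continuous_on UNIV \<phi>" "\<And>j. continuous_on UNIV (partial_deriv j \<phi>)"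
    using test_function_props[OF phi] by metis
  show "integrable (lebesgue_on \<Omega>) (\<lambda>x. u x $ i * partial_deriv j \<phi> x)" if "locally_integrable \<Omega> u"
    using locally_integrable_mult[OF locally_integrable_bounded_linear[OF that bounded_linear_vec_nth] K(6) K(1,2,4) open_sets_lebesgue[OF O]]
    by (simp add: mult.commute)
  have bl: "bounded_linear (\<lambda>A :: real^'n^'m. A $ i $ j)"
    by (rule bounded_linear_compose[of "\<lambda>v. v $ j" "\<lambda>A. A $ i", OF bounded_linear_vec_nth bounded_linear_vec_nth])
  show "integrable (lebesgue_on \<Omega>) (\<lambda>x. G x $ i $ j * \<phi> x)" if "locally_integrable \<Omega> G"
    using locally_integrable_mult[OF locally_integrable_bounded_linear[OF that bl] K(5) K(1,2,3) open_sets_lebesgue[OF O]]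
    by (simp add: mult.commute)
qed

text \<open>\<open>weak_grad\<close> is an arbitrary choice. Uniqueness up to null sets lets every
  energy and norm below be computed with whichever gradient is at hand.\<close>

lemma is_weak_grad_unique:
  fixes u :: "real^'n::finite \<Rightarrow> real^'m::finite"
  assumes O: "open \<Omega>" and G: "is_weak_grad \<Omega> u G" and H: "is_weak_grad \<Omega> u H"
  shows "AE x in lebesgue_on \<Omega>. G x = H x"
proof -
  have l: "locally_integrable \<Omega> G" "locally_integrable \<Omega> H" using G H by (auto simp: is_weak_grad_def)
  have "AE x in lebesgue_on \<Omega>. G x $ i $ j - H x $ i $ j = 0" for i j
  proof (rule fundamental_lemma[OF O])
    have bl: "bounded_linear (\<lambda>A :: real^'n^'m. A $ i $ j)"
      by (rule bounded_linear_compose[of "\<lambda>v. v $ j" "\<lambda>A. A $ i", OF bounded_linear_vec_nth bounded_linear_vec_nth])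
    show "locally_integrable \<Omega> (\<lambda>x. G x $ i $ j - H x $ i $ j)"
      using locally_integrable_add[OF locally_integrable_bounded_linear[OF l(1) bl]
          locally_integrable_scaleR[OF locally_integrable_bounded_linear[OF l(2) bl], of "-1"]]
      by simp
    fix \<phi> :: "real^'n \<Rightarrow> real" assume phi: "\<phi> \<in> test_functions \<Omega>"
    have "(\<integral>x. G x $ i $ j * \<phi> x \<partial>lebesgue_on \<Omega>) = (\<integral>x. H x $ i $ j * \<phi> x \<partial>lebesgue_on \<Omega>)"
    proof -
      have "- (\<integral>x. G x $ i $ j * \<phi> x \<partial>lebesgue_on \<Omega>) = - (\<integral>x. H x $ i $ j * \<phi> x \<partial>lebesgue_on \<Omega>)"
        using G[unfolded is_weak_grad_def, THEN conjunct2, THEN conjunct2, rule_format, OF phi, of i j]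
          H[unfolded is_weak_grad_def, THEN conjunct2, THEN conjunct2, rule_format, OF phi, of i j] by simp
      then show ?thesis by simp
    qed
    then show "(\<integral>x. (G x $ i $ j - H x $ i $ j) * \<phi> x \<partial>lebesgue_on \<Omega>) = 0"
      using weak_grad_integrable(2)[OF O phi l(1)] weak_grad_integrable(2)[OF O phi l(2)]
      by (simp add: left_diff_distrib)
  qed
  then have "AE x in lebesgue_on \<Omega>. \<forall>i j. G x $ i $ j - H x $ i $ j = 0"
    by (simp add: AE_all_countable)
  then show ?thesis by eventually_elim (simp add: vec_eq_iff)
qed

lemma is_weak_grad_add:
  assumes O: "open \<Omega>" and u: "is_weak_grad \<Omega> u G" and v: "is_weak_grad \<Omega> v H"
  shows "is_weak_grad \<Omega> (\<lambda>x. u x + v x) (\<lambda>x. G x + H x)"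
  unfolding is_weak_grad_def
proof (intro conjI ballI allI)
  have l: "locally_integrable \<Omega> G" "locally_integrable \<Omega> H" "locally_integrable \<Omega> u" "locally_integrable \<Omega> v"
    using u v by (auto simp: is_weak_grad_def)
  then show "locally_integrable \<Omega> (\<lambda>x. u x + v x)" "locally_integrable \<Omega> (\<lambda>x. G x + H x)"
    by (auto intro: locally_integrable_add)
  fix \<phi> :: "real^'a \<Rightarrow> real" and i j assume phi: "\<phi> \<in> test_functions \<Omega>"
  then show "(\<integral>x. (u x + v x) $ i * partial_deriv j \<phi> x \<partial>lebesgue_on \<Omega>) = - (\<integral>x. (G x + H x) $ i $ j * \<phi> x \<partial>lebesgue_on \<Omega>)"
    using u v weak_grad_integrable(1)[OF O phi l(3)] weak_grad_integrable(1)[OF O phi l(4)]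
      weak_grad_integrable(2)[OF O phi l(1)] weak_grad_integrable(2)[OF O phi l(2)]
    by (simp add: distrib_right is_weak_grad_def)
qed

lemma is_weak_grad_scaleR:
  assumes u: "is_weak_grad \<Omega> u G"
  shows "is_weak_grad \<Omega> (\<lambda>x. c *\<^sub>R u x) (\<lambda>x. c *\<^sub>R G x)"
  using u unfolding is_weak_grad_def
  by (auto intro: locally_integrable_scaleR simp: mult.assoc)

lemma is_weak_grad_diff:
  assumes O: "open \<Omega>" and u: "is_weak_grad \<Omega> u G" and v: "is_weak_grad \<Omega> v H"
  shows "is_weak_grad \<Omega> (\<lambda>x. u x - v x) (\<lambda>x. G x - H x)"
  using is_weak_grad_add[OF O u is_weak_grad_scaleR[OF v, of "-1"]] by simp

text \<open>A test function on the smaller set is also one on the larger set, and it vanishes in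
  between.\<close>

lemma is_weak_grad_subset:
  assumes O: "open \<Omega>" "open \<Omega>'" "\<Omega>' \<subseteq> \<Omega>" and u: "is_weak_grad \<Omega> u G"
  shows "is_weak_grad \<Omega>' u G"
  unfolding is_weak_grad_def
proof (intro conjI ballI allI)
  show "locally_integrable \<Omega>' u" "locally_integrable \<Omega>' G"
    using u O by (auto simp: is_weak_grad_def intro: locally_integrable_subset)
  fix \<phi> :: "real^'a \<Rightarrow> real" and i j assume phi: "\<phi> \<in> test_functions \<Omega>'"
  obtain K where K: "compact K" "K \<subseteq> \<Omega>'" "\<And>x. x \<notin> K \<Longrightarrow> \<phi> x = 0" "\<And>j x. x \<notin> K \<Longrightarrow> partial_deriv j \<phi> x = 0"
    using test_function_props[OF phi] by metis
  have z: "\<phi> x = 0" "partial_deriv j \<phi> x = 0" if "x \<notin> \<Omega>'" for x using K that by blast+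
  have "(\<integral>x. u x $ i * partial_deriv j \<phi> x \<partial>lebesgue_on \<Omega>) = (\<integral>x. u x $ i * partial_deriv j \<phi> x \<partial>lebesgue_on \<Omega>')"
    "(\<integral>x. G x $ i $ j * \<phi> x \<partial>lebesgue_on \<Omega>) = (\<integral>x. G x $ i $ j * \<phi> x \<partial>lebesgue_on \<Omega>')"
    using z O(3) by (auto intro!: integral_lebesgue_on_subset_eq open_sets_lebesgue O(1,2))
  moreover have "\<phi> \<in> test_functions \<Omega>" using phi test_functions_mono[OF O(3)] by blast
  ultimately show "(\<integral>x. u x $ i * partial_deriv j \<phi> x \<partial>lebesgue_on \<Omega>') = - (\<integral>x. G x $ i $ j * \<phi> x \<partial>lebesgue_on \<Omega>')"
    using u[unfolded is_weak_grad_def, THEN conjunct2, THEN conjunct2, rule_format, of \<phi> i j] by simp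
qed

lemma C1_vec_nth:
  fixes u :: "real^'n::finite \<Rightarrow> real^'m::finite"
  assumes "C1 u"
  shows "C1 (\<lambda>x. u x $ i)" "partial_deriv j (\<lambda>x. u x $ i) x = partial_deriv j u x $ i"
proof -
  have D: "((\<lambda>x. u x $ i) has_derivative (\<lambda>v. frechet_derivative u (at x) v $ i)) (at x)" for x
    using assms by (intro bounded_linear.has_derivative[OF bounded_linear_vec_nth]) (auto simp: C1_def frechet_derivative_works)
  have E: "partial_deriv j (\<lambda>x. u x $ i) x = partial_deriv j u x $ i" for j x
    using partial_deriv_eq[OF D] by (simp add: partial_deriv_def)
  then show "partial_deriv j (\<lambda>x. u x $ i) x = partial_deriv j u x $ i" .
  have "partial_deriv j (\<lambda>x. u x $ i) = (\<lambda>x. partial_deriv j u x $ i)" for j using E by auto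
  then show "C1 (\<lambda>x. u x $ i)"
    using assms differentiableI[OF D] by (auto simp: C1_def intro!: continuous_intros)
qed

lemma is_weak_grad_C1:
  fixes u :: "real^'n::finite \<Rightarrow> real^'m::finite"
  assumes O: "open \<Omega>" and u: "C1 u"
  shows "is_weak_grad \<Omega> u (\<lambda>x. \<chi> i j. partial_deriv j u x $ i)"
  unfolding is_weak_grad_def
proof (intro conjI ballI allI)
  show "locally_integrable \<Omega> u" by (intro locally_integrable_continuous C1_continuous u)
  show "locally_integrable \<Omega> (\<lambda>x. \<chi> i j. partial_deriv j u x $ i)"
    using u by (intro locally_integrable_continuous continuous_on_vec_lambda continuous_intros) (auto simp: C1_def)
  fix \<phi> :: "real^'n \<Rightarrow> real" and i j assume phi: "\<phi> \<in> test_functions \<Omega>"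
  obtain K where K: "compact K" "K \<subseteq> \<Omega>" "\<And>x. x \<notin> K \<Longrightarrow> \<phi> x = 0" "\<And>j x. x \<notin> K \<Longrightarrow> partial_deriv j \<phi> x = 0" "C1 \<phi>"
    using test_function_props[OF phi] by metis
  have z: "\<phi> x = 0" "partial_deriv j \<phi> x = 0" if "x \<notin> \<Omega>" for x using K that by blast+
  have "(\<integral>x. \<phi> x * partial_deriv j (\<lambda>x. u x $ i) x \<partial>lebesgue) = - (\<integral>x. partial_deriv j \<phi> x * u x $ i \<partial>lebesgue)"
    by (rule integration_by_parts[OF K(5) C1_vec_nth(1)[OF u] K(1,3)])
  moreover have "(\<integral>x. u x $ i * partial_deriv j \<phi> x \<partial>lebesgue_on \<Omega>) = (\<integral>x. u x $ i * partial_deriv j \<phi> x \<partial>lebesgue)"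
    "(\<integral>x. partial_deriv j u x $ i * \<phi> x \<partial>lebesgue_on \<Omega>) = (\<integral>x. partial_deriv j u x $ i * \<phi> x \<partial>lebesgue)"
    using z by (auto intro!: integral_lebesgue_on_eq open_sets_lebesgue O)
  ultimately show "(\<integral>x. u x $ i * partial_deriv j \<phi> x \<partial>lebesgue_on \<Omega>) =
      - (\<integral>x. (\<chi> i j. partial_deriv j u x $ i) $ i $ j * \<phi> x \<partial>lebesgue_on \<Omega>)"
    by (simp add: C1_vec_nth(2)[OF u] mult.commute)
qed

lemma is_weak_grad_affine_map:
  fixes \<xi> :: "real^'n::finite^'m::finite"
  assumes O: "open \<Omega>"
  shows "is_weak_grad \<Omega> (\<lambda>x. \<xi> *v x + b) (\<lambda>x. \<xi>)"
proof -
  have D: "((\<lambda>x. \<xi> *v x + b) has_derivative (\<lambda>v. \<xi> *v v)) (at x)" for x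
    using has_derivative_add[OF bounded_linear_imp_has_derivative[OF matrix_vector_mul_bounded_linear] has_derivative_const] by simp
  have P: "partial_deriv j (\<lambda>x. \<xi> *v x + b) = (\<lambda>x. \<xi> *v axis j 1)" for j
    using partial_deriv_eq[OF D] by auto
  have "C1 (\<lambda>x. \<xi> *v x + b)"
    using differentiableI[OF D] by (auto simp: C1_def P)
  from is_weak_grad_C1[OF O this]
  have "is_weak_grad \<Omega> (\<lambda>x. \<xi> *v x + b) (\<lambda>x. \<chi> i j. (\<xi> *v axis j 1) $ i)" by (simp add: P)
  moreover have "(\<chi> i j. (\<xi> *v axis j 1) $ i) = \<xi>"
    by (simp add: vec_eq_iff matrix_vector_mul_component inner_axis)
  ultimately show ?thesis by simp
qed

lemma is_weak_grad_const:
  assumes O: "open (\<Omega> :: (real^'n::finite) set)"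
  shows "is_weak_grad \<Omega> (\<lambda>x. b :: real^'m::finite) (\<lambda>x. 0)"
  using is_weak_grad_affine_map[OF O, of 0 b] by simp

lemma lebesgue_on_affine:
  fixes f :: "'a::euclidean_space \<Rightarrow> 'b::{banach, second_countable_topology}"
  assumes s: "s > 0" and S: "S \<in> sets lebesgue" and T: "T = {y. c + s *\<^sub>R y \<in> S}"
    and f: "f \<in> borel_measurable (lebesgue_on S)"
  shows "T \<in> sets lebesgue" "(\<lambda>y. f (c + s *\<^sub>R y)) \<in> borel_measurable (lebesgue_on T)"
    "integral\<^sup>L (lebesgue_on S) f = s ^ DIM('a) *\<^sub>R (\<integral>y. f (c + s *\<^sub>R y) \<partial>lebesgue_on T)"
    "integrable (lebesgue_on S) f \<longleftrightarrow> integrable (lebesgue_on T) (\<lambda>y. f (c + s *\<^sub>R y))"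
proof -
  have mT: "(\<lambda>y. c + s *\<^sub>R y) \<in> lebesgue \<rightarrow>\<^sub>M lebesgue" using s by (intro measurable_lebesgue_affine) auto
  show TL: "T \<in> sets lebesgue" using measurable_sets[OF mT S] by (simp add: T vimage_def)
  show "(\<lambda>y. f (c + s *\<^sub>R y)) \<in> borel_measurable (lebesgue_on T)"
    by (rule measurable_compose[OF measurable_restrict_space3[OF mT] f]) (auto simp: T)
  have fm: "(\<lambda>x. indicator S x *\<^sub>R f x) \<in> borel_measurable lebesgue"
    using f S by (subst (asm) borel_measurable_restrict_space_iff) auto
  have eq: "(\<lambda>y. indicat_real S (c + s *\<^sub>R y) *\<^sub>R f (c + s *\<^sub>R y)) = (\<lambda>y. indicat_real T y *\<^sub>R f (c + s *\<^sub>R y))"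
    by (auto simp: T indicator_def)
  show "integral\<^sup>L (lebesgue_on S) f = s ^ DIM('a) *\<^sub>R (\<integral>y. f (c + s *\<^sub>R y) \<partial>lebesgue_on T)"
    using integral_lebesgue_affine[OF _ fm, of s c] s S TL by (simp add: integral_restrict_space eq)
  show "integrable (lebesgue_on S) f \<longleftrightarrow> integrable (lebesgue_on T) (\<lambda>y. f (c + s *\<^sub>R y))"
    using integrable_lebesgue_affine[OF _ fm, of s c] s S TL by (simp add: integrable_restrict_space eq)
qed

lemma locally_integrable_affine:
  assumes s: "s > 0" and T: "T = {y. c + s *\<^sub>R y \<in> \<Omega>}" and O: "open \<Omega>" and f: "locally_integrable \<Omega> f"
  shows "locally_integrable T (\<lambda>y. f (c + s *\<^sub>R y))"
  unfolding locally_integrable_def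
proof (intro conjI allI impI)
  have fm: "f \<in> borel_measurable (lebesgue_on \<Omega>)" using f by (simp add: locally_integrable_def)
  show "(\<lambda>y. f (c + s *\<^sub>R y)) \<in> borel_measurable (lebesgue_on T)"
    by (rule lebesgue_on_affine(2)[OF s open_sets_lebesgue[OF O] T fm])
  fix K assume K: "compact K \<and> K \<subseteq> T"
  define K' where "K' = (\<lambda>y. c + s *\<^sub>R y) ` K"
  have "compact K'" unfolding K'_def using K by (intro compact_continuous_image continuous_intros) auto
  moreover have "K' \<subseteq> \<Omega>" using K by (auto simp: K'_def T)
  moreover have "K = {y. c + s *\<^sub>R y \<in> K'}" using s by (auto simp: K'_def)
  ultimately show "integrable (lebesgue_on K) (\<lambda>y. f (c + s *\<^sub>R y))"
    using lebesgue_on_affine(4)[OF s compact_sets_lebesgue, of K' K c f] f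
    by (auto simp: locally_integrable_def borel_measurable_integrable)
qed

text \<open>The factor \<open>1 / s\<close> compensates the chain rule, so the gradient of the
  blown-up function is the old gradient read at the magnified point, without scaling.\<close>

lemma is_weak_grad_affine:
  fixes u :: "real^'n::finite \<Rightarrow> real^'m::finite"
  assumes s: "s > 0" and T: "T = {y. c + s *\<^sub>R y \<in> \<Omega>}" and O: "open \<Omega>" and u: "is_weak_grad \<Omega> u G"
  shows "is_weak_grad T (\<lambda>y. (1 / s) *\<^sub>R u (c + s *\<^sub>R y)) (\<lambda>y. G (c + s *\<^sub>R y))"
  unfolding is_weak_grad_def
proof (intro conjI ballI allI)
  have l: "locally_integrable \<Omega> u" "locally_integrable \<Omega> G" using u by (auto simp: is_weak_grad_def)
  then have lm: "u \<in> borel_measurable (lebesgue_on \<Omega>)" "G \<in> borel_measurable (lebesgue_on \<Omega>)"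
    by (auto simp: locally_integrable_def)
  show "locally_integrable T (\<lambda>y. (1 / s) *\<^sub>R u (c + s *\<^sub>R y))" "locally_integrable T (\<lambda>y. G (c + s *\<^sub>R y))"
    using l by (auto intro!: locally_integrable_scaleR locally_integrable_affine[OF s T O])
  fix \<phi> :: "real^'n \<Rightarrow> real" and i j assume phi: "\<phi> \<in> test_functions T"
  \<comment> \<open>Test functions on \<open>T\<close> are transported back to
    \<open>\<Omega>\<close>; the derivative of the transported one carries the factor
    \<open>1 / s\<close>.\<close>
  define \<psi> where "\<psi> = (\<lambda>x. \<phi> ((- (1/s) *\<^sub>R c) + (1/s) *\<^sub>R x))"
  have psi: "\<psi> \<in> test_functions \<Omega>"
    unfolding \<psi>_def
  proof (rule test_functions_affine[OF phi])
    fix x assume "- (1 / s) *\<^sub>R c + (1 / s) *\<^sub>R x \<in> T"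
    then show "x \<in> \<Omega>" using s by (simp add: T algebra_simps)
  qed (use s in auto)
  have p1: "\<psi> (c + s *\<^sub>R y) = \<phi> y" for y using s by (simp add: \<psi>_def algebra_simps)
  have p2: "partial_deriv j \<psi> (c + s *\<^sub>R y) = (1/s) * partial_deriv j \<phi> y" for y
  proof -
    have "\<phi> differentiable (at z)" for z using C1_test[OF phi] by (auto simp: C1_def)
    from partial_deriv_affine[where c="- (1/s) *\<^sub>R c" and s="1/s" and x="c + s *\<^sub>R y" and j=j, OF this]
    show ?thesis using s by (simp add: \<psi>_def algebra_simps)
  qed
  have i1: "(\<integral>x. u x $ i * partial_deriv j \<psi> x \<partial>lebesgue_on \<Omega>)
      = s ^ CARD('n) * (\<integral>y. u (c + s *\<^sub>R y) $ i * ((1/s) * partial_deriv j \<phi> y) \<partial>lebesgue_on T)"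
    using lebesgue_on_affine(3)[OF s open_sets_lebesgue[OF O] T borel_measurable_integrable[OF weak_grad_integrable(1)[OF O psi l(1)]], of i j]
    by (simp add: p2)
  have i2: "(\<integral>x. G x $ i $ j * \<psi> x \<partial>lebesgue_on \<Omega>)
      = s ^ CARD('n) * (\<integral>y. G (c + s *\<^sub>R y) $ i $ j * \<phi> y \<partial>lebesgue_on T)"
    using lebesgue_on_affine(3)[OF s open_sets_lebesgue[OF O] T borel_measurable_integrable[OF weak_grad_integrable(2)[OF O psi l(2)]], of i j]
    by (simp add: p1)
  have "(\<integral>x. u x $ i * partial_deriv j \<psi> x \<partial>lebesgue_on \<Omega>) = - (\<integral>x. G x $ i $ j * \<psi> x \<partial>lebesgue_on \<Omega>)"
    using u psi by (auto simp: is_weak_grad_def)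
  then show "(\<integral>y. ((1 / s) *\<^sub>R u (c + s *\<^sub>R y)) $ i * partial_deriv j \<phi> y \<partial>lebesgue_on T)
      = - (\<integral>y. G (c + s *\<^sub>R y) $ i $ j * \<phi> y \<partial>lebesgue_on T)"
  proof -
    assume h: "(\<integral>x. u x $ i * partial_deriv j \<psi> x \<partial>lebesgue_on \<Omega>) = - (\<integral>x. G x $ i $ j * \<psi> x \<partial>lebesgue_on \<Omega>)"
    define X where "X = (\<integral>y. u (c + s *\<^sub>R y) $ i * partial_deriv j \<phi> y \<partial>lebesgue_on T)"
    define Y where "Y = (\<integral>y. G (c + s *\<^sub>R y) $ i $ j * \<phi> y \<partial>lebesgue_on T)"
    have I: "(\<integral>y. u (c + s *\<^sub>R y) $ i * ((1/s) * partial_deriv j \<phi> y) \<partial>lebesgue_on T) = X / s"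
      unfolding X_def by (subst integral_divide_zero[symmetric]) (intro Bochner_Integration.integral_cong, auto)
    have "s ^ CARD('n) * (X / s) = - (s ^ CARD('n) * Y)"
      using h unfolding i1 i2 I Y_def .
    then have "s ^ CARD('n) * (X / s) = s ^ CARD('n) * - Y" by (simp only: mult_minus_right)
    moreover have "s ^ CARD('n) \<noteq> 0" using s by simp
    ultimately have "X / s = - Y" using mult_left_cancel by blast
    moreover have "(\<integral>y. ((1 / s) *\<^sub>R u (c + s *\<^sub>R y)) $ i * partial_deriv j \<phi> y \<partial>lebesgue_on T) = X / s"
      unfolding X_def by (subst integral_divide_zero[symmetric]) (intro Bochner_Integration.integral_cong, auto)
    ultimately show ?thesis by (simp add: Y_def)
  qed
qed

subsection \<open>The space \<open>W1p\<close>\<close>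

lemma Lp_space_iff:
  "f \<in> Lp_space p \<Omega> \<longleftrightarrow> f \<in> borel_measurable (lebesgue_on \<Omega>) \<and>
     (\<integral>\<^sup>+x. ennreal (norm (f x) powr p) \<partial>lebesgue_on \<Omega>) < \<infinity>"
proof -
  have "(\<lambda>x. norm (f x) powr p) \<in> borel_measurable (lebesgue_on \<Omega>)" if "f \<in> borel_measurable (lebesgue_on \<Omega>)"
    using that by measurable
  then show ?thesis
    by (auto simp: Lp_space_def integrable_iff_bounded)
qed

lemma norm_powr_add_le:
  fixes a b :: "'a::real_normed_vector"
  assumes "p > 1"
  shows "norm (a + b) powr p \<le> 2 powr p * (norm a powr p + norm b powr p)"
proof -
  have "norm (a + b) powr p \<le> (2 * max (norm a) (norm b)) powr p"
    using norm_triangle_ineq[of a b] assms by (intro powr_mono2) auto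
  also have "\<dots> = 2 powr p * (max (norm a) (norm b)) powr p" by (simp add: powr_mult)
  also have "\<dots> \<le> 2 powr p * (norm a powr p + norm b powr p)"
    by (intro mult_left_mono) (auto simp: max_def)
  finally show ?thesis .
qed

lemma Lp_space_add:
  fixes f g :: "real^'n::finite \<Rightarrow> 'b::euclidean_space"
  assumes p: "p > 1" and f: "f \<in> Lp_space p \<Omega>" and g: "g \<in> Lp_space p \<Omega>"
  shows "(\<lambda>x. f x + g x) \<in> Lp_space p \<Omega>"
proof -
  have [measurable]: "f \<in> borel_measurable (lebesgue_on \<Omega>)" "g \<in> borel_measurable (lebesgue_on \<Omega>)"
    using f g by (auto simp: Lp_space_def)
  have "integrable (lebesgue_on \<Omega>) (\<lambda>x. norm (f x + g x) powr p)"
  proof (rule Bochner_Integration.integrable_bound)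
    show "integrable (lebesgue_on \<Omega>) (\<lambda>x. 2 powr p * (norm (f x) powr p + norm (g x) powr p))"
      using f g by (auto simp: Lp_space_def)
    show "AE x in lebesgue_on \<Omega>. norm (norm (f x + g x) powr p) \<le> norm (2 powr p * (norm (f x) powr p + norm (g x) powr p))"
      using norm_powr_add_le[OF p] by (intro AE_I2) auto
  qed measurable
  then show ?thesis by (simp add: Lp_space_def)
qed

lemma Lp_space_scaleR:
  "f \<in> Lp_space p \<Omega> \<Longrightarrow> (\<lambda>x. c *\<^sub>R f x) \<in> Lp_space p \<Omega>"
  by (auto simp: Lp_space_def powr_mult)

lemma Lp_space_diff:
  assumes "p > 1" "f \<in> Lp_space p \<Omega>" "g \<in> Lp_space p \<Omega>"
  shows "(\<lambda>x. f x - g x) \<in> Lp_space p \<Omega>"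
  using Lp_space_add[OF assms(1,2) Lp_space_scaleR[OF assms(3), of "-1"]] by simp

lemma Lp_space_cong_AE:
  assumes "f \<in> Lp_space p \<Omega>" "g \<in> borel_measurable (lebesgue_on \<Omega>)" "AE x in lebesgue_on \<Omega>. f x = g x"
  shows "g \<in> Lp_space p \<Omega>"
proof -
  have "(\<integral>\<^sup>+x. ennreal (norm (f x) powr p) \<partial>lebesgue_on \<Omega>) = (\<integral>\<^sup>+x. ennreal (norm (g x) powr p) \<partial>lebesgue_on \<Omega>)"
    using assms(3) by (intro nn_integral_cong_AE) auto
  then show ?thesis using assms by (simp add: Lp_space_iff)
qed

lemma weak_grad_AE:
  assumes "open \<Omega>" "is_weak_grad \<Omega> u G"
  shows "is_weak_grad \<Omega> u (weak_grad \<Omega> u)" "AE x in lebesgue_on \<Omega>. weak_grad \<Omega> u x = G x"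
proof -
  show "is_weak_grad \<Omega> u (weak_grad \<Omega> u)" unfolding weak_grad_def by (rule someI[of "is_weak_grad \<Omega> u", OF assms(2)])
  from is_weak_grad_unique[OF assms(1) this assms(2)]
  show "AE x in lebesgue_on \<Omega>. weak_grad \<Omega> u x = G x" .
qed

lemma is_weak_grad_measurable:
  assumes "is_weak_grad \<Omega> u G"
  shows "u \<in> borel_measurable (lebesgue_on \<Omega>)" "G \<in> borel_measurable (lebesgue_on \<Omega>)"
  using assms by (auto simp: is_weak_grad_def locally_integrable_def)

lemma W1p_D:
  assumes O: "open \<Omega>" and u: "u \<in> W1p p \<Omega>"
  shows "u \<in> Lp_space p \<Omega>" "is_weak_grad \<Omega> u (weak_grad \<Omega> u)" "weak_grad \<Omega> u \<in> Lp_space p \<Omega>"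
proof -
  obtain G where G: "u \<in> Lp_space p \<Omega>" "is_weak_grad \<Omega> u G" "G \<in> Lp_space p \<Omega>"
    using u by (auto simp: W1p_def)
  then show "u \<in> Lp_space p \<Omega>" by simp
  note w = weak_grad_AE[OF O G(2)]
  show "is_weak_grad \<Omega> u (weak_grad \<Omega> u)" by (rule w(1))
  show "weak_grad \<Omega> u \<in> Lp_space p \<Omega>"
    using w(2) by (intro Lp_space_cong_AE[OF G(3) is_weak_grad_measurable(2)[OF w(1)]]) (auto elim!: eventually_mono)
qed

lemma W1p_I: "u \<in> Lp_space p \<Omega> \<Longrightarrow> is_weak_grad \<Omega> u G \<Longrightarrow> G \<in> Lp_space p \<Omega> \<Longrightarrow> u \<in> W1p p \<Omega>"
  by (auto simp: W1p_def)

lemma W1p_add: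
  assumes "p > 1" "open \<Omega>" "u \<in> W1p p \<Omega>" "v \<in> W1p p \<Omega>"
  shows "(\<lambda>x. u x + v x) \<in> W1p p \<Omega>"
    "AE x in lebesgue_on \<Omega>. weak_grad \<Omega> (\<lambda>x. u x + v x) x = weak_grad \<Omega> u x + weak_grad \<Omega> v x"
proof -
  note u = W1p_D[OF assms(2,3)] and v = W1p_D[OF assms(2,4)]
  note g = is_weak_grad_add[OF assms(2) u(2) v(2)]
  show "(\<lambda>x. u x + v x) \<in> W1p p \<Omega>" by (intro W1p_I[OF _ g] Lp_space_add assms(1) u v)
  show "AE x in lebesgue_on \<Omega>. weak_grad \<Omega> (\<lambda>x. u x + v x) x = weak_grad \<Omega> u x + weak_grad \<Omega> v x"
    by (rule weak_grad_AE(2)[OF assms(2) g])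
qed

lemma W1p_scaleR:
  assumes "open \<Omega>" "u \<in> W1p p \<Omega>"
  shows "(\<lambda>x. c *\<^sub>R u x) \<in> W1p p \<Omega>"
    "AE x in lebesgue_on \<Omega>. weak_grad \<Omega> (\<lambda>x. c *\<^sub>R u x) x = c *\<^sub>R weak_grad \<Omega> u x"
proof -
  note u = W1p_D[OF assms]
  note g = is_weak_grad_scaleR[OF u(2), of c]
  show "(\<lambda>x. c *\<^sub>R u x) \<in> W1p p \<Omega>" by (intro W1p_I[OF _ g] Lp_space_scaleR u)
  show "AE x in lebesgue_on \<Omega>. weak_grad \<Omega> (\<lambda>x. c *\<^sub>R u x) x = c *\<^sub>R weak_grad \<Omega> u x"
    by (rule weak_grad_AE(2)[OF assms(1) g])
qed

lemma W1p_norm_eq: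
  assumes O: "open \<Omega>" and g: "is_weak_grad \<Omega> u G"
  shows "W1p_norm p \<Omega> u = ((\<integral>x. norm (u x) powr p \<partial>lebesgue_on \<Omega>) + (\<integral>x. norm (G x) powr p \<partial>lebesgue_on \<Omega>)) powr (1 / p)"
proof -
  have [measurable]: "weak_grad \<Omega> u \<in> borel_measurable (lebesgue_on \<Omega>)" "G \<in> borel_measurable (lebesgue_on \<Omega>)"
    using is_weak_grad_measurable weak_grad_AE[OF O g] g by blast+
  have "(\<integral>x. norm (weak_grad \<Omega> u x) powr p \<partial>lebesgue_on \<Omega>) = (\<integral>x. norm (G x) powr p \<partial>lebesgue_on \<Omega>)"
    using weak_grad_AE(2)[OF O g] by (intro integral_cong_AE) auto
  then show ?thesis by (simp add: W1p_norm_def)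
qed

lemma energy_eq:
  fixes L :: "real^'n::finite^'m::finite \<Rightarrow> ennreal"
  assumes O: "open \<Omega>" and g: "is_weak_grad \<Omega> u G"
  shows "energy L \<Omega> u = (\<integral>\<^sup>+x. L (G x) \<partial>lebesgue_on \<Omega>)"
  unfolding energy_def using weak_grad_AE(2)[OF O g] by (intro nn_integral_cong_AE) auto

subsection \<open>Functionals on \<open>W1p\<close> and boundedness of weakly convergent sequences\<close>

text \<open>Young's inequality is integrated for the two functions divided by their norms. A
  vanishing norm is treated first, since then the product is zero almost everywhere.\<close>

lemma hoelder:
  fixes f g :: "'a \<Rightarrow> real"
  assumes p: "1 < p" and q: "q = p / (p - 1)"
    and f: "f \<in> borel_measurable M" "\<And>x. 0 \<le> f x" "integrable M (\<lambda>x. f x powr p)"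
    and g: "g \<in> borel_measurable M" "\<And>x. 0 \<le> g x" "integrable M (\<lambda>x. g x powr q)"
  shows "integrable M (\<lambda>x. f x * g x)"
    "(\<integral>x. f x * g x \<partial>M) \<le> (\<integral>x. f x powr p \<partial>M) powr (1/p) * (\<integral>x. g x powr q \<partial>M) powr (1/q)"
proof -
  have q1: "q > 1" "1/p + 1/q = 1" using p by (auto simp: q field_simps)
  have Y: "f x * g x \<le> f x powr p / p + g x powr q / q" for x
    using Youngs_inequality[OF p q1(1,2) f(2) g(2)] .
  show int: "integrable M (\<lambda>x. f x * g x)"
  proof (rule Bochner_Integration.integrable_bound)
    show "integrable M (\<lambda>x. f x powr p / p + g x powr q / q)" using f g by auto
    show "AE x in M. norm (f x * g x) \<le> norm (f x powr p / p + g x powr q / q)"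
      using Y f(2) g(2) by (intro AE_I2) (smt (verit) mult_nonneg_nonneg real_norm_def)
  qed (use f g in auto)
  define a where "a = (\<integral>x. f x powr p \<partial>M)"
  define b where "b = (\<integral>x. g x powr q \<partial>M)"
  have ab: "a \<ge> 0" "b \<ge> 0" by (auto simp: a_def b_def)
  have zero: "(\<integral>x. f x * g x \<partial>M) = 0" if "a = 0 \<or> b = 0"
  proof -
    have "(AE x in M. f x powr p = 0) \<or> (AE x in M. g x powr q = 0)"
      using that f g integral_nonneg_eq_0_iff_AE[of M "\<lambda>x. f x powr p"] integral_nonneg_eq_0_iff_AE[of M "\<lambda>x. g x powr q"]
      by (auto simp: a_def b_def)
    then have "AE x in M. f x * g x = 0" by auto
    then show ?thesis by (rule integral_eq_zero_AE)
  qed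
  show "(\<integral>x. f x * g x \<partial>M) \<le> (\<integral>x. f x powr p \<partial>M) powr (1/p) * (\<integral>x. g x powr q \<partial>M) powr (1/q)"
  proof (cases "a = 0 \<or> b = 0")
    case True
    then show ?thesis using zero by simp
  next
    case False
    then have pos: "a > 0" "b > 0" using ab by auto
    define s where "s = a powr (1/p)"
    define t where "t = b powr (1/q)"
    have st: "s > 0" "t > 0" "s powr p = a" "t powr q = b"
      using pos p q1 by (auto simp: s_def t_def powr_powr)
    have "(\<integral>x. (f x / s) * (g x / t) \<partial>M) \<le> (\<integral>x. (f x / s) powr p / p + (g x / t) powr q / q \<partial>M)"
    proof (rule integral_mono)
      show "integrable M (\<lambda>x. f x / s * (g x / t))" using int by simp
      show "integrable M (\<lambda>x. (f x / s) powr p / p + (g x / t) powr q / q)"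
        using f g st by (simp add: powr_divide)
      show "f x / s * (g x / t) \<le> (f x / s) powr p / p + (g x / t) powr q / q" for x
        using f(2) g(2) st by (intro Youngs_inequality[OF p q1(1,2)]) auto
    qed
    also have "\<dots> = a / s powr p / p + b / t powr q / q"
      using f g st by (simp add: powr_divide a_def b_def)
    also have "\<dots> = 1" using pos q1 by (simp add: st)
    finally have "(\<integral>x. f x * g x \<partial>M) / (s * t) \<le> 1" by simp
    then have "(\<integral>x. f x * g x \<partial>M) \<le> s * t" using st by (simp add: field_simps)
    then show ?thesis by (simp add: s_def t_def a_def b_def)
  qed
qed

text \<open>Only the gradient part of the norm: the additional term in the energy asks for a bound
  on gradients, and functionals acting through the gradient detect it.\<close>

definition grad_norm :: "real \<Rightarrow> (real^'n::finite) set \<Rightarrow> (real^'n \<Rightarrow> real^'m::finite) \<Rightarrow> real" where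
  "grad_norm p \<Omega> u = (\<integral>x. norm (weak_grad \<Omega> u x) powr p \<partial>lebesgue_on \<Omega>) powr (1 / p)"

lemma grad_norm_le: "1 < p \<Longrightarrow> grad_norm p \<Omega> u \<le> W1p_norm p \<Omega> u"
  unfolding grad_norm_def W1p_norm_def by (intro powr_mono2) auto

lemma grad_norm_nonneg [simp]: "0 \<le> grad_norm p \<Omega> u"
  by (simp add: grad_norm_def)

definition grad_fun :: "(real^'n::finite) set \<Rightarrow> (real^'n \<Rightarrow> real^'n^'m) \<Rightarrow> (real^'n \<Rightarrow> real^'m::finite) \<Rightarrow> real" where
  "grad_fun \<Omega> w v = (\<integral>x. weak_grad \<Omega> v x \<bullet> w x \<partial>lebesgue_on \<Omega>)"

lemma grad_fun:
  fixes w :: "real^'n::finite \<Rightarrow> real^'n^'m::finite"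
  assumes p: "1 < p" and q: "q = p / (p - 1)" and O: "open \<Omega>" and w: "w \<in> Lp_space q \<Omega>"
  shows "\<And>v. v \<in> W1p p \<Omega> \<Longrightarrow> \<bar>grad_fun \<Omega> w v\<bar> \<le> grad_norm p \<Omega> v * (\<integral>x. norm (w x) powr q \<partial>lebesgue_on \<Omega>) powr (1/q)"
    and "grad_fun \<Omega> w \<in> W1p_dual p \<Omega>"
proof -
  have wm[measurable]: "w \<in> borel_measurable (lebesgue_on \<Omega>)" and wi: "integrable (lebesgue_on \<Omega>) (\<lambda>x. norm (w x) powr q)"
    using w by (auto simp: Lp_space_def)
  have H: "integrable (lebesgue_on \<Omega>) (\<lambda>x. weak_grad \<Omega> v x \<bullet> w x) \<and>
     \<bar>grad_fun \<Omega> w v\<bar> \<le> grad_norm p \<Omega> v * (\<integral>x. norm (w x) powr q \<partial>lebesgue_on \<Omega>) powr (1/q)"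
    if v: "v \<in> W1p p \<Omega>" for v
  proof -
    have vm[measurable]: "weak_grad \<Omega> v \<in> borel_measurable (lebesgue_on \<Omega>)"
      and vi: "integrable (lebesgue_on \<Omega>) (\<lambda>x. norm (weak_grad \<Omega> v x) powr p)"
      using W1p_D(3)[OF O v] by (auto simp: Lp_space_def)
    note h = hoelder[OF p q _ _ vi _ _ wi]
    have 1: "integrable (lebesgue_on \<Omega>) (\<lambda>x. norm (weak_grad \<Omega> v x) * norm (w x))"
      by (rule h(1)) auto
    have 2: "integrable (lebesgue_on \<Omega>) (\<lambda>x. weak_grad \<Omega> v x \<bullet> w x)"
      by (rule Bochner_Integration.integrable_bound[OF 1]) (auto intro!: AE_I2 Cauchy_Schwarz_ineq2)
    have "\<bar>grad_fun \<Omega> w v\<bar> \<le> (\<integral>x. norm (weak_grad \<Omega> v x \<bullet> w x) \<partial>lebesgue_on \<Omega>)"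
      unfolding grad_fun_def using integral_norm_bound[of "lebesgue_on \<Omega>" "\<lambda>x. weak_grad \<Omega> v x \<bullet> w x"] by simp
    also have "\<dots> \<le> (\<integral>x. norm (weak_grad \<Omega> v x) * norm (w x) \<partial>lebesgue_on \<Omega>)"
      using 1 2 by (intro integral_mono) (auto simp: Cauchy_Schwarz_ineq2)
    also have "\<dots> \<le> grad_norm p \<Omega> v * (\<integral>x. norm (w x) powr q \<partial>lebesgue_on \<Omega>) powr (1/q)"
      unfolding grad_norm_def by (rule h(2)) auto
    finally show ?thesis using 2 by blast
  qed
  then show "\<And>v. v \<in> W1p p \<Omega> \<Longrightarrow> \<bar>grad_fun \<Omega> w v\<bar> \<le> grad_norm p \<Omega> v * (\<integral>x. norm (w x) powr q \<partial>lebesgue_on \<Omega>) powr (1/q)"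
    by blast
  show "grad_fun \<Omega> w \<in> W1p_dual p \<Omega>"
    unfolding W1p_dual_def mem_Collect_eq
  proof (intro conjI ballI allI exI)
    fix u v :: "real^'n \<Rightarrow> real^'m" assume u: "u \<in> W1p p \<Omega>" and v: "v \<in> W1p p \<Omega>"
    have [measurable]: "weak_grad \<Omega> u \<in> borel_measurable (lebesgue_on \<Omega>)" "weak_grad \<Omega> v \<in> borel_measurable (lebesgue_on \<Omega>)"
      "weak_grad \<Omega> (\<lambda>x. u x + v x) \<in> borel_measurable (lebesgue_on \<Omega>)"
      using W1p_D(2)[OF O u] W1p_D(2)[OF O v] W1p_D(2)[OF O W1p_add(1)[OF p O u v]] is_weak_grad_measurable by blast+
    have "grad_fun \<Omega> w (\<lambda>x. u x + v x) = (\<integral>x. weak_grad \<Omega> u x \<bullet> w x + weak_grad \<Omega> v x \<bullet> w x \<partial>lebesgue_on \<Omega>)"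
      unfolding grad_fun_def using W1p_add(2)[OF p O u v] by (intro integral_cong_AE) (auto simp: inner_add_left)
    then show "grad_fun \<Omega> w (\<lambda>x. u x + v x) = grad_fun \<Omega> w u + grad_fun \<Omega> w v"
      using H[OF u] H[OF v] by (simp add: grad_fun_def)
  next
    fix c :: real and u :: "real^'n \<Rightarrow> real^'m" assume u: "u \<in> W1p p \<Omega>"
    have [measurable]: "weak_grad \<Omega> u \<in> borel_measurable (lebesgue_on \<Omega>)"
      "weak_grad \<Omega> (\<lambda>x. c *\<^sub>R u x) \<in> borel_measurable (lebesgue_on \<Omega>)"
      using W1p_D(2)[OF O u] W1p_D(2)[OF O W1p_scaleR(1)[OF O u]] is_weak_grad_measurable by blast+
    have "grad_fun \<Omega> w (\<lambda>x. c *\<^sub>R u x) = (\<integral>x. c * (weak_grad \<Omega> u x \<bullet> w x) \<partial>lebesgue_on \<Omega>)"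
      unfolding grad_fun_def using W1p_scaleR(2)[OF O u, of c] by (intro integral_cong_AE) auto
    then show "grad_fun \<Omega> w (\<lambda>x. c *\<^sub>R u x) = c * grad_fun \<Omega> w u"
      by (simp add: grad_fun_def)
  next
    fix u :: "real^'n \<Rightarrow> real^'m" assume u: "u \<in> W1p p \<Omega>"
    have "\<bar>grad_fun \<Omega> w u\<bar> \<le> grad_norm p \<Omega> u * (\<integral>x. norm (w x) powr q \<partial>lebesgue_on \<Omega>) powr (1/q)"
      using H[OF u] by blast
    also have "\<dots> \<le> W1p_norm p \<Omega> u * (\<integral>x. norm (w x) powr q \<partial>lebesgue_on \<Omega>) powr (1/q)"
      by (intro mult_right_mono grad_norm_le p) auto
    finally show "\<bar>grad_fun \<Omega> w u\<bar> \<le> (\<integral>x. norm (w x) powr q \<partial>lebesgue_on \<Omega>) powr (1/q) * W1p_norm p \<Omega> u"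
      by (simp add: mult.commute)
  qed
qed

text \<open>The duality map of L^p: the field \<open>|H|^(p-2) H\<close>, normalised to L^q norm 1,
  pairs with \<open>H\<close> to give its full L^p norm. This explicit choice replaces a Hahn-Banach
  extension.\<close>

lemma norming_functional:
  fixes u :: "real^'n::finite \<Rightarrow> real^'m::finite"
  assumes p: "1 < p" and O: "open \<Omega>" and u: "u \<in> W1p p \<Omega>"
  obtains f where "f \<in> W1p_dual p \<Omega>" "\<And>v. v \<in> W1p p \<Omega> \<Longrightarrow> \<bar>f v\<bar> \<le> grad_norm p \<Omega> v" "f u = grad_norm p \<Omega> u"
proof (cases "grad_norm p \<Omega> u = 0")
  case True
  show ?thesis
  proof (rule that[of "\<lambda>_. 0"])
    show "(\<lambda>_. 0) \<in> W1p_dual p \<Omega>" by (auto simp: W1p_dual_def intro: exI[of _ 0])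
  qed (use True in auto)
next
  case False
  define q where "q = p / (p - 1)"
  define H where "H = weak_grad \<Omega> u"
  define J where "J = (\<integral>x. norm (H x) powr p \<partial>lebesgue_on \<Omega>)"
  define a where "a = grad_norm p \<Omega> u"
  define w where "w x = (1 / a powr (p - 1)) *\<^sub>R (norm (H x) powr (p - 2) *\<^sub>R H x)" for x
  have q: "q > 1" "(p - 1) * q = p" using p by (auto simp: q_def field_simps)
  have a: "a > 0" using False by (simp add: a_def less_le)
  have aJ: "a = J powr (1/p)" by (simp add: a_def grad_norm_def J_def H_def)
  have J: "J > 0" using a aJ by (cases "J = 0") (auto simp: J_def less_le)
  have ap: "a powr p = J" using J p by (simp add: aJ powr_powr)
  have [measurable]: "H \<in> borel_measurable (lebesgue_on \<Omega>)" and Hi: "integrable (lebesgue_on \<Omega>) (\<lambda>x. norm (H x) powr p)"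
    using W1p_D(3)[OF O u] by (auto simp: Lp_space_def H_def)
  have nw: "norm (w x) = norm (H x) powr (p - 1) / a powr (p - 1)" for x
  proof (cases "H x = 0")
    case False
    then have "norm (H x) powr (p - 2) * norm (H x) = norm (H x) powr (p - 1)"
      using powr_add[of "norm (H x)" "p - 2" 1] by simp
    then show ?thesis using a by (simp add: w_def)
  qed (use p in \<open>simp add: w_def\<close>)
  have nwq: "norm (w x) powr q = norm (H x) powr p / J" for x
    using a by (simp add: nw powr_divide powr_powr q(2) ap)
  have wL: "w \<in> Lp_space q \<Omega>"
    unfolding Lp_space_def mem_Collect_eq nwq using Hi by (auto simp: w_def[abs_def])
  have wn: "(\<integral>x. norm (w x) powr q \<partial>lebesgue_on \<Omega>) = 1"
    unfolding nwq using J by (simp add: J_def)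
  have "H x \<bullet> w x = norm (H x) powr p / a powr (p - 1)" for x
  proof (cases "H x = 0")
    case False
    then have "norm (H x) powr (p - 2) * (norm (H x))\<^sup>2 = norm (H x) powr p"
      using powr_add[of "norm (H x)" "p - 2" 2] by (simp add: powr_numeral)
    then show ?thesis by (simp add: w_def dot_square_norm)
  qed (use p in \<open>simp add: w_def\<close>)
  then have "grad_fun \<Omega> w u = J / a powr (p - 1)"
    by (simp add: grad_fun_def J_def H_def[symmetric])
  also have "\<dots> = a" using a unfolding ap[symmetric] by (simp add: powr_diff)
  finally have "grad_fun \<Omega> w u = a" .
  then show ?thesis
    using grad_fun(1)[OF p q_def O wL] grad_fun(2)[OF p q_def O wL] wn
    by (intro that[of "grad_fun \<Omega> w"]) (auto simp: a_def)
qed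

text \<open>The terms are dominated by a summable sequence times the gradient norm, so the series is
  again a bounded functional. It supplies the functional that the gliding hump builds.\<close>

lemma W1p_dual_suminf:
  fixes F :: "nat \<Rightarrow> (real^'n::finite \<Rightarrow> real^'m::finite) \<Rightarrow> real"
  assumes p: "1 < p" and O: "open \<Omega>" and F: "\<And>i. F i \<in> W1p_dual p \<Omega>"
    and b: "\<And>i v. v \<in> W1p p \<Omega> \<Longrightarrow> \<bar>F i v\<bar> \<le> grad_norm p \<Omega> v"
    and c: "summable c" "\<And>i. 0 \<le> c i" "\<And>i. \<bar>e i\<bar> \<le> c i"
  shows "\<And>v. v \<in> W1p p \<Omega> \<Longrightarrow> summable (\<lambda>i. e i * F i v)" "(\<lambda>v. \<Sum>i. e i * F i v) \<in> W1p_dual p \<Omega>"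
proof -
  have le: "norm (e i * F i v) \<le> grad_norm p \<Omega> v * c i" if "v \<in> W1p p \<Omega>" for i v
    using mult_mono[OF c(3)[of i] b[OF that, of i]] c(2)[of i] by (simp add: abs_mult mult.commute)
  show s: "summable (\<lambda>i. e i * F i v)" if "v \<in> W1p p \<Omega>" for v
    by (rule summable_comparison_test'[OF summable_mult[OF c(1)] le[OF that]])
  show "(\<lambda>v. \<Sum>i. e i * F i v) \<in> W1p_dual p \<Omega>"
    unfolding W1p_dual_def mem_Collect_eq
  proof (intro conjI ballI allI exI)
    fix u v :: "real^'n \<Rightarrow> real^'m" assume u: "u \<in> W1p p \<Omega>" and v: "v \<in> W1p p \<Omega>"
    have "F i (\<lambda>x. u x + v x) = F i u + F i v" for i using F[of i] u v by (auto simp: W1p_dual_def)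
    then show "(\<Sum>i. e i * F i (\<lambda>x. u x + v x)) = (\<Sum>i. e i * F i u) + (\<Sum>i. e i * F i v)"
      using suminf_add[OF s[OF u] s[OF v]] by (simp add: distrib_left)
  next
    fix a :: real and u :: "real^'n \<Rightarrow> real^'m" assume u: "u \<in> W1p p \<Omega>"
    have "F i (\<lambda>x. a *\<^sub>R u x) = a * F i u" for i using F[of i] u by (auto simp: W1p_dual_def)
    then show "(\<Sum>i. e i * F i (\<lambda>x. a *\<^sub>R u x)) = a * (\<Sum>i. e i * F i u)"
      using suminf_mult[OF s[OF u], of a] by (simp add: mult.left_commute)
  next
    fix u :: "real^'n \<Rightarrow> real^'m" assume u: "u \<in> W1p p \<Omega>"
    have "summable (\<lambda>i. norm (e i * F i u))"
      by (rule summable_comparison_test'[OF summable_mult[OF c(1)], where N=0]) (use le[OF u] in auto)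
    then have "\<bar>\<Sum>i. e i * F i u\<bar> \<le> (\<Sum>i. norm (e i * F i u))" using summable_norm by fastforce
    also have "\<dots> \<le> (\<Sum>i. grad_norm p \<Omega> u * c i)"
      using le[OF u] c(1) \<open>summable (\<lambda>i. norm (e i * F i u))\<close> by (intro suminf_le summable_mult) auto
    also have "\<dots> = grad_norm p \<Omega> u * suminf c" by (rule suminf_mult[OF c(1)])
    also have "\<dots> \<le> W1p_norm p \<Omega> u * suminf c"
      using c by (intro mult_right_mono grad_norm_le p suminf_nonneg) auto
    finally show "\<bar>\<Sum>i. e i * F i u\<bar> \<le> suminf c * W1p_norm p \<Omega> u" by (simp add: mult.commute)
  qed
qed

text \<open>Uniform boundedness by a gliding hump: the signs are chosen so that the partial sum up to
  index \<open>k\<close> is large at the \<open>k\<close>-th element, and the tail of the series is at most half of that.\<close>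

primrec hump :: "('a \<Rightarrow> 'a \<Rightarrow> real) \<Rightarrow> (nat \<Rightarrow> 'a) \<Rightarrow> nat \<Rightarrow> 'a \<Rightarrow> real" where
  "hump f x 0 v = 0"
| "hump f x (Suc k) v = hump f x k v + (if hump f x k (x k) \<ge> 0 then 1 else - 1) * (1/3)^k * f (x k) v"

lemma weakly_convergent_grad_bounded:
  fixes u :: "nat \<Rightarrow> real^'n::finite \<Rightarrow> real^'m::finite"
  assumes p: "1 < p" and O: "open \<Omega>" and conv: "W1p_weakly_converges p \<Omega> u v"
  obtains C where "\<And>n. grad_norm p \<Omega> (u n) \<le> C"
proof (rule ccontr)
  assume "\<not> thesis"
  with that have unb: "\<exists>n. grad_norm p \<Omega> (u n) > C" for C by (meson not_le)
  have uW: "u n \<in> W1p p \<Omega>" for n using conv by (simp add: W1p_weakly_converges_def)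
  have "\<forall>w. \<exists>f. w \<in> W1p p \<Omega> \<longrightarrow> f \<in> W1p_dual p \<Omega> \<and> (\<forall>v\<in>W1p p \<Omega>. \<bar>f v\<bar> \<le> grad_norm p \<Omega> v) \<and> f w = grad_norm p \<Omega> (w :: real^'n \<Rightarrow> real^'m)"
    using norming_functional[OF p O] by meson
  then obtain f where f: "\<And>w. w \<in> W1p p \<Omega> \<Longrightarrow> f w \<in> W1p_dual p \<Omega>"
    "\<And>w v. w \<in> W1p p \<Omega> \<Longrightarrow> v \<in> W1p p \<Omega> \<Longrightarrow> \<bar>f w v\<bar> \<le> grad_norm p \<Omega> v"
    "\<And>w. w \<in> W1p p \<Omega> \<Longrightarrow> f w w = grad_norm p \<Omega> (w :: real^'n \<Rightarrow> real^'m)"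
    by metis
  \<comment> \<open>The growth \<open>k * 3^k\<close> beats the weight \<open>(1/3)^k\<close>, so
    the \<open>k\<close>-th term alone contributes more than \<open>k\<close> at the
    \<open>k\<close>-th element.\<close>
  have "\<forall>k. \<exists>n. grad_norm p \<Omega> (u n) > real k * 3^k" using unb by blast
  then obtain m where m: "\<And>k. grad_norm p \<Omega> (u (m k)) > real k * 3^k" by metis
  define x where "x k = u (m k)" for k
  have xW: "x k \<in> W1p p \<Omega>" for k by (simp add: x_def uW)
  define e where "e k = (if hump f x k (x k) \<ge> 0 then 1 else - 1) * (1/3::real)^k" for k
  have hs: "hump f x k v = (\<Sum>i<k. e i * f (x i) v)" for k v
    by (induction k) (auto simp: e_def)
  have sc: "summable (\<lambda>i. (1/3::real)^i)" by (rule summable_geometric) simp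
  have ae: "\<bar>e i\<bar> \<le> (1/3)^i" for i by (simp add: e_def abs_mult power_abs)
  define l where "l v = (\<Sum>i. e i * f (x i) v)" for v
  have sm: "\<And>v. v \<in> W1p p \<Omega> \<Longrightarrow> summable (\<lambda>i. e i * f (x i) v)" and ld: "l \<in> W1p_dual p \<Omega>"
    unfolding l_def[abs_def]
    by (rule W1p_dual_suminf[OF p O _ _ sc _ ae]; use f xW in auto)+
  have big: "\<bar>l (x k)\<bar> \<ge> real k / 2" for k
  proof -
    define N where "N = grad_norm p \<Omega> (x k)"
    have N: "N \<ge> 0" "N > real k * 3^k" using m[of k] by (auto simp: N_def x_def)
    \<comment> \<open>The sign in \<open>hump\<close> agrees with that of the earlier partial sum,
      so the new term is not cancelled.\<close>
    have A: "\<bar>hump f x (Suc k) (x k)\<bar> \<ge> (1/3)^k * N"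
      using f(3)[OF xW, of k] N by (auto simp: N_def)
    have "l (x k) = (\<Sum>i. e (i + Suc k) * f (x (i + Suc k)) (x k)) + hump f x (Suc k) (x k)"
      unfolding l_def hs by (rule suminf_split_initial_segment[OF sm[OF xW]])
    moreover have "\<bar>\<Sum>i. e (i + Suc k) * f (x (i + Suc k)) (x k)\<bar> \<le> (1/3)^k * N / 2"
    proof -
      have le: "norm (e (i + Suc k) * f (x (i + Suc k)) (x k)) \<le> (1/3)^i * ((1/3)^Suc k * N)" for i
      proof -
        have "\<bar>e (i + Suc k)\<bar> * \<bar>f (x (i + Suc k)) (x k)\<bar> \<le> (1/3)^(i + Suc k) * N"
          by (rule mult_mono[OF ae]) (use f(2)[OF xW xW] in \<open>auto simp: N_def\<close>)
        then show ?thesis by (simp add: abs_mult power_add mult_ac)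
      qed
      have s2: "summable (\<lambda>i. (1/3::real)^i * ((1/3)^Suc k * N))" by (rule summable_mult2[OF sc])
      have s1: "summable (\<lambda>i. norm (e (i + Suc k) * f (x (i + Suc k)) (x k)))"
        by (rule summable_comparison_test'[OF s2, where N=0]) (use le in auto)
      have "\<bar>\<Sum>i. e (i + Suc k) * f (x (i + Suc k)) (x k)\<bar> \<le> (\<Sum>i. norm (e (i + Suc k) * f (x (i + Suc k)) (x k)))"
        using summable_norm[OF s1] by simp
      also have "\<dots> \<le> (\<Sum>i. (1/3::real)^i * ((1/3)^Suc k * N))"
        by (rule suminf_le[OF le s1 s2])
      also have "\<dots> = (\<Sum>i. (1/3::real)^i) * ((1/3)^Suc k * N)"
        by (rule suminf_mult2[OF sc, symmetric])
      \<comment> \<open>The tail sums to \<open>(1/3)^(Suc k) * (3/2) = (1/3)^k / 2\<close>. This is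
        why the ratio is 1/3: half of the main term survives.\<close>
      also have "\<dots> = (1/3)^k * N / 2" by (subst suminf_geometric) auto
      finally show ?thesis .
    qed
    ultimately have "\<bar>l (x k)\<bar> \<ge> (1/3)^k * N / 2" using A by linarith
    moreover have "(1/3)^k * N \<ge> (1/3)^k * (real k * 3^k)" using N by (intro mult_left_mono) auto
    moreover have "(1/3::real)^k * (real k * 3^k) = real k" by (simp add: power_one_over)
    ultimately show ?thesis by linarith
  qed
  have "(\<lambda>n. l (u n)) \<longlonglongrightarrow> l v" using conv ld by (auto simp: W1p_weakly_converges_def)
  then have "Bseq (\<lambda>n. l (u n))" by (rule convergent_imp_Bseq[OF convergentI])
  then obtain K where K: "\<And>n. \<bar>l (u n)\<bar> \<le> K" by (auto simp: Bseq_def)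
  obtain k :: nat where "real k > 2 * K" using reals_Archimedean2 by blast
  then show False using big[of k] K[of "m k"] by (simp add: x_def)
qed

text \<open>Integration over \<open>S\<close> is tested in the direction \<open>b\<close> by the
  functional with field \<open>indicator S * b\<close>. Together with the gradient bound this is
  what the sufficiency proof extracts from weak convergence.\<close>

lemma weakly_convergent_integral_grad:
  fixes u :: "nat \<Rightarrow> real^'n::finite \<Rightarrow> real^'m::finite"
  assumes p: "1 < p" and O: "open \<Omega>" and conv: "W1p_weakly_converges p \<Omega> u v"
    and S: "S \<in> lmeasurable" "S \<subseteq> \<Omega>"
  shows "(\<lambda>n. \<integral>x. weak_grad \<Omega> (u n) x \<partial>lebesgue_on S) \<longlonglongrightarrow> (\<integral>x. weak_grad \<Omega> v x \<partial>lebesgue_on S)"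
proof -
  define q where "q = p / (p - 1)"
  have q: "q > 1" using p by (auto simp: q_def field_simps)
  have SL: "S \<in> sets lebesgue" and OL: "\<Omega> \<in> sets lebesgue" using S O by (auto intro: open_sets_lebesgue)
  have fm: "finite_measure (lebesgue_on S)" by (rule finite_measure_lebesgue_on[OF S(1)])
  have int: "integrable (lebesgue_on S) (weak_grad \<Omega> w)" if w: "w \<in> W1p p \<Omega>" for w :: "real^'n \<Rightarrow> real^'m"
  proof (rule integrable_of_powr[OF fm _ p])
    have *: "weak_grad \<Omega> w \<in> borel_measurable (lebesgue_on \<Omega>)" "(\<integral>\<^sup>+x. ennreal (norm (weak_grad \<Omega> w x) powr p) \<partial>lebesgue_on \<Omega>) < \<infinity>"
      using W1p_D(3)[OF O w] by (auto simp: Lp_space_iff)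
    show "weak_grad \<Omega> w \<in> borel_measurable (lebesgue_on S)" by (rule measurable_restrict_mono[OF *(1) S(2)])
    have "(\<integral>\<^sup>+x. ennreal (norm (weak_grad \<Omega> w x) powr p) \<partial>lebesgue_on S) \<le> (\<integral>\<^sup>+x. ennreal (norm (weak_grad \<Omega> w x) powr p) \<partial>lebesgue_on \<Omega>)"
      using S SL OL by (simp add: nn_integral_restrict_space) (auto intro!: nn_integral_mono simp: indicator_def)
    then show "(\<integral>\<^sup>+x. ennreal (norm (weak_grad \<Omega> w x) powr p) \<partial>lebesgue_on S) < \<infinity>" using *(2) by simp
  qed
  have uv: "u n \<in> W1p p \<Omega>" "v \<in> W1p p \<Omega>" for n using conv by (auto simp: W1p_weakly_converges_def)
  have comp: "(\<lambda>n. (\<integral>x. weak_grad \<Omega> (u n) x \<partial>lebesgue_on S) \<bullet> b) \<longlonglongrightarrow> (\<integral>x. weak_grad \<Omega> v x \<partial>lebesgue_on S) \<bullet> b" for b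
  proof -
    define w where "w x = indicat_real S x *\<^sub>R b" for x
    have wL: "w \<in> Lp_space q \<Omega>"
    proof -
      have "(\<lambda>x. norm (w x) powr q) = (\<lambda>x. indicat_real S x * norm b powr q)"
        using q by (auto simp: w_def indicator_def)
      moreover have "integrable (lebesgue_on \<Omega>) (\<lambda>x. indicat_real S x * norm b powr q)"
      proof -
        have "integrable lebesgue (\<lambda>x. indicat_real S x * norm b powr q)"
          using S(1) by (intro integrable_mult_left integrable_real_indicator) (auto simp: fmeasurable_def)
        then show ?thesis using OL SL S(2) by (subst integral_lebesgue_on_eq(2)) (auto simp: indicator_def)
      qed
      moreover have "w \<in> borel_measurable (lebesgue_on \<Omega>)"
        unfolding w_def using SL by (intro measurable_restrict_space1) auto
      ultimately show ?thesis by (simp add: Lp_space_def)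
    qed
    have eq: "grad_fun \<Omega> w z = (\<integral>x. weak_grad \<Omega> z x \<partial>lebesgue_on S) \<bullet> b" if z: "z \<in> W1p p \<Omega>" for z
    proof -
      have "grad_fun \<Omega> w z = (\<integral>x. weak_grad \<Omega> z x \<bullet> w x \<partial>lebesgue_on S)"
        unfolding grad_fun_def using OL SL S(2) by (intro integral_lebesgue_on_subset_eq) (auto simp: w_def)
      also have "\<dots> = (\<integral>x. weak_grad \<Omega> z x \<bullet> b \<partial>lebesgue_on S)"
        by (intro Bochner_Integration.integral_cong) (auto simp: w_def)
      also have "\<dots> = (\<integral>x. weak_grad \<Omega> z x \<partial>lebesgue_on S) \<bullet> b"
        using int[OF z] by simp
      finally show ?thesis .
    qed
    have "(\<lambda>n. grad_fun \<Omega> w (u n)) \<longlonglongrightarrow> grad_fun \<Omega> w v"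
      using conv grad_fun(2)[OF p q_def O wL] by (auto simp: W1p_weakly_converges_def)
    then show ?thesis using uv by (simp add: eq)
  qed
  then show ?thesis by (subst tendsto_componentwise_iff) (auto intro: comp)
qed

subsection \<open>Midpoint hulls and a Mazur lemma\<close>

text \<open>Jensen's inequality on each cube, and then the preservation of integrals by
  averaging.\<close>

lemma nn_integral_davg_powr_le:
  fixes g :: "real^'n::finite \<Rightarrow> 'b::euclidean_space"
  assumes p: "1 < p" and g: "g \<in> borel_measurable lebesgue"
  shows "(\<integral>\<^sup>+x. ennreal (norm (davg k g x) powr p) \<partial>lebesgue) \<le> (\<integral>\<^sup>+x. ennreal (norm (g x) powr p) \<partial>lebesgue)"
proof -
  have "ennreal (norm (davg k g x) powr p) \<le> ennreal (1 / dvol TYPE('n) k) * (\<integral>\<^sup>+y. ennreal (norm (g y) powr p) \<partial>lebesgue_on (dcube k x))" for x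
  proof -
    let ?v = "dvol TYPE('n) k"
    have gm: "g \<in> borel_measurable (lebesgue_on (dcube k x))" by (rule measurable_restrict_space1[OF g])
    have "ennreal (norm (davg k g x) powr p) = ennreal ((1 / ?v) powr p) * ennreal (norm (\<integral>y. g y \<partial>lebesgue_on (dcube k x)) powr p)"
      by (simp add: davg_def powr_divide ennreal_mult[symmetric])
    also have "\<dots> \<le> ennreal ((1 / ?v) powr p) * (ennreal (?v powr (p - 1)) * (\<integral>\<^sup>+y. ennreal (norm (g y) powr p) \<partial>lebesgue_on (dcube k x)))"
      using jensen_powr[OF finite_measure_dcube gm p] by (intro mult_left_mono) (auto simp: measure_restrict_space measure_dcube)
    also have "\<dots> = ennreal ((1 / ?v) powr p * ?v powr (p - 1)) * (\<integral>\<^sup>+y. ennreal (norm (g y) powr p) \<partial>lebesgue_on (dcube k x))"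
      by (simp add: ennreal_mult mult.assoc)
    also have "(1 / ?v) powr p * ?v powr (p - 1) = 1 / ?v"
      by (simp add: powr_divide powr_diff)
    finally show ?thesis .
  qed
  then have "(\<integral>\<^sup>+x. ennreal (norm (davg k g x) powr p) \<partial>lebesgue) \<le>
      (\<integral>\<^sup>+x. ennreal (1 / dvol TYPE('n) k) * (\<integral>\<^sup>+y. ennreal (norm (g y) powr p) \<partial>lebesgue_on (dcube k x)) \<partial>lebesgue)"
    by (intro nn_integral_mono)
  also have "\<dots> = (\<integral>\<^sup>+x. ennreal (norm (g x) powr p) \<partial>lebesgue)"
    using g by (intro tower_dcube_level) measurable
  finally show ?thesis .
qed

lemma davg_measurable:
  fixes g :: "real^'n::finite \<Rightarrow> 'b::{banach, second_countable_topology}"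
  shows "davg k g \<in> borel_measurable borel"
proof (rule borel_measurableI)
  fix S :: "'b set" assume "open S"
  show "davg k g -` S \<inter> space borel \<in> sets borel"
    by (rule dcube_union_borel[of _ k]) (auto simp: davg_def dest: dcube_eq)
qed

text \<open>Averages converge almost everywhere along a subsequence of generations, so Fatou's lemma
  applies. The bound is asked for from generation 1 on, where dyadic cubes subdivide the unit
  cube.\<close>

lemma nn_integral_powr_le_of_davg:
  fixes g :: "real^'n::finite \<Rightarrow> 'b::euclidean_space"
  assumes g: "integrable lebesgue g"
    and le: "\<And>k. 1 \<le> k \<Longrightarrow> (\<integral>\<^sup>+x. ennreal (norm (davg k g x) powr p) \<partial>lebesgue) \<le> C" and p: "1 < p"
  shows "(\<integral>\<^sup>+x. ennreal (norm (g x) powr p) \<partial>lebesgue) \<le> C"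
proof -
  obtain r where r: "strict_mono r" "AE x in lebesgue. (\<lambda>j. davg (r j) g x) \<longlonglongrightarrow> g x"
    using davg_tendsto[OF g] by blast
  have "(\<integral>\<^sup>+x. ennreal (norm (g x) powr p) \<partial>lebesgue) \<le> (\<integral>\<^sup>+x. liminf (\<lambda>j. ennreal (norm (davg (r j) g x) powr p)) \<partial>lebesgue)"
  proof (rule nn_integral_mono_AE, use r(2) in eventually_elim)
    case (elim x)
    have "(\<lambda>j. ennreal (norm (davg (r j) g x) powr p)) \<longlonglongrightarrow> ennreal (norm (g x) powr p)"
      using elim p by (intro tendsto_ennrealI tendsto_powr' tendsto_norm tendsto_const) auto
    then show ?case using lim_imp_Liminf[OF trivial_limit_sequentially] by (metis order_refl)
  qed
  also have "\<dots> \<le> liminf (\<lambda>j. \<integral>\<^sup>+x. ennreal (norm (davg (r j) g x) powr p) \<partial>lebesgue)"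
    using davg_measurable[of _ g] by (intro nn_integral_liminf) (auto intro!: measurable_completion)
  also have "\<dots> \<le> C"
  proof (rule Liminf_le)
    show "eventually (\<lambda>j. (\<integral>\<^sup>+x. ennreal (norm (davg (r j) g x) powr p) \<partial>lebesgue) \<le> C) sequentially"
    proof (rule eventually_sequentiallyI[of 1])
      fix j :: nat assume "1 \<le> j"
      then have "1 \<le> r j" using seq_suble[OF r(1), of j] by linarith
      then show "(\<integral>\<^sup>+x. ennreal (norm (davg (r j) g x) powr p) \<partial>lebesgue) \<le> C" by (rule le)
    qed
  qed simp
  finally show ?thesis .
qed

text \<open>Midpoints instead of all convex combinations: uniform convexity speaks of midpoints, and
  any property stable under them transfers by rule induction. Starting at index \<open>n\<close>
  makes the members combinations of a tail.\<close>

inductive_set midhull :: "(nat \<Rightarrow> 'a \<Rightarrow> 'b::real_vector) \<Rightarrow> nat \<Rightarrow> ('a \<Rightarrow> 'b) set" for f n where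
  base: "k \<ge> n \<Longrightarrow> f k \<in> midhull f n"
| mid: "x \<in> midhull f n \<Longrightarrow> y \<in> midhull f n \<Longrightarrow> (\<lambda>t. (1/2) *\<^sub>R (x t + y t)) \<in> midhull f n"

lemma midhull_mono: "x \<in> midhull f m \<Longrightarrow> n \<le> m \<Longrightarrow> x \<in> midhull f n"
  by (induction rule: midhull.induct) (auto intro: midhull.intros)

lemma midhull_subseq: "x \<in> midhull (f \<circ> r) n \<Longrightarrow> strict_mono r \<Longrightarrow> x \<in> midhull f n"
proof (induction rule: midhull.induct)
  case (base k)
  then show ?case using seq_suble[of r k] midhull.base[of n "r k" f] by (simp add: order_trans)
qed (auto intro: midhull.intros)

text \<open>Almost minimisers of the p-th moment over the tail hulls are Cauchy: their midpoint
  cannot do much better than the infimum, and uniform convexity bounds their distance by this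
  defect. The dyadic averages tend to zero, which identifies the limit as zero. Values are pairs so
  that functions undergo the same combinations as their gradients.\<close>

lemma mazur_midhull:
  fixes Z :: "nat \<Rightarrow> real^'n::finite \<Rightarrow> 'd::real_vector \<times> 'e::euclidean_space"
  assumes p: "1 < p" and S: "S \<in> lmeasurable"
    and meas: "\<And>k. (\<lambda>t. snd (Z k t)) \<in> borel_measurable lebesgue"
    and supp: "\<And>k t. t \<notin> S \<Longrightarrow> snd (Z k t) = 0"
    and bound: "\<And>k. (\<integral>\<^sup>+t. ennreal (norm (snd (Z k t)) powr p) \<partial>lebesgue) \<le> ennreal C" and C: "C \<ge> 0"
    and cubes: "\<And>l x. 1 \<le> l \<Longrightarrow> (\<lambda>k. \<integral>t. snd (Z k t) \<partial>lebesgue_on (dcube l x)) \<longlonglongrightarrow> 0"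
  obtains x where "\<And>n. x n \<in> midhull Z n" "(\<lambda>n. \<integral>\<^sup>+t. ennreal (norm (snd (x n t)) powr p) \<partial>lebesgue) \<longlonglongrightarrow> 0"
proof -
  have fmS: "finite_measure (lebesgue_on S)" by (rule finite_measure_lebesgue_on[OF S])
  have SL: "S \<in> sets lebesgue" using S by auto
  define N where "N x = (\<integral>t. norm (snd (x t)) powr p \<partial>lebesgue)" for x :: "real^'n \<Rightarrow> 'd \<times> 'e"
  have HM: "(\<lambda>t. snd (x t)) \<in> borel_measurable lebesgue \<and> (\<forall>t. t \<notin> S \<longrightarrow> snd (x t) = 0) \<and>
      integrable lebesgue (\<lambda>t. norm (snd (x t)) powr p) \<and> N x \<le> C" if "x \<in> midhull Z n" for x n
    using that
  proof (induction rule: midhull.induct)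
    case (base k)
    have i: "integrable lebesgue (\<lambda>t. norm (snd (Z k t)) powr p)"
      using meas[of k] bound[of k] by (intro integrableI_bounded) (auto simp: le_less_trans)
    moreover have "N (Z k) \<le> C"
      using bound[of k] C unfolding N_def by (subst (asm) nn_integral_eq_integral[OF i]) auto
    ultimately show ?case using meas supp by auto
  next
    case (mid x y)
    have [measurable]: "(\<lambda>t. snd (x t)) \<in> borel_measurable lebesgue" "(\<lambda>t. snd (y t)) \<in> borel_measurable lebesgue"
      using mid by auto
    have le: "norm (snd ((1/2) *\<^sub>R (x t + y t))) powr p \<le> (norm (snd (x t)) powr p + norm (snd (y t)) powr p) / 2" for t
      using norm_powr_midpoint_le[OF p, of "snd (x t)" "snd (y t)"] by simp
    have i0: "integrable lebesgue (\<lambda>t. (norm (snd (x t)) powr p + norm (snd (y t)) powr p) / 2)" using mid by auto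
    have i: "integrable lebesgue (\<lambda>t. norm (snd ((1/2) *\<^sub>R (x t + y t))) powr p)"
      by (rule Bochner_Integration.integrable_bound[OF i0]) (use le in \<open>auto intro!: AE_I2\<close>)
    have "N (\<lambda>t. (1/2) *\<^sub>R (x t + y t)) \<le> (\<integral>t. (norm (snd (x t)) powr p + norm (snd (y t)) powr p) / 2 \<partial>lebesgue)"
      unfolding N_def by (rule integral_mono[OF i i0 le])
    also have "\<dots> = (N x + N y) / 2" unfolding N_def using mid by simp
    also have "\<dots> \<le> C" using mid by simp
    finally show ?case using i mid by auto
  qed
  \<comment> \<open>The infimum over combinations of the tail from \<open>n\<close>. It increases
    with \<open>n\<close> and is bounded by \<open>C\<close>, hence converges.\<close>
  define h where "h n = Inf (N ` midhull Z n)" for n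
  have N0: "N x \<ge> 0" for x by (simp add: N_def)
  have bdd: "bdd_below (N ` midhull Z n)" for n by (rule bdd_belowI[of _ 0]) (auto simp: N0)
  have ne: "midhull Z n \<noteq> {}" for n using midhull.base[of n n Z] by auto
  have h_le: "h n \<le> N x" if "x \<in> midhull Z n" for n x
    unfolding h_def using bdd that by (intro cInf_lower) auto
  have hC: "h n \<le> C" for n using h_le HM midhull.base[of n n Z] order_trans by blast
  have hmono: "h n \<le> h m" if "n \<le> m" for n m
    unfolding h_def using midhull_mono[of _ Z m n] that ne bdd by (intro cInf_superset_mono) auto
  have inc: "incseq h" unfolding incseq_def using hmono by simp
  have "\<forall>i. h i \<le> C" using hC by simp
  from incseq_convergent[OF inc this] obtain d where d: "h \<longlonglongrightarrow> d" by metis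
  have hd: "h n \<le> d" for n using d hmono by (intro incseq_le[OF _ d]) (auto simp: incseq_def)
  have "\<exists>x\<in>midhull Z n. N x < h n + 1 / real (Suc n)" for n
  proof (rule ccontr)
    assume "\<not> ?thesis"
    then have "h n + 1 / real (Suc n) \<le> h n"
      unfolding h_def[of n] using ne by (intro cInf_greatest) (auto simp: not_less h_def)
    then show False by simp
  qed
  then obtain x where x: "\<And>n. x n \<in> midhull Z n" "\<And>n. N (x n) < h n + 1 / real (Suc n)" by metis
  note xm = HM[OF x(1)]
  have xint: "integrable (lebesgue_on K) (\<lambda>t. snd (x n t))" if "K \<in> sets lebesgue" for n K
  proof -
    have "integrable (lebesgue_on S) (\<lambda>t. snd (x n t))"
    proof (rule integrable_of_powr[OF fmS _ p])
      show "(\<lambda>t. snd (x n t)) \<in> borel_measurable (lebesgue_on S)" using xm by (intro measurable_restrict_space1) auto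
      have "(\<integral>\<^sup>+t. ennreal (norm (snd (x n t)) powr p) \<partial>lebesgue_on S) \<le> (\<integral>\<^sup>+t. ennreal (norm (snd (x n t)) powr p) \<partial>lebesgue)"
        using SL by (simp add: nn_integral_restrict_space) (auto intro!: nn_integral_mono simp: indicator_def)
      also have "\<dots> < \<infinity>" using xm[of n] by (simp add: integrable_iff_bounded)
      finally show "(\<integral>\<^sup>+t. ennreal (norm (snd (x n t)) powr p) \<partial>lebesgue_on S) < \<infinity>" .
    qed
    then have "integrable lebesgue (\<lambda>t. snd (x n t))"
      using integral_lebesgue_on_eq(2)[OF SL, of "\<lambda>t. snd (x n t)"] xm[of n] by auto
    then show ?thesis using integrable_lebesgue_on_subset[of UNIV "\<lambda>t. snd (x n t)" K] that by (simp add: lebesgue_on_UNIV_eq)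
  qed
  have xint0: "integrable lebesgue (\<lambda>t. snd (x n t))" for n
    using xint[of UNIV n] by (simp add: lebesgue_on_UNIV_eq)
  have Zint: "integrable (lebesgue_on K) (\<lambda>t. snd (y t))" if "K \<in> sets lebesgue" "y \<in> midhull Z m" for y m K
  proof -
    note ym = HM[OF that(2)]
    have "integrable (lebesgue_on S) (\<lambda>t. snd (y t))"
    proof (rule integrable_of_powr[OF fmS _ p])
      show "(\<lambda>t. snd (y t)) \<in> borel_measurable (lebesgue_on S)" using ym by (intro measurable_restrict_space1) auto
      have "(\<integral>\<^sup>+t. ennreal (norm (snd (y t)) powr p) \<partial>lebesgue_on S) \<le> (\<integral>\<^sup>+t. ennreal (norm (snd (y t)) powr p) \<partial>lebesgue)"
        using SL by (simp add: nn_integral_restrict_space) (auto intro!: nn_integral_mono simp: indicator_def)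
      also have "\<dots> < \<infinity>" using ym by (simp add: integrable_iff_bounded)
      finally show "(\<integral>\<^sup>+t. ennreal (norm (snd (y t)) powr p) \<partial>lebesgue_on S) < \<infinity>" .
    qed
    then have "integrable lebesgue (\<lambda>t. snd (y t))"
      using integral_lebesgue_on_eq(2)[OF SL, of "\<lambda>t. snd (y t)"] ym by auto
    then show ?thesis using integrable_lebesgue_on_subset[of UNIV "\<lambda>t. snd (y t)" K] that by (simp add: lebesgue_on_UNIV_eq)
  qed
  \<comment> \<open>The convexity defect of two almost minimisers is at most half the remaining
    increase \<open>d - h n\<close> plus the error \<open>1 / Suc n\<close>.\<close>
  have aux: "(A + B) / 2 - Y \<le> (e - a) / 2 + c" if "c' \<le> c" "A < a + c" "B < b + c'" "b \<le> e" "a \<le> Y"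
    for A B Y a b c c' e :: real
    using that by (simp add: field_simps)
  have cauchy: "\<exists>n0. \<forall>n\<ge>n0. \<forall>m\<ge>n. (\<integral>\<^sup>+t. ennreal (norm (snd (x n t) - snd (x m t)) powr p) \<partial>lebesgue) \<le> ennreal \<eta>"
    if eta: "\<eta> > 0" for \<eta> :: real
  proof -
    \<comment> \<open>Half of \<open>\<eta>\<close> is reserved for the \<open>\<epsilon>\<close>
      term, whose integral is at most \<open>2 * \<epsilon> * C\<close>.\<close>
    define \<epsilon> where "\<epsilon> = \<eta> / (4 * (C + 1))"
    have e: "\<epsilon> > 0" "2 * \<epsilon> * C \<le> \<eta> / 2" using eta C by (auto simp: \<epsilon>_def field_simps)
    obtain D where D: "D > 0" "\<And>a b :: 'e. norm (a - b) powr p \<le> \<epsilon> * (norm a powr p + norm b powr p) +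
       D * ((norm a powr p + norm b powr p) / 2 - norm ((1/2) *\<^sub>R (a + b)) powr p)"
      using uniform_convexity_powr[OF p e(1)] by blast
    have "(\<lambda>n. D * ((d - h n) / 2 + 1 / real (Suc n))) \<longlonglongrightarrow> D * ((d - d) / 2 + 0)"
      by (intro tendsto_intros d LIMSEQ_Suc[OF lim_1_over_n]) auto
    then have "eventually (\<lambda>n. D * ((d - h n) / 2 + 1 / real (Suc n)) < \<eta> / 2) sequentially"
      using eta by (intro order_tendstoD) auto
    then obtain n0 where n0: "\<And>n. n \<ge> n0 \<Longrightarrow> D * ((d - h n) / 2 + 1 / real (Suc n)) < \<eta> / 2"
      by (auto simp: eventually_sequentially)
    have "(\<integral>\<^sup>+t. ennreal (norm (snd (x n t) - snd (x m t)) powr p) \<partial>lebesgue) \<le> ennreal \<eta>"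
      if n: "n \<ge> n0" and m: "m \<ge> n" for n m
    proof -
      let ?y = "\<lambda>t. (1/2) *\<^sub>R (x n t + x m t)"
      have y: "?y \<in> midhull Z n" using x(1) midhull_mono[OF x(1) m] by (intro midhull.mid) auto
      note ym = HM[OF y]
      have [measurable]: "(\<lambda>t. snd (x n t)) \<in> borel_measurable lebesgue" "(\<lambda>t. snd (x m t)) \<in> borel_measurable lebesgue"
        using xm by auto
      define R where "R t = \<epsilon> * (norm (snd (x n t)) powr p + norm (snd (x m t)) powr p) +
       D * ((norm (snd (x n t)) powr p + norm (snd (x m t)) powr p) / 2 - norm (snd (?y t)) powr p)" for t
      have Rle: "norm (snd (x n t) - snd (x m t)) powr p \<le> R t" for t
        using D(2)[of "snd (x n t)" "snd (x m t)"] by (simp add: R_def)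
      have R0: "0 \<le> R t" for t using Rle[of t] powr_ge_zero order_trans by blast
      have Ri: "integrable lebesgue R" unfolding R_def using xm ym
        by (intro Bochner_Integration.integrable_add integrable_mult_right Bochner_Integration.integrable_diff integrable_divide) auto
      have "(\<integral>t. R t \<partial>lebesgue) = \<epsilon> * (N (x n) + N (x m)) + D * ((N (x n) + N (x m)) / 2 - N ?y)"
        unfolding R_def N_def using xm ym by (simp del: snd_scaleR)
      also have "\<dots> \<le> \<epsilon> * (C + C) + D * ((d - h n) / 2 + 1 / real (Suc n))"
      proof (intro add_mono mult_left_mono)
        have "1 / real (Suc m) \<le> 1 / real (Suc n)" using m by (simp add: field_simps)
        then show "(N (x n) + N (x m)) / 2 - N ?y \<le> (d - h n) / 2 + 1 / real (Suc n)"
          by (rule aux[OF _ x(2) x(2) hd h_le[OF y]])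
      qed (use xm e D in auto)
      also have "\<dots> \<le> \<eta>"
      proof -
        have "\<epsilon> * (C + C) = 2 * \<epsilon> * C" by simp
        then show ?thesis using n0[OF n] e(2) by linarith
      qed
      finally have "(\<integral>t. R t \<partial>lebesgue) \<le> \<eta>" .
      moreover have "(\<integral>\<^sup>+t. ennreal (norm (snd (x n t) - snd (x m t)) powr p) \<partial>lebesgue) \<le> (\<integral>\<^sup>+t. ennreal (R t) \<partial>lebesgue)"
        using Rle by (intro nn_integral_mono ennreal_leI)
      moreover have "(\<integral>\<^sup>+t. ennreal (R t) \<partial>lebesgue) = ennreal (\<integral>t. R t \<partial>lebesgue)"
        using R0 by (intro nn_integral_eq_integral Ri) auto
      ultimately show ?thesis by (metis (no_types, lifting) ennreal_leI order_trans)
    qed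
    then show ?thesis by blast
  qed
  have davg0: "(\<lambda>m. davg l (\<lambda>t. snd (x m t)) s) \<longlonglongrightarrow> 0" if l: "1 \<le> l" for l s
  proof -
    let ?I = "\<lambda>z. (\<integral>t. snd (z t) \<partial>lebesgue_on (dcube l s))"
    have "(\<lambda>m. ?I (x m)) \<longlonglongrightarrow> 0"
    proof (rule LIMSEQ_I)
      fix e :: real assume e: "e > 0"
      then obtain k0 where k0: "\<And>k. k \<ge> k0 \<Longrightarrow> norm (?I (Z k) - 0) < e"
        using LIMSEQ_D[OF cubes[OF l, of s]] by blast
      \<comment> \<open>Smallness of the cube integral from index \<open>k0\<close> on is stable
        under midpoints, hence inherited by the tail hull.\<close>
      have "norm (?I y) < e" if "y \<in> midhull Z m" "m \<ge> k0" for y m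
        using that
      proof (induction rule: midhull.induct)
        case (base k)
        then show ?case using k0[of k] by simp
      next
        case (mid x y)
        have "?I (\<lambda>t. (1/2) *\<^sub>R (x t + y t)) = (1/2) *\<^sub>R (?I x + ?I y)"
          using Zint[OF _ mid(1), of "dcube l s"] Zint[OF _ mid(2), of "dcube l s"] by simp
        then show ?case using mid norm_triangle_ineq[of "?I x" "?I y"] by simp
      qed
      then show "\<exists>no. \<forall>n\<ge>no. norm (?I (x n) - 0) < e" using x(1) by auto
    qed
    then have "(\<lambda>m. (1 / dvol TYPE('n) l) *\<^sub>R ?I (x m)) \<longlonglongrightarrow> (1 / dvol TYPE('n) l) *\<^sub>R 0"
      by (intro tendsto_intros)
    then show ?thesis by (simp add: davg_def)
  qed
  \<comment> \<open>As \<open>m\<close> grows the averages of \<open>x m\<close> vanish, so the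
    Cauchy bound for \<open>x n - x m\<close> passes, generation by generation, to
    \<open>x n\<close> itself. No limit function in L^p has to be produced.\<close>
  have final: "(\<integral>\<^sup>+t. ennreal (norm (snd (x n t)) powr p) \<partial>lebesgue) \<le> ennreal \<eta>"
    if c: "\<forall>m\<ge>n. (\<integral>\<^sup>+t. ennreal (norm (snd (x n t) - snd (x m t)) powr p) \<partial>lebesgue) \<le> ennreal \<eta>" for n and \<eta> :: real
  proof (rule nn_integral_powr_le_of_davg[OF xint0 _ p])
    fix l :: nat assume l: "1 \<le> l"
    have "(\<integral>\<^sup>+s. ennreal (norm (davg l (\<lambda>t. snd (x n t)) s) powr p) \<partial>lebesgue) =
       (\<integral>\<^sup>+s. liminf (\<lambda>m. ennreal (norm (davg l (\<lambda>t. snd (x n t) - snd (x m t)) s) powr p)) \<partial>lebesgue)"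
    proof (rule nn_integral_cong)
      fix s
      have "davg l (\<lambda>t. snd (x n t) - snd (x m t)) s = davg l (\<lambda>t. snd (x n t)) s - davg l (\<lambda>t. snd (x m t)) s" for m
        using xint[of "dcube l s"] by (simp add: davg_def scaleR_diff_right)
      note e = this
      have tend: "(\<lambda>m. ennreal (norm (davg l (\<lambda>t. snd (x n t)) s - davg l (\<lambda>t. snd (x m t)) s) powr p))
          \<longlonglongrightarrow> ennreal (norm (davg l (\<lambda>t. snd (x n t)) s - 0) powr p)"
        using p by (intro tendsto_ennrealI tendsto_powr' tendsto_norm tendsto_diff tendsto_const davg0 l) auto
      show "ennreal (norm (davg l (\<lambda>t. snd (x n t)) s) powr p) =
          liminf (\<lambda>m. ennreal (norm (davg l (\<lambda>t. snd (x n t) - snd (x m t)) s) powr p))"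
        unfolding e using lim_imp_Liminf[OF trivial_limit_sequentially tend] by simp
    qed
    also have "\<dots> \<le> liminf (\<lambda>m. \<integral>\<^sup>+s. ennreal (norm (davg l (\<lambda>t. snd (x n t) - snd (x m t)) s) powr p) \<partial>lebesgue)"
      by (intro nn_integral_liminf) (auto intro!: measurable_completion davg_measurable measurable_compose[OF davg_measurable])
    also have "\<dots> \<le> ennreal \<eta>"
    proof (rule Liminf_le)
      show "eventually (\<lambda>m. (\<integral>\<^sup>+s. ennreal (norm (davg l (\<lambda>t. snd (x n t) - snd (x m t)) s) powr p) \<partial>lebesgue) \<le> ennreal \<eta>) sequentially"
      proof (rule eventually_sequentiallyI[of n])
        fix m assume m: "n \<le> m"
        have "(\<integral>\<^sup>+s. ennreal (norm (davg l (\<lambda>t. snd (x n t) - snd (x m t)) s) powr p) \<partial>lebesgue)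
           \<le> (\<integral>\<^sup>+t. ennreal (norm (snd (x n t) - snd (x m t)) powr p) \<partial>lebesgue)"
          using xm by (intro nn_integral_davg_powr_le p borel_measurable_diff) auto
        also have "\<dots> \<le> ennreal \<eta>" using c m by blast
        finally show "(\<integral>\<^sup>+s. ennreal (norm (davg l (\<lambda>t. snd (x n t) - snd (x m t)) s) powr p) \<partial>lebesgue) \<le> ennreal \<eta>" .
      qed
    qed simp
    finally show "(\<integral>\<^sup>+s. ennreal (norm (davg l (\<lambda>t. snd (x n t)) s) powr p) \<partial>lebesgue) \<le> ennreal \<eta>" .
  qed
  have "(\<lambda>n. \<integral>\<^sup>+t. ennreal (norm (snd (x n t)) powr p) \<partial>lebesgue) \<longlonglongrightarrow> 0"
  proof (rule order_tendstoI)
    fix a :: ennreal assume "0 < a"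
    obtain \<eta> :: real where eta: "\<eta> > 0" "ennreal \<eta> < a"
    proof (cases a)
      case (real r)
      then show ?thesis using that[of "r / 2"] \<open>0 < a\<close> by (simp add: ennreal_lessI)
    next
      case top
      then show ?thesis using that[of 1] by simp
    qed
    then show "eventually (\<lambda>n. (\<integral>\<^sup>+t. ennreal (norm (snd (x n t)) powr p) \<partial>lebesgue) < a) sequentially"
      using cauchy[OF eta(1)] final eta(2) unfolding eventually_sequentially by (meson le_less_trans)
  qed auto
  then show ?thesis using that x(1) by blast
qed

lemma is_weak_grad_cong:
  fixes u :: "real^'a::finite \<Rightarrow> real^'m::finite"
  assumes O: "open \<Omega>" and eq: "\<And>t. t \<in> \<Omega> \<Longrightarrow> G t = G' t" "\<And>t. t \<in> \<Omega> \<Longrightarrow> u t = u' t" and u: "is_weak_grad \<Omega> u G"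
  shows "is_weak_grad \<Omega> u' G'"
proof -
  have loc: "locally_integrable \<Omega> f'" if "locally_integrable \<Omega> f" "\<And>t. t \<in> \<Omega> \<Longrightarrow> f t = f' t" for f f' :: "real^'a \<Rightarrow> 'c::euclidean_space"
    unfolding locally_integrable_def
  proof (intro conjI allI impI)
    show "f' \<in> borel_measurable (lebesgue_on \<Omega>)"
      using that by (subst measurable_lebesgue_cong[of \<Omega> f' f]) (auto simp: locally_integrable_def)
    fix K assume K: "compact K \<and> K \<subseteq> \<Omega>"
    then have "integrable (lebesgue_on K) f" using that by (auto simp: locally_integrable_def)
    then show "integrable (lebesgue_on K) f'"
      using K that by (subst Bochner_Integration.integrable_cong[of _ "lebesgue_on K" f' f]) auto
  qed
  show ?thesis
    unfolding is_weak_grad_def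
  proof (intro conjI ballI allI)
    show "locally_integrable \<Omega> u'" "locally_integrable \<Omega> G'" using u eq loc unfolding is_weak_grad_def by blast+
    fix \<phi> :: "real^'a \<Rightarrow> real" and i j assume phi: "\<phi> \<in> test_functions \<Omega>"
    have "(\<integral>x. u' x $ i * partial_deriv j \<phi> x \<partial>lebesgue_on \<Omega>) = (\<integral>x. u x $ i * partial_deriv j \<phi> x \<partial>lebesgue_on \<Omega>)"
      "(\<integral>x. G' x $ i $ j * \<phi> x \<partial>lebesgue_on \<Omega>) = (\<integral>x. G x $ i $ j * \<phi> x \<partial>lebesgue_on \<Omega>)"
      using eq by (auto intro!: Bochner_Integration.integral_cong)
    then show "(\<integral>x. u' x $ i * partial_deriv j \<phi> x \<partial>lebesgue_on \<Omega>) = - (\<integral>x. G' x $ i $ j * \<phi> x \<partial>lebesgue_on \<Omega>)"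
      using u[unfolded is_weak_grad_def, THEN conjunct2, THEN conjunct2, rule_format, OF phi, of i j] by simp
  qed
qed

text \<open>If \<open>l (u n)\<close> stayed away from \<open>l v\<close> along a subsequence, then
  with a sign chosen this would be a linear inequality surviving midpoints, while Mazur combinations
  of the differences tend to zero in norm; boundedness of \<open>l\<close> excludes that. The
  hypothesis \<open>hull\<close> isolates how function values are controlled: by the Poincare
  inequality in the blow-up, by explicit smallness in the cube filling.\<close>

lemma weak_convergence_criterion:
  fixes u :: "nat \<Rightarrow> real^'n::finite \<Rightarrow> real^'m::finite"
  assumes p: "1 < p" and O: "open \<Omega>" "\<Omega> \<in> lmeasurable"
    and u: "\<And>k. u k \<in> Lp_space p \<Omega>" "\<And>k. is_weak_grad \<Omega> (u k) (G k)" "\<And>k. G k \<in> Lp_space p \<Omega>"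
    and v: "v \<in> Lp_space p \<Omega>" "is_weak_grad \<Omega> v H" "H \<in> Lp_space p \<Omega>"
    and bound: "\<And>k. (\<integral>\<^sup>+t. ennreal (norm (G k t - H t) powr p) \<partial>lebesgue_on \<Omega>) \<le> ennreal C" and C: "C \<ge> 0"
    and cubes: "\<And>l x. 1 \<le> l \<Longrightarrow> (\<lambda>k. \<integral>t. G k t - H t \<partial>lebesgue_on (dcube l x \<inter> \<Omega>)) \<longlonglongrightarrow> 0"
    and hull: "\<And>x. (\<And>n. x n \<in> midhull (\<lambda>k t. (u k t - v t, if t \<in> \<Omega> then G k t - H t else 0)) n) \<Longrightarrow>
       (\<lambda>n. \<integral>\<^sup>+t. ennreal (norm (snd (x n t)) powr p) \<partial>lebesgue_on \<Omega>) \<longlonglongrightarrow> 0 \<Longrightarrow>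
       (\<lambda>n. \<integral>\<^sup>+t. ennreal (norm (fst (x n t)) powr p) \<partial>lebesgue_on \<Omega>) \<longlonglongrightarrow> 0"
  shows "W1p_weakly_converges p \<Omega> u v"
  unfolding W1p_weakly_converges_def
proof (intro conjI allI ballI)
  show uW: "u n \<in> W1p p \<Omega>" for n using W1p_I u by blast
  show vW: "v \<in> W1p p \<Omega>" using W1p_I v by blast
  fix l :: "(real^'n \<Rightarrow> real^'m) \<Rightarrow> real" assume l: "l \<in> W1p_dual p \<Omega>"
  have OL: "\<Omega> \<in> sets lebesgue" using O by auto
  define Z where "Z k t = (u k t - v t, if t \<in> \<Omega> then G k t - H t else 0)" for k t
  have ladd: "l (\<lambda>x. a x + b x) = l a + l b" if "a \<in> W1p p \<Omega>" "b \<in> W1p p \<Omega>" for a b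
    using l that by (auto simp: W1p_dual_def)
  have lsc: "l (\<lambda>x. c *\<^sub>R a x) = c * l a" if "a \<in> W1p p \<Omega>" for a c
    using l that by (auto simp: W1p_dual_def)
  have ldiff: "l (\<lambda>x. a x - b x) = l a - l b" if "a \<in> W1p p \<Omega>" "b \<in> W1p p \<Omega>" for a b
    using ladd[OF that(1) W1p_scaleR(1)[OF O(1) that(2), of "-1"]] lsc[OF that(2), of "-1"] by simp
  obtain B where B: "\<And>a. a \<in> W1p p \<Omega> \<Longrightarrow> \<bar>l a\<bar> \<le> B * W1p_norm p \<Omega> a"
    using l unfolding W1p_dual_def by blast
  show "(\<lambda>n. l (u n)) \<longlonglongrightarrow> l v"
  proof (rule ccontr)
    assume "\<not> ?thesis"
    then obtain e where e: "e > 0" "\<And>n0. \<exists>n\<ge>n0. e \<le> \<bar>l (u n) - l v\<bar>"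
      unfolding lim_sequentially by (auto simp: dist_real_def not_less)
    \<comment> \<open>One of the two signs occurs infinitely often. Fixing it replaces the absolute
      value by a linear expression.\<close>
    have "\<exists>s\<in>{1,-1::real}. \<forall>n0. \<exists>n\<ge>n0. e \<le> s * (l (u n) - l v)"
    proof (rule ccontr)
      assume "\<not> ?thesis"
      then obtain a b where ab: "\<And>n. n \<ge> a \<Longrightarrow> \<not> e \<le> 1 * (l (u n) - l v)" "\<And>n. n \<ge> b \<Longrightarrow> \<not> e \<le> (-1) * (l (u n) - l v)"
        by blast
      obtain n where "n \<ge> max a b" "e \<le> \<bar>l (u n) - l v\<bar>" using e(2) by blast
      then show False using ab(1)[of n] ab(2)[of n] by (auto simp: abs_if split: if_splits)
    qed
    then obtain s :: real where s1: "s = 1 \<or> s = - 1" and s: "\<And>n0. \<exists>n\<ge>n0. e \<le> s * (l (u n) - l v)" by blast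
    have "infinite {n. e \<le> s * (l (u n) - l v)}"
      unfolding infinite_nat_iff_unbounded_le using s by blast
    then obtain r :: "nat \<Rightarrow> nat" where r: "strict_mono r" "\<And>k. r k \<in> {n. e \<le> s * (l (u n) - l v)}"
      using infinite_enumerate by blast
    have m: "(\<lambda>t. snd ((Z \<circ> r) k t)) \<in> borel_measurable lebesgue" for k
    proof -
      have "(\<lambda>t. G (r k) t - H t) \<in> borel_measurable (lebesgue_on \<Omega>)" using u(3) v(3) by (intro borel_measurable_diff) (auto simp: Lp_space_def)
      then show ?thesis using OL by (simp add: Z_def borel_measurable_if_lebesgue_on borel_measurable_if)
    qed
      have b: "(\<integral>\<^sup>+t. ennreal (norm (snd ((Z \<circ> r) k t)) powr p) \<partial>lebesgue) \<le> ennreal C" for k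
      proof -
        have "(\<integral>\<^sup>+t. ennreal (norm (snd ((Z \<circ> r) k t)) powr p) \<partial>lebesgue) = (\<integral>\<^sup>+t. ennreal (norm (G (r k) t - H t) powr p) \<partial>lebesgue_on \<Omega>)"
          using OL p by (subst nn_integral_restrict_space) (auto intro!: nn_integral_cong simp: Z_def indicator_def)
        then show ?thesis using bound by simp
      qed
      have c: "(\<lambda>k. \<integral>t. snd ((Z \<circ> r) k t) \<partial>lebesgue_on (dcube l x)) \<longlonglongrightarrow> 0" if "1 \<le> l" for l x
      proof -
        have "(\<integral>t. snd (Z k t) \<partial>lebesgue_on (dcube l x)) = (\<integral>t. G k t - H t \<partial>lebesgue_on (dcube l x \<inter> \<Omega>))" for k
        proof -
          have "(\<integral>t. snd (Z k t) \<partial>lebesgue_on (dcube l x)) = (\<integral>t. snd (Z k t) \<partial>lebesgue_on (dcube l x \<inter> \<Omega>))"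
            using OL by (intro integral_lebesgue_on_subset_eq) (auto simp: Z_def)
          also have "\<dots> = (\<integral>t. G k t - H t \<partial>lebesgue_on (dcube l x \<inter> \<Omega>))"
            by (intro Bochner_Integration.integral_cong) (auto simp: Z_def)
          finally show ?thesis .
        qed
        then show ?thesis using LIMSEQ_subseq_LIMSEQ[OF cubes[OF that, of x] r(1)] by (simp add: o_def)
      qed
    have z: "snd ((Z \<circ> r) k t) = 0" if "t \<notin> \<Omega>" for k t using that by (simp add: Z_def)
    obtain x where x: "\<And>n. x n \<in> midhull (Z \<circ> r) n" "(\<lambda>n. \<integral>\<^sup>+t. ennreal (norm (snd (x n t)) powr p) \<partial>lebesgue) \<longlonglongrightarrow> 0"
      using mazur_midhull[OF p O(2) m z b C c] by blast
    \<comment> \<open>What has to survive midpoints: being a function paired with its gradient, both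
      in L^p, and the lower bound \<open>e\<close>.\<close>
    have inv: "is_weak_grad \<Omega> (\<lambda>t. fst (y t)) (\<lambda>t. snd (y t)) \<and> (\<lambda>t. fst (y t)) \<in> Lp_space p \<Omega> \<and>
        (\<lambda>t. snd (y t)) \<in> Lp_space p \<Omega> \<and> e \<le> s * l (\<lambda>t. fst (y t))"
      if "y \<in> midhull (Z \<circ> r) n" for y n
      using that
    proof (induction rule: midhull.induct)
      case (base k)
      have w: "is_weak_grad \<Omega> (\<lambda>t. u (r k) t - v t) (\<lambda>t. G (r k) t - H t)"
        by (rule is_weak_grad_diff[OF O(1) u(2) v(2)])
      have L: "(\<lambda>t. G (r k) t - H t) \<in> Lp_space p \<Omega>" by (rule Lp_space_diff[OF p u(3) v(3)])
      have w2: "is_weak_grad \<Omega> (\<lambda>t. fst ((Z \<circ> r) k t)) (\<lambda>t. snd ((Z \<circ> r) k t))"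
        by (rule is_weak_grad_cong[OF O(1) _ _ w]) (auto simp: Z_def)
      moreover have "(\<lambda>t. snd ((Z \<circ> r) k t)) \<in> Lp_space p \<Omega>"
        using is_weak_grad_measurable(2)[OF w2] by (intro Lp_space_cong_AE[OF L] AE_I2) (auto simp: Z_def)
      moreover have "(\<lambda>t. fst ((Z \<circ> r) k t)) \<in> Lp_space p \<Omega>"
        using Lp_space_diff[OF p u(1) v(1)] by (simp add: Z_def)
      moreover have "e \<le> s * l (\<lambda>t. fst ((Z \<circ> r) k t))"
        using r(2)[of k] ldiff[OF uW vW, of "r k"] by (simp add: Z_def)
      ultimately show ?case by blast
    next
      case (mid x y)
      have xW: "(\<lambda>t. fst (x t)) \<in> W1p p \<Omega>" and yW: "(\<lambda>t. fst (y t)) \<in> W1p p \<Omega>"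
        using mid W1p_I by blast+
      have 1: "l (\<lambda>t. (1/2) *\<^sub>R (fst (x t) + fst (y t))) = (1/2) * (l (\<lambda>t. fst (x t)) + l (\<lambda>t. fst (y t)))"
        using lsc[OF W1p_add(1)[OF p O(1) xW yW], of "1/2"] ladd[OF xW yW] by simp
      have "e \<le> s * ((1/2) * (l (\<lambda>t. fst (x t)) + l (\<lambda>t. fst (y t))))"
        using mid by (simp add: distrib_left)
      moreover have "is_weak_grad \<Omega> (\<lambda>t. (1/2) *\<^sub>R (fst (x t) + fst (y t))) (\<lambda>t. (1/2) *\<^sub>R (snd (x t) + snd (y t)))"
        using mid by (intro is_weak_grad_scaleR is_weak_grad_add O) auto
      moreover have "(\<lambda>t. (1/2) *\<^sub>R (fst (x t) + fst (y t))) \<in> Lp_space p \<Omega>" "(\<lambda>t. (1/2) *\<^sub>R (snd (x t) + snd (y t))) \<in> Lp_space p \<Omega>"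
        using mid by (auto intro!: Lp_space_scaleR Lp_space_add p)
      ultimately show ?case using 1 by (simp only: fst_scaleR snd_scaleR fst_add snd_add)
    qed
    define A where "A n = (\<integral>\<^sup>+t. ennreal (norm (fst (x n t)) powr p) \<partial>lebesgue_on \<Omega>)" for n
    define D where "D n = (\<integral>\<^sup>+t. ennreal (norm (snd (x n t)) powr p) \<partial>lebesgue_on \<Omega>)" for n
    have D0: "D \<longlonglongrightarrow> 0"
    proof (rule tendsto_sandwich[OF _ _ tendsto_const x(2)])
      show "eventually (\<lambda>n. D n \<le> (\<integral>\<^sup>+t. ennreal (norm (snd (x n t)) powr p) \<partial>lebesgue)) sequentially"
        unfolding D_def using OL by (intro always_eventually allI) (auto simp: nn_integral_restrict_space indicator_def intro!: nn_integral_mono)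
    qed auto
    have A0: "A \<longlonglongrightarrow> 0"
      unfolding A_def
    proof (rule hull)
      show "x n \<in> midhull (\<lambda>k t. (u k t - v t, if t \<in> \<Omega> then G k t - H t else 0)) n" for n
        using midhull_subseq[OF x(1) r(1)] unfolding Z_def[abs_def] .
      show "(\<lambda>n. \<integral>\<^sup>+t. ennreal (norm (snd (x n t)) powr p) \<partial>lebesgue_on \<Omega>) \<longlonglongrightarrow> 0"
        using D0 by (simp add: D_def[abs_def])
    qed
    have Ae: "A n = ennreal (\<integral>t. norm (fst (x n t)) powr p \<partial>lebesgue_on \<Omega>)" for n
      unfolding A_def using inv[OF x(1)[of n]] by (intro nn_integral_eq_integral) (auto simp: Lp_space_def)
    have De: "D n = ennreal (\<integral>t. norm (snd (x n t)) powr p \<partial>lebesgue_on \<Omega>)" for n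
      unfolding D_def using inv[OF x(1)[of n]] by (intro nn_integral_eq_integral) (auto simp: Lp_space_def)
    have "(\<lambda>n. \<integral>t. norm (fst (x n t)) powr p \<partial>lebesgue_on \<Omega>) \<longlonglongrightarrow> 0"
      using A0 unfolding Ae by (subst (asm) ennreal_0[symmetric], subst (asm) tendsto_ennreal_iff) auto
    moreover have "(\<lambda>n. \<integral>t. norm (snd (x n t)) powr p \<partial>lebesgue_on \<Omega>) \<longlonglongrightarrow> 0"
      using D0 unfolding De by (subst (asm) ennreal_0[symmetric], subst (asm) tendsto_ennreal_iff) auto
    ultimately have "(\<lambda>n. ((\<integral>t. norm (fst (x n t)) powr p \<partial>lebesgue_on \<Omega>) + (\<integral>t. norm (snd (x n t)) powr p \<partial>lebesgue_on \<Omega>)) powr (1/p)) \<longlonglongrightarrow> (0 + 0) powr (1/p)"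
      using p by (intro tendsto_powr' tendsto_add tendsto_const) auto
    then have "(\<lambda>n. W1p_norm p \<Omega> (\<lambda>t. fst (x n t))) \<longlonglongrightarrow> 0"
    proof -
      assume *: "(\<lambda>n. ((\<integral>t. norm (fst (x n t)) powr p \<partial>lebesgue_on \<Omega>) + (\<integral>t. norm (snd (x n t)) powr p \<partial>lebesgue_on \<Omega>)) powr (1/p)) \<longlonglongrightarrow> (0 + 0) powr (1/p)"
      have "W1p_norm p \<Omega> (\<lambda>t. fst (x n t)) =
          ((\<integral>t. norm (fst (x n t)) powr p \<partial>lebesgue_on \<Omega>) + (\<integral>t. norm (snd (x n t)) powr p \<partial>lebesgue_on \<Omega>)) powr (1/p)" for n
        using inv[OF x(1)[of n]] by (intro W1p_norm_eq[OF O(1)]) blast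
      then show ?thesis using * p by simp
    qed
    then have lim: "(\<lambda>n. B * W1p_norm p \<Omega> (\<lambda>t. fst (x n t))) \<longlonglongrightarrow> 0"
      using tendsto_mult_right_zero by blast
    have "e \<le> B * W1p_norm p \<Omega> (\<lambda>t. fst (x n t))" for n
    proof -
      have i: "e \<le> s * l (\<lambda>t. fst (x n t))" "(\<lambda>t. fst (x n t)) \<in> W1p p \<Omega>" using inv[OF x(1)[of n]] W1p_I by blast+
      have "s * l (\<lambda>t. fst (x n t)) \<le> \<bar>l (\<lambda>t. fst (x n t))\<bar>" using s1 by auto
      then show ?thesis using i B[OF i(2)] by linarith
    qed
    then have "e \<le> 0" using lim by (intro LIMSEQ_le_const[OF lim]) auto
    then show False using e by simp
  qed
qed

subsection \<open>Poincare inequality on the unit cube\<close>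

lemma norm_matrix_vector_le:
  fixes A :: "real^'n::finite^'m::finite"
  shows "norm (A *v h) \<le> norm A * norm h"
proof -
  have "norm (A *v h) \<le> L2_set (\<lambda>i. norm (A $ i) * norm h) UNIV"
    unfolding norm_vec_def[of "A *v h"]
    by (intro L2_set_mono) (auto simp: matrix_vector_mul_component Cauchy_Schwarz_ineq2)
  also have "\<dots> = norm A * norm h"
    by (simp add: norm_vec_def[of A] L2_set_left_distrib)
  finally show ?thesis .
qed

text \<open>The difference quotient falls on the smooth kernel, where the Lipschitz constant bounds
  it; so dominated convergence applies to a merely integrable \<open>f\<close>.\<close>

lemma DERIV_integral_shift:
  fixes f :: "real^'n::finite \<Rightarrow> real" and \<psi> :: "real^'n \<Rightarrow> real"
  assumes f: "integrable M f" and M: "\<And>g. continuous_on UNIV g \<Longrightarrow> (g :: real^'n \<Rightarrow> real) \<in> borel_measurable M"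
    and C: "C1 \<psi>" and K: "compact K" "\<And>y. y \<notin> K \<Longrightarrow> \<psi> y = 0"
  shows "DERIV (\<lambda>t. \<integral>x. \<psi> (x - c - t *\<^sub>R h) * f x \<partial>M) t :>
    (\<integral>x. - (\<Sum>j\<in>UNIV. h $ j * partial_deriv j \<psi> (x - c - t *\<^sub>R h)) * f x \<partial>M)"
proof -
  obtain B where B: "B \<ge> 0" "\<And>x. norm (\<psi> x) \<le> B" "\<And>j x. norm (partial_deriv j \<psi> x) \<le> B"
    "\<And>x y. norm (\<psi> x - \<psi> y) \<le> B * norm (x - y)"
    using C1_compact_bounds[OF C K] by blast
  have cp: "continuous_on UNIV \<psi>" by (rule C1_continuous[OF C])
  have sm: "(\<lambda>x. \<psi> (x - c - s *\<^sub>R h)) \<in> borel_measurable M" for s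
    by (intro M continuous_on_compose2[OF cp]) (auto intro!: continuous_intros)
  have pm: "(\<lambda>x. partial_deriv j \<psi> (x - c - s *\<^sub>R h)) \<in> borel_measurable M" for s j
  proof -
    have "continuous_on UNIV (partial_deriv j \<psi>)" using C by (simp add: C1_def)
    then show ?thesis by (intro M, rule continuous_on_compose2) (auto intro!: continuous_intros)
  qed
  have fm: "f \<in> borel_measurable M" using f by auto
  have si: "integrable M (\<lambda>x. \<psi> (x - c - s *\<^sub>R h) * f x)" for s
  proof (rule Bochner_Integration.integrable_bound)
    show "integrable M (\<lambda>x. B * f x)" using f by auto
    show "AE x in M. norm (\<psi> (x - c - s *\<^sub>R h) * f x) \<le> norm (B * f x)"
      using B(1,2) by (intro AE_I2) (auto simp: abs_mult intro!: mult_right_mono)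
  qed (use sm fm in auto)
  have "((\<lambda>k. ((\<integral>x. \<psi> (x - c - (t + k) *\<^sub>R h) * f x \<partial>M) - (\<integral>x. \<psi> (x - c - t *\<^sub>R h) * f x \<partial>M)) / k) \<longlongrightarrow>
     (\<integral>x. - (\<Sum>j\<in>UNIV. h $ j * partial_deriv j \<psi> (x - c - t *\<^sub>R h)) * f x \<partial>M)) (at 0)"
    unfolding tendsto_at_iff_sequentially
  proof (intro allI impI)
    fix X :: "nat \<Rightarrow> real" assume X: "\<forall>i. X i \<in> UNIV - {0}" "X \<longlonglongrightarrow> 0"
    have eq: "((\<integral>x. \<psi> (x - c - (t + k) *\<^sub>R h) * f x \<partial>M) - (\<integral>x. \<psi> (x - c - t *\<^sub>R h) * f x \<partial>M)) / k =
      (\<integral>x. (\<psi> (x - c - (t + k) *\<^sub>R h) - \<psi> (x - c - t *\<^sub>R h)) / k * f x \<partial>M)" if "k \<noteq> 0" for k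
    proof -
      have "(\<integral>x. (\<psi> (x - c - (t + k) *\<^sub>R h) - \<psi> (x - c - t *\<^sub>R h)) / k * f x \<partial>M) =
         (\<integral>x. (1 / k) * (\<psi> (x - c - (t + k) *\<^sub>R h) * f x - \<psi> (x - c - t *\<^sub>R h) * f x) \<partial>M)"
        by (intro Bochner_Integration.integral_cong) (auto simp: algebra_simps diff_divide_distrib)
      also have "\<dots> = ((\<integral>x. \<psi> (x - c - (t + k) *\<^sub>R h) * f x \<partial>M) - (\<integral>x. \<psi> (x - c - t *\<^sub>R h) * f x \<partial>M)) / k"
        using si by simp
      finally show ?thesis by (rule sym)
    qed
    have "(\<lambda>i. \<integral>x. (\<psi> (x - c - (t + X i) *\<^sub>R h) - \<psi> (x - c - t *\<^sub>R h)) / X i * f x \<partial>M) \<longlonglongrightarrow>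
       (\<integral>x. - (\<Sum>j\<in>UNIV. h $ j * partial_deriv j \<psi> (x - c - t *\<^sub>R h)) * f x \<partial>M)"
    proof (rule integral_dominated_convergence[where w="\<lambda>x. B * norm h * norm (f x)"])
      show "integrable M (\<lambda>x. B * norm h * norm (f x))" using f by auto
      show "AE x in M. norm ((\<psi> (x - c - (t + X i) *\<^sub>R h) - \<psi> (x - c - t *\<^sub>R h)) / X i * f x) \<le> B * norm h * norm (f x)" for i
      proof (intro AE_I2)
        fix x
        have "norm (\<psi> (x - c - (t + X i) *\<^sub>R h) - \<psi> (x - c - t *\<^sub>R h)) \<le> B * norm ((x - c - (t + X i) *\<^sub>R h) - (x - c - t *\<^sub>R h))"
          by (rule B(4))
        also have "(x - c - (t + X i) *\<^sub>R h) - (x - c - t *\<^sub>R h) = - X i *\<^sub>R h" by (simp add: algebra_simps)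
        finally have "norm (\<psi> (x - c - (t + X i) *\<^sub>R h) - \<psi> (x - c - t *\<^sub>R h)) / \<bar>X i\<bar> \<le> B * norm h"
          using X(1) by (simp add: field_simps)
        then have "norm (\<psi> (x - c - (t + X i) *\<^sub>R h) - \<psi> (x - c - t *\<^sub>R h)) / \<bar>X i\<bar> * norm (f x) \<le> B * norm h * norm (f x)"
          by (intro mult_right_mono) auto
        then show "norm ((\<psi> (x - c - (t + X i) *\<^sub>R h) - \<psi> (x - c - t *\<^sub>R h)) / X i * f x) \<le> B * norm h * norm (f x)"
          by (simp add: abs_mult)
      qed
      show "AE x in M. (\<lambda>i. (\<psi> (x - c - (t + X i) *\<^sub>R h) - \<psi> (x - c - t *\<^sub>R h)) / X i * f x)
         \<longlonglongrightarrow> - (\<Sum>j\<in>UNIV. h $ j * partial_deriv j \<psi> (x - c - t *\<^sub>R h)) * f x"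
      proof (intro AE_I2 tendsto_mult tendsto_const)
        fix x
        let ?y = "x - c - t *\<^sub>R h"
        have d: "\<psi> differentiable (at ?y)" using C by (auto simp: C1_def)
        then have D: "(\<psi> has_derivative frechet_derivative \<psi> (at ?y)) (at ?y)" by (simp add: frechet_derivative_works)
        have "((\<lambda>k. ?y - k *\<^sub>R h) has_derivative (\<lambda>k. - (k *\<^sub>R h))) (at 0)"
          by (auto intro!: derivative_eq_intros)
        from has_derivative_compose[OF this, of \<psi> "frechet_derivative \<psi> (at ?y)"]
        have "((\<lambda>k. \<psi> (?y - k *\<^sub>R h)) has_derivative (\<lambda>k. frechet_derivative \<psi> (at ?y) (- (k *\<^sub>R h)))) (at 0)"
          using D by simp
        moreover have "(\<lambda>k. frechet_derivative \<psi> (at ?y) (- (k *\<^sub>R h))) = (*) (- (\<Sum>j\<in>UNIV. h $ j * partial_deriv j \<psi> ?y))"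
          using linear_frechet_derivative[OF d] frechet_eq_sum_partial[OF d, of h]
          by (auto simp: linear_neg linear_scale mult.commute)
        ultimately have "DERIV (\<lambda>k. \<psi> (?y - k *\<^sub>R h)) 0 :> - (\<Sum>j\<in>UNIV. h $ j * partial_deriv j \<psi> ?y)"
          by (simp add: has_field_derivative_def)
        then have "((\<lambda>k. (\<psi> (?y - k *\<^sub>R h) - \<psi> ?y) / k) \<longlongrightarrow> - (\<Sum>j\<in>UNIV. h $ j * partial_deriv j \<psi> ?y)) (at 0)"
          by (simp add: DERIV_def)
        then have "((\<lambda>k. (\<psi> (?y - k *\<^sub>R h) - \<psi> ?y) / k) \<circ> X) \<longlonglongrightarrow> - (\<Sum>j\<in>UNIV. h $ j * partial_deriv j \<psi> ?y)"
          using X unfolding tendsto_at_iff_sequentially by blast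
        moreover have "?y - k *\<^sub>R h = x - c - (t + k) *\<^sub>R h" for k by (simp add: algebra_simps)
        ultimately show "(\<lambda>i. (\<psi> (x - c - (t + X i) *\<^sub>R h) - \<psi> ?y) / X i) \<longlonglongrightarrow> - (\<Sum>j\<in>UNIV. h $ j * partial_deriv j \<psi> ?y)"
          by (simp add: o_def)
      qed
      show "(\<lambda>x. (\<psi> (x - c - (t + X i) *\<^sub>R h) - \<psi> (x - c - t *\<^sub>R h)) / X i * f x) \<in> borel_measurable M" for i
        using sm fm by (intro borel_measurable_times borel_measurable_divide borel_measurable_diff) auto
      show "(\<lambda>x. - (\<Sum>j\<in>UNIV. h $ j * partial_deriv j \<psi> (x - c - t *\<^sub>R h)) * f x) \<in> borel_measurable M"
        using pm fm by (intro borel_measurable_times borel_measurable_uminus borel_measurable_sum) auto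
    qed
    then show "((\<lambda>k. ((\<integral>x. \<psi> (x - c - (t + k) *\<^sub>R h) * f x \<partial>M) - (\<integral>x. \<psi> (x - c - t *\<^sub>R h) * f x \<partial>M)) / k) \<circ> X) \<longlonglongrightarrow>
       (\<integral>x. - (\<Sum>j\<in>UNIV. h $ j * partial_deriv j \<psi> (x - c - t *\<^sub>R h)) * f x \<partial>M)"
      unfolding o_def using eq X(1) by simp
  qed
  then show ?thesis by (simp add: DERIV_def)
qed

text \<open>The componentwise definition of the weak gradient, summed with the coefficients
  \<open>h $ j * w $ i\<close>, becomes a directional derivative paired with
  \<open>w\<close>.\<close>

lemma weak_directional:
  fixes u :: "real^'n::finite \<Rightarrow> real^'m::finite"
  assumes O: "open \<Omega>" and u: "is_weak_grad \<Omega> u G" and phi: "\<phi> \<in> test_functions \<Omega>"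
  shows "(\<integral>x. - (\<Sum>j\<in>UNIV. h $ j * partial_deriv j \<phi> x) * (u x \<bullet> w) \<partial>lebesgue_on \<Omega>) =
    (\<integral>x. \<phi> x * ((G x *v h) \<bullet> w) \<partial>lebesgue_on \<Omega>)"
proof -
  have l: "locally_integrable \<Omega> u" "locally_integrable \<Omega> G" using u by (auto simp: is_weak_grad_def)
  have i1: "integrable (lebesgue_on \<Omega>) (\<lambda>x. u x $ i * partial_deriv j \<phi> x)" for i j
    by (rule weak_grad_integrable(1)[OF O phi l(1)])
  have i2: "integrable (lebesgue_on \<Omega>) (\<lambda>x. G x $ i $ j * \<phi> x)" for i j
    by (rule weak_grad_integrable(2)[OF O phi l(2)])
  have "(\<integral>x. - (\<Sum>j\<in>UNIV. h $ j * partial_deriv j \<phi> x) * (u x \<bullet> w) \<partial>lebesgue_on \<Omega>) =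
     (\<integral>x. (\<Sum>j\<in>UNIV. \<Sum>i\<in>UNIV. - (h $ j * w $ i) * (u x $ i * partial_deriv j \<phi> x)) \<partial>lebesgue_on \<Omega>)"
    by (intro Bochner_Integration.integral_cong refl, subst sum.swap)
       (simp add: inner_vec_def sum_product sum_negf mult_ac)
  also have "\<dots> = (\<Sum>j\<in>UNIV. \<Sum>i\<in>UNIV. - (h $ j * w $ i) * (\<integral>x. u x $ i * partial_deriv j \<phi> x \<partial>lebesgue_on \<Omega>))"
    using i1 by (subst Bochner_Integration.integral_sum, intro Bochner_Integration.integrable_sum integrable_mult_right, simp,
      intro sum.cong refl, subst Bochner_Integration.integral_sum) auto
  also have "\<dots> = (\<Sum>j\<in>UNIV. \<Sum>i\<in>UNIV. (h $ j * w $ i) * (\<integral>x. G x $ i $ j * \<phi> x \<partial>lebesgue_on \<Omega>))"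
    using u[unfolded is_weak_grad_def, THEN conjunct2, THEN conjunct2, rule_format, OF phi] by simp
  also have "\<dots> = (\<integral>x. (\<Sum>j\<in>UNIV. \<Sum>i\<in>UNIV. (h $ j * w $ i) * (G x $ i $ j * \<phi> x)) \<partial>lebesgue_on \<Omega>)"
    using i2 by (subst Bochner_Integration.integral_sum, intro Bochner_Integration.integrable_sum integrable_mult_right, simp,
      intro sum.cong refl, subst Bochner_Integration.integral_sum) auto
  also have "\<dots> = (\<integral>x. \<phi> x * ((G x *v h) \<bullet> w) \<partial>lebesgue_on \<Omega>)"
  proof (intro Bochner_Integration.integral_cong refl)
    fix x
    have "\<phi> x * ((G x *v h) \<bullet> w) = \<phi> x * (\<Sum>i\<in>UNIV. (\<Sum>j\<in>UNIV. G x $ i $ j * h $ j) * w $ i)"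
      by (simp add: inner_vec_def matrix_vector_mult_def)
    also have "\<dots> = (\<Sum>i\<in>UNIV. \<Sum>j\<in>UNIV. (h $ j * w $ i) * (G x $ i $ j * \<phi> x))"
      by (simp add: sum_distrib_left sum_distrib_right mult_ac)
    finally show "(\<Sum>j\<in>UNIV. \<Sum>i\<in>UNIV. (h $ j * w $ i) * (G x $ i $ j * \<phi> x)) = \<phi> x * ((G x *v h) \<bullet> w)"
      by (subst sum.swap) simp
  qed
  finally show ?thesis .
qed

text \<open>All cells are moved by \<open>t * h\<close> simultaneously. The mean value theorem,
  applied to one scalar function of \<open>t\<close>, gives a single intermediate \<open>t\<close>
  for all cells; at this \<open>t\<close> the moved cells are disjoint and inside the cube, so the
  integrals of \<open>|G|^p\<close> over them add up to at most the total. The smooth weight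
  \<open>\<psi>\<close> makes that function of \<open>t\<close> differentiable although
  \<open>u\<close> is only weakly differentiable.\<close>

lemma shift_estimate_smooth:
  fixes u :: "real^'n::finite \<Rightarrow> real^'m::finite"
  assumes p: "1 < p" and u: "is_weak_grad unit_cube u G" and ui: "integrable (lebesgue_on unit_cube) u"
    and G: "G \<in> Lp_space p unit_cube"
    and A: "finite A" and sub: "\<And>c x. c \<in> A \<Longrightarrow> x \<in> box a b \<Longrightarrow> c + x \<in> unit_cube \<and> c + h + x \<in> unit_cube"
    and dis: "\<And>c c' x y. c \<in> A \<Longrightarrow> c' \<in> A \<Longrightarrow> x \<in> box a b \<Longrightarrow> y \<in> box a b \<Longrightarrow> c + x = c' + y \<Longrightarrow> c = c'"
    and psi: "\<psi> \<in> test_functions (box a b)" and b: "\<And>x. 0 \<le> \<psi> x" "\<And>x. \<psi> x \<le> 1"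
  shows "(\<Sum>c\<in>A. norm ((\<integral>x. \<psi> (x - c - h) *\<^sub>R u x \<partial>lebesgue_on unit_cube) - (\<integral>x. \<psi> (x - c) *\<^sub>R u x \<partial>lebesgue_on unit_cube)) powr p)
    \<le> norm h powr p * measure lebesgue (box a b) powr (p - 1) * (\<integral>x. norm (G x) powr p \<partial>lebesgue_on unit_cube)"
proof -
  let ?Y = "unit_cube :: (real^'n) set"
  let ?M = "lebesgue_on ?Y"
  obtain K where K: "compact K" "K \<subseteq> box a b" "\<And>x. x \<notin> K \<Longrightarrow> \<psi> x = 0" "C1 \<psi>" "continuous_on UNIV \<psi>"
    using test_function_props[OF psi] by metis
  have psim: "(\<lambda>x. \<psi> (x - c)) \<in> borel_measurable ?M" for c
    by (intro measurable_restrict_space1 borel_measurable_continuous_lebesgue continuous_on_compose2[OF K(5)]) (auto intro!: continuous_intros)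
  have pui: "integrable ?M (\<lambda>x. \<psi> (x - c) *\<^sub>R u x)" for c
  proof (rule Bochner_Integration.integrable_bound[OF ui])
    show "AE x in ?M. norm (\<psi> (x - c) *\<^sub>R u x) \<le> norm (u x)"
      using b by (intro AE_I2) (auto intro!: mult_left_le_one_le)
  qed (use psim ui in auto)
  define d where "d c = (\<integral>x. \<psi> (x - c - h) *\<^sub>R u x \<partial>?M) - (\<integral>x. \<psi> (x - c) *\<^sub>R u x \<partial>?M)" for c
  \<comment> \<open>Duality vectors: pairing \<open>d c\<close> with \<open>w c\<close> gives the
    p-th power to be estimated and turns vector-valued differences into scalars.\<close>
  define w where "w c = norm (d c) powr (p - 2) *\<^sub>R d c" for c
  define F where "F c t = (\<integral>x. \<psi> (x - c - t *\<^sub>R h) * (u x \<bullet> w c) \<partial>?M)" for c t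
  have Fv: "F c t = (\<integral>x. \<psi> (x - (c + t *\<^sub>R h)) *\<^sub>R u x \<partial>?M) \<bullet> w c" for c t
    unfolding F_def using pui[of "c + t *\<^sub>R h"] by (subst integral_inner_left[symmetric]) (auto simp: algebra_simps)
  have wd: "d c \<bullet> w c = norm (d c) powr p" "norm (w c) = norm (d c) powr (p - 1)" for c
  proof -
    show "d c \<bullet> w c = norm (d c) powr p"
    proof (cases "d c = 0")
      case False
      then have "norm (d c) powr (p - 2) * (norm (d c))\<^sup>2 = norm (d c) powr p"
        using powr_add[of "norm (d c)" "p - 2" 2] by (simp add: powr_numeral)
      then show ?thesis by (simp add: w_def dot_square_norm)
    qed (use p in \<open>simp add: w_def\<close>)
    show "norm (w c) = norm (d c) powr (p - 1)"
    proof (cases "d c = 0")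
      case False
      then have "norm (d c) powr (p - 2) * norm (d c) = norm (d c) powr (p - 1)"
        using powr_add[of "norm (d c)" "p - 2" 1] by simp
      then show ?thesis by (simp add: w_def)
    qed (use p in \<open>simp add: w_def\<close>)
  qed
  define F' where "F' c t = (\<integral>x. - (\<Sum>j\<in>UNIV. h $ j * partial_deriv j \<psi> (x - c - t *\<^sub>R h)) * (u x \<bullet> w c) \<partial>?M)" for c t
  have DF: "DERIV (F c) t :> F' c t" for c t
    unfolding F_def[abs_def] F'_def using ui K
    by (intro DERIV_integral_shift measurable_restrict_space1 borel_measurable_continuous_lebesgue) auto
  have "DERIV (\<lambda>t. \<Sum>c\<in>A. F c t) t :> (\<Sum>c\<in>A. F' c t)" for t by (intro DERIV_sum DF)
  then have "\<exists>t. 0 < t \<and> t < 1 \<and> (\<Sum>c\<in>A. F c 1) - (\<Sum>c\<in>A. F c 0) = (1 - 0) * (\<Sum>c\<in>A. F' c t)"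
    by (intro MVT2) auto
  then obtain t where t: "0 < t" "t < 1" "(\<Sum>c\<in>A. F c 1) - (\<Sum>c\<in>A. F c 0) = (\<Sum>c\<in>A. F' c t)" by auto
  have F10: "F c 1 - F c 0 = norm (d c) powr p" for c
  proof -
    have "F c 1 - F c 0 = d c \<bullet> w c"
      by (simp add: Fv d_def inner_diff_left diff_diff_eq)
    then show ?thesis by (simp only: wd(1))
  qed
  define S where "S c = {x. x - c - t *\<^sub>R h \<in> box a b}" for c
  define g where "g c = (\<integral>x. \<psi> (x - c - t *\<^sub>R h) *\<^sub>R G x \<partial>?M)" for c
  \<comment> \<open>By assumption the cell stays in the cube at both ends of the motion; convexity
    of the cube handles intermediate times.\<close>
  have SY: "S c \<subseteq> ?Y" if "c \<in> A" for c
  proof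
    fix x assume "x \<in> S c"
    then have "x - c - t *\<^sub>R h \<in> box a b" by (simp add: S_def)
    from sub[OF that this]
    have "c + (x - c - t *\<^sub>R h) \<in> ?Y" "c + h + (x - c - t *\<^sub>R h) \<in> ?Y" by blast+
    then have "(1 - t) *\<^sub>R (c + (x - c - t *\<^sub>R h)) + t *\<^sub>R (c + h + (x - c - t *\<^sub>R h)) \<in> ?Y"
      using t by (intro convexD[OF convex_unit_cube]) auto
    moreover have "(1 - t) *\<^sub>R (c + (x - c - t *\<^sub>R h)) + t *\<^sub>R (c + h + (x - c - t *\<^sub>R h)) = x"
      by (simp add: algebra_simps)
    ultimately show "x \<in> ?Y" by simp
  qed
  have Seq: "S c = (+) (c + t *\<^sub>R h) ` box a b" for c
    by (auto simp: S_def algebra_simps intro!: image_eqI[of _ _ "_ - (c + t *\<^sub>R h)"])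
  have Sm: "S c \<in> lmeasurable" "measure lebesgue (S c) = measure lebesgue (box a b)" for c
    unfolding Seq by (simp_all add: measurable_translation measure_translation)
  have SL: "S c \<in> sets lebesgue" for c using Sm by auto
  have Gm: "G \<in> borel_measurable ?M" and Gi: "integrable ?M (\<lambda>x. norm (G x) powr p)"
    using G by (auto simp: Lp_space_def)
  have fmY: "finite_measure ?M" by (rule finite_measure_lebesgue_on) simp
  have Gint: "integrable ?M G"
    by (rule integrable_of_powr[OF fmY Gm p]) (use G in \<open>auto simp: Lp_space_iff\<close>)
  have pGi: "integrable ?M (\<lambda>x. \<psi> (x - c) *\<^sub>R G x)" for c
  proof (rule Bochner_Integration.integrable_bound[OF Gint])
    show "AE x in ?M. norm (\<psi> (x - c) *\<^sub>R G x) \<le> norm (G x)"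
      using b by (intro AE_I2) (auto intro!: mult_left_le_one_le)
  qed (use psim Gm in auto)
  have F't: "F' c t = (g c *v h) \<bullet> w c" if c: "c \<in> A" for c
  proof -
    define \<phi> where "\<phi> x = \<psi> (- (c + t *\<^sub>R h) + 1 *\<^sub>R x)" for x
    have ph: "\<phi> x = \<psi> (x - c - t *\<^sub>R h)" for x by (simp add: \<phi>_def algebra_simps)
    have phT: "\<phi> \<in> test_functions ?Y"
      unfolding \<phi>_def
    proof (rule test_functions_affine[OF psi])
      fix x assume "- (c + t *\<^sub>R h) + 1 *\<^sub>R x \<in> box a b"
      then have "x \<in> S c" by (simp add: S_def algebra_simps)
      then show "x \<in> ?Y" using SY[OF c] by blast
    qed simp
    have pd: "partial_deriv j \<phi> x = partial_deriv j \<psi> (x - c - t *\<^sub>R h)" for j x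
    proof -
      have "\<psi> differentiable (at z)" for z using K(4) by (auto simp: C1_def)
      from partial_deriv_affine[where c="- (c + t *\<^sub>R h)" and s=1 and x=x and j=j, OF this]
      show ?thesis by (simp add: \<phi>_def[abs_def] algebra_simps)
    qed
    have "F' c t = (\<integral>x. \<phi> x * ((G x *v h) \<bullet> w c) \<partial>?M)"
      using weak_directional[OF open_unit_cube u phT, of h "w c"] by (simp add: F'_def pd)
    also have "\<dots> = (\<integral>x. ((\<phi> x *\<^sub>R G x) *v h) \<bullet> w c \<partial>?M)"
      by (intro Bochner_Integration.integral_cong) (auto simp: scaleR_matrix_vector_assoc[symmetric])
    also have "\<dots> = (g c *v h) \<bullet> w c"
    proof -
      have bl: "bounded_linear (\<lambda>B :: real^'n^'m. (B *v h) \<bullet> w c)"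
        by (rule bounded_linear_compose[OF bounded_linear_inner_left])
           (auto intro!: linear_conv_bounded_linear[THEN iffD1] linearI simp: matrix_vector_mult_add_rdistrib scaleR_matrix_vector_assoc)
      show ?thesis
        unfolding g_def ph using integral_bounded_linear[OF bl pGi[of "c + t *\<^sub>R h"]] by (simp add: algebra_simps)
    qed
    finally show ?thesis .
  qed
  have gle: "norm (g c) powr p \<le> measure lebesgue (box a b) powr (p - 1) * (\<integral>x. norm (G x) powr p \<partial>lebesgue_on (S c))" if c: "c \<in> A" for c
  proof -
    have fm: "finite_measure (lebesgue_on (S c))" by (rule finite_measure_lebesgue_on[OF Sm(1)])
    have ge: "g c = (\<integral>x. \<psi> (x - c - t *\<^sub>R h) *\<^sub>R G x \<partial>lebesgue_on (S c))"
      unfolding g_def using SL SY[OF c] K(2,3)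
      by (intro integral_lebesgue_on_subset_eq) (auto simp: S_def)
    have m: "(\<lambda>x. \<psi> (x - c - t *\<^sub>R h) *\<^sub>R G x) \<in> borel_measurable (lebesgue_on (S c))"
      using pGi[of "c + t *\<^sub>R h"] by (intro measurable_restrict_mono[OF _ SY[OF c]]) (auto simp: algebra_simps dest: borel_measurable_integrable)
    have GiS: "integrable (lebesgue_on (S c)) (\<lambda>x. norm (G x) powr p)"
      by (rule integrable_lebesgue_on_subset[OF Gi SY[OF c]]) (use SL in auto)
    have "ennreal (norm (g c) powr p) \<le> ennreal (measure lebesgue (box a b) powr (p - 1)) * (\<integral>\<^sup>+x. ennreal (norm (\<psi> (x - c - t *\<^sub>R h) *\<^sub>R G x) powr p) \<partial>lebesgue_on (S c))"
      using jensen_powr[OF fm m p] SL Sm(2)[of c] unfolding ge by (simp add: measure_restrict_space)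
    also have "\<dots> \<le> ennreal (measure lebesgue (box a b) powr (p - 1)) * (\<integral>\<^sup>+x. ennreal (norm (G x) powr p) \<partial>lebesgue_on (S c))"
      using b p by (intro mult_left_mono nn_integral_mono ennreal_leI powr_mono2) (auto intro!: mult_left_le_one_le)
    also have "\<dots> = ennreal (measure lebesgue (box a b) powr (p - 1) * (\<integral>x. norm (G x) powr p \<partial>lebesgue_on (S c)))"
      using GiS by (subst nn_integral_eq_integral) (auto simp: ennreal_mult)
    finally show ?thesis by (subst (asm) ennreal_le_iff) auto
  qed
  have Ssum: "(\<Sum>c\<in>A. \<integral>x. norm (G x) powr p \<partial>lebesgue_on (S c)) \<le> (\<integral>x. norm (G x) powr p \<partial>?M)"
  proof -
    have iS: "integrable lebesgue (\<lambda>x. indicator (S c) x * norm (G x) powr p)" if "c \<in> A" for c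
      using integrable_lebesgue_on_subset[OF Gi SY[OF that]] SL by (simp add: integrable_restrict_space)
    have "(\<Sum>c\<in>A. \<integral>x. norm (G x) powr p \<partial>lebesgue_on (S c)) = (\<integral>x. (\<Sum>c\<in>A. indicator (S c) x * norm (G x) powr p) \<partial>lebesgue)"
      using SL iS by (simp add: integral_restrict_space Bochner_Integration.integral_sum)
    also have "\<dots> \<le> (\<integral>x. indicator ?Y x * norm (G x) powr p \<partial>lebesgue)"
    proof (rule integral_mono)
      show "integrable lebesgue (\<lambda>x. \<Sum>c\<in>A. indicator (S c) x * norm (G x) powr p)" using iS by auto
      show "integrable lebesgue (\<lambda>x. indicator ?Y x * norm (G x) powr p)" using Gi by (simp add: integrable_restrict_space)
      fix x
      show "(\<Sum>c\<in>A. indicator (S c) x * norm (G x) powr p) \<le> indicator ?Y x * norm (G x) powr p"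
      proof (cases "\<exists>c\<in>A. x \<in> S c")
        case True
        then obtain c where c: "c \<in> A" "x \<in> S c" by blast
        have "x \<notin> S c'" if "c' \<in> A" "c' \<noteq> c" for c'
        proof
          assume "x \<in> S c'"
          then have "c + (x - c - t *\<^sub>R h) = c' + (x - c' - t *\<^sub>R h)" "x - c - t *\<^sub>R h \<in> box a b" "x - c' - t *\<^sub>R h \<in> box a b"
            using c by (auto simp: S_def)
          then show False using dis[OF c(1) that(1)] that(2) by blast
        qed
        then have "(\<Sum>c'\<in>A. indicator (S c') x * norm (G x) powr p) = (\<Sum>c'\<in>A. if c' = c then norm (G x) powr p else 0)"
          using c by (intro sum.cong) auto
        then show ?thesis using c A SY[OF c(1)] by auto
      next
        case False
        then have "(\<Sum>c'\<in>A. indicator (S c') x * norm (G x) powr p) = 0" by (intro sum.neutral) auto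
        then show ?thesis by simp
      qed
    qed
    also have "\<dots> = (\<integral>x. norm (G x) powr p \<partial>?M)" by (simp add: integral_restrict_space)
    finally show ?thesis .
  qed
  have "(\<Sum>c\<in>A. norm (d c) powr p) = (\<Sum>c\<in>A. F' c t)"
    using t(3) by (simp add: F10[symmetric] sum_subtractf)
  \<comment> \<open>Cauchy-Schwarz and the tangent inequality leave the fraction
    \<open>(p - 1) / p\<close> of the left side on the right, where it is absorbed.\<close>
  also have "\<dots> \<le> (\<Sum>c\<in>A. (norm (g c *v h) powr p + (p - 1) * norm (d c) powr p) / p)"
  proof (rule sum_mono)
    fix c assume c: "c \<in> A"
    have "F' c t \<le> norm (g c *v h) * norm (d c) powr (p - 1)"
      unfolding F't[OF c] wd(2)[symmetric] by (rule norm_cauchy_schwarz)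
    also have "\<dots> \<le> (norm (g c *v h) powr p + (p - 1) * norm (d c) powr p) / p"
      using powr_tangent[of "norm (g c *v h)" "norm (d c)" p] p by (simp add: field_simps)
    finally show "F' c t \<le> (norm (g c *v h) powr p + (p - 1) * norm (d c) powr p) / p" .
  qed
  also have "\<dots> = ((\<Sum>c\<in>A. norm (g c *v h) powr p) + (p - 1) * (\<Sum>c\<in>A. norm (d c) powr p)) / p"
    by (simp add: sum_divide_distrib[symmetric] sum.distrib sum_distrib_left)
  finally have "(\<Sum>c\<in>A. norm (d c) powr p) \<le> (\<Sum>c\<in>A. norm (g c *v h) powr p)"
    using p by (simp add: field_simps)
  also have "\<dots> \<le> (\<Sum>c\<in>A. norm h powr p * (measure lebesgue (box a b) powr (p - 1) * (\<integral>x. norm (G x) powr p \<partial>lebesgue_on (S c))))"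
  proof (rule sum_mono)
    fix c assume c: "c \<in> A"
    have "norm (g c *v h) powr p \<le> (norm (g c) * norm h) powr p"
      using p by (intro powr_mono2 norm_matrix_vector_le) auto
    also have "\<dots> = norm h powr p * norm (g c) powr p" by (simp add: powr_mult)
    also have "\<dots> \<le> norm h powr p * (measure lebesgue (box a b) powr (p - 1) * (\<integral>x. norm (G x) powr p \<partial>lebesgue_on (S c)))"
      by (intro mult_left_mono gle c) auto
    finally show "norm (g c *v h) powr p \<le> norm h powr p * (measure lebesgue (box a b) powr (p - 1) * (\<integral>x. norm (G x) powr p \<partial>lebesgue_on (S c)))" .
  qed
  also have "\<dots> = norm h powr p * measure lebesgue (box a b) powr (p - 1) * (\<Sum>c\<in>A. \<integral>x. norm (G x) powr p \<partial>lebesgue_on (S c))"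
    by (simp add: sum_distrib_left mult.assoc)
  also have "\<dots> \<le> norm h powr p * measure lebesgue (box a b) powr (p - 1) * (\<integral>x. norm (G x) powr p \<partial>?M)"
    by (intro mult_left_mono Ssum) auto
  finally show ?thesis unfolding d_def .
qed

text \<open>The weight is sharpened from bumps to the indicator of the box by dominated convergence,
  since the smooth bound does not depend on the bump.\<close>

lemma shift_estimate:
  fixes u :: "real^'n::finite \<Rightarrow> real^'m::finite"
  assumes p: "1 < p" and u: "is_weak_grad unit_cube u G" and ui: "integrable (lebesgue_on unit_cube) u"
    and G: "G \<in> Lp_space p unit_cube"
    and A: "finite A" and sub: "\<And>c x. c \<in> A \<Longrightarrow> x \<in> box a b \<Longrightarrow> c + x \<in> unit_cube \<and> c + h + x \<in> unit_cube"
    and dis: "\<And>c c' x y. c \<in> A \<Longrightarrow> c' \<in> A \<Longrightarrow> x \<in> box a b \<Longrightarrow> y \<in> box a b \<Longrightarrow> c + x = c' + y \<Longrightarrow> c = c'"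
  shows "(\<Sum>c\<in>A. norm ((\<integral>x. indicator (box a b) (x - c - h) *\<^sub>R u x \<partial>lebesgue_on unit_cube) - (\<integral>x. indicator (box a b) (x - c) *\<^sub>R u x \<partial>lebesgue_on unit_cube)) powr p)
    \<le> norm h powr p * measure lebesgue (box a b) powr (p - 1) * (\<integral>x. norm (G x) powr p \<partial>lebesgue_on unit_cube)"
proof -
  let ?M = "lebesgue_on (unit_cube :: (real^'n) set)"
  have lim: "(\<lambda>r. \<integral>x. bump r a b (x - c) *\<^sub>R u x \<partial>?M) \<longlonglongrightarrow> (\<integral>x. indicator (box a b) (x - c) *\<^sub>R u x \<partial>?M)" for c
  proof (rule integral_dominated_convergence[where w="\<lambda>x. norm (u x)"])
    have cb: "continuous_on UNIV (bump r a b)" for r using Ck_bump[of 0 r a b] by simp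
    have bm: "(\<lambda>x. bump r a b (x - c)) \<in> borel_measurable ?M" for r
      by (intro measurable_restrict_space1 borel_measurable_continuous_lebesgue continuous_on_compose2[OF cb]) (auto intro!: continuous_intros)
    show "(\<lambda>x. bump r a b (x - c) *\<^sub>R u x) \<in> borel_measurable ?M" for r
      using bm ui by (intro borel_measurable_scaleR) auto
    have "(\<lambda>x. indicator (box a b) (x - c) :: real) \<in> borel_measurable ?M"
      by (rule borel_measurable_LIMSEQ_real[OF tendsto_bump bm])
    then show "(\<lambda>x. indicator (box a b) (x - c) *\<^sub>R u x) \<in> borel_measurable ?M"
      using ui by (intro borel_measurable_scaleR) auto
    show "AE x in ?M. (\<lambda>r. bump r a b (x - c) *\<^sub>R u x) \<longlonglongrightarrow> indicator (box a b) (x - c) *\<^sub>R u x"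
      by (intro AE_I2 tendsto_scaleR tendsto_bump tendsto_const)
    show "AE x in ?M. norm (bump r a b (x - c) *\<^sub>R u x) \<le> norm (u x)" for r
      using bump_bounds[of r a b] by (intro AE_I2) (auto intro!: mult_left_le_one_le)
  qed (use ui in auto)
  have lim': "(\<lambda>r. \<integral>x. bump r a b (x - c - h) *\<^sub>R u x \<partial>?M) \<longlonglongrightarrow> (\<integral>x. indicator (box a b) (x - c - h) *\<^sub>R u x \<partial>?M)" for c
    using lim[of "c + h"] by (simp add: diff_diff_eq)
  have "(\<lambda>r. \<Sum>c\<in>A. norm ((\<integral>x. bump r a b (x - c - h) *\<^sub>R u x \<partial>?M) - (\<integral>x. bump r a b (x - c) *\<^sub>R u x \<partial>?M)) powr p)
    \<longlonglongrightarrow> (\<Sum>c\<in>A. norm ((\<integral>x. indicator (box a b) (x - c - h) *\<^sub>R u x \<partial>?M) - (\<integral>x. indicator (box a b) (x - c) *\<^sub>R u x \<partial>?M)) powr p)"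
    using p by (intro tendsto_sum tendsto_powr' tendsto_norm tendsto_diff lim lim' tendsto_const) auto
  then show ?thesis
  proof (rule LIMSEQ_le_const2)
    show "\<exists>N. \<forall>n\<ge>N. (\<Sum>c\<in>A. norm ((\<integral>x. bump n a b (x - c - h) *\<^sub>R u x \<partial>?M) - (\<integral>x. bump n a b (x - c) *\<^sub>R u x \<partial>?M)) powr p)
      \<le> norm h powr p * measure lebesgue (box a b) powr (p - 1) * (\<integral>x. norm (G x) powr p \<partial>?M)"
    proof (intro exI allI impI)
      fix n
      show "(\<Sum>c\<in>A. norm ((\<integral>x. bump n a b (x - c - h) *\<^sub>R u x \<partial>?M) - (\<integral>x. bump n a b (x - c) *\<^sub>R u x \<partial>?M)) powr p)
        \<le> norm h powr p * measure lebesgue (box a b) powr (p - 1) * (\<integral>x. norm (G x) powr p \<partial>?M)"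
        by (rule shift_estimate_smooth[OF p u ui G A _ _ bump_test_functions[OF order_refl] bump_bounds])
           (use sub dis in blast)+
    qed
  qed
qed

section \<open>Dyadic cells of the unit cube and the sum over pairs of cells\<close>

definition grid :: "nat \<Rightarrow> ('n::finite \<Rightarrow> int) set" where
  "grid k = {z. \<forall>i. - (2^(k-1)) \<le> z i \<and> z i < 2^(k-1)}"

text \<open>The lower corner of the cell labelled \<open>z\<close>. It belongs to the half-open
  cell, so it also serves as a representative from which \<open>z\<close> is read off.\<close>

definition gpoint :: "nat \<Rightarrow> ('n::finite \<Rightarrow> int) \<Rightarrow> real^'n" where
  "gpoint k z = (\<chi> i. of_int (z i) / 2^k)"

lemma card_int_fun_interval:
  "finite {z :: 'n::finite \<Rightarrow> int. \<forall>i. a \<le> z i \<and> z i < b}"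
  "card {z :: 'n::finite \<Rightarrow> int. \<forall>i. a \<le> z i \<and> z i < b} = nat (b - a) ^ CARD('n)"
proof -
  have "{z :: 'n::finite \<Rightarrow> int. \<forall>i. a \<le> z i \<and> z i < b} = PiE UNIV (\<lambda>_. {a..<b})"
    by (auto simp: PiE_def Pi_def)
  then show "finite {z :: 'n::finite \<Rightarrow> int. \<forall>i. a \<le> z i \<and> z i < b}"
    "card {z :: 'n::finite \<Rightarrow> int. \<forall>i. a \<le> z i \<and> z i < b} = nat (b - a) ^ CARD('n)"
    by (simp_all add: finite_PiE card_PiE)
qed

lemma finite_grid [simp]: "finite (grid k)"
  unfolding grid_def by (rule card_int_fun_interval)

lemma card_grid:
  assumes "1 \<le> k"
  shows "real (card (grid k :: ('n::finite \<Rightarrow> int) set)) = 1 / dvol TYPE('n) k"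
proof -
  obtain j where j: "k = Suc j" using assms by (cases k) auto
  have "card (grid k :: ('n \<Rightarrow> int) set) = nat (2^(k-1) - - (2^(k-1))) ^ CARD('n)"
    unfolding grid_def by (rule card_int_fun_interval)
  also have "nat (2^(k-1) - - (2^(k-1))) = (2::nat)^k"
    by (simp add: j nat_power_eq nat_mult_distrib)
  finally show ?thesis by (simp add: dvol_def power_one_over)
qed

lemma floor_gpoint: "\<lfloor>2^k * gpoint k z $ i\<rfloor> = z i"
  by (simp add: gpoint_def)

lemma dcube_gpoint: "x \<in> dcube k (gpoint k z) \<longleftrightarrow> (\<forall>i. \<lfloor>2^k * x $ i\<rfloor> = z i)"
  by (simp add: dcube_def floor_gpoint)

text \<open>The unit cube is centred at the origin, so its faces sit at multiples of
  \<open>1 / 2^k\<close> only when \<open>k \<ge> 1\<close>; the labels then run from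
  \<open>- (2^(k-1))\<close> inclusive to \<open>2^(k-1)\<close> exclusive.\<close>

lemma grid_iff_half_open:
  assumes k: "1 \<le> k"
  shows "(\<lambda>i. \<lfloor>2^k * x $ i\<rfloor>) \<in> grid k \<longleftrightarrow> x \<in> half_open_cube"
proof -
  obtain j where j: "k = Suc j" using k by (cases k) auto
  have "(- (2^j) \<le> \<lfloor>2^k * t\<rfloor> \<and> \<lfloor>2^k * t\<rfloor> < 2^j) \<longleftrightarrow> (- 1/2 \<le> t \<and> t < 1/2)" for t :: real
  proof -
    have "- (2^j) \<le> \<lfloor>2^k * t\<rfloor> \<longleftrightarrow> real_of_int (- (2^j)) \<le> 2^k * t" by (rule le_floor_iff)
    also have "\<dots> \<longleftrightarrow> 2^j * (- 1) \<le> 2^j * (2 * t)" by (simp add: j mult.assoc mult.left_commute)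
    also have "\<dots> \<longleftrightarrow> - 1/2 \<le> t" by (subst mult_le_cancel_left_pos) auto
    finally have 1: "- (2^j) \<le> \<lfloor>2^k * t\<rfloor> \<longleftrightarrow> - 1/2 \<le> t" .
    have "\<lfloor>2^k * t\<rfloor> < 2^j \<longleftrightarrow> 2^k * t < real_of_int (2^j)" by (rule floor_less_iff)
    also have "\<dots> \<longleftrightarrow> 2^j * (2 * t) < 2^j * 1" by (simp add: j mult.assoc mult.left_commute)
    also have "\<dots> \<longleftrightarrow> t < 1/2" by (subst mult_less_cancel_left_pos) auto
    finally have 2: "\<lfloor>2^k * t\<rfloor> < 2^j \<longleftrightarrow> t < 1/2" .
    show ?thesis using 1 2 by blast
  qed
  then show ?thesis by (auto simp: grid_def half_open_cube_def j)
qed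

lemma gpoint_dcube_subset:
  assumes "1 \<le> k" "z \<in> grid k"
  shows "dcube k (gpoint k z) \<subseteq> half_open_cube"
proof
  fix x assume "x \<in> dcube k (gpoint k z)"
  then have "(\<lambda>i. \<lfloor>2^k * x $ i\<rfloor>) = z" by (auto simp: dcube_gpoint)
  then have "(\<lambda>i. \<lfloor>2^k * x $ i\<rfloor>) \<in> grid k" using assms(2) by (simp only:)
  then show "x \<in> half_open_cube" using grid_iff_half_open[OF assms(1), of x] by blast
qed

lemma dbox_gpoint_subset:
  assumes "1 \<le> k" "z \<in> grid k"
  shows "dbox k (gpoint k z) \<subseteq> unit_cube"
proof -
  have "dbox k (gpoint k z) \<subseteq> interior half_open_cube"
    using dbox_subset gpoint_dcube_subset[OF assms] by (intro interior_maximal) auto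
  moreover have "interior half_open_cube \<subseteq> interior (cbox (\<chi> i. - 1/2) (\<chi> i. 1/2))"
    by (intro interior_mono) (auto simp: half_open_cube_def mem_box_cart less_imp_le)
  ultimately show ?thesis by (auto simp: unit_cube_eq_box interior_cbox)
qed

text \<open>The open cell at the origin. Every other open cell is its translate by a corner, which
  is the shape that \<open>shift_estimate\<close> works with.\<close>

definition pcell :: "nat \<Rightarrow> (real^'n::finite) set" where
  "pcell k = box 0 (\<chi> i. 1 / 2^k)"

lemma dbox_gpoint_iff: "x \<in> dbox k (gpoint k z) \<longleftrightarrow> x - gpoint k z \<in> pcell k"
proof -
  have "dcenter k (gpoint k z) $ i - (1/2) / 2^k = gpoint k z $ i"
    "dcenter k (gpoint k z) $ i + (1/2) / 2^k = gpoint k z $ i + 1 / 2^k" for i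
    by (simp_all add: dcenter_def floor_gpoint gpoint_def add_divide_distrib)
  then show ?thesis unfolding dbox_def pcell_def mem_box_cart by (auto simp: algebra_simps)
qed

lemma integral_dbox_eq_dcube:
  fixes u :: "real^'n::finite \<Rightarrow> 'b::euclidean_space"
  assumes "integrable (lebesgue_on (dcube k x)) u"
  shows "(\<integral>y. u y \<partial>lebesgue_on (dbox k x)) = (\<integral>y. u y \<partial>lebesgue_on (dcube k x))"
proof -
  have BL: "dbox k x \<in> sets lebesgue" by (intro open_sets_lebesgue) simp
  have i: "integrable lebesgue (\<lambda>y. indicat_real (dcube k x) y *\<^sub>R u y)" using assms by (simp add: integrable_restrict_space)
  have j: "integrable (lebesgue_on (dbox k x)) u" by (rule integrable_lebesgue_on_subset[OF assms dbox_subset _ BL]) simp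
  then have j: "integrable lebesgue (\<lambda>y. indicat_real (dbox k x) y *\<^sub>R u y)" using BL by (simp add: integrable_restrict_space)
  have "(\<integral>y. indicat_real (dbox k x) y *\<^sub>R u y \<partial>lebesgue) = (\<integral>y. indicat_real (dcube k x) y *\<^sub>R u y \<partial>lebesgue)"
    using AE_dbox[of k x] i j by (intro integral_cong_AE) (auto elim!: eventually_mono simp: indicator_def)
  then show ?thesis using BL by (simp add: integral_restrict_space)
qed

text \<open>Ordered pairs of cells are sorted by their offset, and \<open>shift_estimate\<close>
  treats all pairs with one offset together. With \<open>N = CARD('n)\<close> there are
  \<open>2^N / dvol\<close> candidate offsets, each of length at most \<open>N\<close>; this
  accounts for the constant and for the exponent \<open>p - 2\<close>.\<close>

lemma grid_pairs_estimate:
  fixes u :: "real^'n::finite \<Rightarrow> real^'m::finite"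
  assumes p: "1 < p" and k: "1 \<le> k" and u: "is_weak_grad unit_cube u G" and ui: "integrable (lebesgue_on unit_cube) u"
    and G: "G \<in> Lp_space p unit_cube"
  defines "U \<equiv> \<lambda>z. \<integral>x. u x \<partial>lebesgue_on (dbox k (gpoint k z))"
  shows "(\<Sum>z\<in>grid k. \<Sum>z'\<in>grid k. norm (U z' - U z) powr p) \<le>
    2 ^ CARD('n) * CARD('n) powr p * dvol TYPE('n) k powr (p - 2) * (\<integral>x. norm (G x) powr p \<partial>lebesgue_on unit_cube)"
proof -
  let ?v = "dvol TYPE('n) k"
  define J where "J = (\<integral>x. norm (G x) powr p \<partial>lebesgue_on unit_cube)"
  \<comment> \<open>Differences of two labels lie in this box, twice as wide as the grid in each
    coordinate.\<close>
  define E :: "('n \<Rightarrow> int) set" where "E = {e. \<forall>i. - (2^k) \<le> e i \<and> e i < 2^k}"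
  define P where "P e = {z \<in> grid k. (\<lambda>i. z i + e i) \<in> grid k}" for e :: "'n \<Rightarrow> int"
  have finE: "finite E" unfolding E_def by (rule card_int_fun_interval)
  have cE: "real (card E) = 2 ^ CARD('n) / ?v"
  proof -
    have "card E = nat (2^k - - (2^k)) ^ CARD('n)" unfolding E_def by (rule card_int_fun_interval)
    also have "nat (2^k - - (2^k)) = (2::nat) * 2^k" by (simp add: nat_power_eq nat_mult_distrib)
    finally show ?thesis by (simp add: dvol_def power_one_over power_mult_distrib)
  qed
  have mcell: "measure lebesgue (pcell k :: (real^'n) set) = ?v"
  proof -
    have eq: "dbox k (gpoint k (\<lambda>_. 0)) = (pcell k :: (real^'n) set)"
      using dbox_gpoint_iff[of _ k "\<lambda>_. 0"] by (auto simp: gpoint_def zero_vec_def[symmetric])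
    have ae: "AE y in lebesgue. y \<in> dbox k (gpoint k (\<lambda>_. 0) :: real^'n) \<longleftrightarrow> y \<in> dcube k (gpoint k (\<lambda>_. 0))" by (rule AE_dbox)
    have "emeasure lebesgue (dbox k (gpoint k (\<lambda>_. 0) :: real^'n)) = emeasure lebesgue (dcube k (gpoint k (\<lambda>_. 0) :: real^'n))"
      by (rule emeasure_eq_AE[OF ae]) (auto intro: open_sets_lebesgue)
    then show ?thesis using measure_dcube[of k "gpoint k (\<lambda>_. 0) :: real^'n"] by (simp only: eq measure_def)
  qed
  have Uint: "U z = (\<integral>x. indicator (pcell k) (x - gpoint k z) *\<^sub>R u x \<partial>lebesgue_on unit_cube)" if z: "z \<in> grid k" for z
  proof -
    have "(\<integral>x. indicator (pcell k) (x - gpoint k z) *\<^sub>R u x \<partial>lebesgue_on unit_cube)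
      = (\<integral>x. indicator (pcell k) (x - gpoint k z) *\<^sub>R u x \<partial>lebesgue_on (dbox k (gpoint k z)))"
      using dbox_gpoint_subset[OF k z] by (intro integral_lebesgue_on_subset_eq) (auto simp: dbox_gpoint_iff intro!: open_sets_lebesgue)
    also have "\<dots> = U z"
      unfolding U_def by (intro Bochner_Integration.integral_cong) (auto simp: dbox_gpoint_iff)
    finally show ?thesis by simp
  qed
  have est: "(\<Sum>z\<in>P e. norm (U (\<lambda>i. z i + e i) - U z) powr p) \<le> CARD('n) powr p * ?v powr (p - 1) * J" if e: "e \<in> E" for e
  proof -
    define h where "h = gpoint k e"
    have gadd: "gpoint k (\<lambda>i. z i + e i) = gpoint k z + h" for z
      by (simp add: h_def gpoint_def vec_eq_iff add_divide_distrib)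
    have inj: "inj_on (gpoint k) (P e)"
      by (rule inj_onI) (auto simp: gpoint_def vec_eq_iff fun_eq_iff)
    have fP: "finite (P e)" by (simp add: P_def)
    have nh: "norm h \<le> CARD('n)"
    proof -
      have "norm h \<le> (\<Sum>i\<in>UNIV. \<bar>h $ i\<bar>)" by (rule norm_le_l1_cart)
      also have "\<dots> \<le> (\<Sum>i\<in>(UNIV::'n set). 1)"
      proof (rule sum_mono)
        fix i
        have "- (2^k) \<le> e i" "e i \<le> 2^k" using e by (auto simp: E_def less_imp_le)
        then have "\<bar>e i\<bar> \<le> 2^k" by linarith
        then have "\<bar>real_of_int (e i)\<bar> \<le> 2^k" by (metis of_int_abs of_int_le_numeral_power_cancel_iff)
        then show "\<bar>h $ i\<bar> \<le> 1" by (simp add: h_def gpoint_def field_simps)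
      qed
      finally show ?thesis by simp
    qed
    have "(\<Sum>z\<in>P e. norm (U (\<lambda>i. z i + e i) - U z) powr p) =
      (\<Sum>c\<in>gpoint k ` P e. norm ((\<integral>x. indicator (pcell k) (x - c - h) *\<^sub>R u x \<partial>lebesgue_on unit_cube)
         - (\<integral>x. indicator (pcell k) (x - c) *\<^sub>R u x \<partial>lebesgue_on unit_cube)) powr p)"
      by (subst sum.reindex[OF inj]) (auto intro!: sum.cong simp: P_def Uint gadd diff_diff_eq)
    also have "\<dots> \<le> norm h powr p * measure lebesgue (pcell k :: (real^'n) set) powr (p - 1) * J"
      unfolding pcell_def J_def
    proof (rule shift_estimate[OF p u ui G])
      show "finite (gpoint k ` P e)" using fP by simp
      fix c x :: "real^'n" assume "c \<in> gpoint k ` P e" and x: "x \<in> box 0 (\<chi> i. 1 / 2 ^ k)"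
      then obtain z where z: "z \<in> grid k" "(\<lambda>i. z i + e i) \<in> grid k" "c = gpoint k z" by (auto simp: P_def)
      have "c + x \<in> dbox k (gpoint k z)" "c + h + x \<in> dbox k (gpoint k (\<lambda>i. z i + e i))"
        using x unfolding dbox_gpoint_iff by (auto simp: z gadd pcell_def)
      then show "c + x \<in> unit_cube \<and> c + h + x \<in> unit_cube"
        using dbox_gpoint_subset[OF k z(1)] dbox_gpoint_subset[OF k z(2)] by blast
    next
      fix c c' x y :: "real^'n" assume "c \<in> gpoint k ` P e" "c' \<in> gpoint k ` P e" and xy: "x \<in> box 0 (\<chi> i. 1 / 2 ^ k)" "y \<in> box 0 (\<chi> i. 1 / 2 ^ k)" "c + x = c' + y"
      then obtain z z' where z: "c = gpoint k z" "c' = gpoint k z'" by auto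
      have "c + x \<in> dbox k (gpoint k z)" "c + x \<in> dbox k (gpoint k z')"
        using xy by (auto simp: dbox_gpoint_iff z pcell_def) (metis add_diff_cancel_left' xy(3) z)
      then have "c + x \<in> dcube k (gpoint k z)" "c + x \<in> dcube k (gpoint k z')" using dbox_subset by blast+
      then have "z = z'" by (auto simp: dcube_gpoint fun_eq_iff)
      then show "c = c'" by (simp add: z)
    qed
    also have "\<dots> \<le> CARD('n) powr p * ?v powr (p - 1) * J"
      unfolding mcell using nh p by (intro mult_right_mono powr_mono2) (auto simp: J_def)
    finally show ?thesis .
  qed
  have "(\<Sum>z\<in>grid k. \<Sum>z'\<in>grid k. norm (U z' - U z) powr p) = (\<Sum>(z, z')\<in>grid k \<times> grid k. norm (U z' - U z) powr p)"
    by (simp add: sum.cartesian_product)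
  also have "\<dots> = (\<Sum>(e, z)\<in>(\<lambda>(z, z'). (\<lambda>i. z' i - z i, z)) ` (grid k \<times> grid k). norm (U (\<lambda>i. z i + e i) - U z) powr p)"
    by (subst sum.reindex) (auto simp: inj_on_def fun_eq_iff intro!: sum.cong)
  also have "\<dots> \<le> (\<Sum>(e, z)\<in>Sigma E P. norm (U (\<lambda>i. z i + e i) - U z) powr p)"
  proof (rule sum_mono2)
    show "finite (Sigma E P)" using finE by (auto simp: P_def)
    show "(\<lambda>(z, z'). (\<lambda>i. z' i - z i, z)) ` (grid k \<times> grid k) \<subseteq> Sigma E P"
    proof safe
      fix z z' :: "'n \<Rightarrow> int" assume z: "z \<in> grid k" "z' \<in> grid k"
      have "2 * (2::int)^(k-1) = 2^k" using k by (cases k) auto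
      moreover have "- (2^(k-1)) \<le> z i" "z i < 2^(k-1)" "- (2^(k-1)) \<le> z' i" "z' i < 2^(k-1)" for i
        using z by (auto simp: grid_def)
      ultimately have "- (2^k) \<le> z' i - z i \<and> z' i - z i < 2^k" for i by (smt (verit))
      then show "(\<lambda>i. z' i - z i) \<in> E" by (simp add: E_def)
      show "z \<in> P (\<lambda>i. z' i - z i)" using z by (simp add: P_def)
    qed
  qed auto
  also have "\<dots> = (\<Sum>e\<in>E. \<Sum>z\<in>P e. norm (U (\<lambda>i. z i + e i) - U z) powr p)"
    using finE by (subst sum.Sigma) (auto simp: P_def)
  also have "\<dots> \<le> (\<Sum>e\<in>E. CARD('n) powr p * ?v powr (p - 1) * J)"
    by (intro sum_mono est)
  also have "\<dots> = 2 ^ CARD('n) * CARD('n) powr p * ?v powr (p - 2) * J"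
    using powr_add[of ?v "p - 2" 1] by (simp add: cE field_simps)
  finally show ?thesis unfolding J_def .
qed

text \<open>On a cell, the average of \<open>u - m\<close> is a sum of differences of cell
  integrals, because \<open>m\<close> is the sum of all cell integrals and there are
  \<open>1 / dvol\<close> cells. In the total the powers of \<open>dvol\<close> cancel, leaving a
  bound independent of the generation, which passes to \<open>u - m\<close> through its averages. No
  compactness is involved.\<close>

theorem poincare_unit_cube:
  fixes u :: "real^'n::finite \<Rightarrow> real^'m::finite"
  assumes p: "1 < p" and u: "is_weak_grad unit_cube u G" and ui: "integrable (lebesgue_on unit_cube) u"
    and G: "G \<in> Lp_space p unit_cube"
  defines "m \<equiv> \<integral>x. u x \<partial>lebesgue_on unit_cube"
  shows "(\<integral>\<^sup>+x. ennreal (norm (u x - m) powr p) \<partial>lebesgue_on unit_cube) \<le>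
    ennreal (2 ^ CARD('n) * CARD('n) powr p) * (\<integral>\<^sup>+x. ennreal (norm (G x) powr p) \<partial>lebesgue_on unit_cube)"
proof -
  let ?Y = "unit_cube :: (real^'n) set"
  define J where "J = (\<integral>x. norm (G x) powr p \<partial>lebesgue_on ?Y)"
  define K where "K = 2 ^ CARD('n) * CARD('n) powr p"
  have J: "(\<integral>\<^sup>+x. ennreal (norm (G x) powr p) \<partial>lebesgue_on ?Y) = ennreal J"
    unfolding J_def using G by (intro nn_integral_eq_integral) (auto simp: Lp_space_def)
  interpret Y: finite_measure "lebesgue_on ?Y" by (rule finite_measure_lebesgue_on) simp
  define g where "g x = indicat_real ?Y x *\<^sub>R (u x - m)" for x
  have gi: "integrable lebesgue g"
  proof -
    have "integrable (lebesgue_on ?Y) (\<lambda>x. u x - m)" using ui by auto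
    then show ?thesis by (simp add: integrable_restrict_space g_def[abs_def])
  qed
  have main: "(\<integral>\<^sup>+x. ennreal (norm (davg k g x) powr p) \<partial>lebesgue) \<le> ennreal (K * J)" if k: "1 \<le> k" for k
  proof -
    let ?v = "dvol TYPE('n) k"
    define U where "U z = (\<integral>x. u x \<partial>lebesgue_on (dbox k (gpoint k z)))" for z :: "'n \<Rightarrow> int"
    have gid: "integrable (lebesgue_on (dcube k x)) g" for x
      using integrable_lebesgue_on_subset[of UNIV g "dcube k x"] gi by (simp add: lebesgue_on_UNIV_eq)
    have fmb: "finite_measure (lebesgue_on (dbox k x))" for x :: "real^'n"
      by (rule finite_measure_lebesgue_on, rule fmeasurableI2[OF dcube_lmeasurable[of k x]])
         (use dbox_subset in \<open>auto intro: open_sets_lebesgue\<close>)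
    have mb: "measure lebesgue (dbox k x) = ?v" for x :: "real^'n"
    proof -
      have "emeasure lebesgue (dbox k x) = emeasure lebesgue (dcube k x)"
        by (rule emeasure_eq_AE[OF AE_dbox]) (auto intro: open_sets_lebesgue)
      then show ?thesis using measure_dcube[of k x] by (simp only: measure_def)
    qed
    have gU: "(\<integral>x. g x \<partial>lebesgue_on (dcube k (gpoint k z))) = U z - ?v *\<^sub>R m" if z: "z \<in> grid k" for z
    proof -
      interpret B: finite_measure "lebesgue_on (dbox k (gpoint k z))" by (rule fmb)
      have sub: "dbox k (gpoint k z) \<subseteq> ?Y" by (rule dbox_gpoint_subset[OF k z])
      have "(\<integral>x. g x \<partial>lebesgue_on (dcube k (gpoint k z))) = (\<integral>x. g x \<partial>lebesgue_on (dbox k (gpoint k z)))"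
        by (rule integral_dbox_eq_dcube[OF gid, symmetric])
      also have "\<dots> = (\<integral>x. u x - m \<partial>lebesgue_on (dbox k (gpoint k z)))"
        using sub by (intro Bochner_Integration.integral_cong) (auto simp: g_def indicator_def)
      also have "\<dots> = U z - ?v *\<^sub>R m"
        using integrable_lebesgue_on_subset[OF ui sub] mb[of "gpoint k z"]
        by (subst Bochner_Integration.integral_diff) (auto simp: U_def measure_restrict_space open_sets_lebesgue)
      finally show ?thesis .
    qed
    have msum: "m = (\<Sum>z\<in>grid k. U z)"
    proof -
      have iz: "integrable lebesgue (\<lambda>x. indicat_real (dbox k (gpoint k z)) x *\<^sub>R u x)" if z: "z \<in> grid k" for z
        using integrable_lebesgue_on_subset[OF ui dbox_gpoint_subset[OF k z]] by (simp add: integrable_restrict_space open_sets_lebesgue)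
      have "(\<Sum>z\<in>grid k. U z) = (\<integral>x. (\<Sum>z\<in>grid k. indicat_real (dbox k (gpoint k z)) x *\<^sub>R u x) \<partial>lebesgue)"
        using iz by (subst Bochner_Integration.integral_sum) (auto simp: U_def integral_restrict_space open_sets_lebesgue)
      also have "\<dots> = (\<integral>x. indicat_real ?Y x *\<^sub>R u x \<partial>lebesgue)"
      proof (rule integral_cong_AE)
        have "AE x in lebesgue. \<forall>z\<in>(grid k :: ('n \<Rightarrow> int) set). x \<in> dbox k (gpoint k z) \<longleftrightarrow> x \<in> dcube k (gpoint k z)"
          using AE_dbox by (subst AE_finite_all) auto
        then show "AE x in lebesgue. (\<Sum>z\<in>grid k. indicat_real (dbox k (gpoint k z)) x *\<^sub>R u x) = indicat_real ?Y x *\<^sub>R u x"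
          using AE_unit_cube_iff_half_open
        proof eventually_elim
          case (elim x)
          have "(\<Sum>z\<in>grid k. indicat_real (dbox k (gpoint k z)) x *\<^sub>R u x) =
            (\<Sum>z\<in>grid k. if z = (\<lambda>i. \<lfloor>2^k * x $ i\<rfloor>) then u x else 0)"
            using elim(1) by (intro sum.cong) (auto simp: dcube_gpoint indicator_def)
          also have "\<dots> = (if (\<lambda>i. \<lfloor>2^k * x $ i\<rfloor>) \<in> grid k then u x else 0)" by simp
          also have "\<dots> = indicat_real ?Y x *\<^sub>R u x"
            unfolding grid_iff_half_open[OF k] using elim(2) by simp
          finally show ?case .
        qed
        show "(\<lambda>x. \<Sum>z\<in>grid k. indicat_real (dbox k (gpoint k z)) x *\<^sub>R u x) \<in> borel_measurable lebesgue"
          using iz by (intro borel_measurable_sum) auto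
        have "integrable lebesgue (\<lambda>x. indicat_real ?Y x *\<^sub>R u x)" using ui by (simp add: integrable_restrict_space)
        then show "(\<lambda>x. indicat_real ?Y x *\<^sub>R u x) \<in> borel_measurable lebesgue" by auto
      qed
      also have "\<dots> = m" by (simp add: m_def integral_restrict_space)
      finally show ?thesis by simp
    qed
    have dv: "norm (davg k g (gpoint k z)) powr p \<le> ?v powr (1 - p) * (\<Sum>z'\<in>grid k. norm (U z' - U z) powr p)" if z: "z \<in> grid k" for z
    proof -
      have "davg k g (gpoint k z) = (1 / ?v) *\<^sub>R U z - m" by (simp add: davg_def gU[OF z] scaleR_diff_right)
      \<comment> \<open>The number of cells equals the factor \<open>1 / ?v\<close>, so
        \<open>U z\<close> can be distributed over all of them.\<close>
      also have "\<dots> = (\<Sum>z'\<in>grid k. U z - U z')"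
        using card_grid[OF k, where 'n='n] by (simp add: sum_subtractf msum sum_constant_scaleR del: sum_constant)
      finally have "norm (davg k g (gpoint k z)) powr p \<le> real (card (grid k :: ('n \<Rightarrow> int) set)) powr (p - 1) * (\<Sum>z'\<in>grid k. norm (U z - U z') powr p)"
        using sum_powr_le[of "grid k :: ('n \<Rightarrow> int) set" p "\<lambda>z'. U z - U z'"] p by simp
      also have "real (card (grid k :: ('n \<Rightarrow> int) set)) powr (p - 1) = ?v powr (1 - p)"
        unfolding card_grid[OF k] by (simp add: powr_divide powr_diff)
      finally show ?thesis by (simp add: norm_minus_commute)
    qed
    have "(\<integral>\<^sup>+x. ennreal (norm (davg k g x) powr p) \<partial>lebesgue) \<le>
       (\<integral>\<^sup>+x. (\<Sum>z\<in>grid k. ennreal (norm (davg k g (gpoint k z)) powr p) * indicator (dcube k (gpoint k z)) x) \<partial>lebesgue)"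
    proof (rule nn_integral_mono)
      fix x :: "real^'n"
      let ?z = "\<lambda>i. \<lfloor>2^k * x $ i\<rfloor>"
      have xz: "x \<in> dcube k (gpoint k ?z)" by (simp add: dcube_gpoint)
      show "ennreal (norm (davg k g x) powr p) \<le> (\<Sum>z\<in>grid k. ennreal (norm (davg k g (gpoint k z)) powr p) * indicator (dcube k (gpoint k z)) x)"
      proof (cases "?z \<in> grid k")
        case True
        have "davg k g x = davg k g (gpoint k ?z)" using dcube_eq[OF xz] by (simp add: davg_def)
        then have "ennreal (norm (davg k g x) powr p) = ennreal (norm (davg k g (gpoint k ?z)) powr p) * indicator (dcube k (gpoint k ?z)) x"
          using xz by simp
        also have "\<dots> \<le> (\<Sum>z\<in>grid k. ennreal (norm (davg k g (gpoint k z)) powr p) * indicator (dcube k (gpoint k z)) x)"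
          using True by (intro member_le_sum) auto
        finally show ?thesis .
      next
        case False
        have "g y = 0" if y: "y \<in> dcube k x" for y
        proof -
          have "(\<lambda>i. \<lfloor>2^k * y $ i\<rfloor>) = ?z" using y by (auto simp: dcube_def)
          then have "y \<notin> half_open_cube" using False grid_iff_half_open[OF k, of y] by simp
          then show ?thesis using unit_cube_subset_half_open by (auto simp: g_def indicator_def)
        qed
        then have "(\<integral>y. g y \<partial>lebesgue_on (dcube k x)) = (\<integral>y. 0 \<partial>lebesgue_on (dcube k x))"
          by (intro Bochner_Integration.integral_cong) auto
        then have "davg k g x = 0" by (simp add: davg_def)
        then show ?thesis using p by simp
      qed
    qed
    also have "\<dots> = (\<Sum>z\<in>grid k. ennreal (norm (davg k g (gpoint k z)) powr p) * ennreal ?v)"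
    proof -
      have t: "(\<integral>\<^sup>+x. c * indicator (dcube k y) x \<partial>lebesgue) = c * ennreal ?v" for c and y :: "real^'n"
        by (subst nn_integral_cmult_indicator) (simp_all only: emeasure_dcube dcube_lebesgue)
      have "(\<lambda>x. c * indicator (dcube k y) x) \<in> borel_measurable lebesgue" for c :: ennreal and y :: "real^'n"
        by (intro borel_measurable_times_ennreal borel_measurable_const borel_measurable_indicator dcube_lebesgue)
      then show ?thesis by (subst nn_integral_sum) (simp_all only: t)
    qed
    also have "\<dots> = ennreal (\<Sum>z\<in>grid k. norm (davg k g (gpoint k z)) powr p * ?v)"
      by (simp add: ennreal_mult[symmetric] sum_ennreal)
    also have "\<dots> \<le> ennreal (K * J)"
    proof (rule ennreal_leI)
      have "(\<Sum>z\<in>grid k. norm (davg k g (gpoint k z)) powr p * ?v) \<le>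
          (\<Sum>z\<in>grid k. (?v powr (1 - p) * (\<Sum>z'\<in>grid k. norm (U z' - U z) powr p)) * ?v)"
        by (intro sum_mono mult_right_mono dv) auto
      also have "\<dots> = ?v powr (2 - p) * (\<Sum>z\<in>grid k. \<Sum>z'\<in>grid k. norm (U z' - U z) powr p)"
        using powr_add[of ?v "1 - p" 1] by (simp add: sum_distrib_left sum_distrib_right mult_ac)
      also have "\<dots> \<le> ?v powr (2 - p) * (2 ^ CARD('n) * CARD('n) powr p * ?v powr (p - 2) * J)"
        using grid_pairs_estimate[OF p k u ui G] by (intro mult_left_mono) (auto simp: U_def J_def)
      also have "\<dots> = K * J * (?v powr (2 - p) * ?v powr (p - 2))"
        by (simp add: K_def)
      also have "?v powr (2 - p) * ?v powr (p - 2) = 1" by (simp flip: powr_add)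
      finally show "(\<Sum>z\<in>grid k. norm (davg k g (gpoint k z)) powr p * ?v) \<le> K * J" by simp
    qed
    finally show ?thesis .
  qed
  have "(\<integral>\<^sup>+x. ennreal (norm (u x - m) powr p) \<partial>lebesgue_on ?Y) = (\<integral>\<^sup>+x. ennreal (norm (g x) powr p) \<partial>lebesgue)"
    using p by (subst nn_integral_restrict_space) (auto intro!: nn_integral_cong simp: g_def indicator_def)
  also have "\<dots> \<le> ennreal (K * J)" by (rule nn_integral_powr_le_of_davg[OF gi main p])
  also have "\<dots> = ennreal K * ennreal J" by (simp add: ennreal_mult K_def J_def)
  finally show ?thesis unfolding J K_def .
qed

subsection \<open>Quasiconvexity implies lower semicontinuity\<close>

lemma emeasure_gt_le:
  fixes f :: "'a \<Rightarrow> ennreal"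
  assumes f[measurable]: "f \<in> borel_measurable M" and c: "c > 0"
    and le: "(\<integral>\<^sup>+x. f x \<partial>M) \<le> ennreal C" and C: "C \<ge> 0"
  shows "emeasure M {x \<in> space M. f x > ennreal c} \<le> ennreal (C / c)"
proof -
  let ?A = "{x \<in> space M. f x > ennreal c}"
  have "ennreal c * emeasure M ?A = (\<integral>\<^sup>+x. ennreal c * indicator ?A x \<partial>M)"
    by (subst nn_integral_cmult_indicator) auto
  also have "\<dots> \<le> (\<integral>\<^sup>+x. f x \<partial>M)"
    by (intro nn_integral_mono) (auto simp: indicator_def less_imp_le)
  also have "\<dots> \<le> ennreal C" by (rule le)
  finally have "ennreal (1 / c) * (ennreal c * emeasure M ?A) \<le> ennreal (1 / c) * ennreal C"
    by (rule mult_left_mono) simp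
  moreover have "ennreal (1 / c) * (ennreal c * emeasure M ?A) = emeasure M ?A"
    using c by (simp add: mult.assoc[symmetric] ennreal_mult[symmetric])
  moreover have "ennreal (1 / c) * ennreal C = ennreal (C / c)"
    using c C by (simp add: ennreal_mult[symmetric])
  ultimately show ?thesis by simp
qed

text \<open>The smallness clause speaks of small sets. Splitting the cube into finitely many dyadic
  cells of measure below the threshold for \<open>e = 1\<close> bounds all integrals by the number
  of cells.\<close>

lemma equi_integrable_bounded:
  fixes f :: "nat \<Rightarrow> real^'n::finite \<Rightarrow> ennreal"
  assumes "equi_integrable_on f unit_cube"
  obtains C :: real where "C \<ge> 0" "\<And>n. (\<integral>\<^sup>+x. f n x \<partial>lebesgue_on unit_cube) \<le> ennreal C"
proof -
  obtain d :: real where d: "d > 0" "\<And>E n. E \<in> sets lebesgue \<Longrightarrow> E \<subseteq> unit_cube \<Longrightarrow> emeasure lebesgue E < ennreal d \<Longrightarrow>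
      (\<integral>\<^sup>+x. f n x \<partial>lebesgue_on E) < ennreal 1"
    using assms unfolding equi_integrable_on_def by (metis zero_less_one)
  have "(\<lambda>k. dvol TYPE('n) k) \<longlonglongrightarrow> 0"
  proof -
    have "(\<lambda>k. (1 / 2::real)^k) \<longlonglongrightarrow> 0" by (rule LIMSEQ_realpow_zero) auto
    then have "(\<lambda>k. ((1 / 2::real)^k) ^ CARD('n)) \<longlonglongrightarrow> 0 ^ CARD('n)" by (rule tendsto_power)
    then show ?thesis by (simp add: dvol_def power_one_over zero_power)
  qed
  then have "eventually (\<lambda>k. dvol TYPE('n) k < d) sequentially" using d by (intro order_tendstoD) auto
  then obtain k0 where k0: "\<And>k. k \<ge> k0 \<Longrightarrow> dvol TYPE('n) k < d" by (auto simp: eventually_sequentially)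
  define k where "k = max k0 1"
  have k: "1 \<le> k" "dvol TYPE('n) k < d" using k0 by (auto simp: k_def)
  let ?B = "\<lambda>z. dbox k (gpoint k z) :: (real^'n) set"
  have BL: "?B z \<in> sets lebesgue" for z by (intro open_sets_lebesgue) simp
  have eB: "emeasure lebesgue (?B z) = ennreal (dvol TYPE('n) k)" for z
  proof -
    have "emeasure lebesgue (?B z) = emeasure lebesgue (dcube k (gpoint k z))"
      by (rule emeasure_eq_AE[OF AE_dbox]) (auto intro: open_sets_lebesgue)
    then show ?thesis by (simp only: emeasure_dcube)
  qed
  have "(\<integral>\<^sup>+x. f n x \<partial>lebesgue_on unit_cube) \<le> ennreal (real (card (grid k :: ('n \<Rightarrow> int) set)))" for n
  proof -
    have fm: "f n \<in> borel_measurable (lebesgue_on unit_cube)" using assms by (auto simp: equi_integrable_on_def)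
    have fmB: "(\<lambda>x. f n x * indicator (?B z) x) \<in> borel_measurable lebesgue" if z: "z \<in> grid k" for z
      using measurable_restrict_mono[OF fm dbox_gpoint_subset[OF k(1) z]] BL[of z]
      by (subst (asm) borel_measurable_restrict_space_iff_ennreal) auto
    have "(\<integral>\<^sup>+x. f n x \<partial>lebesgue_on unit_cube) = (\<integral>\<^sup>+x. f n x * indicator unit_cube x \<partial>lebesgue)"
      by (subst nn_integral_restrict_space) auto
    also have "\<dots> \<le> (\<integral>\<^sup>+x. (\<Sum>z\<in>grid k. f n x * indicator (?B z) x) \<partial>lebesgue)"
    proof (rule nn_integral_mono_AE)
      have "AE x in lebesgue. \<forall>z\<in>(grid k :: ('n \<Rightarrow> int) set). x \<in> dbox k (gpoint k z) \<longleftrightarrow> x \<in> dcube k (gpoint k z)"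
        using AE_dbox by (subst AE_finite_all) auto
      then show "AE x in lebesgue. f n x * indicator unit_cube x \<le> (\<Sum>z\<in>grid k. f n x * indicator (?B z) x)"
      proof eventually_elim
        case (elim x)
        show ?case
        proof (cases "x \<in> unit_cube")
          case True
          define z where "z = (\<lambda>i. \<lfloor>2^k * x $ i\<rfloor>)"
          have z: "z \<in> grid k" using grid_iff_half_open[OF k(1), of x] True unit_cube_subset_half_open by (auto simp: z_def)
          moreover have "x \<in> ?B z" using elim z by (auto simp: dcube_gpoint z_def)
          ultimately have "f n x = f n x * indicator (?B z) x" by simp
          also have "\<dots> \<le> (\<Sum>z\<in>grid k. f n x * indicator (?B z) x)" using z by (intro member_le_sum) auto
          finally show ?thesis using True by simp
        qed simp
      qed
    qed
    also have "\<dots> = (\<Sum>z\<in>grid k. (\<integral>\<^sup>+x. f n x * indicator (?B z) x \<partial>lebesgue))"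
      using fmB by (rule nn_integral_sum)
    also have "\<dots> \<le> (\<Sum>z\<in>(grid k :: ('n \<Rightarrow> int) set). 1)"
    proof (rule sum_mono)
      fix z :: "'n \<Rightarrow> int" assume z: "z \<in> grid k"
      have "(\<integral>\<^sup>+x. f n x * indicator (?B z) x \<partial>lebesgue) = (\<integral>\<^sup>+x. f n x \<partial>lebesgue_on (?B z))"
        using BL by (subst nn_integral_restrict_space) auto
      also have "\<dots> < ennreal 1"
        using d(2)[OF BL dbox_gpoint_subset[OF k(1) z]] k(2) eB d(1) by (simp only: ennreal_lessI)
      finally show "(\<integral>\<^sup>+x. f n x * indicator (?B z) x \<partial>lebesgue) \<le> 1" by (simp add: less_imp_le)
    qed
    also have "\<dots> = ennreal (real (card (grid k :: ('n \<Rightarrow> int) set)))" by (simp add: ennreal_of_nat_eq_real_of_nat)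
    finally show ?thesis .
  qed
  then show ?thesis by (intro that[of "real (card (grid k :: ('n \<Rightarrow> int) set))"]) auto
qed

text \<open>\<open>L\<close> may be infinite, so uniform continuity on a ball is applied to a
  truncation. At \<open>b\<close> the truncation is inactive, and at \<open>a\<close> it only lowers
  the value, which is harmless for an upper bound of \<open>L b\<close>.\<close>

lemma truncated_uniform_continuity:
  fixes L :: "'a::euclidean_space \<Rightarrow> ennreal"
  assumes L: "continuous_on UNIV L" and M: "M \<ge> 0" and e: "e > 0"
  obtains \<eta> where "\<eta> > 0" "\<And>a b. norm a \<le> R \<Longrightarrow> norm (a - b) \<le> \<eta> \<Longrightarrow> L b \<le> ennreal M \<Longrightarrow> L b \<le> L a + ennreal e"
proof -
  define f where "f x = enn2real (min (L x) (ennreal (M + e)))" for x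
  have fin: "min (L x) (ennreal (M + e)) = ennreal (f x)" for x
  proof -
    have "min (L x) (ennreal (M + e)) < top" by (simp add: min_less_iff_disj)
    then show ?thesis by (simp add: f_def)
  qed
  have "continuous_on UNIV (\<lambda>x. min (L x) (ennreal (M + e)))" by (intro continuous_intros L)
  then have "continuous_on UNIV (\<lambda>x. ennreal (f x))" by (simp only: fin)
  then have lim: "((\<lambda>x. ennreal (f x)) \<longlongrightarrow> ennreal (f y)) (at y)" for y by (simp add: continuous_on_def)
  have f0: "f y \<ge> 0" for y by (simp add: f_def)
  have "continuous_on UNIV f"
    unfolding continuous_on_def using tendsto_enn2real[OF lim f0] f0 by simp
  then have "continuous_on (cball 0 (R + 1)) f" using continuous_on_subset by blast
  then have "uniformly_continuous_on (cball 0 (R + 1)) f" by (intro compact_uniformly_continuous) auto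
  then obtain d where d: "d > 0" "\<And>x y. x \<in> cball 0 (R + 1) \<Longrightarrow> y \<in> cball 0 (R + 1) \<Longrightarrow> dist x y < d \<Longrightarrow> dist (f x) (f y) < e"
    unfolding uniformly_continuous_on_def using e by metis
  show ?thesis
  \<comment> \<open>The bound 1 keeps \<open>b\<close> in the ball of radius \<open>R + 1\<close>;
    halving \<open>d\<close> yields the strict inequality.\<close>
  proof (rule that[of "min (d / 2) 1"])
    show "min (d / 2) 1 > 0" using d by simp
    fix a b assume a: "norm a \<le> R" and ab: "norm (a - b) \<le> min (d / 2) 1" and Lb: "L b \<le> ennreal M"
    have "norm b \<le> R + 1" using a ab norm_triangle_ineq3[of a b] by auto
    then have "dist (f a) (f b) < e" using a ab d by (intro d(2)) (auto simp: dist_norm)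
    then have le: "f b \<le> f a + e" by (auto simp: dist_real_def)
    have "L b \<le> ennreal (M + e)" using e by (intro order_trans[OF Lb] ennreal_leI) simp
    then have "L b = ennreal (f b)" using fin[of b] by (simp add: min_absorb1)
    also have "ennreal (f b) \<le> ennreal (f a + e)" by (rule ennreal_leI[OF le])
    also have "\<dots> = ennreal (f a) + ennreal e" using e by (simp add: f_def)
    also have "\<dots> \<le> L a + ennreal e" unfolding fin[symmetric] by (intro add_right_mono) simp
    finally show "L b \<le> L a + ennreal e" .
  qed
qed

lemma Lp_bound_of_grad_norm:
  assumes p: "1 < p" and O: "open \<Omega>" and u: "u \<in> W1p p \<Omega>" and le: "grad_norm p \<Omega> u \<le> C"
  shows "(\<integral>\<^sup>+x. ennreal (norm (weak_grad \<Omega> u x) powr p) \<partial>lebesgue_on \<Omega>) \<le> ennreal (C powr p)"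
proof -
  let ?J = "\<integral>x. norm (weak_grad \<Omega> u x) powr p \<partial>lebesgue_on \<Omega>"
  have J0: "?J \<ge> 0" by simp
  have "(\<integral>\<^sup>+x. ennreal (norm (weak_grad \<Omega> u x) powr p) \<partial>lebesgue_on \<Omega>) = ennreal ?J"
    using W1p_D(3)[OF O u] by (intro nn_integral_eq_integral) (auto simp: Lp_space_def)
  also have "?J = grad_norm p \<Omega> u powr p" using p J0 by (simp add: grad_norm_def powr_powr)
  also have "ennreal \<dots> \<le> ennreal (C powr p)" using p le by (intro ennreal_leI powr_mono2) auto
  finally show ?thesis .
qed

text \<open>Where the truncated integrand is controlled, the energy density of \<open>w\<close> is at most that of
  \<open>v\<close> up to a small error; the exceptional set has small measure and is absorbed by equi-integrability.\<close>

lemma quasiconvex_limit: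
  fixes L :: "real^'n::finite^'m::finite \<Rightarrow> ennreal"
  assumes p: "1 < p" and L: "continuous_on UNIV L" and C: "condition_Cpp p L" and qc: "W1p_quasiconvex p L"
    and v: "W1p_weakly_converges p unit_cube v (\<lambda>y. \<xi> *v y)" and t: "t \<ge> 0"
    and le: "\<And>n. energy L unit_cube (v n) \<le> ennreal t"
  shows "L \<xi> \<le> ennreal t"
proof (rule ennreal_le_epsilon)
  fix e :: real assume e: "e > 0"
  let ?Y = "unit_cube :: (real^'n) set"
  let ?M = "lebesgue_on ?Y"
  have "(SUP n. energy L ?Y (v n)) \<le> ennreal t" by (rule SUP_least[OF le])
  then have "(SUP n. energy L ?Y (v n)) < \<infinity>" by (rule le_less_trans) simp
  from C[unfolded condition_Cpp_def, rule_format, OF conjI[OF v this]]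
  obtain r w where r: "strict_mono r" and w: "\<And>n. w n \<in> affine_W1p_0 p \<xi>"
    and meas: "tendsto_zero_in_measure ?Y (\<lambda>n y. norm (weak_grad ?Y (v (r n)) y - weak_grad ?Y (w n) y))"
    and ei: "equi_integrable_on (\<lambda>n y. L (weak_grad ?Y (w n) y)) ?Y"
    by blast
  define a where "a n = weak_grad ?Y (v (r n))" for n
  define b where "b n = weak_grad ?Y (w n)" for n
  have vW: "v n \<in> W1p p ?Y" for n using v by (simp add: W1p_weakly_converges_def)
  have am[measurable]: "a n \<in> borel_measurable ?M" for n
    using is_weak_grad_measurable(2)[OF W1p_D(2)[OF open_unit_cube vW]] by (simp add: a_def)
  have bm[measurable]: "b n \<in> borel_measurable ?M" for n
  proof -
    have 1: "(\<lambda>y. w n y - \<xi> *v y) \<in> W1p p ?Y" using w[of n] by (auto simp: affine_W1p_0_def W1p_0_def)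
    have "is_weak_grad ?Y (\<lambda>y. (w n y - \<xi> *v y) + (\<xi> *v y + 0)) (\<lambda>y. weak_grad ?Y (\<lambda>y. w n y - \<xi> *v y) y + \<xi>)"
      by (intro is_weak_grad_add open_unit_cube is_weak_grad_affine_map W1p_D(2)[OF open_unit_cube 1])
    then have "is_weak_grad ?Y (w n) (\<lambda>y. weak_grad ?Y (\<lambda>y. w n y - \<xi> *v y) y + \<xi>)" by simp
    from is_weak_grad_measurable(2)[OF weak_grad_AE(1)[OF open_unit_cube this]] show ?thesis by (simp add: b_def)
  qed
  have Lm[measurable]: "L \<in> borel_measurable borel" by (rule borel_measurable_continuous_onI[OF L])
  obtain C1 where C1: "C1 \<ge> 0" "\<And>n. (\<integral>\<^sup>+x. L (b n x) \<partial>?M) \<le> ennreal C1"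
    using equi_integrable_bounded[OF ei] unfolding b_def by blast
  obtain d where d: "d > 0" "\<And>E n. E \<in> sets lebesgue \<Longrightarrow> E \<subseteq> ?Y \<Longrightarrow> emeasure lebesgue E < ennreal d \<Longrightarrow>
      (\<integral>\<^sup>+x. L (b n x) \<partial>lebesgue_on E) < ennreal (e / 2)"
    using ei e unfolding equi_integrable_on_def b_def by (metis half_gt_zero)
  obtain C2 where C2: "\<And>n. grad_norm p ?Y (v n) \<le> C2"
    using weakly_convergent_grad_bounded[OF p open_unit_cube v] by blast
  \<comment> \<open>By Markov's inequality the set where \<open>L (b n)\<close> exceeds
    \<open>M\<close> has measure at most \<open>C1 / M < d / 3\<close>; the 4 and the
    \<open>+ 1\<close> make this strict. \<open>R\<close> is chosen in the same way for the p-th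
    moments of the gradients \<open>a n\<close>.\<close>
  define M where "M = 4 * (C1 + 1) / d"
  have M: "M > 0" "C1 / M < d / 3"
  proof -
    show "M > 0" using C1(1) d(1) by (simp add: M_def)
    have "0 \<le> C1 * d" using C1(1) d(1) by simp
    then show "C1 / M < d / 3" using C1(1) d(1) by (simp add: M_def field_simps add_nonneg_pos)
  qed
  define R where "R = (4 * (C2 powr p + 1) / d) powr (1 / p)"
  have Rp: "R powr p = 4 * (C2 powr p + 1) / d" using p d by (simp add: R_def powr_powr)
  have R: "R > 0" "C2 powr p / (R powr p) < d / 3"
  proof -
    have q: "C2 powr p + 1 > 0" by (simp add: add_nonneg_pos)
    then show "R > 0" using d by (auto simp: R_def)
    have "C2 powr p * (3 * d) < d * (4 * (C2 powr p + 1))" using d by (simp add: algebra_simps add_nonneg_pos)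
    then show "C2 powr p / (R powr p) < d / 3" unfolding Rp using q d by (simp add: field_simps)
  qed
  obtain \<eta> where eta: "\<eta> > 0" "\<And>x y. norm x \<le> R \<Longrightarrow> norm (x - y) \<le> \<eta> \<Longrightarrow> L y \<le> ennreal M \<Longrightarrow> L y \<le> L x + ennreal (e / 2)"
    using truncated_uniform_continuity[OF L, of M "e / 2" R] M e by (metis half_gt_zero less_imp_le)
  have "(\<lambda>n. emeasure lebesgue {x \<in> ?Y. \<bar>norm (a n x - b n x)\<bar> > \<eta>}) \<longlonglongrightarrow> 0"
    using meas eta(1) unfolding tendsto_zero_in_measure_def a_def b_def by blast
  then have "eventually (\<lambda>n. emeasure lebesgue {x \<in> ?Y. \<bar>norm (a n x - b n x)\<bar> > \<eta>} < ennreal (d / 3)) sequentially"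
    using d by (intro order_tendstoD) auto
  then obtain n where n: "emeasure lebesgue {x \<in> ?Y. \<bar>norm (a n x - b n x)\<bar> > \<eta>} < ennreal (d / 3)"
    by (auto simp: eventually_sequentially)
  have sL: "S \<in> sets lebesgue" "emeasure lebesgue S = emeasure ?M S" if "S \<in> sets ?M" for S
  proof -
    have s: "S \<subseteq> ?Y" "S \<in> sets lebesgue" using that by (auto simp: sets_restrict_space_iff)
    then show "S \<in> sets lebesgue" by simp
    show "emeasure lebesgue S = emeasure ?M S"
      using s by (subst emeasure_restrict_space) auto
  qed
  define E1 where "E1 = {x \<in> space ?M. \<bar>norm (a n x - b n x)\<bar> > \<eta>}"
  define E2 where "E2 = {x \<in> space ?M. ennreal (norm (a n x) powr p) > ennreal (R powr p)}"
  define E3 where "E3 = {x \<in> space ?M. L (b n x) > ennreal M}"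
  have Em: "E1 \<in> sets ?M" "E2 \<in> sets ?M" "E3 \<in> sets ?M" unfolding E1_def E2_def E3_def by measurable
  have e1: "emeasure ?M E1 < ennreal (d / 3)" using n sL(2)[OF Em(1)] by (simp add: E1_def)
  have e2: "emeasure ?M E2 < ennreal (d / 3)"
  proof -
    have "emeasure ?M E2 \<le> ennreal (C2 powr p / (R powr p))"
      unfolding E2_def using R(1) Lp_bound_of_grad_norm[OF p open_unit_cube vW C2, of "r n"]
      by (intro emeasure_gt_le) (auto simp: a_def[symmetric])
    also have "\<dots> < ennreal (d / 3)" using R by (intro ennreal_lessI) (auto intro: d)
    finally show ?thesis .
  qed
  have e3: "emeasure ?M E3 < ennreal (d / 3)"
  proof -
    have "emeasure ?M E3 \<le> ennreal (C1 / M)"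
      unfolding E3_def using M C1 by (intro emeasure_gt_le) auto
    also have "\<dots> < ennreal (d / 3)" using M d by (intro ennreal_lessI) auto
    finally show ?thesis .
  qed
  \<comment> \<open>Off \<open>B\<close> the gradients are close, \<open>a n\<close> is bounded by
    \<open>R\<close> and \<open>L (b n)\<close> by \<open>M\<close>, so truncated continuity
    applies. The three parts together stay below the equi-integrability threshold
    \<open>d\<close>.\<close>
  define B where "B = E1 \<union> E2 \<union> E3"
  have Bm: "B \<in> sets ?M" using Em by (auto simp: B_def)
  have "emeasure ?M B \<le> emeasure ?M E1 + emeasure ?M E2 + emeasure ?M E3"
    unfolding B_def using Em by (intro order_trans[OF emeasure_subadditive] add_right_mono emeasure_subadditive) auto
  also have "\<dots> < ennreal (d / 3) + ennreal (d / 3) + ennreal (d / 3)"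
    by (intro add_strict_mono e1 e2 e3)
  also have "\<dots> = ennreal d" using d by (simp add: ennreal_plus[symmetric] del: ennreal_plus)
  finally have Bd: "emeasure lebesgue B < ennreal d" using sL(2)[OF Bm] by simp
  have BL: "B \<in> sets lebesgue" "B \<subseteq> ?Y" using sL(1)[OF Bm] Bm by (auto simp: sets_restrict_space_iff)
  have Bint: "(\<integral>\<^sup>+x. L (b n x) * indicator B x \<partial>?M) < ennreal (e / 2)"
  proof -
    have "(\<integral>\<^sup>+x. L (b n x) * indicator B x \<partial>?M) = (\<integral>\<^sup>+x. L (b n x) \<partial>lebesgue_on B)"
      using BL by (simp add: nn_integral_restrict_space) (auto intro!: nn_integral_cong simp: indicator_def)
    then show ?thesis using d(2)[OF BL Bd] by simp
  qed
  have "L \<xi> \<le> energy L ?Y (w n)" using qc w[of n] by (auto simp: W1p_quasiconvex_def)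
  also have "\<dots> = (\<integral>\<^sup>+x. L (b n x) \<partial>?M)" by (simp add: energy_def b_def)
  also have "\<dots> \<le> (\<integral>\<^sup>+x. (L (a n x) + ennreal (e / 2)) + L (b n x) * indicator B x \<partial>?M)"
  proof (rule nn_integral_mono)
    fix x assume x: "x \<in> space ?M"
    show "L (b n x) \<le> (L (a n x) + ennreal (e / 2)) + L (b n x) * indicator B x"
    proof (cases "x \<in> B")
      case True
      then show ?thesis by (simp add: add_increasing)
    next
      case False
      then have h: "norm (a n x - b n x) \<le> \<eta>" "norm (a n x) powr p \<le> R powr p" "L (b n x) \<le> ennreal M"
        using x by (auto simp: B_def E1_def E2_def E3_def not_less)
      have "norm (a n x) \<le> R"
      proof (rule ccontr)
        assume "\<not> ?thesis"
        then have "R powr p < norm (a n x) powr p" using R p by (intro powr_less_mono2) auto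
        then show False using h by simp
      qed
      then show ?thesis using eta(2)[OF _ h(1,3)] False by simp
    qed
  qed
  also have "\<dots> = ((\<integral>\<^sup>+x. L (a n x) \<partial>?M) + ennreal (e / 2)) + (\<integral>\<^sup>+x. L (b n x) * indicator B x \<partial>?M)"
  proof -
    have 1: "(\<lambda>x. L (b n x) * indicator B x) \<in> borel_measurable ?M" using Bm by measurable
    have 2: "emeasure ?M ?Y = 1" using emeasure_unit_cube[where 'n='n] by (simp add: emeasure_restrict_space)
    show ?thesis using 1 2 by (simp add: nn_integral_add)
  qed
  also have "\<dots> \<le> (ennreal t + ennreal (e / 2)) + ennreal (e / 2)"
    using le[of "r n"] Bint by (intro add_mono) (auto simp: energy_def a_def)
  also have "\<dots> = ennreal t + ennreal e"
    using e t by (simp add: ennreal_plus[symmetric] del: ennreal_plus)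
  finally show "L \<xi> \<le> ennreal t + ennreal e" .
qed

lemma liminf_less_frequently:
  fixes a :: "nat \<Rightarrow> ennreal"
  assumes "liminf a < t"
  shows "\<exists>n\<ge>N. a n < t"
proof (rule ccontr)
  assume "\<not> ?thesis"
  then have "eventually (\<lambda>n. t \<le> a n) sequentially"
    by (intro eventually_sequentiallyI[of N]) (auto simp: not_less)
  then have "t \<le> liminf a" by (rule Liminf_bounded)
  then show False using assms by simp
qed

section \<open>Dyadic energy averages and the blow-up at a point\<close>

definition eavg :: "nat \<Rightarrow> (real^'n::finite \<Rightarrow> ennreal) \<Rightarrow> real^'n \<Rightarrow> ennreal" where
  "eavg k f x = ennreal (1 / dvol TYPE('n) k) * (\<integral>\<^sup>+y. f y \<partial>lebesgue_on (dcube k x))"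

lemma dcube_const_measurable:
  fixes g :: "real^'n::finite \<Rightarrow> ennreal"
  assumes "\<And>x y. y \<in> dcube k x \<Longrightarrow> g y = g x"
  shows "g \<in> borel_measurable lebesgue"
proof (rule measurable_completion, simp, rule borel_measurableI)
  fix S :: "ennreal set" assume "open S"
  show "g -` S \<inter> space borel \<in> sets borel"
    by (rule dcube_union_borel[of _ k]) (use assms in auto)
qed

lemma eavg_measurable: "eavg k f \<in> borel_measurable lebesgue"
  by (rule dcube_const_measurable[of k]) (auto simp: eavg_def dest: dcube_eq)

lemma linear_Lp_space:
  fixes \<xi> :: "real^'n::finite^'m::finite"
  assumes p: "1 < p" and O: "bounded \<Omega>" "\<Omega> \<in> lmeasurable"
  shows "(\<lambda>y. \<xi> *v y) \<in> Lp_space p \<Omega>"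
proof -
  interpret finite_measure "lebesgue_on \<Omega>" by (rule finite_measure_lebesgue_on[OF O(2)])
  have lc: "continuous_on UNIV (\<lambda>y. \<xi> *v y)" by (intro linear_continuous_on matrix_vector_mul_bounded_linear)
  have lm: "(\<lambda>y. \<xi> *v y) \<in> borel_measurable (lebesgue_on \<Omega>)" by (intro measurable_restrict_space1 borel_measurable_continuous_lebesgue lc)
  obtain B where B: "\<And>y. y \<in> \<Omega> \<Longrightarrow> norm y \<le> B" using O(1) unfolding bounded_iff by blast
  have "integrable (lebesgue_on \<Omega>) (\<lambda>y. norm (\<xi> *v y) powr p)"
  proof (rule integrable_const_bound[of _ "(norm \<xi> * B) powr p"])
    show "AE y in lebesgue_on \<Omega>. norm (norm (\<xi> *v y) powr p) \<le> (norm \<xi> * B) powr p"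
      using p B by (intro AE_I2) (auto intro!: powr_mono2 order_trans[OF norm_matrix_vector_le] mult_left_mono)
  qed (use lm in measurable)
  then show ?thesis using lm by (simp add: Lp_space_def)
qed

text \<open>If the inequality failed, some real \<open>t\<close> would lie strictly between the two
  sides. Fine generations and suitable indices with average energy below \<open>t\<close> then give
  rescaled functions on the unit cube of energy at most \<open>t\<close>, chosen diagonally so that
  their gradient averages over each fixed cell tend to \<open>\<xi>\<close>; and
  \<open>quasiconvex_limit\<close> yields \<open>L \<xi> \<le> t\<close>.\<close>

lemma blow_up:
  fixes L :: "real^'n::finite^'m::finite \<Rightarrow> ennreal"
  assumes p: "1 < p" and L: "continuous_on UNIV L" and C: "condition_Cpp p L" and qc: "W1p_quasiconvex p L"
    and O: "open \<Omega>" and u: "\<And>n. u n \<in> W1p p \<Omega>" and v: "v \<in> W1p p \<Omega>"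
    and conv: "\<And>S. S \<in> lmeasurable \<Longrightarrow> S \<subseteq> \<Omega> \<Longrightarrow>
      (\<lambda>n. \<integral>x. weak_grad \<Omega> (u n) x \<partial>lebesgue_on S) \<longlonglongrightarrow> (\<integral>x. weak_grad \<Omega> v x \<partial>lebesgue_on S)"
    and dl: "\<delta> > 0" and x0: "x0 \<in> \<Omega>" and r: "strict_mono r"
    and osc: "(\<lambda>j. eavg (r j) (\<lambda>y. ennreal (norm (weak_grad \<Omega> v y - \<xi>))) x0) \<longlonglongrightarrow> 0"
  shows "L \<xi> \<le> liminf (\<lambda>j. liminf (\<lambda>n. eavg (r j) (\<lambda>y. L (weak_grad \<Omega> (u n) y) + ennreal (\<delta> * norm (weak_grad \<Omega> (u n) y) powr p)) x0))"
proof (rule ccontr)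
  let ?Y = "unit_cube :: (real^'n) set"
  let ?M = "lebesgue_on ?Y"
  define G where "G n = weak_grad \<Omega> (u n)" for n
  define H where "H = weak_grad \<Omega> v"
  define F where "F n y = L (G n y) + ennreal (\<delta> * norm (G n y) powr p)" for n y
  assume "\<not> ?thesis"
  then have "liminf (\<lambda>j. liminf (\<lambda>n. eavg (r j) (F n) x0)) < L \<xi>" by (simp add: not_le F_def[abs_def] G_def)
  then obtain t' where t': "liminf (\<lambda>j. liminf (\<lambda>n. eavg (r j) (F n) x0)) < t'" "t' < L \<xi>" using dense by blast
  then obtain t where t: "t' = ennreal t" "t \<ge> 0" by (cases t') (auto simp: top_unique)
  obtain j0 where j0: "\<And>j. j \<ge> j0 \<Longrightarrow> dcube j x0 \<subseteq> \<Omega>" using open_dcube_exhaust[OF O x0] by blast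
  have GW: "is_weak_grad \<Omega> (u n) (G n)" "G n \<in> Lp_space p \<Omega>" "u n \<in> Lp_space p \<Omega>" for n
    using W1p_D[OF O u] by (auto simp: G_def)
  have HW: "H \<in> Lp_space p \<Omega>" using W1p_D[OF O v] by (auto simp: H_def)
  have Gm: "G n \<in> borel_measurable (lebesgue_on \<Omega>)" "H \<in> borel_measurable (lebesgue_on \<Omega>)" "u n \<in> borel_measurable (lebesgue_on \<Omega>)" for n
    using GW HW by (auto simp: Lp_space_def)
  have OL: "\<Omega> \<in> sets lebesgue" by (rule open_sets_lebesgue[OF O])
  have intO: "integrable (lebesgue_on S) f" if f: "f \<in> Lp_space p \<Omega>" and S: "S \<in> lmeasurable" "S \<subseteq> \<Omega>" for f :: "real^'n \<Rightarrow> 'c::euclidean_space" and S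
  proof (rule integrable_of_powr[OF finite_measure_lebesgue_on[OF S(1)] _ p])
    show "f \<in> borel_measurable (lebesgue_on S)" using f by (intro measurable_restrict_mono[OF _ S(2)]) (auto simp: Lp_space_def)
    have "(\<integral>\<^sup>+x. ennreal (norm (f x) powr p) \<partial>lebesgue_on S) \<le> (\<integral>\<^sup>+x. ennreal (norm (f x) powr p) \<partial>lebesgue_on \<Omega>)"
      using S OL by (simp add: nn_integral_restrict_space fmeasurableD) (auto intro!: nn_integral_mono simp: indicator_def)
    then show "(\<integral>\<^sup>+x. ennreal (norm (f x) powr p) \<partial>lebesgue_on S) < \<infinity>" using f by (auto simp: Lp_space_iff le_less_trans)
  qed
  define \<tau> where "\<tau> k y = dcenter k x0 + (1 / 2^k) *\<^sub>R y" for k and y :: "real^'n"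
  \<comment> \<open>The diagonal choice. The generation is fixed first, among the
    \<open>r j\<close>, and the index \<open>n\<close> afterwards: for a fixed generation the
    finitely many cell conditions hold for all large \<open>n\<close>, and the energy condition for
    arbitrarily large ones.\<close>
  have step: "\<exists>k n. k \<ge> i \<and> dcube k x0 \<subseteq> \<Omega> \<and> k \<in> range r \<and>
      (\<exists>j\<ge>i. k = r j) \<and> eavg k (F n) x0 < ennreal t \<and>
      (\<forall>l\<in>{1..i}. \<forall>z\<in>grid l. norm (\<integral>y. G n (\<tau> k y) - H (\<tau> k y) \<partial>lebesgue_on (dcube l (gpoint l z) \<inter> ?Y)) \<le> 1 / real (Suc i))" for i
  proof -
    obtain j where j: "j \<ge> max i j0" "liminf (\<lambda>n. eavg (r j) (F n) x0) < ennreal t"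
      using liminf_less_frequently[OF t'(1), of "max i j0"] t by blast
    define k where "k = r j"
    have k: "k \<ge> i" "k \<ge> j0" using seq_suble[OF r, of j] j by (auto simp: k_def)
    have sub: "dcube k x0 \<subseteq> \<Omega>" by (rule j0[OF k(2)])
    have lim: "(\<lambda>n. \<integral>y. G n (\<tau> k y) - H (\<tau> k y) \<partial>lebesgue_on (dcube l (gpoint l z) \<inter> ?Y)) \<longlonglongrightarrow> 0" for l z
    proof -
      define P where "P = dcube l (gpoint l z) \<inter> ?Y"
      define S where "S = {x. 2^k *\<^sub>R (x - dcenter k x0) \<in> P}"
      have PL: "P \<in> sets lebesgue" by (simp add: P_def)
      have SL: "S \<in> sets lebesgue"
      proof -
        have "(\<lambda>x. (- (2^k *\<^sub>R dcenter k x0)) + 2^k *\<^sub>R x) -` P \<inter> space lebesgue \<in> sets lebesgue"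
          by (rule measurable_sets[OF measurable_lebesgue_affine PL]) simp
        moreover have "(\<lambda>x. (- (2^k *\<^sub>R dcenter k x0)) + 2^k *\<^sub>R x) -` P \<inter> space lebesgue = S"
          by (auto simp: S_def algebra_simps)
        ultimately show ?thesis by simp
      qed
      have Sb: "S \<subseteq> dbox k x0" by (auto simp: S_def P_def dbox_iff)
      have SO: "S \<subseteq> \<Omega>" using Sb dbox_subset sub by blast
      have Sm: "S \<in> lmeasurable"
        by (rule fmeasurableI2[OF dcube_lmeasurable[of k x0] _ SL]) (use Sb dbox_subset in blast)
      have PT: "P = {y. dcenter k x0 + (1 / 2^k) *\<^sub>R y \<in> S}" by (auto simp: S_def)
      have int: "integrable (lebesgue_on S) (G n)" "integrable (lebesgue_on S) H" for n
        by (intro intO GW(2) HW Sm SO)+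
      have eq: "(\<integral>y. G n (\<tau> k y) - H (\<tau> k y) \<partial>lebesgue_on P) = (1 / (1 / 2^k) ^ CARD('n)) *\<^sub>R ((\<integral>x. G n x \<partial>lebesgue_on S) - (\<integral>x. H x \<partial>lebesgue_on S))" for n
      proof -
        have "(\<integral>x. G n x - H x \<partial>lebesgue_on S) = (1 / 2^k) ^ DIM(real^'n) *\<^sub>R (\<integral>y. G n (\<tau> k y) - H (\<tau> k y) \<partial>lebesgue_on P)"
          unfolding \<tau>_def using int by (intro lebesgue_on_affine(3)[OF _ SL PT, of "\<lambda>x. G n x - H x"]) auto
        then show ?thesis using int by simp
      qed
      have "(\<lambda>n. (1 / (1 / 2^k) ^ CARD('n)) *\<^sub>R ((\<integral>x. G n x \<partial>lebesgue_on S) - (\<integral>x. H x \<partial>lebesgue_on S))) \<longlonglongrightarrow>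
          (1 / (1 / 2^k) ^ CARD('n)) *\<^sub>R ((\<integral>x. H x \<partial>lebesgue_on S) - (\<integral>x. H x \<partial>lebesgue_on S))"
        unfolding G_def H_def by (intro tendsto_intros conv Sm SO)
      then show ?thesis unfolding P_def[symmetric] eq by simp
    qed
    have "eventually (\<lambda>n. norm (\<integral>y. G n (\<tau> k y) - H (\<tau> k y) \<partial>lebesgue_on (dcube l (gpoint l z) \<inter> ?Y)) < 1 / real (Suc i)) sequentially" for l z
      by (rule order_tendstoD(2)[OF tendsto_norm_zero[OF lim]]) simp
    then have "eventually (\<lambda>n. \<forall>l\<in>{1..i}. \<forall>z\<in>grid l. norm (\<integral>y. G n (\<tau> k y) - H (\<tau> k y) \<partial>lebesgue_on (dcube l (gpoint l z) \<inter> ?Y)) < 1 / real (Suc i)) sequentially"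
      by (intro eventually_ball_finite ballI) auto
    then obtain N where N: "\<And>n l z. n \<ge> N \<Longrightarrow> l \<in> {1..i} \<Longrightarrow> z \<in> grid l \<Longrightarrow>
        norm (\<integral>y. G n (\<tau> k y) - H (\<tau> k y) \<partial>lebesgue_on (dcube l (gpoint l z) \<inter> ?Y)) < 1 / real (Suc i)"
      unfolding eventually_sequentially by blast
    obtain n where n: "n \<ge> N" "eavg k (F n) x0 < ennreal t"
      using liminf_less_frequently[OF j(2), of N] by (auto simp: k_def)
    show ?thesis
      by (rule exI[of _ k], rule exI[of _ n]) (use k sub n N j in \<open>auto simp: k_def intro: less_imp_le\<close>)
  qed
  define good where "good i k n \<longleftrightarrow> dcube k x0 \<subseteq> \<Omega> \<and> (\<exists>j\<ge>i. k = r j) \<and> eavg k (F n) x0 < ennreal t \<and>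
      (\<forall>l\<in>{1..i}. \<forall>z\<in>grid l. norm (\<integral>y. G n (\<tau> k y) - H (\<tau> k y) \<partial>lebesgue_on (dcube l (gpoint l z) \<inter> ?Y)) \<le> 1 / real (Suc i))" for i k n
  have "\<forall>i. \<exists>kn. good i (fst kn) (snd kn)" using step unfolding good_def by fastforce
  then obtain kn where kn: "\<And>i. good i (fst (kn i)) (snd (kn i))" by metis
  define kk where "kk i = fst (kn i)" for i
  define nn where "nn i = snd (kn i)" for i
  have K1: "dcube (kk i) x0 \<subseteq> \<Omega>" and K2: "\<exists>j\<ge>i. kk i = r j" and K3: "eavg (kk i) (F (nn i)) x0 < ennreal t"
    and K4: "\<And>l z. l \<in> {1..i} \<Longrightarrow> z \<in> grid l \<Longrightarrow>
      norm (\<integral>y. G (nn i) (\<tau> (kk i) y) - H (\<tau> (kk i) y) \<partial>lebesgue_on (dcube l (gpoint l z) \<inter> ?Y)) \<le> 1 / real (Suc i)" for i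
    using kn[of i] by (auto simp: good_def kk_def nn_def)
  obtain jj where jj: "\<And>i. jj i \<ge> i" "\<And>i. kk i = r (jj i)" using K2 by metis
  define V where "V i y = G (nn i) (\<tau> (kk i) y)" for i y
  define w where "w i y = (1 / (1 / 2^(kk i))) *\<^sub>R u (nn i) (\<tau> (kk i) y)" for i y
  define ml where "ml = (\<integral>y. \<xi> *v y \<partial>?M)"
  \<comment> \<open>A constant is added so that \<open>vv i\<close> has the mean of the linear map.
    Gradients are unchanged, and the differences become accessible to the Poincare
    inequality.\<close>
  define vv where "vv i y = w i y + (ml - (\<integral>y. w i y \<partial>?M))" for i y
  interpret Y: finite_measure ?M by (rule finite_measure_lebesgue_on) simp
  have mY: "measure ?M ?Y = 1" by (simp add: measure_restrict_space)
  have wg: "is_weak_grad ?Y (w i) (V i)" for i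
  proof -
    have "is_weak_grad (dbox (kk i) x0) (u (nn i)) (G (nn i))"
      by (rule is_weak_grad_subset[OF O open_dbox subset_trans[OF dbox_subset K1] GW(1)])
    from is_weak_grad_affine[OF _ _ _ this, of "1 / 2^(kk i)" ?Y "dcenter (kk i) x0"]
    show ?thesis unfolding w_def[abs_def] V_def[abs_def] \<tau>_def by (simp add: dbox_affine_iff)
  qed
  have vg: "is_weak_grad ?Y (vv i) (V i)" for i
    using is_weak_grad_add[OF open_unit_cube wg is_weak_grad_const[OF open_unit_cube]] unfolding vv_def[abs_def] by simp
  have cv: "(\<integral>\<^sup>+y. g (\<tau> k y) \<partial>?M) = eavg k g x0" if "g \<in> borel_measurable (lebesgue_on (dcube k x0))" for g :: "real^'n \<Rightarrow> ennreal" and k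
    unfolding eavg_def \<tau>_def using nn_integral_dcube[OF that]
    by (simp add: mult.assoc[symmetric] ennreal_mult[symmetric])
  have subm: "g \<in> borel_measurable (lebesgue_on (dcube (kk i) x0))" if "g \<in> borel_measurable (lebesgue_on \<Omega>)" for g :: "real^'n \<Rightarrow> 'c::topological_space" and i
    by (rule measurable_restrict_mono[OF that K1])
  have [measurable]: "L \<in> borel_measurable borel" by (rule borel_measurable_continuous_onI[OF L])
  \<comment> \<open>The part of the density with \<open>\<delta>\<close> is the source of the
    gradient bound \<open>t / \<delta>\<close>, as \<open>L\<close> need not be coercive.\<close>
  have en: "(\<integral>\<^sup>+y. L (V i y) \<partial>?M) \<le> ennreal t" and gb: "(\<integral>\<^sup>+y. ennreal (norm (V i y) powr p) \<partial>?M) \<le> ennreal (t / \<delta>)" for i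
  proof -
    have [measurable]: "G (nn i) \<in> borel_measurable (lebesgue_on (dcube (kk i) x0))" by (rule subm[OF Gm(1)])
    have Fm: "F (nn i) \<in> borel_measurable (lebesgue_on (dcube (kk i) x0))" unfolding F_def[abs_def] by measurable
    have Vm[measurable]: "V i \<in> borel_measurable ?M" by (rule is_weak_grad_measurable(2)[OF wg])
    have a: "(\<integral>\<^sup>+y. L (V i y) + ennreal (\<delta> * norm (V i y) powr p) \<partial>?M) \<le> ennreal t"
      using cv[OF Fm] K3[of i] by (simp add: F_def V_def)
    have "(\<integral>\<^sup>+y. L (V i y) \<partial>?M) \<le> (\<integral>\<^sup>+y. L (V i y) + ennreal (\<delta> * norm (V i y) powr p) \<partial>?M)"
      by (intro nn_integral_mono) simp
    then show "(\<integral>\<^sup>+y. L (V i y) \<partial>?M) \<le> ennreal t" using a by simp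
    have "(\<integral>\<^sup>+y. ennreal (norm (V i y) powr p) \<partial>?M) = ennreal (1 / \<delta>) * (\<integral>\<^sup>+y. ennreal (\<delta> * norm (V i y) powr p) \<partial>?M)"
      using dl by (subst nn_integral_cmult[symmetric]) (auto simp: ennreal_mult[symmetric])
    also have "\<dots> \<le> ennreal (1 / \<delta>) * ennreal t"
    proof (rule mult_left_mono)
      have "(\<integral>\<^sup>+y. ennreal (\<delta> * norm (V i y) powr p) \<partial>?M) \<le> (\<integral>\<^sup>+y. L (V i y) + ennreal (\<delta> * norm (V i y) powr p) \<partial>?M)"
        by (intro nn_integral_mono) simp
      then show "(\<integral>\<^sup>+y. ennreal (\<delta> * norm (V i y) powr p) \<partial>?M) \<le> ennreal t" using a by simp
    qed simp
    also have "\<dots> = ennreal (t / \<delta>)" using dl t by (simp add: ennreal_mult[symmetric])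
    finally show "(\<integral>\<^sup>+y. ennreal (norm (V i y) powr p) \<partial>?M) \<le> ennreal (t / \<delta>)" .
  qed
  have VL: "V i \<in> Lp_space p ?Y" for i
    using gb[of i] is_weak_grad_measurable(2)[OF wg] by (auto simp: Lp_space_iff le_less_trans)
  have constL: "(\<lambda>y. c) \<in> Lp_space p ?Y" for c :: "'c::euclidean_space"
    by (auto simp: Lp_space_def)
  have linL: "(\<lambda>y. \<xi> *v y) \<in> Lp_space p ?Y" by (rule linear_Lp_space[OF p bounded_unit_cube unit_cube_lmeasurable])
  have wL: "w i \<in> Lp_space p ?Y" for i
  proof -
    have "(\<integral>\<^sup>+y. ennreal (norm (u (nn i) (\<tau> (kk i) y)) powr p) \<partial>?M) = eavg (kk i) (\<lambda>y. ennreal (norm (u (nn i) y) powr p)) x0"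
      using subm[OF Gm(3)[of "nn i"]] by (intro cv) measurable
    also have "\<dots> < \<infinity>"
    proof -
      have "(\<integral>\<^sup>+y. ennreal (norm (u (nn i) y) powr p) \<partial>lebesgue_on (dcube (kk i) x0)) \<le> (\<integral>\<^sup>+y. ennreal (norm (u (nn i) y) powr p) \<partial>lebesgue_on \<Omega>)"
        using OL K1[of i] by (simp add: nn_integral_restrict_space) (auto intro!: nn_integral_mono simp: indicator_def)
      also have "\<dots> < \<infinity>" using GW(3)[of "nn i"] by (simp add: Lp_space_iff)
      finally show ?thesis by (simp add: eavg_def ennreal_mult_less_top)
    qed
    finally have f: "(\<integral>\<^sup>+y. ennreal (norm (u (nn i) (\<tau> (kk i) y)) powr p) \<partial>?M) < \<infinity>" .
    have "(\<lambda>y. u (nn i) (\<tau> (kk i) y)) \<in> borel_measurable ?M"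
      unfolding \<tau>_def by (rule measurable_dcube_affine[OF subm[OF Gm(3)]])
    then have "(\<lambda>y. u (nn i) (\<tau> (kk i) y)) \<in> Lp_space p ?Y" using f by (simp add: Lp_space_iff)
    from Lp_space_scaleR[OF this] show ?thesis unfolding w_def[abs_def] .
  qed
  have LpI: "integrable ?M f" if "f \<in> Lp_space p ?Y" for f :: "real^'n \<Rightarrow> 'c::euclidean_space"
    using that by (intro integrable_of_powr[OF Y.finite_measure_axioms _ p]) (auto simp: Lp_space_iff)
  have vL: "vv i \<in> Lp_space p ?Y" for i
    unfolding vv_def[abs_def] by (intro Lp_space_add p wL constL)
  have wi: "integrable ?M (w i)" for i by (rule LpI[OF wL])
  have li: "integrable ?M (\<lambda>y. \<xi> *v y)" by (rule LpI[OF linL])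
  have vmean: "(\<integral>y. vv i y \<partial>?M) = ml" for i
    unfolding vv_def using wi mY by simp
  have lg: "is_weak_grad ?Y (\<lambda>y. \<xi> *v y) (\<lambda>y. \<xi>)"
    using is_weak_grad_affine_map[OF open_unit_cube, of \<xi> 0] by simp
  have "W1p_weakly_converges p ?Y vv (\<lambda>y. \<xi> *v y)"
  proof (rule weak_convergence_criterion[OF p open_unit_cube unit_cube_lmeasurable vL vg VL linL lg constL])
    define C' where "C' = 2 powr p * (t / \<delta> + norm \<xi> powr p)"
    show "0 \<le> C'" using t dl by (auto simp: C'_def intro!: mult_nonneg_nonneg add_nonneg_nonneg)
    show "(\<integral>\<^sup>+y. ennreal (norm (V k y - \<xi>) powr p) \<partial>?M) \<le> ennreal C'" for k
    proof -
      have Vm[measurable]: "V k \<in> borel_measurable ?M" by (rule is_weak_grad_measurable(2)[OF wg])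
      have "(\<integral>\<^sup>+y. ennreal (norm (V k y - \<xi>) powr p) \<partial>?M) \<le> (\<integral>\<^sup>+y. ennreal (2 powr p) * (ennreal (norm (V k y) powr p) + ennreal (norm \<xi> powr p)) \<partial>?M)"
      proof (rule nn_integral_mono)
        fix y
        have "norm (V k y - \<xi>) powr p \<le> 2 powr p * (norm (V k y) powr p + norm \<xi> powr p)"
          using norm_powr_add_le[OF p, of "V k y" "- \<xi>"] by simp
        then show "ennreal (norm (V k y - \<xi>) powr p) \<le> ennreal (2 powr p) * (ennreal (norm (V k y) powr p) + ennreal (norm \<xi> powr p))"
          by (simp add: ennreal_mult[symmetric] ennreal_plus[symmetric] ennreal_leI del: ennreal_plus)
      qed
      also have "\<dots> = ennreal (2 powr p) * ((\<integral>\<^sup>+y. ennreal (norm (V k y) powr p) \<partial>?M) + ennreal (norm \<xi> powr p))"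
      proof -
        have "emeasure ?M ?Y = 1" using emeasure_unit_cube[where 'n='n] by (simp add: emeasure_restrict_space)
        then show ?thesis by (simp add: nn_integral_cmult nn_integral_add)
      qed
      also have "\<dots> \<le> ennreal (2 powr p) * (ennreal (t / \<delta>) + ennreal (norm \<xi> powr p))"
        by (intro mult_left_mono add_right_mono gb) simp
      also have "\<dots> = ennreal C'" using t dl by (simp add: C'_def ennreal_mult[symmetric] ennreal_plus[symmetric] del: ennreal_plus)
      finally show ?thesis .
    qed
    show "(\<lambda>i. \<integral>y. V i y - \<xi> \<partial>lebesgue_on (dcube l x \<inter> ?Y)) \<longlonglongrightarrow> 0" if l: "1 \<le> l" for l x
    proof (cases "(\<lambda>i. \<lfloor>2^l * x $ i\<rfloor>) \<in> grid l")
      case False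
      have "dcube l x \<inter> ?Y = {}"
      proof -
        have "y \<notin> ?Y" if y: "y \<in> dcube l x" for y
        proof -
          have "(\<lambda>i. \<lfloor>2^l * y $ i\<rfloor>) = (\<lambda>i. \<lfloor>2^l * x $ i\<rfloor>)" using y by (auto simp: dcube_def)
          then have "y \<notin> half_open_cube" using False grid_iff_half_open[OF l, of y] by simp
          then show ?thesis using unit_cube_subset_half_open by blast
        qed
        then show ?thesis by blast
      qed
      then show ?thesis by simp
    next
      case True
      define z where "z = (\<lambda>i. \<lfloor>2^l * x $ i\<rfloor>)"
      have z: "z \<in> grid l" using True by (simp add: z_def)
      have dx: "dcube l x = dcube l (gpoint l z)" by (rule dcube_eq) (simp add: dcube_gpoint z_def)
      define P where "P = dcube l (gpoint l z) \<inter> ?Y"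
      have PL: "P \<in> sets lebesgue" "P \<subseteq> ?Y" by (auto simp: P_def)
      define o' where "o' i = enn2real (eavg (r (jj i)) (\<lambda>y. ennreal (norm (H y - \<xi>))) x0)" for i
      have os: "(\<lambda>i. eavg (r (jj i)) (\<lambda>y. ennreal (norm (H y - \<xi>))) x0) \<longlonglongrightarrow> 0"
      proof -
        have "filterlim jj at_top sequentially" using jj(1)
          by (intro filterlim_at_top_mono[OF filterlim_ident]) (auto intro!: always_eventually)
        from filterlim_compose[OF osc this] show ?thesis by (simp add: H_def)
      qed
      then have oz: "o' \<longlonglongrightarrow> 0" unfolding o'_def[abs_def] using tendsto_enn2real[of _ 0] by simp
      have Hi: "integrable ?M (\<lambda>y. H (\<tau> (kk i) y))" for i
      proof -
        have "integrable (lebesgue_on (dcube (kk i) x0)) H" by (rule intO[OF HW dcube_lmeasurable K1])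
        then show ?thesis unfolding \<tau>_def using integrable_dcube[of H "kk i" x0] by auto
      qed
      \<comment> \<open>The deviation from \<open>\<xi>\<close> splits into \<open>V i - H\<close>,
        small by the diagonal choice once \<open>i \<ge> l\<close>, and \<open>H - \<xi>\<close>,
        bounded by the dyadic oscillation at the blow-up point.\<close>
      have bnd: "norm (\<integral>y. V i y - \<xi> \<partial>lebesgue_on P) \<le> 1 / real (Suc i) + o' i" if i: "i \<ge> l" for i
      proof -
        have Vi: "integrable ?M (V i)" by (rule LpI[OF VL])
        have iP: "integrable (lebesgue_on P) (V i)" "integrable (lebesgue_on P) (\<lambda>y. H (\<tau> (kk i) y))" "integrable (lebesgue_on P) (\<lambda>y. \<xi>)"
          using integrable_lebesgue_on_subset[OF Vi PL(2)] integrable_lebesgue_on_subset[OF Hi PL(2)] integrable_lebesgue_on_subset[of ?Y "\<lambda>y. \<xi>" P] PL by auto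
        have "(\<integral>y. V i y - \<xi> \<partial>lebesgue_on P) = (\<integral>y. (V i y - H (\<tau> (kk i) y)) + (H (\<tau> (kk i) y) - \<xi>) \<partial>lebesgue_on P)" by simp
        also have "\<dots> = (\<integral>y. V i y - H (\<tau> (kk i) y) \<partial>lebesgue_on P) + (\<integral>y. H (\<tau> (kk i) y) - \<xi> \<partial>lebesgue_on P)"
          by (intro Bochner_Integration.integral_add Bochner_Integration.integrable_diff iP)
        finally have "norm (\<integral>y. V i y - \<xi> \<partial>lebesgue_on P) \<le> norm (\<integral>y. V i y - H (\<tau> (kk i) y) \<partial>lebesgue_on P) + norm (\<integral>y. H (\<tau> (kk i) y) - \<xi> \<partial>lebesgue_on P)"
          by (simp add: norm_triangle_ineq)
        also have "\<dots> \<le> 1 / real (Suc i) + o' i"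
        proof (rule add_mono)
          show "norm (\<integral>y. V i y - H (\<tau> (kk i) y) \<partial>lebesgue_on P) \<le> 1 / real (Suc i)"
          proof -
            have "l \<in> {1..i}" using l i by simp
            from K4[OF this z] show ?thesis by (simp add: V_def P_def)
          qed
          have hi: "integrable ?M (\<lambda>y. norm (H (\<tau> (kk i) y) - \<xi>))" using Hi by auto
          have "norm (\<integral>y. H (\<tau> (kk i) y) - \<xi> \<partial>lebesgue_on P) \<le> (\<integral>y. norm (H (\<tau> (kk i) y) - \<xi>) \<partial>lebesgue_on P)"
            by (rule integral_norm_bound)
          also have "\<dots> \<le> (\<integral>y. norm (H (\<tau> (kk i) y) - \<xi>) \<partial>?M)"
          proof -
            have h1: "integrable lebesgue (\<lambda>y. indicat_real ?Y y * norm (H (\<tau> (kk i) y) - \<xi>))" using hi by (simp add: integrable_restrict_space)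
            have h2: "integrable lebesgue (\<lambda>y. indicat_real P y * norm (H (\<tau> (kk i) y) - \<xi>))"
              using integrable_lebesgue_on_subset[OF hi PL(2) _ PL(1)] PL(1) by (simp add: integrable_restrict_space)
            show ?thesis using h1 h2 PL by (simp add: integral_restrict_space) (intro integral_mono, auto simp: indicator_def)
          qed
          also have "\<dots> = o' i"
          proof -
            have "(\<integral>\<^sup>+y. ennreal (norm (H (\<tau> (kk i) y) - \<xi>)) \<partial>?M) = eavg (kk i) (\<lambda>y. ennreal (norm (H y - \<xi>))) x0"
              proof (intro cv)
                have [measurable]: "H \<in> borel_measurable (lebesgue_on (dcube (kk i) x0))" using subm[OF Gm(2)] .
                show "(\<lambda>x. ennreal (norm (H x - \<xi>))) \<in> borel_measurable (lebesgue_on (dcube (kk i) x0))" by measurable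
              qed
            moreover have "(\<integral>\<^sup>+y. ennreal (norm (H (\<tau> (kk i) y) - \<xi>)) \<partial>?M) = ennreal (\<integral>y. norm (H (\<tau> (kk i) y) - \<xi>) \<partial>?M)"
              by (rule nn_integral_eq_integral[OF hi]) simp
            ultimately have "eavg (kk i) (\<lambda>y. ennreal (norm (H y - \<xi>))) x0 = ennreal (\<integral>y. norm (H (\<tau> (kk i) y) - \<xi>) \<partial>?M)" by simp
            moreover have "0 \<le> (\<integral>y. norm (H (\<tau> (kk i) y) - \<xi>) \<partial>?M)" by simp
            ultimately show ?thesis by (simp only: o'_def jj(2)[symmetric] enn2real_ennreal)
          qed
          finally show "norm (\<integral>y. H (\<tau> (kk i) y) - \<xi> \<partial>lebesgue_on P) \<le> o' i" .
        qed
        finally show ?thesis .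
      qed
      have "(\<lambda>i. 1 / real (Suc i) + o' i) \<longlonglongrightarrow> 0"
        using tendsto_add[OF LIMSEQ_Suc[OF lim_1_over_n] oz] by simp
      then have "(\<lambda>i. \<integral>y. V i y - \<xi> \<partial>lebesgue_on P) \<longlonglongrightarrow> 0"
        by (rule Lim_null_comparison[rotated]) (use bnd in \<open>auto intro!: eventually_sequentiallyI[of l]\<close>)
      then show ?thesis by (simp add: dx P_def)
    qed
    fix x assume xh: "\<And>n. x n \<in> midhull (\<lambda>k y. (vv k y - \<xi> *v y, if y \<in> ?Y then V k y - \<xi> else 0)) n"
      and xs: "(\<lambda>n. \<integral>\<^sup>+y. ennreal (norm (snd (x n y)) powr p) \<partial>?M) \<longlonglongrightarrow> 0"
    \<comment> \<open>Mean zero is preserved by midpoints, so the Poincare inequality controls every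
      combination by its own gradient.\<close>
    have inv: "is_weak_grad ?Y (\<lambda>y. fst (z y)) (\<lambda>y. snd (z y)) \<and> integrable ?M (\<lambda>y. fst (z y)) \<and> (\<integral>y. fst (z y) \<partial>?M) = 0 \<and> (\<lambda>y. snd (z y)) \<in> Lp_space p ?Y"
      if "z \<in> midhull (\<lambda>k y. (vv k y - \<xi> *v y, if y \<in> ?Y then V k y - \<xi> else 0)) n" for z n
      using that
    proof (induction rule: midhull.induct)
      case (base k)
      have g: "is_weak_grad ?Y (\<lambda>y. vv k y - \<xi> *v y) (\<lambda>y. if y \<in> ?Y then V k y - \<xi> else 0)"
        by (rule is_weak_grad_cong[OF open_unit_cube _ _ is_weak_grad_diff[OF open_unit_cube vg lg]]) auto
      have "(\<lambda>y. if y \<in> ?Y then V k y - \<xi> else 0) \<in> Lp_space p ?Y"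
        by (rule Lp_space_cong_AE[OF Lp_space_diff[OF p VL constL] is_weak_grad_measurable(2)[OF g]]) (auto intro!: AE_I2)
      moreover have "(\<integral>y. vv k y - \<xi> *v y \<partial>?M) = 0"
        using LpI[OF vL] li vmean by (simp add: ml_def)
      ultimately show ?case using g LpI[OF vL, of k] li by simp
    next
      case (mid z1 z2)
      have "is_weak_grad ?Y (\<lambda>y. (1/2) *\<^sub>R (fst (z1 y) + fst (z2 y))) (\<lambda>y. (1/2) *\<^sub>R (snd (z1 y) + snd (z2 y)))"
        using mid by (intro is_weak_grad_scaleR is_weak_grad_add open_unit_cube) auto
      moreover have "(\<lambda>y. (1/2) *\<^sub>R (snd (z1 y) + snd (z2 y))) \<in> Lp_space p ?Y"
        using mid by (intro Lp_space_scaleR Lp_space_add p) auto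
      ultimately show ?case using mid by simp
    qed
    show "(\<lambda>n. \<integral>\<^sup>+y. ennreal (norm (fst (x n y)) powr p) \<partial>?M) \<longlonglongrightarrow> 0"
    proof (rule tendsto_sandwich[OF _ _ tendsto_const])
      show "eventually (\<lambda>n. (\<integral>\<^sup>+y. ennreal (norm (fst (x n y)) powr p) \<partial>?M) \<le>
         ennreal (2 ^ CARD('n) * CARD('n) powr p) * (\<integral>\<^sup>+y. ennreal (norm (snd (x n y)) powr p) \<partial>?M)) sequentially"
      proof (intro always_eventually allI)
        fix n
        note i = inv[OF xh[of n]]
        show "(\<integral>\<^sup>+y. ennreal (norm (fst (x n y)) powr p) \<partial>?M) \<le>
         ennreal (2 ^ CARD('n) * CARD('n) powr p) * (\<integral>\<^sup>+y. ennreal (norm (snd (x n y)) powr p) \<partial>?M)"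
          using poincare_unit_cube[OF p, of "\<lambda>y. fst (x n y)" "\<lambda>y. snd (x n y)"] i by simp
      qed
      have "(\<lambda>n. ennreal (2 ^ CARD('n) * CARD('n) powr p) * (\<integral>\<^sup>+y. ennreal (norm (snd (x n y)) powr p) \<partial>?M)) \<longlonglongrightarrow> ennreal (2 ^ CARD('n) * CARD('n) powr p) * 0"
        by (intro ennreal_tendsto_cmult xs) simp
      then show "(\<lambda>n. ennreal (2 ^ CARD('n) * CARD('n) powr p) * (\<integral>\<^sup>+y. ennreal (norm (snd (x n y)) powr p) \<partial>?M)) \<longlonglongrightarrow> 0" by simp
    qed auto
  qed
  moreover have "energy L ?Y (vv n) \<le> ennreal t" for n
    using energy_eq[OF open_unit_cube vg, of L n] en by simp
  ultimately have "L \<xi> \<le> ennreal t" using quasiconvex_limit[OF p L C qc _ t(2)] by blast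
  then show False using t'(2) t by simp
qed

text \<open>Fatou's lemma is used first in the generation \<open>j\<close> and then in
  \<open>n\<close>. What remains is the integral of an average, which is the integral of the density
  itself, so the bound is the same for every \<open>j\<close>. The term with \<open>\<delta>\<close>
  costs at most \<open>\<delta> * K\<close>, where \<open>K\<close> bounds the gradients of the
  whole sequence.\<close>

theorem quasiconvex_imp_lsc:
  fixes L :: "real^'n::finite^'m::finite \<Rightarrow> ennreal"
  assumes O: "open \<Omega>" "bounded \<Omega>" and p: "1 < p" and L: "continuous_on UNIV L"
    and C: "condition_Cpp p L" and qc: "W1p_quasiconvex p L"
  shows "W1p_seq_weakly_lsc p \<Omega> (energy L \<Omega>)"
  unfolding W1p_seq_weakly_lsc_def
proof (intro allI impI)
  fix u and v :: "real^'n \<Rightarrow> real^'m" assume conv: "W1p_weakly_converges p \<Omega> u v"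
  have Om: "\<Omega> \<in> lmeasurable" using O by (rule lmeasurable_open[rotated])
  have OL: "\<Omega> \<in> sets lebesgue" using Om by auto
  have uW: "u n \<in> W1p p \<Omega>" and vW: "v \<in> W1p p \<Omega>" for n using conv by (auto simp: W1p_weakly_converges_def)
  obtain C0 where C0: "\<And>n. grad_norm p \<Omega> (u n) \<le> C0" using weakly_convergent_grad_bounded[OF p O(1) conv] by blast
  define K where "K = C0 powr p"
  define G where "G n = weak_grad \<Omega> (u n)" for n
  define H where "H = weak_grad \<Omega> v"
  have GK: "(\<integral>\<^sup>+x. ennreal (norm (G n x) powr p) \<partial>lebesgue_on \<Omega>) \<le> ennreal K" for n
    unfolding G_def K_def by (rule Lp_bound_of_grad_norm[OF p O(1) uW C0])
  have Gm[measurable]: "G n \<in> borel_measurable (lebesgue_on \<Omega>)" for n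
    using W1p_D(3)[OF O(1) uW] by (auto simp: Lp_space_def G_def)
  have HL: "H \<in> Lp_space p \<Omega>" using W1p_D(3)[OF O(1) vW] by (auto simp: H_def)
  have [measurable]: "L \<in> borel_measurable borel" by (rule borel_measurable_continuous_onI[OF L])
  have Hi: "integrable (lebesgue_on \<Omega>) H"
    using HL by (intro integrable_of_powr[OF finite_measure_lebesgue_on[OF Om] _ p]) (auto simp: Lp_space_iff)
  \<comment> \<open>Extension by zero makes dyadic differentiation on the whole space applicable.
    Around a point of the open set all sufficiently fine cubes lie inside, where nothing
    changes.\<close>
  define H0 where "H0 x = indicat_real \<Omega> x *\<^sub>R H x" for x
  have H0i: "integrable lebesgue H0" using Hi OL by (simp add: integrable_restrict_space H0_def[abs_def])
  obtain r :: "nat \<Rightarrow> nat" where r: "strict_mono r"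
    "AE x in lebesgue. (\<lambda>j. ennreal (1 / dvol TYPE('n) (r j)) * (\<integral>\<^sup>+y. ennreal (norm (H0 y - H0 x)) \<partial>lebesgue_on (dcube (r j) x))) \<longlonglongrightarrow> 0"
    using dyadic_differentiation[OF H0i] by blast
  have main: "energy L \<Omega> v \<le> liminf (\<lambda>n. energy L \<Omega> (u n)) + ennreal (\<delta> * K)" if dl: "\<delta> > 0" for \<delta> :: real
  proof -
    define F where "F n y = L (G n y) + ennreal (\<delta> * norm (G n y) powr p)" for n y
    define F0 where "F0 n y = F n y * indicator \<Omega> y" for n y
    have Fm[measurable]: "F n \<in> borel_measurable (lebesgue_on \<Omega>)" for n unfolding F_def[abs_def] by measurable
    have F0m: "F0 n \<in> borel_measurable lebesgue" for n
      using Fm[of n] OL unfolding F0_def[abs_def] by (subst (asm) borel_measurable_restrict_space_iff_ennreal) auto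
    have F0int: "(\<integral>\<^sup>+x. F0 n x \<partial>lebesgue) \<le> energy L \<Omega> (u n) + ennreal (\<delta> * K)" for n
    proof -
      have "(\<integral>\<^sup>+x. F0 n x \<partial>lebesgue) = (\<integral>\<^sup>+x. F n x \<partial>lebesgue_on \<Omega>)"
        using OL by (simp add: nn_integral_restrict_space F0_def)
      also have "\<dots> = (\<integral>\<^sup>+x. L (G n x) \<partial>lebesgue_on \<Omega>) + (\<integral>\<^sup>+x. ennreal \<delta> * ennreal (norm (G n x) powr p) \<partial>lebesgue_on \<Omega>)"
        unfolding F_def using dl by (subst nn_integral_add) (auto simp: ennreal_mult)
      also have "(\<integral>\<^sup>+x. ennreal \<delta> * ennreal (norm (G n x) powr p) \<partial>lebesgue_on \<Omega>) = ennreal \<delta> * (\<integral>\<^sup>+x. ennreal (norm (G n x) powr p) \<partial>lebesgue_on \<Omega>)"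
        by (rule nn_integral_cmult) measurable
      also have "(\<integral>\<^sup>+x. L (G n x) \<partial>lebesgue_on \<Omega>) + ennreal \<delta> * (\<integral>\<^sup>+x. ennreal (norm (G n x) powr p) \<partial>lebesgue_on \<Omega>) \<le> energy L \<Omega> (u n) + ennreal \<delta> * ennreal K"
        using GK by (intro add_mono mult_left_mono) (auto simp: energy_def G_def)
      also have "ennreal \<delta> * ennreal K = ennreal (\<delta> * K)" using dl by (simp add: ennreal_mult K_def)
      finally show ?thesis .
    qed
    have "energy L \<Omega> v = (\<integral>\<^sup>+x. L (H x) * indicator \<Omega> x \<partial>lebesgue)"
      using OL by (simp add: energy_def H_def nn_integral_restrict_space)
    also have "\<dots> \<le> (\<integral>\<^sup>+x. liminf (\<lambda>j. liminf (\<lambda>n. eavg (r j) (F0 n) x)) \<partial>lebesgue)"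
    proof (rule nn_integral_mono_AE, use r(2) in eventually_elim)
      case (elim x)
      show ?case
      proof (cases "x \<in> \<Omega>")
        case True
        obtain j0 where j0: "\<And>j. j \<ge> j0 \<Longrightarrow> dcube j x \<subseteq> \<Omega>" using open_dcube_exhaust[OF O(1) True] by blast
        have rj: "r j \<ge> j0" if "j \<ge> j0" for j using seq_suble[OF r(1), of j] that by linarith
        have e1: "eavg (r j) (F0 n) x = eavg (r j) (F n) x" if "j \<ge> j0" for j n
          unfolding eavg_def using j0[OF rj[OF that]] by (intro arg_cong2[where f="(*)"] refl nn_integral_cong) (auto simp: F0_def)
        have o1: "(\<lambda>j. eavg (r j) (\<lambda>y. ennreal (norm (H y - H x))) x) \<longlonglongrightarrow> 0"
        proof (rule Lim_transform_eventually[OF elim], rule eventually_sequentiallyI[of j0])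
          fix j assume j: "j0 \<le> j"
          show "ennreal (1 / dvol TYPE('n) (r j)) * (\<integral>\<^sup>+y. ennreal (norm (H0 y - H0 x)) \<partial>lebesgue_on (dcube (r j) x)) = eavg (r j) (\<lambda>y. ennreal (norm (H y - H x))) x"
            unfolding eavg_def using j0[OF rj[OF j]] True
            by (intro arg_cong2[where f="(*)"] refl nn_integral_cong) (auto simp: H0_def subset_iff)
        qed
        have "L (H x) \<le> liminf (\<lambda>j. liminf (\<lambda>n. eavg (r j) (F n) x))"
          using blow_up[OF p L C qc O(1) uW vW weakly_convergent_integral_grad[OF p O(1) conv] dl True r(1), of "H x"] o1
          by (simp add: F_def[abs_def] G_def H_def)
        also have "\<dots> = liminf (\<lambda>j. liminf (\<lambda>n. eavg (r j) (F0 n) x))"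
          by (rule Liminf_eq, rule eventually_sequentiallyI[of j0]) (simp add: e1)
        finally show ?thesis using True by simp
      qed simp
    qed
    also have "\<dots> \<le> liminf (\<lambda>j. \<integral>\<^sup>+x. liminf (\<lambda>n. eavg (r j) (F0 n) x) \<partial>lebesgue)"
      by (intro nn_integral_liminf borel_measurable_liminf eavg_measurable)
    also have "\<dots> \<le> liminf (\<lambda>j::nat. liminf (\<lambda>n. energy L \<Omega> (u n)) + ennreal (\<delta> * K))"
    proof (rule Liminf_mono, rule always_eventually, rule allI)
      fix j
      have "(\<integral>\<^sup>+x. liminf (\<lambda>n. eavg (r j) (F0 n) x) \<partial>lebesgue) \<le> liminf (\<lambda>n. \<integral>\<^sup>+x. eavg (r j) (F0 n) x \<partial>lebesgue)"
        by (intro nn_integral_liminf eavg_measurable)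
      also have "\<dots> = liminf (\<lambda>n. \<integral>\<^sup>+x. F0 n x \<partial>lebesgue)"
        unfolding eavg_def using tower_dcube_level[OF F0m] by simp
      also have "\<dots> \<le> liminf (\<lambda>n. energy L \<Omega> (u n) + ennreal (\<delta> * K))"
        by (intro Liminf_mono always_eventually allI F0int)
      also have "\<dots> = liminf (\<lambda>n. energy L \<Omega> (u n)) + ennreal (\<delta> * K)"
        by (rule Liminf_add_const) simp
      finally show "(\<integral>\<^sup>+x. liminf (\<lambda>n. eavg (r j) (F0 n) x) \<partial>lebesgue) \<le> liminf (\<lambda>n. energy L \<Omega> (u n)) + ennreal (\<delta> * K)" .
    qed
    also have "\<dots> = liminf (\<lambda>n. energy L \<Omega> (u n)) + ennreal (\<delta> * K)" by (simp add: Liminf_const)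
    finally show ?thesis .
  qed
  show "energy L \<Omega> v \<le> liminf (\<lambda>n. energy L \<Omega> (u n))"
  proof (rule ennreal_le_epsilon)
    fix e :: real assume e: "e > 0"
    have "K \<ge> 0" by (simp add: K_def)
    \<comment> \<open>\<open>K + 1\<close> is the denominator because \<open>K\<close> may be
      zero.\<close>
    then have d: "e / (K + 1) > 0" "e / (K + 1) * K \<le> e" using e by (auto simp: field_simps)
    have "energy L \<Omega> v \<le> liminf (\<lambda>n. energy L \<Omega> (u n)) + ennreal (e / (K + 1) * K)" by (rule main[OF d(1)])
    also have "\<dots> \<le> liminf (\<lambda>n. energy L \<Omega> (u n)) + ennreal e" by (intro add_left_mono ennreal_leI d(2))
    finally show "energy L \<Omega> v \<le> liminf (\<lambda>n. energy L \<Omega> (u n)) + ennreal e" .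
  qed
qed

subsection \<open>Lower semicontinuity implies quasiconvexity\<close>

text \<open>Jensen's inequality with total mass one: L^1 norms are bounded by L^p norms with
  constant 1.\<close>

lemma integral_norm_le_W1p_norm:
  fixes u :: "real^'n::finite \<Rightarrow> real^'m::finite"
  assumes p: "1 < p" and O: "open \<Omega>" "\<Omega> \<in> lmeasurable" "measure lebesgue \<Omega> = 1"
    and u: "u \<in> Lp_space p \<Omega>" "is_weak_grad \<Omega> u G" "G \<in> Lp_space p \<Omega>"
  shows "integrable (lebesgue_on \<Omega>) u" "integrable (lebesgue_on \<Omega>) G"
    "(\<integral>x. norm (u x) \<partial>lebesgue_on \<Omega>) \<le> W1p_norm p \<Omega> u" "(\<integral>x. norm (G x) \<partial>lebesgue_on \<Omega>) \<le> W1p_norm p \<Omega> u"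
proof -
  let ?M = "lebesgue_on \<Omega>"
  have fm: "finite_measure ?M" by (rule finite_measure_lebesgue_on[OF O(2)])
  have OL: "\<Omega> \<in> sets lebesgue" using O by auto
  define A where "A = (\<integral>x. norm (u x) powr p \<partial>?M)"
  define D where "D = (\<integral>x. norm (G x) powr p \<partial>?M)"
  have AD: "A \<ge> 0" "D \<ge> 0" by (auto simp: A_def D_def)
  have W: "W1p_norm p \<Omega> u = (A + D) powr (1 / p)" using W1p_norm_eq[OF O(1) u(2)] by (simp add: A_def D_def)
  have gen: "integrable ?M f \<and> (\<integral>x. norm (f x) \<partial>?M) powr p \<le> (\<integral>x. norm (f x) powr p \<partial>?M)"
    if f: "f \<in> Lp_space p \<Omega>" for f :: "real^'n \<Rightarrow> 'c::euclidean_space"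
  proof
    have fM: "f \<in> borel_measurable ?M" using f by (simp add: Lp_space_def)
    show fi: "integrable ?M f" using f by (intro integrable_of_powr[OF fm _ p]) (auto simp: Lp_space_iff)
    have "ennreal (norm (\<integral>x. norm (f x) \<partial>?M) powr p) \<le> ennreal (measure ?M (space ?M) powr (p - 1)) * (\<integral>\<^sup>+x. ennreal (norm (norm (f x)) powr p) \<partial>?M)"
      using fM by (intro jensen_powr[OF fm _ p]) measurable
    also have "\<dots> = ennreal (\<integral>x. norm (f x) powr p \<partial>?M)"
      using f O(3) OL by (subst nn_integral_eq_integral) (auto simp: Lp_space_def measure_restrict_space)
    finally show "(\<integral>x. norm (f x) \<partial>?M) powr p \<le> (\<integral>x. norm (f x) powr p \<partial>?M)"
      by (subst (asm) ennreal_le_iff) auto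
  qed
  have root: "x \<le> (A + D) powr (1 / p)" if x: "x \<ge> 0" "x powr p \<le> A + D" for x
  proof -
    have "x = (x powr p) powr (1 / p)" using x p by (simp add: powr_powr)
    also have "\<dots> \<le> (A + D) powr (1 / p)" using x p by (intro powr_mono2) auto
    finally show ?thesis .
  qed
  show "integrable ?M u" "integrable ?M G" using gen u by blast+
  show "(\<integral>x. norm (u x) \<partial>?M) \<le> W1p_norm p \<Omega> u"
    unfolding W using gen[OF u(1)] AD by (intro root) (auto simp: A_def)
  show "(\<integral>x. norm (G x) \<partial>?M) \<le> W1p_norm p \<Omega> u"
    unfolding W using gen[OF u(3)] AD by (intro root) (auto simp: D_def)
qed

text \<open>\<open>\<psi>\<close> may be nonzero on the boundary of the cube; the absence of a
  boundary term is what zero boundary values of \<open>\<phi>\<close> mean. It is clear for the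
  approximating test functions and passes to the limit because \<open>\<psi>\<close> and its
  derivative are bounded on the cube.\<close>

lemma W1p_0_integration_by_parts:
  fixes \<phi> :: "real^'n::finite \<Rightarrow> real^'m::finite" and \<psi> :: "real^'n \<Rightarrow> real"
  assumes p: "1 < p" and phi: "\<phi> \<in> W1p_0 p unit_cube" and C: "C1 \<psi>"
  shows "(\<integral>x. \<phi> x $ i * partial_deriv j \<psi> x + weak_grad unit_cube \<phi> x $ i $ j * \<psi> x \<partial>lebesgue_on unit_cube) = 0"
proof -
  let ?Y = "unit_cube :: (real^'n) set"
  let ?M = "lebesgue_on ?Y"
  define \<Phi> where "\<Phi> = weak_grad ?Y \<phi>"
  have W: "\<phi> \<in> W1p p ?Y" using phi by (simp add: W1p_0_def)
  obtain t where t: "\<And>k. t k \<in> test_functions ?Y" "(\<lambda>k. W1p_norm p ?Y (\<lambda>x. \<phi> x - t k x)) \<longlonglongrightarrow> 0"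
    using phi by (auto simp: W1p_0_def)
  note pw = W1p_D[OF open_unit_cube W, folded \<Phi>_def]
  define T where "T k x = (\<chi> i j. partial_deriv j (t k) x $ i)" for k x
  have tw: "is_weak_grad ?Y (t k) (T k)" for k
    unfolding T_def[abs_def] by (rule is_weak_grad_C1[OF open_unit_cube C1_test[OF t(1)]])
  interpret Y: finite_measure ?M by (rule finite_measure_lebesgue_on) simp
  have cl: "f \<in> Lp_space p ?Y" if "continuous_on UNIV f" and K: "compact K" "\<And>x. x \<notin> K \<Longrightarrow> f x = 0" for f :: "real^'n \<Rightarrow> 'c::euclidean_space" and K
  proof -
    have "bounded (f ` K)" using K(1) continuous_on_subset[OF that(1)] by (intro compact_imp_bounded compact_continuous_image) auto
    then obtain B where B: "B > 0" "\<And>x. x \<in> K \<Longrightarrow> norm (f x) \<le> B" unfolding bounded_pos by auto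
    have Bf: "norm (f x) \<le> B" for x using B K(2) by (cases "x \<in> K") auto
    have m: "f \<in> borel_measurable ?M" by (intro measurable_restrict_space1 borel_measurable_continuous_lebesgue that(1))
    have "integrable ?M (\<lambda>x. norm (f x) powr p)"
    proof (rule Y.integrable_const_bound[of _ "B powr p"])
      show "AE x in ?M. norm (norm (f x) powr p) \<le> B powr p" using p Bf by (intro AE_I2) (auto intro!: powr_mono2)
    qed (use m in measurable)
    then show ?thesis using m by (simp add: Lp_space_def)
  qed
  have tL: "t k \<in> Lp_space p ?Y" "T k \<in> Lp_space p ?Y" for k
  proof -
    obtain K where K: "compact K" "\<And>x. x \<notin> K \<Longrightarrow> t k x = 0" "\<And>j x. x \<notin> K \<Longrightarrow> partial_deriv j (t k) x = 0"
      "continuous_on UNIV (t k)" "\<And>j. continuous_on UNIV (partial_deriv j (t k))"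
      using test_function_props[OF t(1)[of k]] by metis
    show "t k \<in> Lp_space p ?Y" by (rule cl[OF K(4,1,2)])
    show "T k \<in> Lp_space p ?Y"
      unfolding T_def[abs_def] using K(3)
      by (intro cl[OF _ K(1)] continuous_on_vec_lambda continuous_on_component K(5)) (simp add: vec_eq_iff)
  qed
  note dw = is_weak_grad_diff[OF open_unit_cube pw(2) tw]
  note n = integral_norm_le_W1p_norm[OF p open_unit_cube unit_cube_lmeasurable measure_unit_cube
      Lp_space_diff[OF p pw(1) tL(1)] dw Lp_space_diff[OF p pw(3) tL(2)]]
  have pi: "integrable ?M \<phi>" "integrable ?M \<Phi>"
    using pw(1,3) by (auto intro!: integrable_of_powr[OF Y.finite_measure_axioms _ p] simp: Lp_space_iff)
  have ti: "integrable ?M (t k)" "integrable ?M (T k)" for k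
    using tL[of k] by (auto intro!: integrable_of_powr[OF Y.finite_measure_axioms _ p] simp: Lp_space_iff)
  have bd: "\<exists>B\<ge>0. \<forall>x\<in>?Y. \<bar>g x\<bar> \<le> B" if "continuous_on UNIV g" for g :: "real^'n \<Rightarrow> real"
  proof -
    have "compact (closure ?Y)" by (simp add: compact_closure)
    then have "bounded (g ` closure ?Y)" using continuous_on_subset[OF that] by (intro compact_imp_bounded compact_continuous_image) auto
    then obtain B where B: "B > 0" "\<And>x. x \<in> closure ?Y \<Longrightarrow> norm (g x) \<le> B" unfolding bounded_pos by auto
    then show ?thesis using closure_subset by (intro exI[of _ B]) auto
  qed
  have cpsi: "continuous_on UNIV \<psi>" "continuous_on UNIV (partial_deriv j \<psi>)"
    using C1_continuous[OF C] C by (auto simp: C1_def)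
  obtain B where B: "B \<ge> 0" "\<And>x. x \<in> ?Y \<Longrightarrow> \<bar>\<psi> x\<bar> \<le> B" using bd[OF cpsi(1)] by blast
  obtain B' where B': "B' \<ge> 0" "\<And>x. x \<in> ?Y \<Longrightarrow> \<bar>partial_deriv j \<psi> x\<bar> \<le> B'" using bd[OF cpsi(2)] by blast
  have ms: "\<psi> \<in> borel_measurable ?M" "partial_deriv j \<psi> \<in> borel_measurable ?M"
    using cpsi by (auto intro!: measurable_restrict_space1 borel_measurable_continuous_lebesgue)
  have mi: "integrable ?M (\<lambda>x. f x * g x)" "\<bar>\<integral>x. f x * g x \<partial>?M\<bar> \<le> b * (\<integral>x. \<bar>f x\<bar> \<partial>?M)"
    if f: "integrable ?M f" and g: "g \<in> borel_measurable ?M" "\<And>x. x \<in> ?Y \<Longrightarrow> \<bar>g x\<bar> \<le> b" "b \<ge> 0" for f g :: "real^'n \<Rightarrow> real" and b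
  proof -
    show i: "integrable ?M (\<lambda>x. f x * g x)"
    proof (rule Bochner_Integration.integrable_bound)
      show "integrable ?M (\<lambda>x. b * f x)" using f by auto
      show "AE x in ?M. norm (f x * g x) \<le> norm (b * f x)"
      proof (rule AE_I2)
        fix x assume "x \<in> space ?M"
        then have "\<bar>g x\<bar> \<le> b" using g(2) by simp
        from mult_right_mono[OF this, of "\<bar>f x\<bar>"] show "norm (f x * g x) \<le> norm (b * f x)"
          using g(3) by (simp add: abs_mult mult.commute)
      qed
    qed (use f g in auto)
    have "\<bar>\<integral>x. f x * g x \<partial>?M\<bar> \<le> (\<integral>x. \<bar>f x * g x\<bar> \<partial>?M)" by (rule integral_abs_bound)
    also have "\<dots> \<le> (\<integral>x. b * \<bar>f x\<bar> \<partial>?M)"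
    proof (rule integral_mono)
      show "\<bar>f x * g x\<bar> \<le> b * \<bar>f x\<bar>" if "x \<in> space ?M" for x
        using that mult_right_mono[OF g(2)[of x], of "\<bar>f x\<bar>"] by (simp add: abs_mult mult.commute)
    qed (use f i in auto)
    finally show "\<bar>\<integral>x. f x * g x \<partial>?M\<bar> \<le> b * (\<integral>x. \<bar>f x\<bar> \<partial>?M)" by simp
  qed
  have ci: "integrable ?M (\<lambda>x. f x $ i)" if "integrable ?M f" for f :: "real^'n \<Rightarrow> real^'m"
    by (rule integrable_bounded_linear[OF bounded_linear_vec_nth that])
  have bl: "bounded_linear (\<lambda>A :: real^'n^'m. A $ i $ j)"
    by (rule bounded_linear_compose[of "\<lambda>v. v $ j" "\<lambda>A. A $ i", OF bounded_linear_vec_nth bounded_linear_vec_nth])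
  have cij: "integrable ?M (\<lambda>x. F x $ i $ j)" if "integrable ?M F" for F :: "real^'n \<Rightarrow> real^'n^'m"
    by (rule integrable_bounded_linear[OF bl that])
  have ibp: "(\<integral>x. t k x $ i * partial_deriv j \<psi> x \<partial>?M) + (\<integral>x. T k x $ i $ j * \<psi> x \<partial>?M) = 0" for k
  proof -
    obtain K where K: "compact K" "K \<subseteq> ?Y" "\<And>x. x \<notin> K \<Longrightarrow> t k x = 0" "\<And>j x. x \<notin> K \<Longrightarrow> partial_deriv j (t k) x = 0" "C1 (t k)"
      using test_function_props[OF t(1)[of k]] by metis
    have z: "t k x = 0" "partial_deriv j (t k) x = 0" if "x \<notin> ?Y" for x using K that by blast+
    have "(\<integral>x. t k x $ i * partial_deriv j \<psi> x \<partial>lebesgue) = - (\<integral>x. partial_deriv j (\<lambda>x. t k x $ i) x * \<psi> x \<partial>lebesgue)"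
      using K by (intro integration_by_parts[OF C1_vec_nth(1)[OF K(5)] C, of K]) auto
    moreover have "(\<integral>x. t k x $ i * partial_deriv j \<psi> x \<partial>?M) = (\<integral>x. t k x $ i * partial_deriv j \<psi> x \<partial>lebesgue)"
      "(\<integral>x. T k x $ i $ j * \<psi> x \<partial>?M) = (\<integral>x. T k x $ i $ j * \<psi> x \<partial>lebesgue)"
      using z by (auto intro!: integral_lebesgue_on_eq simp: T_def)
    ultimately show ?thesis by (simp add: C1_vec_nth(2)[OF K(5)] T_def)
  qed
  define I where "I = (\<integral>x. \<phi> x $ i * partial_deriv j \<psi> x + \<Phi> x $ i $ j * \<psi> x \<partial>?M)"
  have "\<bar>I\<bar> \<le> (B' + B) * W1p_norm p ?Y (\<lambda>x. \<phi> x - t k x)" for k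
  proof -
    define w where "w = W1p_norm p ?Y (\<lambda>x. \<phi> x - t k x)"
    have e1: "integrable ?M (\<lambda>x. (\<phi> x - t k x) $ i)" by (rule ci[OF n(1)])
    have e2: "integrable ?M (\<lambda>x. (\<Phi> x - T k x) $ i $ j)" by (rule cij[OF n(2)])
    have "I = (\<integral>x. \<phi> x $ i * partial_deriv j \<psi> x \<partial>?M) + (\<integral>x. \<Phi> x $ i $ j * \<psi> x \<partial>?M)"
      unfolding I_def by (intro Bochner_Integration.integral_add mi(1)[OF ci[OF pi(1)] ms(2) B'(2,1)] mi(1)[OF cij[OF pi(2)] ms(1) B(2,1)])
    also have "\<dots> = ((\<integral>x. \<phi> x $ i * partial_deriv j \<psi> x \<partial>?M) - (\<integral>x. t k x $ i * partial_deriv j \<psi> x \<partial>?M))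
        + ((\<integral>x. \<Phi> x $ i $ j * \<psi> x \<partial>?M) - (\<integral>x. T k x $ i $ j * \<psi> x \<partial>?M))"
      using ibp[of k] by simp
    also have "(\<integral>x. \<phi> x $ i * partial_deriv j \<psi> x \<partial>?M) - (\<integral>x. t k x $ i * partial_deriv j \<psi> x \<partial>?M) = (\<integral>x. (\<phi> x - t k x) $ i * partial_deriv j \<psi> x \<partial>?M)"
      using mi(1)[OF ci[OF pi(1)] ms(2) B'(2,1)] mi(1)[OF ci[OF ti(1)[of k]] ms(2) B'(2,1)]
      by (simp add: left_diff_distrib)
    also have "(\<integral>x. \<Phi> x $ i $ j * \<psi> x \<partial>?M) - (\<integral>x. T k x $ i $ j * \<psi> x \<partial>?M) = (\<integral>x. (\<Phi> x - T k x) $ i $ j * \<psi> x \<partial>?M)"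
      using mi(1)[OF cij[OF pi(2)] ms(1) B(2,1)] mi(1)[OF cij[OF ti(2)[of k]] ms(1) B(2,1)]
      by (simp add: left_diff_distrib)
    finally have "\<bar>I\<bar> \<le> \<bar>\<integral>x. (\<phi> x - t k x) $ i * partial_deriv j \<psi> x \<partial>?M\<bar> + \<bar>\<integral>x. (\<Phi> x - T k x) $ i $ j * \<psi> x \<partial>?M\<bar>" by simp
    also have "\<dots> \<le> B' * (\<integral>x. \<bar>(\<phi> x - t k x) $ i\<bar> \<partial>?M) + B * (\<integral>x. \<bar>(\<Phi> x - T k x) $ i $ j\<bar> \<partial>?M)"
      by (intro add_mono mi(2)[OF e1 ms(2) B'(2,1)] mi(2)[OF e2 ms(1) B(2,1)])
    also have "\<dots> \<le> B' * w + B * w"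
    proof (intro add_mono mult_left_mono B B')
      have "(\<integral>x. \<bar>(\<phi> x - t k x) $ i\<bar> \<partial>?M) \<le> (\<integral>x. norm (\<phi> x - t k x) \<partial>?M)"
        using e1 n(1)[of k] by (intro integral_mono component_le_norm_cart) auto
      then show "(\<integral>x. \<bar>(\<phi> x - t k x) $ i\<bar> \<partial>?M) \<le> w" using n(3)[of k] by (simp add: w_def)
      have cj: "\<bar>A $ i $ j\<bar> \<le> norm A" for A :: "real^'n^'m"
        using component_le_norm_cart[of "A $ i" j] Finite_Cartesian_Product.norm_nth_le[of A i] by linarith
      have "(\<integral>x. \<bar>(\<Phi> x - T k x) $ i $ j\<bar> \<partial>?M) \<le> (\<integral>x. norm (\<Phi> x - T k x) \<partial>?M)"
        using e2 n(2)[of k] by (intro integral_mono cj) auto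
      then show "(\<integral>x. \<bar>(\<Phi> x - T k x) $ i $ j\<bar> \<partial>?M) \<le> w" using n(4)[of k] by (simp add: w_def)
    qed
    finally show ?thesis by (simp add: w_def distrib_right)
  qed
  moreover have "(\<lambda>k. (B' + B) * W1p_norm p ?Y (\<lambda>x. \<phi> x - t k x)) \<longlonglongrightarrow> 0"
    using tendsto_mult_right_zero[OF t(2)] by blast
  ultimately have "\<bar>I\<bar> \<le> 0" by (intro LIMSEQ_le_const) auto
  then show ?thesis by (simp add: I_def \<Phi>_def)
qed

section \<open>Filling an open set by its maximal dyadic cubes\<close>

locale cube_filling =
  fixes \<Omega> :: "(real^'n::finite) set" and n :: nat
  assumes O: "open \<Omega>" "\<Omega> \<in> lmeasurable"
begin

text \<open>The least admissible generation selects the largest dyadic cube of generation at least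
  \<open>n\<close> around the point. These cubes are equal or disjoint and tile
  \<open>\<Omega>\<close>. The value is meaningful on \<open>\<Omega>\<close>, where openness
  provides an admissible generation.\<close>

definition level :: "real^'n \<Rightarrow> nat" where
  "level x = (LEAST k. n \<le> k \<and> dcube k x \<subseteq> \<Omega>)"

lemma level:
  assumes "x \<in> \<Omega>"
  shows "n \<le> level x" "dcube (level x) x \<subseteq> \<Omega>"
proof -
  obtain k where "\<And>j. j \<ge> k \<Longrightarrow> dcube j x \<subseteq> \<Omega>" using open_dcube_exhaust[OF O(1) assms] by blast
  then have "n \<le> max n k \<and> dcube (max n k) x \<subseteq> \<Omega>" by simp
  then have "n \<le> level x \<and> dcube (level x) x \<subseteq> \<Omega>" unfolding level_def by (rule LeastI)
  then show "n \<le> level x" "dcube (level x) x \<subseteq> \<Omega>" by auto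
qed

text \<open>Two points of one cube share all their coarser cubes, so the minimisation sees the same
  candidates for both.\<close>

lemma level_const:
  assumes x: "x \<in> \<Omega>" and y: "y \<in> dcube (level x) x"
  shows "level y = level x"
proof -
  have eq: "dcube k y = dcube k x" if "k \<le> level x" for k
    using dcube_mono[OF that, of x] y by (intro dcube_eq) blast
  show ?thesis
    unfolding level_def[of y]
  proof (rule Least_equality)
    show "n \<le> level x \<and> dcube (level x) y \<subseteq> \<Omega>" using level[OF x] eq by simp
    fix k assume k: "n \<le> k \<and> dcube k y \<subseteq> \<Omega>"
    show "level x \<le> k"
    proof (rule ccontr)
      assume "\<not> level x \<le> k"
      then have "k < level x" "n \<le> k \<and> dcube k x \<subseteq> \<Omega>" using k eq[of k] by auto
      then show False using not_less_Least unfolding level_def by blast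
    qed
  qed
qed

definition loc :: "real^'n \<Rightarrow> real^'n" where
  "loc x = 2 ^ level x *\<^sub>R (x - dcenter (level x) x)"

text \<open>The family \<open>g\<close> depends on the generation because functions are scaled by
  the side length of their cell while gradients are not.\<close>

definition fill :: "(nat \<Rightarrow> real^'n \<Rightarrow> 'b::euclidean_space) \<Rightarrow> real^'n \<Rightarrow> 'b" where
  "fill g x = (if x \<in> \<Omega> then g (level x) (loc x) else 0)"

lemma in_cell:
  assumes x: "x \<in> \<Omega>" and y: "y \<in> unit_cube"
  defines "z \<equiv> dcenter (level x) x + (1 / 2 ^ level x) *\<^sub>R y"
  shows "z \<in> dcube (level x) x" "z \<in> \<Omega>" "level z = level x" "loc z = y" "fill g z = g (level x) y"
proof -
  show z: "z \<in> dcube (level x) x" unfolding z_def by (rule unit_cube_to_dcube[OF y])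
  then show zO: "z \<in> \<Omega>" using level(2)[OF x] by blast
  show l: "level z = level x" by (rule level_const[OF x z])
  show c: "loc z = y" unfolding loc_def l dcenter_eq[OF z] by (simp add: z_def)
  show "fill g z = g (level x) y" using zO by (simp add: fill_def l c)
qed

text \<open>On each of countably many cells the filled function is one \<open>g k\<close> composed
  with an affine map, so measurability is checked piece by piece.\<close>

lemma fill_measurable:
  fixes g :: "nat \<Rightarrow> real^'n \<Rightarrow> 'b::euclidean_space"
  assumes g: "\<And>k. g k \<in> borel_measurable lebesgue"
  shows "fill g \<in> borel_measurable lebesgue"
proof -
  define A where "A = (\<lambda>(k, z). {x \<in> \<Omega>. level x = k} \<inter> dcube k (gpoint k z))"
  define C where "C = insert (- \<Omega>) (range (A :: nat \<times> ('n \<Rightarrow> int) \<Rightarrow> _))"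
  have OL: "\<Omega> \<in> sets lebesgue" using O by auto
  have lev: "{x \<in> \<Omega>. level x = k} \<in> sets lebesgue" for k
  proof -
    have "{x \<in> \<Omega>. level x = k} \<in> sets borel"
    proof (rule dcube_union_borel[of _ k])
      fix x assume x: "x \<in> {x \<in> \<Omega>. level x = k}"
      then show "dcube k x \<subseteq> {x \<in> \<Omega>. level x = k}" using level(2)[of x] level_const[of x] by auto
    qed
    then show ?thesis by simp
  qed
  show ?thesis
  proof (rule measurable_piecewise_restrict[of C])
    show "countable C" by (simp add: C_def)
    show "space lebesgue \<subseteq> \<Union> C"
    proof
      fix x :: "real^'n"
      show "x \<in> \<Union> C"
      proof (cases "x \<in> \<Omega>")
        case True
        then have "x \<in> A (level x, \<lambda>i. \<lfloor>2 ^ level x * x $ i\<rfloor>)" by (simp add: A_def dcube_gpoint)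
        then show ?thesis by (auto simp: C_def)
      qed (simp add: C_def)
    qed
    fix S assume "S \<in> C"
    then consider "S = - \<Omega>" | k z where "S = A (k, z)" by (auto simp: C_def)
    note cs = this
    then show "S \<inter> space lebesgue \<in> sets lebesgue"
      using OL lev by cases (auto simp: A_def Compl_in_sets_lebesgue)
    from cs show "fill g \<in> borel_measurable (restrict_space lebesgue S)"
    proof cases
      case 1
      have "fill g \<in> borel_measurable (lebesgue_on S) \<longleftrightarrow> (\<lambda>_. 0 :: 'b) \<in> borel_measurable (lebesgue_on S)"
        by (rule measurable_lebesgue_cong) (simp add: 1 fill_def)
      then show ?thesis by simp
    next
      case (2 k z)
      let ?c = "dcenter k (gpoint k z)"
      have "fill g \<in> borel_measurable (lebesgue_on S) \<longleftrightarrow> (\<lambda>x. g k (- (2 ^ k *\<^sub>R ?c) + 2 ^ k *\<^sub>R x)) \<in> borel_measurable (lebesgue_on S)"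
      proof (rule measurable_lebesgue_cong)
        fix x assume "x \<in> S"
        then have x: "x \<in> \<Omega>" "level x = k" "x \<in> dcube k (gpoint k z)" by (auto simp: 2 A_def)
        then show "fill g x = g k (- (2 ^ k *\<^sub>R ?c) + 2 ^ k *\<^sub>R x)"
          using dcenter_eq[OF x(3)] by (simp add: fill_def loc_def scaleR_diff_right)
      qed
      moreover have "(\<lambda>x. g k (- (2 ^ k *\<^sub>R ?c) + 2 ^ k *\<^sub>R x)) \<in> borel_measurable lebesgue"
        by (rule measurable_compose[OF measurable_lebesgue_affine g]) simp
      ultimately show ?thesis using measurable_restrict_space1 by blast
    qed
  qed
qed

text \<open>\<open>tower_dcube\<close> with the variable generation \<open>level\<close>: the
  integral over \<open>S\<close> of normalised cell integrals takes the place of a sum over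
  cells.\<close>

lemma nn_integral_cells:
  assumes S: "S \<subseteq> \<Omega>" "\<And>x. x \<in> S \<Longrightarrow> dcube (level x) x \<subseteq> S" and f: "f \<in> borel_measurable (lebesgue_on S)"
  shows "(\<integral>\<^sup>+x. f x \<partial>lebesgue_on S) =
    (\<integral>\<^sup>+x. (\<integral>\<^sup>+y. f (dcenter (level x) x + (1 / 2 ^ level x) *\<^sub>R y) \<partial>lebesgue_on unit_cube) \<partial>lebesgue_on S)"
proof -
  have "(\<integral>\<^sup>+x. f x \<partial>lebesgue_on S) =
     (\<integral>\<^sup>+x. ennreal (1 / dvol TYPE('n) (level x)) * (\<integral>\<^sup>+y. f y \<partial>lebesgue_on (dcube (level x) x)) \<partial>lebesgue_on S)"
  proof (rule tower_dcube[symmetric, OF _ _ f])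
    show "dcube (level x) x \<subseteq> S" if "x \<in> S" for x by (rule S(2)[OF that])
    show "level y = level x" if "x \<in> S" "y \<in> dcube (level x) x" for x y using S(1) that by (intro level_const) auto
  qed
  also have "\<dots> = (\<integral>\<^sup>+x. (\<integral>\<^sup>+y. f (dcenter (level x) x + (1 / 2 ^ level x) *\<^sub>R y) \<partial>lebesgue_on unit_cube) \<partial>lebesgue_on S)"
  proof (rule nn_integral_cong)
    fix x assume "x \<in> space (lebesgue_on S)"
    then have "dcube (level x) x \<subseteq> S" using S by simp
    from nn_integral_dcube[OF measurable_restrict_mono[OF f this]]
    show "ennreal (1 / dvol TYPE('n) (level x)) * (\<integral>\<^sup>+y. f y \<partial>lebesgue_on (dcube (level x) x)) =
      (\<integral>\<^sup>+y. f (dcenter (level x) x + (1 / 2 ^ level x) *\<^sub>R y) \<partial>lebesgue_on unit_cube)"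
      by (simp add: mult.assoc[symmetric] ennreal_mult[symmetric])
  qed
  finally show ?thesis .
qed

text \<open>On each cell the positive and negative parts have equal integrals, so the nonnegative
  formula gives equal totals; no countable signed sum over cells arises.\<close>

lemma integral_cells_eq_0:
  fixes q :: "real^'n \<Rightarrow> real"
  assumes S: "S \<subseteq> \<Omega>" "S \<in> sets lebesgue" "\<And>x. x \<in> S \<Longrightarrow> dcube (level x) x \<subseteq> S" and q: "integrable (lebesgue_on S) q"
    and z: "\<And>x. x \<in> S \<Longrightarrow> (\<integral>y. q (dcenter (level x) x + (1 / 2 ^ level x) *\<^sub>R y) \<partial>lebesgue_on unit_cube) = 0"
  shows "(\<integral>x. q x \<partial>lebesgue_on S) = 0"
proof -
  let ?Y = "unit_cube :: (real^'n) set"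
  have qm: "q \<in> borel_measurable (lebesgue_on S)" using q by auto
  have "(\<integral>\<^sup>+x. ennreal (q x) \<partial>lebesgue_on S) =
    (\<integral>\<^sup>+x. (\<integral>\<^sup>+y. ennreal (q (dcenter (level x) x + (1 / 2 ^ level x) *\<^sub>R y)) \<partial>lebesgue_on ?Y) \<partial>lebesgue_on S)"
    using qm by (intro nn_integral_cells S) auto
  also have "\<dots> = (\<integral>\<^sup>+x. (\<integral>\<^sup>+y. ennreal (- q (dcenter (level x) x + (1 / 2 ^ level x) *\<^sub>R y)) \<partial>lebesgue_on ?Y) \<partial>lebesgue_on S)"
  proof (rule nn_integral_cong)
    fix x assume "x \<in> space (lebesgue_on S)"
    then have x: "x \<in> S" by simp
    let ?h = "\<lambda>y. q (dcenter (level x) x + (1 / 2 ^ level x) *\<^sub>R y)"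
    have "integrable (lebesgue_on (dcube (level x) x)) q"
      by (rule integrable_lebesgue_on_subset[OF q S(3)[OF x] S(2)]) simp
    then have hi: "integrable (lebesgue_on ?Y) ?h" using integrable_dcube[of q "level x" x] by auto
    have "enn2real (\<integral>\<^sup>+y. ennreal (?h y) \<partial>lebesgue_on ?Y) = enn2real (\<integral>\<^sup>+y. ennreal (- ?h y) \<partial>lebesgue_on ?Y)"
      using z[OF x] real_lebesgue_integral_def[OF hi] by simp
    moreover have "(\<integral>\<^sup>+y. ennreal (?h y) \<partial>lebesgue_on ?Y) < top" "(\<integral>\<^sup>+y. ennreal (- ?h y) \<partial>lebesgue_on ?Y) < top"
      using hi unfolding real_integrable_def by (auto simp: less_top)
    ultimately show "(\<integral>\<^sup>+y. ennreal (?h y) \<partial>lebesgue_on ?Y) = (\<integral>\<^sup>+y. ennreal (- ?h y) \<partial>lebesgue_on ?Y)"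
      by (metis ennreal_enn2real)
  qed
  also have "\<dots> = (\<integral>\<^sup>+x. ennreal (- q x) \<partial>lebesgue_on S)"
    using qm by (intro nn_integral_cells[symmetric] S) auto
  finally show ?thesis by (simp add: real_lebesgue_integral_def[OF q])
qed

text \<open>For a family that does not depend on the generation the inner integral is constant, so
  the filled integral is the cube integral times the measure of \<open>\<Omega>\<close>.\<close>

lemma nn_integral_fill:
  fixes g :: "nat \<Rightarrow> real^'n \<Rightarrow> 'b::euclidean_space"
  assumes g: "\<And>k. g k \<in> borel_measurable lebesgue" and h: "h \<in> borel_measurable borel"
  shows "(\<integral>\<^sup>+x. h (fill g x) \<partial>lebesgue_on \<Omega>) = (\<integral>\<^sup>+x. (\<integral>\<^sup>+y. h (g (level x) y) \<partial>lebesgue_on unit_cube) \<partial>lebesgue_on \<Omega>)"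
proof -
  have "(\<lambda>x. h (fill g x)) \<in> borel_measurable (lebesgue_on \<Omega>)"
    by (intro measurable_restrict_space1 measurable_compose[OF fill_measurable h] g)
  then have "(\<integral>\<^sup>+x. h (fill g x) \<partial>lebesgue_on \<Omega>) =
    (\<integral>\<^sup>+x. (\<integral>\<^sup>+y. h (fill g (dcenter (level x) x + (1 / 2 ^ level x) *\<^sub>R y)) \<partial>lebesgue_on unit_cube) \<partial>lebesgue_on \<Omega>)"
    by (intro nn_integral_cells level(2)) auto
  also have "\<dots> = (\<integral>\<^sup>+x. (\<integral>\<^sup>+y. h (g (level x) y) \<partial>lebesgue_on unit_cube) \<partial>lebesgue_on \<Omega>)"
    by (intro nn_integral_cong) (simp add: in_cell(5))
  finally show ?thesis .
qed

end

theorem lsc_imp_quasiconvex: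
  fixes L :: "real^'n::finite^'m::finite \<Rightarrow> ennreal"
  assumes O: "open \<Omega>" "bounded \<Omega>" "\<Omega> \<noteq> {}" and p: "1 < p" and L: "continuous_on UNIV L"
    and lsc: "W1p_seq_weakly_lsc p \<Omega> (energy L \<Omega>)"
  shows "W1p_quasiconvex p L"
  unfolding W1p_quasiconvex_def
proof (intro allI ballI)
  fix \<xi> :: "real^'n^'m" and u :: "real^'n \<Rightarrow> real^'m" assume u: "u \<in> affine_W1p_0 p \<xi>"
  let ?Y = "unit_cube :: (real^'n) set"
  have Om: "\<Omega> \<in> lmeasurable" using O by (intro lmeasurable_open)
  have OL: "\<Omega> \<in> sets lebesgue" using Om by auto
  interpret Om: finite_measure "lebesgue_on \<Omega>" by (rule finite_measure_lebesgue_on[OF Om])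
  define \<phi> where "\<phi> y = u y - \<xi> *v y" for y
  define \<Phi> where "\<Phi> = weak_grad ?Y \<phi>"
  have ph0: "\<phi> \<in> W1p_0 p ?Y" using u by (simp add: affine_W1p_0_def \<phi>_def[abs_def])
  then have "\<phi> \<in> W1p p ?Y" by (simp add: W1p_0_def)
  note pw = W1p_D[OF open_unit_cube this, folded \<Phi>_def]
  note ibp = W1p_0_integration_by_parts[OF p ph0, folded \<Phi>_def]
  define \<phi>0 where "\<phi>0 y = indicat_real ?Y y *\<^sub>R \<phi> y" for y
  define \<Phi>0 where "\<Phi>0 y = indicat_real ?Y y *\<^sub>R \<Phi> y" for y
  have m0: "\<phi>0 \<in> borel_measurable lebesgue" "\<Phi>0 \<in> borel_measurable lebesgue"
    using pw(1,3) by (auto simp: \<phi>0_def[abs_def] \<Phi>0_def[abs_def] Lp_space_def borel_measurable_restrict_space_iff)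
  have fil: "cube_filling \<Omega>" by (rule cube_filling.intro[OF O(1) Om])
  \<comment> \<open>Functions are scaled by the side \<open>1 / 2^k\<close> of their cell, gradients
    are copied unscaled; so \<open>f n\<close> tends to zero while the distribution of the values of
    \<open>F n\<close> does not change.\<close>
  define f where "f n = cube_filling.fill \<Omega> n (\<lambda>k y. (1 / 2^k) *\<^sub>R \<phi>0 y)" for n
  define F where "F n = cube_filling.fill \<Omega> n (\<lambda>k. \<Phi>0)" for n
  have gm: "(\<lambda>y. (1 / 2^k) *\<^sub>R \<phi>0 y) \<in> borel_measurable lebesgue" for k :: nat using m0 by auto
  have fm: "f n \<in> borel_measurable lebesgue" "F n \<in> borel_measurable lebesgue" for n
    unfolding f_def F_def by (intro cube_filling.fill_measurable[OF fil] gm m0)+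
  have [measurable]: "L \<in> borel_measurable borel" by (rule borel_measurable_continuous_onI[OF L])
  define J where "J = (\<integral>x. norm (\<phi> x) powr p \<partial>lebesgue_on ?Y)"
  define D where "D = (\<integral>x. norm (\<Phi> x) powr p \<partial>lebesgue_on ?Y)"
  have JD: "J \<ge> 0" "D \<ge> 0" by (auto simp: J_def D_def)
  have J: "(\<integral>\<^sup>+x. ennreal (norm (\<phi> x) powr p) \<partial>lebesgue_on ?Y) = ennreal J"
    unfolding J_def using pw(1) by (intro nn_integral_eq_integral) (auto simp: Lp_space_def)
  have D: "(\<integral>\<^sup>+x. ennreal (norm (\<Phi> x) powr p) \<partial>lebesgue_on ?Y) = ennreal D"
    unfolding D_def using pw(3) by (intro nn_integral_eq_integral) (auto simp: Lp_space_def)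
  define \<mu> where "\<mu> = measure lebesgue \<Omega>"
  have emu: "emeasure lebesgue \<Omega> = ennreal \<mu>" using Om by (simp add: \<mu>_def emeasure_eq_measure2)
  have mu0: "\<mu> > 0"
  proof -
    have "\<not> negligible \<Omega>" using O open_not_negligible by blast
    then have "\<mu> \<noteq> 0" using Om negligible_iff_measure0 by (auto simp: \<mu>_def)
    then show ?thesis by (simp add: \<mu>_def less_le)
  qed
  have constint: "(\<integral>\<^sup>+x. c \<partial>lebesgue_on \<Omega>) = c * ennreal \<mu>" for c
    using OL emu by (simp add: emeasure_restrict_space)
  \<comment> \<open>Integrals of functions of \<open>F n\<close> are independent of
    \<open>n\<close>. With the p-th power this bounds the gradients, with
    \<open>L (\<xi> + _)\<close> it computes the energy.\<close>
  have Fh: "(\<integral>\<^sup>+x. h (F n x) \<partial>lebesgue_on \<Omega>) = (\<integral>\<^sup>+y. h (\<Phi> y) \<partial>lebesgue_on ?Y) * ennreal \<mu>" if h: "h \<in> borel_measurable borel" for h n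
  proof -
    have "(\<integral>\<^sup>+x. h (F n x) \<partial>lebesgue_on \<Omega>) = (\<integral>\<^sup>+x. (\<integral>\<^sup>+y. h (\<Phi>0 y) \<partial>lebesgue_on ?Y) \<partial>lebesgue_on \<Omega>)"
      unfolding F_def by (rule cube_filling.nn_integral_fill[OF fil m0(2) h])
    also have "(\<integral>\<^sup>+y. h (\<Phi>0 y) \<partial>lebesgue_on ?Y) = (\<integral>\<^sup>+y. h (\<Phi> y) \<partial>lebesgue_on ?Y)"
      by (intro nn_integral_cong) (simp add: \<Phi>0_def)
    finally show ?thesis by (simp only: constint)
  qed
  have Fp: "(\<integral>\<^sup>+x. ennreal (norm (F n x) powr p) \<partial>lebesgue_on \<Omega>) = ennreal (D * \<mu>)" for n
    using Fh[of "\<lambda>A. ennreal (norm A powr p)" n] D JD mu0 by (simp add: ennreal_mult)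
  \<comment> \<open>All levels are at least \<open>n\<close>, so no copy has amplitude factor above
    \<open>1 / 2^n\<close>.\<close>
  have fp: "(\<integral>\<^sup>+x. ennreal (norm (f n x) powr p) \<partial>lebesgue_on \<Omega>) \<le> ennreal ((1/2^n) powr p * J * \<mu>)" for n
  proof -
    have "(\<integral>\<^sup>+x. ennreal (norm (f n x) powr p) \<partial>lebesgue_on \<Omega>) =
      (\<integral>\<^sup>+x. (\<integral>\<^sup>+y. ennreal (norm ((1 / 2 ^ cube_filling.level \<Omega> n x) *\<^sub>R \<phi>0 y) powr p) \<partial>lebesgue_on ?Y) \<partial>lebesgue_on \<Omega>)"
      unfolding f_def by (rule cube_filling.nn_integral_fill[OF fil gm, of "\<lambda>v. ennreal (norm v powr p)"]) measurable
    also have "\<dots> \<le> (\<integral>\<^sup>+x. ennreal ((1/2^n) powr p * J) \<partial>lebesgue_on \<Omega>)"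
    proof (rule nn_integral_mono)
      fix x assume "x \<in> space (lebesgue_on \<Omega>)"
      then have x: "x \<in> \<Omega>" by simp
      have lv: "n \<le> cube_filling.level \<Omega> n x" by (rule cube_filling.level(1)[OF fil x])
      have "(\<integral>\<^sup>+y. ennreal (norm ((1 / 2 ^ cube_filling.level \<Omega> n x) *\<^sub>R \<phi>0 y) powr p) \<partial>lebesgue_on ?Y) \<le>
        (\<integral>\<^sup>+y. ennreal ((1/2^n) powr p) * ennreal (norm (\<phi> y) powr p) \<partial>lebesgue_on ?Y)"
      proof (rule nn_integral_mono)
        fix y assume "y \<in> space (lebesgue_on ?Y)"
        then have "norm ((1 / 2 ^ cube_filling.level \<Omega> n x) *\<^sub>R \<phi>0 y) powr p = ((1 / 2 ^ cube_filling.level \<Omega> n x) * norm (\<phi> y)) powr p"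
          by (simp add: \<phi>0_def)
        also have "\<dots> \<le> ((1/2^n) * norm (\<phi> y)) powr p"
          using p lv by (intro powr_mono2 mult_right_mono) (auto simp: field_simps)
        also have "\<dots> = (1/2^n) powr p * norm (\<phi> y) powr p" by (rule powr_mult)
        finally show "ennreal (norm ((1 / 2 ^ cube_filling.level \<Omega> n x) *\<^sub>R \<phi>0 y) powr p) \<le> ennreal ((1/2^n) powr p) * ennreal (norm (\<phi> y) powr p)"
          by (simp add: ennreal_mult[symmetric] ennreal_leI)
      qed
      also have "\<dots> = ennreal ((1/2^n) powr p) * ennreal J"
        using pw(1) by (subst nn_integral_cmult) (auto simp: J Lp_space_def)
      also have "\<dots> = ennreal ((1/2^n) powr p * J)" using JD by (simp add: ennreal_mult)
      finally show "(\<integral>\<^sup>+y. ennreal (norm ((1 / 2 ^ cube_filling.level \<Omega> n x) *\<^sub>R \<phi>0 y) powr p) \<partial>lebesgue_on ?Y) \<le> ennreal ((1/2^n) powr p * J)" .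
    qed
    also have "\<dots> = ennreal ((1/2^n) powr p * J * \<mu>)"
      unfolding constint using JD mu0 by (simp add: ennreal_mult)
    finally show ?thesis .
  qed
  have fL: "f n \<in> Lp_space p \<Omega>" "F n \<in> Lp_space p \<Omega>" for n
    using fm[of n] fp[of n] Fp[of n] by (auto simp: Lp_space_iff intro!: measurable_restrict_space1 intro: le_less_trans)
  have fi: "integrable (lebesgue_on \<Omega>) g" if "g \<in> Lp_space p \<Omega>" for g :: "real^'n \<Rightarrow> 'c::euclidean_space"
    using that by (intro integrable_of_powr[OF Om.finite_measure_axioms _ p]) (auto simp: Lp_space_iff)
  have fl: "locally_integrable \<Omega> g" if "g \<in> Lp_space p \<Omega>" for g :: "real^'n \<Rightarrow> 'c::euclidean_space"
    unfolding locally_integrable_def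
  proof (intro conjI allI impI)
    show "g \<in> borel_measurable (lebesgue_on \<Omega>)" using that by (simp add: Lp_space_def)
    fix K assume "compact K \<and> K \<subseteq> \<Omega>"
    then show "integrable (lebesgue_on K) g"
      using integrable_lebesgue_on_subset[OF fi[OF that] _ OL] compact_sets_lebesgue by blast
  qed
  have incell: "f n (dcenter (cube_filling.level \<Omega> n x) x + (1 / 2 ^ cube_filling.level \<Omega> n x) *\<^sub>R y) = (1 / 2 ^ cube_filling.level \<Omega> n x) *\<^sub>R \<phi> y"
    "F n (dcenter (cube_filling.level \<Omega> n x) x + (1 / 2 ^ cube_filling.level \<Omega> n x) *\<^sub>R y) = \<Phi> y" if "x \<in> \<Omega>" "y \<in> ?Y" for n x y
    using that unfolding f_def F_def by (simp_all add: cube_filling.in_cell(5)[OF fil] \<phi>0_def \<Phi>0_def)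
  \<comment> \<open>The copies fit together across cell boundaries because each has zero boundary
    values: integration by parts holds on every cell against test functions that cross its boundary,
    and the cell identities combine.\<close>
  have fg: "is_weak_grad \<Omega> (f n) (F n)" for n
    unfolding is_weak_grad_def
  proof (intro conjI ballI allI)
    show lf: "locally_integrable \<Omega> (f n)" and lF: "locally_integrable \<Omega> (F n)" by (rule fl[OF fL(1)], rule fl[OF fL(2)])
    fix \<psi> :: "real^'n \<Rightarrow> real" and i j assume psi: "\<psi> \<in> test_functions \<Omega>"
    note i1 = weak_grad_integrable(1)[OF O(1) psi lf, of i j] and i2 = weak_grad_integrable(2)[OF O(1) psi lF, of i j]
    have "(\<integral>x. f n x $ i * partial_deriv j \<psi> x + F n x $ i $ j * \<psi> x \<partial>lebesgue_on \<Omega>) = 0"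
    proof (rule cube_filling.integral_cells_eq_0[OF fil order_refl OL cube_filling.level(2)[OF fil]])
      show "integrable (lebesgue_on \<Omega>) (\<lambda>x. f n x $ i * partial_deriv j \<psi> x + F n x $ i $ j * \<psi> x)" using i1 i2 by auto
      fix x assume x: "x \<in> \<Omega>"
      define k where "k = cube_filling.level \<Omega> n x"
      define c where "c = dcenter k x"
      \<comment> \<open>The test function in cell coordinates. The factor \<open>1 / 2^k\<close> of
        its derivatives turns into the amplitude factor of \<open>f n\<close> on this cell.\<close>
      define \<Psi> where "\<Psi> y = \<psi> (c + (1 / 2^k) *\<^sub>R y)" for y
      have PT: "\<Psi> \<in> test_functions UNIV" unfolding \<Psi>_def by (rule test_functions_affine[OF psi]) auto
      have pd: "partial_deriv j \<Psi> y = (1 / 2^k) * partial_deriv j \<psi> (c + (1 / 2^k) *\<^sub>R y)" for y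
      proof -
        have "\<psi> differentiable (at z)" for z using C1_test[OF psi] by (auto simp: C1_def)
        from partial_deriv_affine[where c=c and s="1/2^k" and x=y and j=j, OF this]
        show ?thesis by (simp add: \<Psi>_def[abs_def])
      qed
      have "(\<integral>y. f n (c + (1 / 2^k) *\<^sub>R y) $ i * partial_deriv j \<psi> (c + (1 / 2^k) *\<^sub>R y) + F n (c + (1 / 2^k) *\<^sub>R y) $ i $ j * \<psi> (c + (1 / 2^k) *\<^sub>R y) \<partial>lebesgue_on ?Y)
         = (\<integral>y. \<phi> y $ i * partial_deriv j \<Psi> y + \<Phi> y $ i $ j * \<Psi> y \<partial>lebesgue_on ?Y)"
        using incell[OF x] by (intro Bochner_Integration.integral_cong) (auto simp: c_def k_def pd[unfolded c_def k_def] \<Psi>_def)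
      also have "\<dots> = 0" by (rule ibp[OF C1_test[OF PT]])
      finally show "(\<integral>y. f n (dcenter (cube_filling.level \<Omega> n x) x + (1 / 2 ^ cube_filling.level \<Omega> n x) *\<^sub>R y) $ i *
          partial_deriv j \<psi> (dcenter (cube_filling.level \<Omega> n x) x + (1 / 2 ^ cube_filling.level \<Omega> n x) *\<^sub>R y) +
          F n (dcenter (cube_filling.level \<Omega> n x) x + (1 / 2 ^ cube_filling.level \<Omega> n x) *\<^sub>R y) $ i $ j *
          \<psi> (dcenter (cube_filling.level \<Omega> n x) x + (1 / 2 ^ cube_filling.level \<Omega> n x) *\<^sub>R y) \<partial>lebesgue_on ?Y) = 0"
        by (simp add: c_def k_def)
    qed auto
    then show "(\<integral>x. f n x $ i * partial_deriv j \<psi> x \<partial>lebesgue_on \<Omega>) = - (\<integral>x. F n x $ i $ j * \<psi> x \<partial>lebesgue_on \<Omega>)"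
      using i1 i2 by simp
  qed
  \<comment> \<open>For \<open>l \<le> n\<close> a cube of generation \<open>l\<close> meets
    \<open>\<Omega>\<close> in a union of filling cells, and \<open>\<Phi>\<close> has mean zero; so
    these integrals vanish exactly rather than in the limit.\<close>
  have cubes: "(\<integral>t. F n t \<partial>lebesgue_on (dcube l x \<inter> \<Omega>)) = 0" if nl: "l \<le> n" for l n x
  proof -
    let ?S = "dcube l x \<inter> \<Omega>"
    have SL: "?S \<in> sets lebesgue" using OL by auto
    have Si: "integrable (lebesgue_on ?S) (F n)" by (rule integrable_lebesgue_on_subset[OF fi[OF fL(2)] _ OL SL]) auto
    have Pi: "integrable (lebesgue_on ?Y) \<Phi>"
      using pw(3) by (intro integrable_of_powr[OF finite_measure_lebesgue_on[OF unit_cube_lmeasurable] _ p]) (auto simp: Lp_space_iff)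
    have Pc: "(\<integral>y. \<Phi> y $ i $ j \<partial>lebesgue_on ?Y) = 0" for i j
    proof -
      \<comment> \<open>Mean zero of the gradient is integration by parts against the constant
        function 1.\<close>
      have c1: "C1 (\<lambda>x::real^'n. 1::real)" "\<And>x. partial_deriv j (\<lambda>x::real^'n. 1::real) x = 0" for j
        using partial_deriv_eq[OF has_derivative_const] by (auto simp: C1_def partial_deriv_eq[OF has_derivative_const, abs_def])
      show ?thesis using ibp[OF c1(1), of i j] by (simp add: c1(2))
    qed
    have bl: "bounded_linear (\<lambda>A :: real^'n^'m. A $ i $ j)" for i j
      by (rule bounded_linear_compose[of "\<lambda>v. v $ j" "\<lambda>A. A $ i", OF bounded_linear_vec_nth bounded_linear_vec_nth])
    have "(\<integral>t. F n t \<partial>lebesgue_on ?S) $ i $ j = 0" for i j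
    proof -
      have "(\<integral>t. F n t \<partial>lebesgue_on ?S) $ i $ j = (\<integral>t. F n t $ i $ j \<partial>lebesgue_on ?S)"
        by (rule integral_bounded_linear[OF bl Si, symmetric])
      also have "\<dots> = 0"
      proof (rule cube_filling.integral_cells_eq_0[OF fil _ SL])
        show "?S \<subseteq> \<Omega>" by simp
        show "integrable (lebesgue_on ?S) (\<lambda>t. F n t $ i $ j)" by (rule integrable_bounded_linear[OF bl Si])
        fix y assume y: "y \<in> ?S"
        then have yO: "y \<in> \<Omega>" by simp
        have "dcube (cube_filling.level \<Omega> n y) y \<subseteq> dcube l y"
          using cube_filling.level(1)[OF fil yO, of n] nl by (intro dcube_mono) auto
        also have "dcube l y = dcube l x" using y by (intro dcube_eq) auto
        finally show "dcube (cube_filling.level \<Omega> n y) y \<subseteq> ?S" using cube_filling.level(2)[OF fil yO, of n] by auto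
        show "(\<integral>s. F n (dcenter (cube_filling.level \<Omega> n y) y + (1 / 2 ^ cube_filling.level \<Omega> n y) *\<^sub>R s) $ i $ j \<partial>lebesgue_on ?Y) = 0"
        proof -
          have "(\<integral>s. F n (dcenter (cube_filling.level \<Omega> n y) y + (1 / 2 ^ cube_filling.level \<Omega> n y) *\<^sub>R s) $ i $ j \<partial>lebesgue_on ?Y) = (\<integral>s. \<Phi> s $ i $ j \<partial>lebesgue_on ?Y)"
            using incell(2)[OF yO] by (intro Bochner_Integration.integral_cong) auto
          then show ?thesis by (simp add: Pc)
        qed
      qed
      finally show ?thesis .
    qed
    then show ?thesis by (simp add: vec_eq_iff)
  qed
  have linL: "(\<lambda>y. \<xi> *v y) \<in> Lp_space p \<Omega>" by (rule linear_Lp_space[OF p O(2) Om])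
  have lg: "is_weak_grad \<Omega> (\<lambda>y. \<xi> *v y) (\<lambda>y. \<xi>)" using is_weak_grad_affine_map[OF O(1), of \<xi> 0] by simp
  have cL: "(\<lambda>y. \<xi>) \<in> Lp_space p \<Omega>" by (auto simp: Lp_space_def)
  define U where "U n x = \<xi> *v x + f n x" for n x
  have Ug: "is_weak_grad \<Omega> (U n) (\<lambda>x. \<xi> + F n x)" for n
    unfolding U_def[abs_def] by (rule is_weak_grad_add[OF O(1) lg fg])
  have "W1p_weakly_converges p \<Omega> U (\<lambda>y. \<xi> *v y)"
  proof (rule weak_convergence_criterion[OF p O(1) Om _ Ug _ linL lg cL])
    show "U k \<in> Lp_space p \<Omega>" for k unfolding U_def[abs_def] by (rule Lp_space_add[OF p linL fL(1)])
    show "(\<lambda>x. \<xi> + F k x) \<in> Lp_space p \<Omega>" for k by (rule Lp_space_add[OF p cL fL(2)])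
    show "(\<integral>\<^sup>+t. ennreal (norm (\<xi> + F k t - \<xi>) powr p) \<partial>lebesgue_on \<Omega>) \<le> ennreal (D * \<mu>)" for k
      using Fp[of k] by simp
    show "0 \<le> D * \<mu>" using JD mu0 by simp
    show "(\<lambda>k. \<integral>t. \<xi> + F k t - \<xi> \<partial>lebesgue_on (dcube l x \<inter> \<Omega>)) \<longlonglongrightarrow> 0" for l x
      by (rule tendsto_eventually, rule eventually_sequentiallyI[of l]) (simp add: cubes)
    fix x assume xh: "\<And>n. x n \<in> midhull (\<lambda>k t. (U k t - \<xi> *v t, if t \<in> \<Omega> then \<xi> + F k t - \<xi> else 0)) n"
    \<comment> \<open>Smallness of the functions comes here from their amplitude: the bound with
      \<open>1/2^n\<close> holds for all indices from \<open>n\<close> on and is stable under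
      midpoints by convexity of the power.\<close>
    have inv: "(\<lambda>t. fst (z t)) \<in> borel_measurable (lebesgue_on \<Omega>) \<and>
       (\<integral>\<^sup>+t. ennreal (norm (fst (z t)) powr p) \<partial>lebesgue_on \<Omega>) \<le> ennreal ((1/2^n) powr p * J * \<mu>)"
      if "z \<in> midhull (\<lambda>k t. (U k t - \<xi> *v t, if t \<in> \<Omega> then \<xi> + F k t - \<xi> else 0)) n" for z n
      using that
    proof (induction rule: midhull.induct)
      case (base k)
      have "ennreal ((1/2^k) powr p * J * \<mu>) \<le> ennreal ((1/2^n) powr p * J * \<mu>)"
        using base p JD mu0 by (intro ennreal_leI mult_right_mono powr_mono2) (auto simp: field_simps)
      then show ?case using fp[of k] fL(1)[of k] by (auto simp: U_def Lp_space_def intro: order_trans)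
    next
      case (mid a b)
      have [measurable]: "(\<lambda>t. fst (a t)) \<in> borel_measurable (lebesgue_on \<Omega>)" "(\<lambda>t. fst (b t)) \<in> borel_measurable (lebesgue_on \<Omega>)"
        using mid by auto
      have "(\<integral>\<^sup>+t. ennreal (norm (fst ((1/2) *\<^sub>R (a t + b t))) powr p) \<partial>lebesgue_on \<Omega>) \<le>
        (\<integral>\<^sup>+t. ennreal (1/2) * (ennreal (norm (fst (a t)) powr p) + ennreal (norm (fst (b t)) powr p)) \<partial>lebesgue_on \<Omega>)"
      proof (rule nn_integral_mono)
        fix t
        have "norm (fst ((1/2) *\<^sub>R (a t + b t))) powr p \<le> (1/2) * (norm (fst (a t)) powr p + norm (fst (b t)) powr p)"
          using norm_powr_midpoint_le[OF p, of "fst (a t)" "fst (b t)"] by simp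
        then have "ennreal (norm (fst ((1/2) *\<^sub>R (a t + b t))) powr p) \<le> ennreal ((1/2) * (norm (fst (a t)) powr p + norm (fst (b t)) powr p))"
          by (rule ennreal_leI)
        also have "\<dots> = ennreal (1/2) * (ennreal (norm (fst (a t)) powr p) + ennreal (norm (fst (b t)) powr p))"
          by (subst ennreal_mult) (auto simp: ennreal_plus)
        finally show "ennreal (norm (fst ((1/2) *\<^sub>R (a t + b t))) powr p) \<le> ennreal (1/2) * (ennreal (norm (fst (a t)) powr p) + ennreal (norm (fst (b t)) powr p))" .
      qed
      also have "\<dots> = ennreal (1/2) * ((\<integral>\<^sup>+t. ennreal (norm (fst (a t)) powr p) \<partial>lebesgue_on \<Omega>) + (\<integral>\<^sup>+t. ennreal (norm (fst (b t)) powr p) \<partial>lebesgue_on \<Omega>))"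
        by (simp add: nn_integral_cmult nn_integral_add)
      also have "\<dots> \<le> ennreal (1/2) * (ennreal ((1/2^n) powr p * J * \<mu>) + ennreal ((1/2^n) powr p * J * \<mu>))"
        using mid by (intro mult_left_mono add_mono) auto
      also have "\<dots> = ennreal ((1/2) * ((1/2^n) powr p * J * \<mu> + (1/2^n) powr p * J * \<mu>))"
      proof -
        have a: "0 \<le> (1/2^n) powr p * J * \<mu>" using JD mu0 by simp
        show ?thesis unfolding ennreal_plus[OF a a, symmetric] by (rule ennreal_mult[symmetric]) (use add_nonneg_nonneg[OF a a] in auto)
      qed
      also have "(1/2) * ((1/2^n) powr p * J * \<mu> + (1/2^n) powr p * J * \<mu>) = (1/2^n) powr p * J * \<mu>" by simp
      finally show ?case by simp
    qed
    show "(\<lambda>n. \<integral>\<^sup>+t. ennreal (norm (fst (x n t)) powr p) \<partial>lebesgue_on \<Omega>) \<longlonglongrightarrow> 0"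
    proof (rule tendsto_sandwich[OF _ _ tendsto_const])
      show "eventually (\<lambda>n. (\<integral>\<^sup>+t. ennreal (norm (fst (x n t)) powr p) \<partial>lebesgue_on \<Omega>) \<le> ennreal ((1/2^n) powr p * J * \<mu>)) sequentially"
        using inv[OF xh] by simp
      have "(\<lambda>n. (1/2::real)^n) \<longlonglongrightarrow> 0" by (rule LIMSEQ_realpow_zero) auto
      then have "(\<lambda>n. ((1/2::real)^n) powr p * J * \<mu>) \<longlonglongrightarrow> 0 powr p * J * \<mu>"
        using p by (intro tendsto_mult tendsto_powr' tendsto_const) auto
      then have "(\<lambda>n. ennreal ((1/2^n) powr p * J * \<mu>)) \<longlonglongrightarrow> ennreal 0"
        by (intro tendsto_ennrealI) (simp add: power_one_over)
      then show "(\<lambda>n. ennreal ((1/2^n) powr p * J * \<mu>)) \<longlonglongrightarrow> 0" by simp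
    qed auto
  qed
  then have "energy L \<Omega> (\<lambda>y. \<xi> *v y) \<le> liminf (\<lambda>n. energy L \<Omega> (U n))"
    using lsc unfolding W1p_seq_weakly_lsc_def by blast
  moreover have "energy L \<Omega> (\<lambda>y. \<xi> *v y) = L \<xi> * ennreal \<mu>"
    using energy_eq[OF O(1) lg, of L] constint by simp
  moreover have "energy L \<Omega> (U n) = energy L ?Y u * ennreal \<mu>" for n
  proof -
    have "is_weak_grad ?Y (\<lambda>y. (\<xi> *v y + 0) + \<phi> y) (\<lambda>y. \<xi> + \<Phi> y)"
      by (intro is_weak_grad_add open_unit_cube is_weak_grad_affine_map pw(2))
    then have "is_weak_grad ?Y u (\<lambda>y. \<xi> + \<Phi> y)" by (simp add: \<phi>_def)
    then have "energy L ?Y u = (\<integral>\<^sup>+y. L (\<xi> + \<Phi> y) \<partial>lebesgue_on ?Y)" by (rule energy_eq[OF open_unit_cube])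
    moreover have "energy L \<Omega> (U n) = (\<integral>\<^sup>+x. L (\<xi> + F n x) \<partial>lebesgue_on \<Omega>)" by (rule energy_eq[OF O(1) Ug])
    moreover have "(\<integral>\<^sup>+x. L (\<xi> + F n x) \<partial>lebesgue_on \<Omega>) = (\<integral>\<^sup>+y. L (\<xi> + \<Phi> y) \<partial>lebesgue_on ?Y) * ennreal \<mu>"
      by (rule Fh[of "\<lambda>A. L (\<xi> + A)"]) measurable
    ultimately show ?thesis by simp
  qed
  ultimately have "L \<xi> * ennreal \<mu> \<le> energy L ?Y u * ennreal \<mu>" by (simp add: Liminf_const)
  \<comment> \<open>The measure \<open>\<mu>\<close> is positive and finite, so it cancels although
    both energies may be infinite.\<close>
  then have "L \<xi> * ennreal \<mu> * ennreal (1 / \<mu>) \<le> energy L ?Y u * ennreal \<mu> * ennreal (1 / \<mu>)"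
    by (rule mult_right_mono) simp
  then show "L \<xi> \<le> energy L ?Y u"
    using mu0 by (simp add: mult.assoc ennreal_mult[symmetric])
qed

theorem corollary1p2:
  fixes \<Omega> :: "(real^'n::finite) set"
    and L :: "real^'n^'m::finite \<Rightarrow> ennreal"
    and p :: real
  assumes "open \<Omega>" and "bounded \<Omega>" and "\<Omega> \<noteq> {}" and "lipschitz_boundary \<Omega>"
    and "1 < p"
    and "continuous_on UNIV L"
    and "condition_Cpp p L"
  shows "W1p_seq_weakly_lsc p \<Omega> (energy L \<Omega>) \<longleftrightarrow> W1p_quasiconvex p L"
  using assms lsc_imp_quasiconvex quasiconvex_imp_lsc by blast

end
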